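(* Let $L_\pm$ be a splitting of $L=L(G)$ with $L_+=L_+(G)$, and let $C$ be a local group homomorphism from $S^1$ to $G$. For $k\in D_+(S^1)$ (close enough to the identity that the expressions below are defined) and $f\in L_-$ define $$(k\diamond f)(\lambda)=f(k^{-1}(\lambda))\,C\left(\frac{k^{-1}(\lambda)}{\lambda}\right),\qquad k\sharp f=\text{the }L_-\text{ component of }k\diamond f,$$ i.e. $k\sharp f=g_-$ where $k\diamond f=g_+g_-$ with $g_\pm\in L_\pm$. Then $\sharp$ defines a (local) action of $D_+(S^1)$ on $L_-$. Moreover, the infinitesimal vector field $Z_j$ on $L_-$ corresponding to $X_j=\lambda^{j+1}\frac{\partial}{\partial\lambda}$ for the $\sharp$-action is $$Z_j(f)f^{-1}=-\left(\lambda^{j+1}f_\lambda f^{-1}+\lambda^jf\,C'(1)f^{-1}\right)_-,\qquad j\ge-1,$$ where $C'(1)=\frac{dC}{d\lambda}\big|_{\lambda=1}$. In particular, this formula defines an action of $\mathcal V_+$ on $L_-$, i.e. $[Z_j,Z_k]=(k-j)Z_{j+k}$ for $j,k\ge-1$.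
   Context: $G$ is a complex (matrix) Lie group with Lie algebra $\mathfrak g$; $L(G)$ is the group of smooth loops $S^1\to G$ with loop parameter $\lambda$, $\mathcal L$ its Lie algebra. $L_+(G)$ is the subgroup of loops that are boundary values of holomorphic maps from $|\lambda|<1$ to $G$. A splitting consists of subgroups $L_\pm$ with Lie algebras $\mathcal L_\pm$ with $L_+\cap L_-=\{e\}$ and $\mathcal L=\mathcal L_+\oplus\mathcal L_-$; $\xi_-$ denotes the $\mathcal L_-$ component of $\xi$. A local group homomorphism $C$ from $S^1$ to $G$ is a smooth map defined on $\mathcal I_\epsilon=\{e^{i\theta}:|\theta|<\epsilon\}$ for some $\epsilon>0$ with $C(\lambda_1\lambda_2)=C(\lambda_1)C(\lambda_2)$ whenever $\lambda_1,\lambda_2,\lambda_1\lambda_2\in\mathcal I_\epsilon$. $D_+(S^1)$ is the group of diffeomorphisms of $S^1$ that are boundary values of holomorphic maps from $|\lambda|\le1$ to itself. $\mathcal V_+$ is the positive half Virasoro algebra, spanned by $\{\xi_j\mid j\ge-1\}$ with $[\xi_j,\xi_k]=(k-j)\xi_{j+k}$; it is (formally) embedded in the Lie algebra of $D_+(S^1)$ by $\xi_j\mapsto X_j=\lambda^{j+1}\partial/\partial\lambda$. An action of $\mathcal V_+$ on a manifold is a sequence of vector fields $X_j$, $j\ge-1$, on it with $[X_j,X_k]=(k-j)X_{j+k}$. The infinitesimal vector field corresponding to $X_j$ is $Z_j(f)=\frac{d}{ds}\big|_{s=0}(k_s\sharp f)$, where $k_s$ is the (formal, local) flow of $X_j$,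 so that $k_s^{-1}(\lambda)=\lambda-s\lambda^{j+1}+O(s^2)$. *)

theory Defs
  imports "HOL-Analysis.Analysis" "HOL-Algebra.Group"
begin

section \<open>Smooth functions\<close>

primrec higher_differentiable_on ::
    "nat \<Rightarrow> 'a::real_normed_vector set \<Rightarrow> ('a \<Rightarrow> 'b::real_normed_vector) \<Rightarrow> bool" where
  "higher_differentiable_on 0 S f \<longleftrightarrow> continuous_on S f"
| "higher_differentiable_on (Suc n) S f \<longleftrightarrow>
     (\<forall>x\<in>S. f differentiable (at x)) \<and>
     (\<forall>v. higher_differentiable_on n S (\<lambda>x. frechet_derivative f (at x) v))"

text \<open>Meant for open \<open>S\<close>; real smoothness, also when the domain is the complex plane.\<close>
definition smooth_on :: "'a::real_normed_vector set \<Rightarrow> ('a \<Rightarrow> 'b::real_normed_vector) \<Rightarrow> bool" where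
  "smooth_on S f \<longleftrightarrow> (\<forall>n. higher_differentiable_on n S f)"

definition nth_deriv :: "nat \<Rightarrow> (real \<Rightarrow> 'b::real_normed_vector) \<Rightarrow> real \<Rightarrow> 'b" where
  "nth_deriv n = (\<lambda>h \<theta>. vector_derivative h (at \<theta>)) ^^ n"


section \<open>Complex matrix Lie groups\<close>

definition cscale :: "complex \<Rightarrow> complex^'n^'m \<Rightarrow> complex^'n^'m" where
  "cscale c A = (\<chi> i k. c * A $ i $ k)"

definition GL_group :: "(complex^'n^'n) monoid" where
  "GL_group = \<lparr>carrier = {A. invertible A}, mult = (**), one = mat 1\<rparr>"

definition matrix_lie_algebra :: "(complex^'n^'n) set \<Rightarrow> (complex^'n^'n) set" where
  "matrix_lie_algebra G =
     {X. \<exists>\<gamma> :: real \<Rightarrow> complex^'n^'n. (\<forall>t. \<gamma> t \<in> G) \<and> \<gamma> 0 = mat 1 \<and>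
           (\<gamma> has_vector_derivative X) (at 0)}"

definition complex_matrix_lie_group :: "(complex^'n^'n) set \<Rightarrow> bool" where
  "complex_matrix_lie_group G \<longleftrightarrow>
     subgroup G GL_group \<and>
     closedin (top_of_set {A. invertible A}) G \<and>
     (\<forall>X \<in> matrix_lie_algebra G. cscale \<i> X \<in> matrix_lie_algebra G)"


section \<open>Smooth loops\<close>

text \<open>
  A loop is a function on the unit circle, represented as an extensional function on the
  complex plane (value \<open>undefined\<close> off the circle), so that equality of loops is HOL equality.
  Pointwise operations are therefore restricted to the circle.
\<close>

abbreviation S1 :: "complex set" where "S1 \<equiv> sphere 0 1"

definition loops :: "'b::real_normed_vector set \<Rightarrow> (complex \<Rightarrow> 'b) set" where
  "loops A = {f \<in> S1 \<rightarrow>\<^sub>E A. smooth_on UNIV (\<lambda>\<theta>::real. f (cis \<theta>))}"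

definition loop_one :: "complex \<Rightarrow> complex^'n^'n" where
  "loop_one = (\<lambda>z\<in>S1. mat 1)"

definition loop_mult ::
    "(complex \<Rightarrow> complex^'n^'n) \<Rightarrow> (complex \<Rightarrow> complex^'n^'n) \<Rightarrow> complex \<Rightarrow> complex^'n^'n" where
  "loop_mult f g = (\<lambda>z\<in>S1. f z ** g z)"

definition loop_inv :: "(complex \<Rightarrow> complex^'n^'n) \<Rightarrow> complex \<Rightarrow> complex^'n^'n" where
  "loop_inv f = (\<lambda>z\<in>S1. matrix_inv (f z))"

definition loop_group :: "(complex^'n^'n) set \<Rightarrow> (complex \<Rightarrow> complex^'n^'n) monoid" where
  "loop_group G = \<lparr>carrier = loops G, mult = loop_mult, one = loop_one\<rparr>"

text \<open>
  The derivative with respect to \<open>\<lambda>\<close> of a function given only on the circle (or on an arc of it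
  around \<open>z\<close>), that is \<open>d/d\<lambda> = (\<i> \<lambda>)\<^sup>-\<^sup>1 d/d\<theta>\<close> for \<open>\<lambda> = cis \<theta>\<close>.
\<close>
definition circle_deriv :: "(complex \<Rightarrow> complex^'n^'n) \<Rightarrow> complex \<Rightarrow> complex^'n^'n" where
  "circle_deriv f z =
     cscale (1 / (\<i> * z)) (vector_derivative (\<lambda>\<theta>. f (cis \<theta>)) (at (Arg z)))"

text \<open>Convergence in the \<open>C\<^sup>\<infinity>\<close> (Frechet) topology on loops.\<close>
definition loop_tendsto ::
    "('i \<Rightarrow> complex \<Rightarrow> 'b::real_normed_vector) \<Rightarrow> (complex \<Rightarrow> 'b) \<Rightarrow> 'i filter \<Rightarrow> bool" where
  "loop_tendsto u l F \<longleftrightarrow>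
     (\<forall>n. uniform_limit UNIV (\<lambda>i. nth_deriv n (\<lambda>\<theta>. u i (cis \<theta>)))
                             (nth_deriv n (\<lambda>\<theta>. l (cis \<theta>))) F)"

definition has_velocity ::
    "(real \<Rightarrow> complex \<Rightarrow> complex^'n^'n) \<Rightarrow> (complex \<Rightarrow> complex^'n^'n) \<Rightarrow> bool" where
  "has_velocity c v \<longleftrightarrow>
     c 0 \<in> loops UNIV \<and> (\<forall>\<^sub>F s in at 0. c s \<in> loops UNIV) \<and> v \<in> loops UNIV \<and>
     loop_tendsto (\<lambda>s. \<lambda>z\<in>S1. (c s z - c 0 z) /\<^sub>R s) v (at 0)"


section \<open>Tangent vectors and vector fields\<close>

definition curve_in ::
    "(complex \<Rightarrow> complex^'n^'n) set \<Rightarrow> (complex \<Rightarrow> complex^'n^'n) \<Rightarrow> (complex \<Rightarrow> complex^'n^'n) \<Rightarrow>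
     (real \<Rightarrow> complex \<Rightarrow> complex^'n^'n) \<Rightarrow> bool" where
  "curve_in M f v c \<longleftrightarrow> (\<forall>s. c s \<in> M) \<and> c 0 = f \<and> has_velocity c v"

definition tangent ::
    "(complex \<Rightarrow> complex^'n^'n) set \<Rightarrow> (complex \<Rightarrow> complex^'n^'n) \<Rightarrow> (complex \<Rightarrow> complex^'n^'n) set"
    where
  "tangent M f = {v. \<exists>c. curve_in M f v c}"

definition subgroup_lie_algebra ::
    "(complex \<Rightarrow> complex^'n^'n) set \<Rightarrow> (complex \<Rightarrow> complex^'n^'n) set" where
  "subgroup_lie_algebra H = tangent H loop_one"

text \<open>\<open>w\<close> is the derivative at \<open>f\<close> of \<open>Y : M \<rightarrow> C\<^sup>\<infinity>(S\<^sup>1, gl\<^sub>n)\<close> in the direction \<open>v\<close>.\<close>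
definition directional_deriv ::
    "(complex \<Rightarrow> complex^'n^'n) set \<Rightarrow>
     ((complex \<Rightarrow> complex^'n^'n) \<Rightarrow> complex \<Rightarrow> complex^'n^'n) \<Rightarrow>
     (complex \<Rightarrow> complex^'n^'n) \<Rightarrow> (complex \<Rightarrow> complex^'n^'n) \<Rightarrow> (complex \<Rightarrow> complex^'n^'n) \<Rightarrow> bool"
    where
  "directional_deriv M Y f v w \<longleftrightarrow>
     v \<in> tangent M f \<and> (\<forall>c. curve_in M f v c \<longrightarrow> has_velocity (\<lambda>s. Y (c s)) w)"

definition vector_field_on ::
    "(complex \<Rightarrow> complex^'n^'n) set \<Rightarrow>
     ((complex \<Rightarrow> complex^'n^'n) \<Rightarrow> complex \<Rightarrow> complex^'n^'n) \<Rightarrow> bool" where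
  "vector_field_on M X \<longleftrightarrow>
     (\<forall>f\<in>M. X f \<in> tangent M f \<and> (\<forall>v \<in> tangent M f. \<exists>w. directional_deriv M X f v w))"

text \<open>The value at \<open>f\<close> of the bracket \<open>[X, Y] = DY(X) - DX(Y)\<close>.\<close>
definition lie_bracket_at ::
    "(complex \<Rightarrow> complex^'n^'n) set \<Rightarrow>
     ((complex \<Rightarrow> complex^'n^'n) \<Rightarrow> complex \<Rightarrow> complex^'n^'n) \<Rightarrow>
     ((complex \<Rightarrow> complex^'n^'n) \<Rightarrow> complex \<Rightarrow> complex^'n^'n) \<Rightarrow>
     (complex \<Rightarrow> complex^'n^'n) \<Rightarrow> (complex \<Rightarrow> complex^'n^'n) \<Rightarrow> bool" where
  "lie_bracket_at M X Y f b \<longleftrightarrow>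
     (\<exists>a a'. directional_deriv M Y f (X f) a \<and> directional_deriv M X f (Y f) a' \<and>
             b = (\<lambda>z\<in>S1. a z - a' z))"

text \<open>
  Only the \<open>Z j\<close> with \<open>j \<ge> -1\<close> matter: \<open>j + k = -2\<close> forces \<open>j = k\<close>, and then the coefficient
  vanishes.
\<close>
definition virasoro_action ::
    "(complex \<Rightarrow> complex^'n^'n) set \<Rightarrow>
     (int \<Rightarrow> (complex \<Rightarrow> complex^'n^'n) \<Rightarrow> complex \<Rightarrow> complex^'n^'n) \<Rightarrow> bool" where
  "virasoro_action M Z \<longleftrightarrow>
     (\<forall>j\<ge>-1. vector_field_on M (Z j)) \<and>
     (\<forall>j\<ge>-1. \<forall>k\<ge>-1. \<forall>f\<in>M.
        lie_bracket_at M (Z j) (Z k) f (\<lambda>z\<in>S1. real_of_int (k - j) *\<^sub>R Z (j + k) f z))"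


section \<open>Splittings\<close>

definition Lplus :: "(complex^'n^'n) set \<Rightarrow> (complex \<Rightarrow> complex^'n^'n) set" where
  "Lplus G = {f \<in> loops G. \<exists>F. continuous_on (cball 0 1) F \<and>
      (\<forall>i k. (\<lambda>z. F z $ i $ k) holomorphic_on ball 0 1) \<and>
      (\<forall>z \<in> ball 0 1. F z \<in> G) \<and> (\<forall>z\<in>S1. F z = f z)}"

text \<open>The component in the Lie algebra of \<open>Lm\<close>, with respect to the direct sum.\<close>
definition minus_proj ::
    "(complex \<Rightarrow> complex^'n^'n) set \<Rightarrow> (complex \<Rightarrow> complex^'n^'n) set \<Rightarrow>
     (complex \<Rightarrow> complex^'n^'n) \<Rightarrow> complex \<Rightarrow> complex^'n^'n" where
  "minus_proj Lp Lm \<xi> =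
     (THE \<eta>. \<eta> \<in> subgroup_lie_algebra Lm \<and>
        (\<exists>\<zeta> \<in> subgroup_lie_algebra Lp. \<xi> = (\<lambda>z\<in>S1. \<zeta> z + \<eta> z)))"

text \<open>
  The Lie algebra of the loop group of \<open>G\<close> consists of the smooth loops in the Lie algebra of \<open>G\<close>.
  Its decomposition is a direct sum of topological vector spaces, i.e. the projections are
  continuous. (By the open mapping theorem for Frechet spaces an algebraic direct sum of
  closed subspaces has this property.)
\<close>
definition splitting ::
    "(complex^'n^'n) set \<Rightarrow> (complex \<Rightarrow> complex^'n^'n) set \<Rightarrow> (complex \<Rightarrow> complex^'n^'n) set \<Rightarrow> bool"
    where
  "splitting G Lp Lm \<longleftrightarrow>
     subgroup Lp (loop_group G) \<and> subgroup Lm (loop_group G) \<and> Lp \<inter> Lm = {loop_one} \<and>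
     (\<forall>\<xi> \<in> loops (matrix_lie_algebra G).
        \<exists>!(\<zeta>, \<eta>). \<zeta> \<in> subgroup_lie_algebra Lp \<and> \<eta> \<in> subgroup_lie_algebra Lm \<and>
                  \<xi> = (\<lambda>z\<in>S1. \<zeta> z + \<eta> z)) \<and>
     (\<forall>u \<xi>. (\<forall>m::nat. u m \<in> loops (matrix_lie_algebra G)) \<longrightarrow>
        \<xi> \<in> loops (matrix_lie_algebra G) \<longrightarrow> loop_tendsto u \<xi> sequentially \<longrightarrow>
        loop_tendsto (\<lambda>m. minus_proj Lp Lm (u m)) (minus_proj Lp Lm \<xi>) sequentially)"

definition big_cell ::
    "(complex \<Rightarrow> complex^'n^'n) set \<Rightarrow> (complex \<Rightarrow> complex^'n^'n) set \<Rightarrow>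
     (complex \<Rightarrow> complex^'n^'n) set" where
  "big_cell Lp Lm = {loop_mult gp gm | gp gm. gp \<in> Lp \<and> gm \<in> Lm}"

text \<open>The factor \<open>g\<^sub>-\<close> in \<open>h = g\<^sub>+ g\<^sub>-\<close>; meaningful for \<open>h\<close> in the big cell.\<close>
definition minus_factor ::
    "(complex \<Rightarrow> complex^'n^'n) set \<Rightarrow> (complex \<Rightarrow> complex^'n^'n) set \<Rightarrow>
     (complex \<Rightarrow> complex^'n^'n) \<Rightarrow> complex \<Rightarrow> complex^'n^'n" where
  "minus_factor Lp Lm h = (THE gm. gm \<in> Lm \<and> (\<exists>gp\<in>Lp. h = loop_mult gp gm))"

text \<open>The big cell contains a neighbourhood of the identity in the loop group of \<open>G\<close>.\<close>
definition big_cell_near_one ::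
    "(complex^'n^'n) set \<Rightarrow> (complex \<Rightarrow> complex^'n^'n) set \<Rightarrow> (complex \<Rightarrow> complex^'n^'n) set \<Rightarrow> bool"
    where
  "big_cell_near_one G Lp Lm \<longleftrightarrow>
     (\<forall>u. (\<forall>m::nat. u m \<in> loops G) \<longrightarrow> loop_tendsto u loop_one sequentially \<longrightarrow>
          (\<forall>\<^sub>F m in sequentially. u m \<in> big_cell Lp Lm))"


section \<open>Local homomorphisms, diffeomorphisms and the two actions\<close>

definition arc :: "real \<Rightarrow> complex set" where
  "arc \<epsilon> = {cis \<theta> | \<theta>. \<bar>\<theta>\<bar> < \<epsilon>}"

definition local_hom :: "(complex^'n^'n) set \<Rightarrow> real \<Rightarrow> (complex \<Rightarrow> complex^'n^'n) \<Rightarrow> bool" where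
  "local_hom G \<epsilon> C \<longleftrightarrow>
     \<epsilon> > 0 \<and> C ` arc \<epsilon> \<subseteq> G \<and> smooth_on {-\<epsilon><..<\<epsilon>} (\<lambda>\<theta>::real. C (cis \<theta>)) \<and>
     (\<forall>x\<in>arc \<epsilon>. \<forall>y\<in>arc \<epsilon>. x * y \<in> arc \<epsilon> \<longrightarrow> C (x * y) = C x ** C y)"

definition Dplus :: "(complex \<Rightarrow> complex) set" where
  "Dplus = {k. bij_betw k S1 S1 \<and> smooth_on UNIV (\<lambda>\<theta>::real. k (cis \<theta>)) \<and>
      smooth_on UNIV (\<lambda>\<theta>::real. inv_into S1 k (cis \<theta>)) \<and>
      (\<exists>K. continuous_on (cball 0 1) K \<and> K holomorphic_on ball 0 1 \<and>
           K ` cball 0 1 \<subseteq> cball 0 1 \<and> (\<forall>z\<in>S1. K z = k z))}"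

text \<open>Here \<open>\<kappa>\<close> stands for \<open>k\<^sup>-\<^sup>1\<close>.\<close>
definition diamond ::
    "(complex \<Rightarrow> complex^'n^'n) \<Rightarrow> (complex \<Rightarrow> complex) \<Rightarrow> (complex \<Rightarrow> complex^'n^'n) \<Rightarrow>
     complex \<Rightarrow> complex^'n^'n" where
  "diamond C \<kappa> f = (\<lambda>z\<in>S1. f (\<kappa> z) ** C (\<kappa> z / z))"

definition sharp ::
    "(complex \<Rightarrow> complex^'n^'n) set \<Rightarrow> (complex \<Rightarrow> complex^'n^'n) set \<Rightarrow>
     (complex \<Rightarrow> complex^'n^'n) \<Rightarrow> (complex \<Rightarrow> complex) \<Rightarrow> (complex \<Rightarrow> complex^'n^'n) \<Rightarrow>
     complex \<Rightarrow> complex^'n^'n" where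
  "sharp Lp Lm C k f = minus_factor Lp Lm (diamond C (inv_into S1 k) f)"

definition diamond_defined :: "real \<Rightarrow> (complex \<Rightarrow> complex) \<Rightarrow> bool" where
  "diamond_defined \<epsilon> k \<longleftrightarrow> (\<forall>z\<in>S1. inv_into S1 k z / z \<in> arc \<epsilon>)"

definition sharp_defined ::
    "(complex \<Rightarrow> complex^'n^'n) set \<Rightarrow> (complex \<Rightarrow> complex^'n^'n) set \<Rightarrow> real \<Rightarrow>
     (complex \<Rightarrow> complex^'n^'n) \<Rightarrow> (complex \<Rightarrow> complex) \<Rightarrow> (complex \<Rightarrow> complex^'n^'n) \<Rightarrow> bool" where
  "sharp_defined Lp Lm \<epsilon> C k f \<longleftrightarrow>
     k \<in> Dplus \<and> diamond_defined \<epsilon> k \<and> diamond C (inv_into S1 k) f \<in> big_cell Lp Lm"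


section \<open>Infinitesimal vector fields\<close>

text \<open>
  The flow of \<open>\<lambda>\<^sup>j\<^sup>+\<^sup>1 \<partial>/\<partial>\<lambda>\<close> moves points off the circle, where loops and local homomorphisms are
  not defined. To substitute into a smooth function given on \<open>S\<close> (the circle or an arc), extend it
  to a neighbourhood so that the Cauchy-Riemann equations hold along \<open>S\<close>. A holomorphic
  extension is an instance if there is one; in general only the first order matters.
\<close>
definition complex_extension ::
    "complex set \<Rightarrow> (complex \<Rightarrow> complex^'n^'n) \<Rightarrow> complex set \<Rightarrow> (complex \<Rightarrow> complex^'n^'n) \<Rightarrow> bool"
    where
  "complex_extension S h U H \<longleftrightarrow>
     open U \<and> S \<subseteq> U \<and> smooth_on U H \<and> (\<forall>z\<in>S. H z = h z) \<and>
     (\<forall>z\<in>S. \<forall>i k. (\<lambda>w. H w $ i $ k) field_differentiable (at z))"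

text \<open>
  A smooth local family \<open>\<kappa> s = k\<^sub>s\<^sup>-\<^sup>1\<close> with \<open>k\<^sub>s\<^sup>-\<^sup>1(\<lambda>) = \<lambda> - s \<lambda>\<^sup>j\<^sup>+\<^sup>1 + O(s\<^sup>2)\<close>. The inverse of the
  actual local flow of \<open>\<lambda>\<^sup>j\<^sup>+\<^sup>1 \<partial>/\<partial>\<lambda>\<close> is an instance.
\<close>
definition inverse_flow :: "int \<Rightarrow> real \<Rightarrow> (real \<Rightarrow> complex \<Rightarrow> complex) \<Rightarrow> bool" where
  "inverse_flow j \<delta> \<kappa> \<longleftrightarrow>
     \<delta> > 0 \<and> smooth_on ({-\<delta><..<\<delta>} \<times> UNIV) (\<lambda>(s::real, \<theta>::real). \<kappa> s (cis \<theta>)) \<and>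
     (\<exists>B. \<forall>s \<in> {-\<delta><..<\<delta>}. \<forall>z\<in>S1.
        norm (\<kappa> s z - (z - of_real s * z powi (j + 1))) \<le> B * s\<^sup>2)"

text \<open>\<open>a\<close> is a curve \<open>s \<mapsto> k\<^sub>s \<diamondop> f\<close>, where \<open>k\<^sub>s\<close> is a local flow of \<open>\<lambda>\<^sup>j\<^sup>+\<^sup>1 \<partial>/\<partial>\<lambda>\<close>.\<close>
definition diamond_flow_curve ::
    "real \<Rightarrow> (complex \<Rightarrow> complex^'n^'n) \<Rightarrow> int \<Rightarrow> (complex \<Rightarrow> complex^'n^'n) \<Rightarrow>
     (real \<Rightarrow> complex \<Rightarrow> complex^'n^'n) \<Rightarrow> bool" where
  "diamond_flow_curve \<epsilon> C j f a \<longleftrightarrow>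
     (\<exists>U F V C' \<delta> \<kappa>. complex_extension S1 f U F \<and> complex_extension (arc \<epsilon>) C V C' \<and>
        inverse_flow j \<delta> \<kappa> \<and> a = (\<lambda>s. diamond C' (\<kappa> s) F))"

text \<open>
  \<open>v = d/ds k\<^sub>s \<sharp> f\<close> at \<open>s = 0\<close> for the formal flow \<open>k\<^sub>s\<close>: as \<open>k\<^sub>s\<close> is given to first order in \<open>s\<close>,
  so are \<open>k\<^sub>s \<diamondop> f\<close> and its factorization \<open>g\<^sub>+(s) g\<^sub>-(s)\<close>, and \<open>v\<close> is the velocity of \<open>g\<^sub>-\<close>. An exact
  factorization of \<open>k\<^sub>s \<diamondop> f\<close> with differentiable \<open>g\<^sub>-\<close> is an instance.
\<close>
definition sharp_velocity ::
    "(complex \<Rightarrow> complex^'n^'n) set \<Rightarrow> (complex \<Rightarrow> complex^'n^'n) set \<Rightarrow> real \<Rightarrow>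
     (complex \<Rightarrow> complex^'n^'n) \<Rightarrow> int \<Rightarrow> (complex \<Rightarrow> complex^'n^'n) \<Rightarrow>
     (complex \<Rightarrow> complex^'n^'n) \<Rightarrow> bool" where
  "sharp_velocity Lp Lm \<epsilon> C j f v \<longleftrightarrow>
     (\<exists>a gp gm. diamond_flow_curve \<epsilon> C j f a \<and> (\<forall>s. gp s \<in> Lp \<and> gm s \<in> Lm) \<and>
        loop_mult (gp 0) (gm 0) = a 0 \<and>
        (\<exists>w. has_velocity a w \<and> has_velocity (\<lambda>s. loop_mult (gp s) (gm s)) w) \<and>
        has_velocity gm v)"

definition sharp_field ::
    "(complex \<Rightarrow> complex^'n^'n) set \<Rightarrow> (complex \<Rightarrow> complex^'n^'n) set \<Rightarrow> real \<Rightarrow>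
     (complex \<Rightarrow> complex^'n^'n) \<Rightarrow> int \<Rightarrow> (complex \<Rightarrow> complex^'n^'n) \<Rightarrow> complex \<Rightarrow> complex^'n^'n"
    where
  "sharp_field Lp Lm \<epsilon> C j f = (THE v. sharp_velocity Lp Lm \<epsilon> C j f v)"

end

theory Submission
  imports Defs "HOL-Complex_Analysis.Complex_Analysis"
begin

text \<open>
  Precomposition with \<open>k\<^sup>-\<^sup>1\<close> preserves \<open>L\<^sub>+\<close>, because an element of \<open>D\<^sub>+(S\<^sup>1)\<close> extends to a bijection
  of the closed disc. Hence \<open>k \<diamondop> (g\<^sub>+ g\<^sub>-) = (g\<^sub>+ \<circ> k\<^sup>-\<^sup>1) (k \<diamondop> g\<^sub>-)\<close> has the same \<open>L\<^sub>-\<close> factor as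
  \<open>k \<diamondop> g\<^sub>-\<close>, and as \<open>C\<close> is multiplicative, \<open>\<sharp>\<close> is a local action.

  Let \<open>X\<^sub>j = \<lambda>\<^sup>j\<^sup>+\<^sup>1 f\<^sub>\<lambda> f\<^sup>-\<^sup>1 + \<lambda>\<^sup>j f C'(1) f\<^sup>-\<^sup>1 = p\<^sub>j + q\<^sub>j\<close> be the decomposition in \<open>\<L>\<^sub>+ \<oplus> \<L>\<^sub>-\<close>.
  The velocity of \<open>k\<^sub>s \<diamondop> f\<close> at \<open>s = 0\<close> is \<open>- X\<^sub>j f\<close>, and differentiating a factorization gives
  \<open>Z\<^sub>j f\<^sup>-\<^sup>1 = - q\<^sub>j\<close>. Along \<open>u f\<close> the derivative of \<open>X\<^sub>k\<close> is \<open>\<lambda>\<^sup>k\<^sup>+\<^sup>1 u\<^sub>\<lambda> + [u, X\<^sub>k]\<close>. Taking \<open>u = - q\<^sub>j\<close>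
  and antisymmetrizing in \<open>j\<close> and \<open>k\<close> leaves \<open>(k - j) X\<^sub>j\<^sub>+\<^sub>k + [q\<^sub>k, q\<^sub>j]\<close> up to the terms
  \<open>\<lambda>\<^sup>k\<^sup>+\<^sup>1 \<partial>\<^sub>\<lambda> p\<^sub>j - \<lambda>\<^sup>j\<^sup>+\<^sup>1 \<partial>\<^sub>\<lambda> p\<^sub>k + [p\<^sub>j, p\<^sub>k]\<close>, which are in \<open>\<L>\<^sub>+\<close> since \<open>j, k \<ge> -1\<close>. Projection to
  \<open>\<L>\<^sub>-\<close> is continuous, so it commutes with differentiation, and the Virasoro relations follow.
\<close>

section \<open>Calculus of smooth functions\<close>

text \<open>Tangent vectors and directional derivatives are given by curves, so neither an
  exponential map nor a chart of the loop groups enters: product, inverse and angular-derivative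
  rules for \<open>has_velocity\<close> carry the calculus. The price is that an element of a Lie
  algebra comes with nothing but some curve. Thus the bracket of two elements of \<L>_- first
  appears only as the velocity of a curve in \<L>_-; it belongs to \<L>_- because the continuous
  projection makes both subalgebras closed, one being its kernel and the other its fixed set. The
  delicate point is that \<lambda>^(j+1) d/d\<lambda> preserves \<L>_+. Its flow moves points out of
  the closed disc, where elements of \<L>_+ have no values. Precomposition with a holomorphic
  self-map of the disc preserves \<open>Lplus\<close>, as long as the resulting loop is smooth, even
  if the map is not invertible; so the flow is first contracted by r < 1, and the limit r
  \<rightarrow> 1 is then taken with all derivatives. Loops in \<open>Lm\<close> do not extend to
  the disc at all. There the flow acts through extensions that satisfy the Cauchy-Riemann equations
  along the circle, whose first derivatives are determined by the boundary values.\<close>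

lemma higher_differentiable_on_cong:
  assumes "open S" "\<And>x. x \<in> S \<Longrightarrow> f x = g x" "higher_differentiable_on n S f"
  shows "higher_differentiable_on n S g"
  using assms(2,3)
proof (induction n arbitrary: f g)
  case 0
  then show ?case by (auto cong: continuous_on_cong)
next
  case (Suc n)
  have fd: "f differentiable at x" if "x \<in> S" for x
    using Suc.prems(2) that by simp
  have "g differentiable at x" if "x \<in> S" for x
    using fd[OF that] Suc.prems(1) that \<open>open S\<close>
    by (meson differentiable_def has_derivative_transform_within_open)
  moreover have "higher_differentiable_on n S (\<lambda>x. frechet_derivative g (at x) v)" for v
  proof (rule Suc.IH)
    show "higher_differentiable_on n S (\<lambda>x. frechet_derivative f (at x) v)"
      using Suc.prems(2) by simp
    show "frechet_derivative f (at x) v = frechet_derivative g (at x) v" if "x \<in> S" for x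
      using frechet_derivative_transform_within_open[OF fd[OF that] \<open>open S\<close> that] Suc.prems(1)
      by simp
  qed
  ultimately show ?case by simp
qed

text \<open>The recursion in \<open>higher_differentiable_on\<close> refers to the chosen derivative
  \<open>frechet_derivative\<close>. Here any explicit derivative may take its place, which is how
  the later inductions over the order run.\<close>

lemma higher_differentiable_on_SucI:
  assumes "open S" "\<And>x. x \<in> S \<Longrightarrow> (f has_derivative f' x) (at x)"
    and "\<And>v. higher_differentiable_on n S (\<lambda>x. f' x v)"
  shows "higher_differentiable_on (Suc n) S f"
proof -
  have "higher_differentiable_on n S (\<lambda>x. frechet_derivative f (at x) v)" for v
    by (rule higher_differentiable_on_cong[OF assms(1) _ assms(3)[of v]])
      (metis assms(2) frechet_derivative_at)
  then show ?thesis
    using assms(2) by (auto simp: differentiable_def)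
qed

lemma higher_differentiable_on_has_derivative:
  "higher_differentiable_on (Suc n) S f \<Longrightarrow> x \<in> S \<Longrightarrow>
     (f has_derivative frechet_derivative f (at x)) (at x)"
  by (simp add: frechet_derivative_works[symmetric])

lemma higher_differentiable_on_SucD:
  "higher_differentiable_on (Suc n) S f \<Longrightarrow> higher_differentiable_on n S f"
proof (induction n arbitrary: f)
  case 0
  then show ?case
    by (auto intro!: differentiable_imp_continuous_on
        simp: differentiable_on_def differentiable_at_withinI)
qed simp

lemma higher_differentiable_on_subset:
  "higher_differentiable_on n T f \<Longrightarrow> S \<subseteq> T \<Longrightarrow> higher_differentiable_on n S f"
  by (induction n arbitrary: f) (auto intro: continuous_on_subset)

lemma higher_differentiable_on_const: "open S \<Longrightarrow> higher_differentiable_on n S (\<lambda>x. c)"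
  by (induction n arbitrary: c) auto

lemma higher_differentiable_on_add:
  assumes "open S" "higher_differentiable_on n S f" "higher_differentiable_on n S g"
  shows "higher_differentiable_on n S (\<lambda>x. f x + g x)"
  using assms(2,3)
proof (induction n arbitrary: f g)
  case 0
  then show ?case by (auto intro: continuous_intros)
next
  case (Suc n)
  show ?case
    by (rule higher_differentiable_on_SucI[OF \<open>open S\<close> has_derivative_add[OF
        higher_differentiable_on_has_derivative[OF Suc.prems(1)]
        higher_differentiable_on_has_derivative[OF Suc.prems(2)]]])
      (use Suc in auto)
qed

lemma higher_differentiable_on_sum:
  assumes "open S" "\<And>i. i \<in> I \<Longrightarrow> higher_differentiable_on n S (f i)"
  shows "higher_differentiable_on n S (\<lambda>x. \<Sum>i\<in>I. f i x)"
  using assms(2)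
  by (induction I rule: infinite_finite_induct)
    (auto intro: higher_differentiable_on_const higher_differentiable_on_add assms(1))

lemma higher_differentiable_on_bilinear:
  assumes "open S" "bounded_bilinear B"
    and "higher_differentiable_on n S f" "higher_differentiable_on n S g"
  shows "higher_differentiable_on n S (\<lambda>x. B (f x) (g x))"
  using assms(3,4)
proof (induction n arbitrary: f g)
  case 0
  then show ?case using bounded_bilinear.continuous_on[OF assms(2)] by simp
next
  case (Suc n)
  show ?case
  proof (rule higher_differentiable_on_SucI[OF \<open>open S\<close>])
    show "((\<lambda>x. B (f x) (g x)) has_derivative (\<lambda>v. B (f x) (frechet_derivative g (at x) v) +
        B (frechet_derivative f (at x) v) (g x))) (at x)" if "x \<in> S" for x
      by (rule bounded_bilinear.FDERIV[OF assms(2)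
          higher_differentiable_on_has_derivative[OF Suc.prems(1) that]
          higher_differentiable_on_has_derivative[OF Suc.prems(2) that]])
    show "higher_differentiable_on n S (\<lambda>x. B (f x) (frechet_derivative g (at x) v) +
        B (frechet_derivative f (at x) v) (g x))" for v
      by (intro higher_differentiable_on_add[OF \<open>open S\<close>] Suc.IH
          higher_differentiable_on_SucD[OF Suc.prems(1)] higher_differentiable_on_SucD[OF Suc.prems(2)])
        (use Suc.prems in simp_all)
  qed
qed

lemma higher_differentiable_on_linear:
  assumes "open S" "bounded_linear T" "higher_differentiable_on n S f"
  shows "higher_differentiable_on n S (\<lambda>x. T (f x))"
  using assms(3)
proof (induction n arbitrary: f)
  case 0
  then show ?case using bounded_linear.continuous_on[OF assms(2)] by simp
next
  case (Suc n)
  show ?case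
    by (rule higher_differentiable_on_SucI[OF \<open>open S\<close> bounded_linear.has_derivative[OF assms(2)
        higher_differentiable_on_has_derivative[OF Suc.prems]]])
      (use Suc in auto)
qed

text \<open>The chain rule yields the derivative of F in a direction that varies with x, while the
  induction hypothesis concerns fixed directions. Expanding the varying direction in the basis of
  the Euclidean domain of F leaves a finite sum of products, to which the bilinear rule
  applies.\<close>

lemma higher_differentiable_on_compose:
  fixes F :: "'b::euclidean_space \<Rightarrow> 'c::real_normed_vector"
  assumes "open S" "open U" "g ` S \<subseteq> U"
    and "higher_differentiable_on n U F" "higher_differentiable_on n S g"
  shows "higher_differentiable_on n S (\<lambda>x. F (g x))"
  using assms(4,5)
proof (induction n arbitrary: F)
  case 0
  then show ?case using assms(3) by (auto intro: continuous_on_compose2)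
next
  case (Suc n)
  define g' where "g' = (\<lambda>x. frechet_derivative g (at x))"
  define F' where "F' = (\<lambda>y. frechet_derivative F (at y))"
  have der: "((\<lambda>x. F (g x)) has_derivative
      (\<lambda>v. \<Sum>b\<in>Basis. (g' x v \<bullet> b) *\<^sub>R F' (g x) b)) (at x)" if "x \<in> S" for x
  proof -
    have g: "(g has_derivative g' x) (at x)"
      using higher_differentiable_on_has_derivative[OF Suc.prems(2) that] by (simp add: g'_def)
    have F: "(F has_derivative F' (g x)) (at (g x))"
      using higher_differentiable_on_has_derivative[OF Suc.prems(1)] that assms(3)
      by (auto simp: F'_def)
    interpret F: bounded_linear "F' (g x)" by (rule has_derivative_bounded_linear[OF F])
    have *: "F' (g x) w = (\<Sum>b\<in>Basis. (w \<bullet> b) *\<^sub>R F' (g x) b)" for w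
    proof -
      have "F' (g x) w = F' (g x) (\<Sum>b\<in>Basis. (w \<bullet> b) *\<^sub>R b)"
        by (simp only: euclidean_representation)
      then show ?thesis by (simp only: F.sum F.scaleR)
    qed
    show ?thesis
      by (rule has_derivative_eq_rhs[OF has_derivative_compose[OF g F]]) (rule ext, rule *)
  qed
  show ?case
  proof (rule higher_differentiable_on_SucI[OF \<open>open S\<close> der])
    fix v
    show "higher_differentiable_on n S (\<lambda>x. \<Sum>b\<in>Basis. (g' x v \<bullet> b) *\<^sub>R F' (g x) b)"
      using Suc.prems unfolding g'_def F'_def
      by (intro higher_differentiable_on_sum[OF \<open>open S\<close>] Suc.IH
          higher_differentiable_on_bilinear[OF \<open>open S\<close> bounded_bilinear_scaleR]
          higher_differentiable_on_linear[OF \<open>open S\<close> bounded_linear_inner_left])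
        (auto intro: higher_differentiable_on_SucD)
  qed
qed

section \<open>Closure properties of smooth functions\<close>

lemma smooth_onI: "(\<And>n. higher_differentiable_on n S f) \<Longrightarrow> smooth_on S f"
  by (simp add: smooth_on_def)

lemma smooth_onD: "smooth_on S f \<Longrightarrow> higher_differentiable_on n S f"
  by (simp add: smooth_on_def)

lemma smooth_on_cong:
  assumes "open S" "\<And>x. x \<in> S \<Longrightarrow> f x = g x" "smooth_on S f"
  shows "smooth_on S g"
  by (rule smooth_onI, rule higher_differentiable_on_cong[OF assms(1,2) smooth_onD[OF assms(3)]])

lemma smooth_on_subset:
  assumes "smooth_on T f" "S \<subseteq> T"
  shows "smooth_on S f"
  by (rule smooth_onI, rule higher_differentiable_on_subset[OF smooth_onD[OF assms(1)] assms(2)])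

lemma smooth_on_const: "open S \<Longrightarrow> smooth_on S (\<lambda>x. c)"
  by (simp add: smooth_on_def higher_differentiable_on_const)

lemma smooth_on_add:
  assumes "open S" "smooth_on S f" "smooth_on S g"
  shows "smooth_on S (\<lambda>x. f x + g x)"
  by (rule smooth_onI, rule higher_differentiable_on_add[OF assms(1) assms(2,3)[THEN smooth_onD]])

lemma smooth_on_sum:
  assumes "open S" "\<And>i. i \<in> I \<Longrightarrow> smooth_on S (f i)"
  shows "smooth_on S (\<lambda>x. \<Sum>i\<in>I. f i x)"
  by (rule smooth_onI, rule higher_differentiable_on_sum[OF assms(1) smooth_onD[OF assms(2)]])

lemma smooth_on_bilinear:
  assumes "bounded_bilinear B" "open S" "smooth_on S f" "smooth_on S g"
  shows "smooth_on S (\<lambda>x. B (f x) (g x))"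
  by (rule smooth_onI,
      rule higher_differentiable_on_bilinear[OF assms(2,1) assms(3,4)[THEN smooth_onD]])

lemma smooth_on_linear:
  assumes "bounded_linear T" "open S" "smooth_on S f"
  shows "smooth_on S (\<lambda>x. T (f x))"
  by (rule smooth_onI, rule higher_differentiable_on_linear[OF assms(2,1) smooth_onD[OF assms(3)]])

lemma smooth_on_compose:
  fixes F :: "'b::euclidean_space \<Rightarrow> 'c::real_normed_vector"
  assumes "open S" "open U" "g ` S \<subseteq> U" "smooth_on U F" "smooth_on S g"
  shows "smooth_on S (\<lambda>x. F (g x))"
  by (rule smooth_onI,
      rule higher_differentiable_on_compose[OF assms(1,2,3) assms(4,5)[THEN smooth_onD]])

lemma smooth_on_id:
  assumes "open S" shows "smooth_on S (\<lambda>x. x)"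
proof -
  have "higher_differentiable_on n S (\<lambda>x. x)" for n
    using assms by (cases n) (auto intro: higher_differentiable_on_const)
  then show ?thesis by (simp add: smooth_on_def)
qed

lemma smooth_on_imp_continuous_on: "smooth_on S f \<Longrightarrow> continuous_on S f"
  unfolding smooth_on_def using higher_differentiable_on.simps(1) by blast

lemma smooth_on_has_derivative:
  "smooth_on S f \<Longrightarrow> x \<in> S \<Longrightarrow> (f has_derivative frechet_derivative f (at x)) (at x)"
  unfolding smooth_on_def using higher_differentiable_on_has_derivative by blast

lemma smooth_on_frechet_derivative:
  "smooth_on S f \<Longrightarrow> smooth_on S (\<lambda>x. frechet_derivative f (at x) v)"
  by (rule smooth_onI) (use smooth_onD[of S f "Suc n" for n] in simp)

lemma smooth_on_has_vector_derivative:
  fixes h :: "real \<Rightarrow> 'b::real_normed_vector"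
  shows "smooth_on S h \<Longrightarrow> x \<in> S \<Longrightarrow>
    (h has_vector_derivative vector_derivative h (at x)) (at x)"
  using smooth_on_has_derivative[of S h x] vector_derivative_works[of h "at x"]
  by (auto intro: differentiableI)

lemma smooth_on_vector_derivative:
  fixes h :: "real \<Rightarrow> 'b::real_normed_vector"
  assumes "open S" "smooth_on S h"
  shows "smooth_on S (\<lambda>x. vector_derivative h (at x))"
proof (rule smooth_on_cong[OF assms(1) _ smooth_on_frechet_derivative[OF assms(2), of 1]])
  fix x assume "x \<in> S"
  then show "frechet_derivative h (at x) 1 = vector_derivative h (at x)"
    using frechet_derivative_eq_vector_derivative[of h x]
      differentiableI[OF smooth_on_has_derivative[OF assms(2)]]
    by simp
qed

section \<open>Uniform convergence with all derivatives\<close>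

text \<open>Convergence of the derivatives up to order n, in a recursive form that suits induction
  along the derivative rules; \<open>unif_conv_iff\<close> relates it to
  \<open>nth_deriv\<close>.\<close>

primrec unif_conv ::
    "nat \<Rightarrow> ('i \<Rightarrow> real \<Rightarrow> 'b::real_normed_vector) \<Rightarrow> (real \<Rightarrow> 'b) \<Rightarrow> 'i filter \<Rightarrow> bool" where
  "unif_conv 0 u l F \<longleftrightarrow> uniform_limit UNIV u l F"
| "unif_conv (Suc n) u l F \<longleftrightarrow> uniform_limit UNIV u l F \<and>
     unif_conv n (\<lambda>i \<theta>. vector_derivative (u i) (at \<theta>)) (\<lambda>\<theta>. vector_derivative l (at \<theta>)) F"

lemma nth_deriv_0 [simp]: "nth_deriv 0 h = h"
  by (simp add: nth_deriv_def)

lemma nth_deriv_Suc: "nth_deriv (Suc n) h = nth_deriv n (\<lambda>\<theta>. vector_derivative h (at \<theta>))"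
  unfolding nth_deriv_def by (simp only: funpow_Suc_right o_apply)

lemma unif_conv_iff:
  "unif_conv n u l F \<longleftrightarrow> (\<forall>m\<le>n. uniform_limit UNIV (\<lambda>i. nth_deriv m (u i)) (nth_deriv m l) F)"
proof (induction n arbitrary: u l)
  case (Suc n)
  have "(\<forall>m\<le>Suc n. P m) \<longleftrightarrow> P 0 \<and> (\<forall>m\<le>n. P (Suc m))" for P
    by (metis Suc_le_mono le0 old.nat.exhaust)
  then show ?case by (simp add: Suc nth_deriv_Suc)
qed simp

definition smooth_conv ::
    "('i \<Rightarrow> real \<Rightarrow> 'b::real_normed_vector) \<Rightarrow> (real \<Rightarrow> 'b) \<Rightarrow> 'i filter \<Rightarrow> bool" where
  "smooth_conv u l F \<longleftrightarrow> (\<forall>n. unif_conv n u l F)"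

lemma smooth_conv_iff:
  "smooth_conv u l F \<longleftrightarrow> (\<forall>n. uniform_limit UNIV (\<lambda>i. nth_deriv n (u i)) (nth_deriv n l) F)"
  unfolding smooth_conv_def unif_conv_iff by blast

lemma loop_tendsto_iff:
  "loop_tendsto u l F \<longleftrightarrow> smooth_conv (\<lambda>i \<theta>. u i (cis \<theta>)) (\<lambda>\<theta>. l (cis \<theta>)) F"
  unfolding loop_tendsto_def smooth_conv_iff ..

lemma unif_conv_SucD: "unif_conv (Suc n) u l F \<Longrightarrow> unif_conv n u l F"
  unfolding unif_conv_iff by auto

lemma unif_conv_uniform_limit: "unif_conv n u l F \<Longrightarrow> uniform_limit UNIV u l F"
  by (cases n) auto

lemma smooth_conv_uniform_limit: "smooth_conv u l F \<Longrightarrow> uniform_limit UNIV u l F"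
  unfolding smooth_conv_def using unif_conv_uniform_limit by blast

lemma unif_conv_cong:
  assumes "\<forall>\<^sub>F i in F. u i = u' i"
  shows "unif_conv n u l F \<longleftrightarrow> unif_conv n u' l F"
proof -
  have "uniform_limit UNIV (\<lambda>i. nth_deriv m (u i)) (nth_deriv m l) F \<longleftrightarrow>
        uniform_limit UNIV (\<lambda>i. nth_deriv m (u' i)) (nth_deriv m l) F" for m
    by (rule uniform_limit_cong[OF eventually_mono[OF assms]]) simp_all
  then show ?thesis by (simp add: unif_conv_iff)
qed

lemma smooth_conv_cong:
  "\<forall>\<^sub>F i in F. u i = u' i \<Longrightarrow> smooth_conv u l F \<longleftrightarrow> smooth_conv u' l F"
  unfolding smooth_conv_def using unif_conv_cong by blast

text \<open>Periodicity makes all derivatives bounded, as the product rule for limits requires.\<close>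
definition periodic_smooth :: "(real \<Rightarrow> 'b::real_normed_vector) set" where
  "periodic_smooth = {h. smooth_on UNIV h \<and> (\<forall>\<theta>. h (\<theta> + 2 * pi) = h \<theta>)}"

section \<open>Periodic functions on the line\<close>

lemma frechet_derivative_shift:
  fixes f :: "'a::real_normed_vector \<Rightarrow> 'b::real_normed_vector"
  assumes "\<And>x. f (x + p) = f x"
  shows "frechet_derivative f (at (x + p)) = frechet_derivative f (at x)"
proof -
  have "(f has_derivative D) (at (x + p)) \<longleftrightarrow> (f has_derivative D) (at x)" for D
  proof -
    have "f (x + p + h) = f (x + h)" for h
      using assms[of "x + h"] by (simp add: add.assoc add.left_commute add.commute)
    then show ?thesis by (simp add: has_derivative_at assms)
  qed
  then show ?thesis by (simp add: frechet_derivative_def)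
qed

lemma vector_derivative_shift:
  fixes f :: "real \<Rightarrow> 'b::real_normed_vector"
  assumes "\<And>x. f (x + p) = f x"
  shows "vector_derivative f (at (x + p)) = vector_derivative f (at x)"
proof -
  have "(f has_vector_derivative D) (at (x + p)) \<longleftrightarrow> (f has_vector_derivative D) (at x)" for D
  proof -
    have "f (x + p + h) = f (x + h)" for h
      using assms[of "x + h"] by (simp add: add.assoc add.left_commute add.commute)
    then show ?thesis by (simp add: has_vector_derivative_def has_derivative_at assms)
  qed
  then show ?thesis by (simp add: vector_derivative_def)
qed

lemma periodic_smooth_deriv:
  "h \<in> periodic_smooth \<Longrightarrow> (\<lambda>\<theta>. vector_derivative h (at \<theta>)) \<in> periodic_smooth"
  unfolding periodic_smooth_def
  by (auto intro: smooth_on_vector_derivative vector_derivative_shift)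

lemma periodic_smooth_smooth: "h \<in> periodic_smooth \<Longrightarrow> smooth_on UNIV h"
  by (simp add: periodic_smooth_def)

lemma periodic_smooth_has_vector_derivative:
  "h \<in> periodic_smooth \<Longrightarrow> (h has_vector_derivative vector_derivative h (at \<theta>)) (at \<theta>)"
  using smooth_on_has_vector_derivative by (fastforce simp: periodic_smooth_def)

text \<open>Reduction modulo the period, so that compactness of the interval from 0 to 2 pi serves
  for the whole line.\<close>

lemma periodic_range:
  fixes h :: "real \<Rightarrow> 'b"
  assumes "\<And>\<theta>. h (\<theta> + 2 * pi) = h \<theta>"
  shows "\<exists>\<phi>\<in>{0..2*pi}. h \<theta> = h \<phi>"
proof -
  have per: "h (\<theta> + 2 * pi * of_int k) = h \<theta>" for \<theta> k
  proof (induction k rule: int_induct[where k = 0])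
    case (step1 i)
    then show ?case using assms[of "\<theta> + 2 * pi * of_int i"] by (simp add: algebra_simps)
  next
    case (step2 i)
    then show ?case using assms[of "\<theta> + 2 * pi * of_int (i - 1)"] by (simp add: algebra_simps)
  qed simp
  define k where "k = \<lfloor>\<theta> / (2 * pi)\<rfloor>"
  have "of_int k \<le> \<theta> / (2 * pi)" "\<theta> / (2 * pi) < of_int k + 1" by (auto simp: k_def)
  then have "\<theta> + 2 * pi * of_int (- k) \<in> {0..2*pi}" by (simp add: field_simps)
  then show ?thesis using per[of \<theta> "- k"] by metis
qed

lemma periodic_range_compact:
  fixes h :: "real \<Rightarrow> 'b::real_normed_vector"
  assumes "continuous_on UNIV h" "\<And>\<theta>. h (\<theta> + 2 * pi) = h \<theta>"
  shows "compact (range h)"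
proof -
  have "range h = h ` {0..2*pi}" using periodic_range[of h, OF assms(2)] by auto
  then show ?thesis
    using compact_continuous_image[OF continuous_on_subset[OF assms(1)]] by simp
qed

lemma periodic_smooth_compact_range: "h \<in> periodic_smooth \<Longrightarrow> compact (range h)"
  unfolding periodic_smooth_def
  by (auto intro: periodic_range_compact smooth_on_imp_continuous_on)

lemma periodic_smooth_const: "(\<lambda>\<theta>. c) \<in> periodic_smooth"
  by (simp add: periodic_smooth_def smooth_on_const)

lemma periodic_smooth_bilinear:
  assumes "bounded_bilinear B" "f \<in> periodic_smooth" "g \<in> periodic_smooth"
  shows "(\<lambda>\<theta>. B (f \<theta>) (g \<theta>)) \<in> periodic_smooth"
  using assms(2,3) smooth_on_bilinear[OF assms(1) open_UNIV, of f g]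
  by (simp add: periodic_smooth_def)

lemma periodic_smooth_linear:
  assumes "bounded_linear T" "f \<in> periodic_smooth"
  shows "(\<lambda>\<theta>. T (f \<theta>)) \<in> periodic_smooth"
  using assms(2) smooth_on_linear[OF assms(1) open_UNIV, of f] by (simp add: periodic_smooth_def)

lemma periodic_smooth_add:
  assumes "f \<in> periodic_smooth" "g \<in> periodic_smooth"
  shows "(\<lambda>\<theta>. f \<theta> + g \<theta>) \<in> periodic_smooth"
  using assms smooth_on_add[OF open_UNIV, of f g] by (simp add: periodic_smooth_def)

lemma periodic_smooth_compose:
  fixes G :: "'b::euclidean_space \<Rightarrow> 'c::real_normed_vector"
  assumes "open U" "smooth_on U G" "w \<in> periodic_smooth" "range w \<subseteq> U"
  shows "(\<lambda>\<theta>. G (w \<theta>)) \<in> periodic_smooth"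
  using assms(3) smooth_on_compose[OF open_UNIV assms(1,4,2)] by (simp add: periodic_smooth_def)

section \<open>Sum and product rules for convergence with all derivatives\<close>

lemma unif_conv_const: "unif_conv n (\<lambda>i. l) l F"
  by (simp add: unif_conv_iff uniform_limit_const)

lemma smooth_conv_const: "smooth_conv (\<lambda>i. l) l F"
  by (simp add: smooth_conv_def unif_conv_const)

text \<open>The recursive clause restated for explicit derivatives. Those of the approximating
  functions have to exist only eventually along the filter, as is the case for curves of loops that
  are smooth only for small parameters.\<close>

lemma unif_conv_transform:
  assumes "\<forall>\<^sub>F i in F. \<forall>\<theta>. (u i has_vector_derivative u' i \<theta>) (at \<theta>)"
    and "\<And>\<theta>. (l has_vector_derivative l' \<theta>) (at \<theta>)"
  shows "unif_conv (Suc n) u l F \<longleftrightarrow> uniform_limit UNIV u l F \<and> unif_conv n u' l' F"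
proof -
  have "\<forall>\<^sub>F i in F. (\<lambda>\<theta>. vector_derivative (u i) (at \<theta>)) = u' i"
    using assms(1) by (auto elim!: eventually_mono simp: vector_derivative_at)
  moreover have "(\<lambda>\<theta>. vector_derivative l (at \<theta>)) = l'"
    using assms(2) by (auto simp: vector_derivative_at)
  ultimately show ?thesis using unif_conv_cong by force
qed

lemma eventually_smooth_has_vector_derivative:
  assumes "\<forall>\<^sub>F i in F. smooth_on UNIV (u i)"
  shows "\<forall>\<^sub>F i in F. \<forall>\<theta>. (u i has_vector_derivative vector_derivative (u i) (at \<theta>)) (at \<theta>)"
  using assms by (rule eventually_mono) (simp add: smooth_on_has_vector_derivative)

lemma eventually_smooth_vector_derivative:
  assumes "\<forall>\<^sub>F i in F. smooth_on UNIV (u i)"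
  shows "\<forall>\<^sub>F i in F. smooth_on UNIV (\<lambda>\<theta>. vector_derivative (u i) (at \<theta>))"
  using assms by (rule eventually_mono) (simp add: smooth_on_vector_derivative)

lemma unif_conv_add:
  assumes "unif_conv n u l F" "unif_conv n v m F"
    and "\<forall>\<^sub>F i in F. smooth_on UNIV (u i)" "\<forall>\<^sub>F i in F. smooth_on UNIV (v i)"
    and "smooth_on UNIV l" "smooth_on UNIV m"
  shows "unif_conv n (\<lambda>i \<theta>. u i \<theta> + v i \<theta>) (\<lambda>\<theta>. l \<theta> + m \<theta>) F"
  using assms
proof (induction n arbitrary: u l v m)
  case 0
  then show ?case by (simp add: uniform_limit_add)
next
  case (Suc n)
  have *: "\<forall>\<^sub>F i in F. \<forall>\<theta>. ((\<lambda>\<theta>. u i \<theta> + v i \<theta>) has_vector_derivative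
        (vector_derivative (u i) (at \<theta>) + vector_derivative (v i) (at \<theta>))) (at \<theta>)"
    using eventually_smooth_has_vector_derivative[OF Suc.prems(3)]
      eventually_smooth_has_vector_derivative[OF Suc.prems(4)]
    by eventually_elim (auto intro: derivative_intros)
  have **: "((\<lambda>\<theta>. l \<theta> + m \<theta>) has_vector_derivative
      (vector_derivative l (at \<theta>) + vector_derivative m (at \<theta>))) (at \<theta>)" for \<theta>
    using Suc.prems(5,6) smooth_on_has_vector_derivative by (fastforce intro: derivative_intros)
  show ?case
    unfolding unif_conv_transform[OF * **]
    using Suc.prems
    by (intro conjI Suc.IH uniform_limit_add eventually_smooth_vector_derivative
        smooth_on_vector_derivative[OF open_UNIV]) simp_all
qed

text \<open>A product converges uniformly when the limits of the factors are bounded. Hence the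
  asymmetry of the hypotheses: the limits are periodic, so all their derivatives have compact range,
  while the approximating functions are only smooth. The Leibniz rule reduces the order by one in
  one of the factors.\<close>

lemma unif_conv_bilinear:
  assumes B: "bounded_bilinear B" and "unif_conv n u l F" "unif_conv n v m F"
    and "\<forall>\<^sub>F i in F. smooth_on UNIV (u i)" "\<forall>\<^sub>F i in F. smooth_on UNIV (v i)"
    and "l \<in> periodic_smooth" "m \<in> periodic_smooth"
  shows "unif_conv n (\<lambda>i \<theta>. B (u i \<theta>) (v i \<theta>)) (\<lambda>\<theta>. B (l \<theta>) (m \<theta>)) F"
  using assms(2-)
proof (induction n arbitrary: u l v m)
  case 0
  then show ?case
    by (simp add: bounded_bilinear.bounded_uniform_limit[OF B] periodic_smooth_compact_range
        compact_imp_bounded)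
next
  case (Suc n)
  have *: "\<forall>\<^sub>F i in F. \<forall>\<theta>. ((\<lambda>\<theta>. B (u i \<theta>) (v i \<theta>)) has_vector_derivative
      (B (u i \<theta>) (vector_derivative (v i) (at \<theta>)) + B (vector_derivative (u i) (at \<theta>)) (v i \<theta>)))
        (at \<theta>)"
    using eventually_smooth_has_vector_derivative[OF Suc.prems(3)]
      eventually_smooth_has_vector_derivative[OF Suc.prems(4)]
    by eventually_elim (intro allI bounded_bilinear.has_vector_derivative[OF B], simp_all)
  have **: "((\<lambda>\<theta>. B (l \<theta>) (m \<theta>)) has_vector_derivative
      (B (l \<theta>) (vector_derivative m (at \<theta>)) + B (vector_derivative l (at \<theta>)) (m \<theta>))) (at \<theta>)"
    for \<theta>
    using Suc.prems(5,6)
    by (intro bounded_bilinear.has_vector_derivative[OF B] periodic_smooth_has_vector_derivative)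
  have smB: "\<forall>\<^sub>F i in F. smooth_on UNIV (\<lambda>\<theta>. B (p i \<theta>) (q i \<theta>))"
    if "\<forall>\<^sub>F i in F. smooth_on UNIV (p i)" "\<forall>\<^sub>F i in F. smooth_on UNIV (q i)" for p q
    using that by eventually_elim (rule smooth_on_bilinear[OF B open_UNIV])
  have "uniform_limit UNIV (\<lambda>i \<theta>. B (u i \<theta>) (v i \<theta>)) (\<lambda>\<theta>. B (l \<theta>) (m \<theta>)) F"
    using Suc.prems
    by (simp add: bounded_bilinear.bounded_uniform_limit[OF B] periodic_smooth_compact_range
        compact_imp_bounded)
  then show ?case
    unfolding unif_conv_transform[OF * **]
    using Suc.prems unif_conv_SucD[OF Suc.prems(1)] unif_conv_SucD[OF Suc.prems(2)]
    by (intro conjI unif_conv_add Suc.IH smB eventually_smooth_vector_derivative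
        periodic_smooth_deriv periodic_smooth_smooth periodic_smooth_bilinear[OF B]) simp_all
qed

lemma smooth_conv_add:
  assumes "smooth_conv u l F" "smooth_conv v m F"
    and "\<forall>\<^sub>F i in F. u i \<in> periodic_smooth" "\<forall>\<^sub>F i in F. v i \<in> periodic_smooth"
    and "l \<in> periodic_smooth" "m \<in> periodic_smooth"
  shows "smooth_conv (\<lambda>i \<theta>. u i \<theta> + v i \<theta>) (\<lambda>\<theta>. l \<theta> + m \<theta>) F"
  unfolding smooth_conv_def
  using unif_conv_add[OF _ _ eventually_mono[OF assms(3) periodic_smooth_smooth]
      eventually_mono[OF assms(4) periodic_smooth_smooth] assms(5,6)[THEN periodic_smooth_smooth]]
    assms(1,2) by (simp add: smooth_conv_def)

lemma smooth_conv_bilinear: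
  assumes "bounded_bilinear B" "smooth_conv u l F" "smooth_conv v m F"
    and "\<forall>\<^sub>F i in F. u i \<in> periodic_smooth" "\<forall>\<^sub>F i in F. v i \<in> periodic_smooth"
    and "l \<in> periodic_smooth" "m \<in> periodic_smooth"
  shows "smooth_conv (\<lambda>i \<theta>. B (u i \<theta>) (v i \<theta>)) (\<lambda>\<theta>. B (l \<theta>) (m \<theta>)) F"
  unfolding smooth_conv_def
  using unif_conv_bilinear[OF assms(1) _ _ eventually_mono[OF assms(4) periodic_smooth_smooth]
      eventually_mono[OF assms(5) periodic_smooth_smooth] assms(6,7)]
    assms(2,3) by (simp add: smooth_conv_def)

lemma smooth_conv_linear:
  assumes "bounded_linear T" "smooth_conv u l F" "\<forall>\<^sub>F i in F. u i \<in> periodic_smooth"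
    and "l \<in> periodic_smooth"
  shows "smooth_conv (\<lambda>i \<theta>. T (u i \<theta>)) (\<lambda>\<theta>. T (l \<theta>)) F"
proof -
  \<comment> \<open>A linear map is treated as a bilinear one whose first factor is the constant
    function 1.\<close>
  have "bounded_bilinear (\<lambda>(r::real) x. r *\<^sub>R T x)"
    using bounded_bilinear.comp[OF bounded_bilinear_scaleR bounded_linear_ident assms(1)] by simp
  from smooth_conv_bilinear[OF this smooth_conv_const[of "\<lambda>\<theta>. 1"] assms(2) _ assms(3) _ assms(4)]
  show ?thesis by (simp add: periodic_smooth_const)
qed

lemma unif_conv_sum:
  assumes "finite A" "\<And>a. a \<in> A \<Longrightarrow> unif_conv n (u a) (l a) F"
    and "\<And>a. a \<in> A \<Longrightarrow> \<forall>\<^sub>F i in F. smooth_on UNIV (u a i)" "\<And>a. a \<in> A \<Longrightarrow> smooth_on UNIV (l a)"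
  shows "unif_conv n (\<lambda>i \<theta>. \<Sum>a\<in>A. u a i \<theta>) (\<lambda>\<theta>. \<Sum>a\<in>A. l a \<theta>) F"
  using assms
proof (induction A rule: finite_induct)
  case empty
  then show ?case by (simp add: unif_conv_const)
next
  case (insert a A)
  have "\<forall>\<^sub>F i in F. \<forall>a\<in>A. smooth_on UNIV (u a i)"
    using insert by (simp add: eventually_ball_finite)
  then have "\<forall>\<^sub>F i in F. smooth_on UNIV (\<lambda>\<theta>. \<Sum>a\<in>A. u a i \<theta>)"
    by eventually_elim (simp add: smooth_on_sum[OF open_UNIV])
  moreover have "smooth_on UNIV (\<lambda>\<theta>. \<Sum>a\<in>A. l a \<theta>)"
    by (rule smooth_on_sum[OF open_UNIV]) (use insert in simp)
  moreover have "unif_conv n (\<lambda>i \<theta>. \<Sum>a\<in>A. u a i \<theta>) (\<lambda>\<theta>. \<Sum>a\<in>A. l a \<theta>) F"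
    using insert by simp
  ultimately show ?case
    using insert unif_conv_add[of n "u a" "l a" F] by simp
qed

lemma smooth_conv_sum:
  assumes "finite A" "\<And>a. a \<in> A \<Longrightarrow> smooth_conv (u a) (l a) F"
    and "\<And>a. a \<in> A \<Longrightarrow> \<forall>\<^sub>F i in F. u a i \<in> periodic_smooth" "\<And>a. a \<in> A \<Longrightarrow> l a \<in> periodic_smooth"
  shows "smooth_conv (\<lambda>i \<theta>. \<Sum>a\<in>A. u a i \<theta>) (\<lambda>\<theta>. \<Sum>a\<in>A. l a \<theta>) F"
  unfolding smooth_conv_def
  by (intro allI unif_conv_sum[OF assms(1)] assms(2)[unfolded smooth_conv_def, rule_format]
      eventually_mono[OF assms(3) periodic_smooth_smooth] periodic_smooth_smooth[OF assms(4)])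

lemma periodic_smooth_sum:
  assumes "\<And>a. a \<in> A \<Longrightarrow> l a \<in> periodic_smooth"
  shows "(\<lambda>\<theta>. \<Sum>a\<in>A. l a \<theta>) \<in> periodic_smooth"
  using assms by (simp add: periodic_smooth_def smooth_on_sum)

lemma smooth_conv_deriv:
  "smooth_conv u l F \<Longrightarrow>
   smooth_conv (\<lambda>i \<theta>. vector_derivative (u i) (at \<theta>)) (\<lambda>\<theta>. vector_derivative l (at \<theta>)) F"
  using unif_conv.simps(2)[of _ u l F] unfolding smooth_conv_def by blast


lemma bounded_linear_basis_expansion:
  fixes f :: "'a::euclidean_space \<Rightarrow> 'b::real_normed_vector"
  assumes "bounded_linear f"
  shows "f w = (\<Sum>b\<in>Basis. (w \<bullet> b) *\<^sub>R f b)"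
proof -
  interpret bounded_linear f by (rule assms)
  have "f w = f (\<Sum>b\<in>Basis. (w \<bullet> b) *\<^sub>R b)" by (simp only: euclidean_representation)
  then show ?thesis by (simp only: sum scaleR)
qed

section \<open>Composition of convergent families with smooth functions\<close>

text \<open>The compact range of the limit has a closed e-neighbourhood inside U, which uniformly
  close functions cannot leave. It is written as the sum of the range and a ball, so that its
  compactness follows from that of the summands.\<close>

lemma uniform_limit_compact_neighbourhood:
  fixes w :: "'i \<Rightarrow> 'a \<Rightarrow> 'b::euclidean_space"
  assumes "uniform_limit UNIV w l F" "compact (range l)" "range l \<subseteq> U" "open U"
  obtains K where "compact K" "K \<subseteq> U" "range l \<subseteq> K" "\<forall>\<^sub>F i in F. range (w i) \<subseteq> K"
proof -
  obtain e where e: "e > 0" "(\<Union>x\<in>range l. cball x e) \<subseteq> U"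
    using compact_subset_open_imp_cball_epsilon_subset[OF assms(2,4,3)] by blast
  define K where "K = {x + y | x y. x \<in> range l \<and> y \<in> cball 0 e}"
  have K: "K = (\<Union>x\<in>range l. cball x e)"
  proof (rule subset_antisym; rule subsetI)
    fix z assume "z \<in> (\<Union>x\<in>range l. cball x e)"
    then obtain x where "x \<in> range l" "dist x z \<le> e" by auto
    then have "z = x + (z - x)" "z - x \<in> cball 0 e" by (auto simp: dist_norm norm_minus_commute)
    then show "z \<in> K" using \<open>x \<in> range l\<close> unfolding K_def by blast
  next
    fix z assume "z \<in> K"
    then obtain x y where "x \<in> range l" "z = x + y" "norm y \<le> e" by (auto simp: K_def)
    then have "z \<in> cball x e" by (simp add: dist_norm)
    then show "z \<in> (\<Union>x\<in>range l. cball x e)" using \<open>x \<in> range l\<close> by blast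
  qed
  show ?thesis
  proof (rule that)
    show "compact K" unfolding K_def by (rule compact_sums[OF assms(2) compact_cball])
    show "K \<subseteq> U" "range l \<subseteq> K" using e by (auto simp: K)
    show "\<forall>\<^sub>F i in F. range (w i) \<subseteq> K"
      using uniform_limitD[OF assms(1) e(1)]
    proof eventually_elim
      case (elim i)
      have "w i x \<in> cball (l x) e" for x using elim by (simp add: dist_commute less_imp_le)
      then show ?case unfolding K by blast
    qed
  qed
qed

lemma uniform_limit_compose_continuous:
  fixes w :: "'i \<Rightarrow> 'a \<Rightarrow> 'b::euclidean_space" and G :: "'b \<Rightarrow> 'c::metric_space"
  assumes "uniform_limit UNIV w l F" "compact (range l)" "range l \<subseteq> U" "open U"
    and "continuous_on U G"
  shows "uniform_limit UNIV (\<lambda>i x. G (w i x)) (\<lambda>x. G (l x)) F"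
proof (rule uniform_limitI)
  fix e :: real assume "e > 0"
  obtain K where K: "compact K" "K \<subseteq> U" "range l \<subseteq> K" "\<forall>\<^sub>F i in F. range (w i) \<subseteq> K"
    using uniform_limit_compact_neighbourhood[OF assms(1-4)] .
  have "uniformly_continuous_on K G"
    using K assms(5) by (auto intro: compact_uniformly_continuous continuous_on_subset)
  then obtain d where d: "d > 0" "\<And>x y. x \<in> K \<Longrightarrow> y \<in> K \<Longrightarrow> dist y x < d \<Longrightarrow> dist (G y) (G x) < e"
    using \<open>e > 0\<close> unfolding uniformly_continuous_on_def by metis
  show "\<forall>\<^sub>F i in F. \<forall>x\<in>UNIV. dist (G (w i x)) (G (l x)) < e"
    using uniform_limitD[OF assms(1) d(1)] K(4)
    by eventually_elim (use d K(3) in blast)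
qed

text \<open>The basis expansion of the chain rule again: the derivative of the composite is a finite
  sum of products of a component of the derivative of \<open>w i\<close> and a partial derivative of
  G along \<open>w i\<close>. The second factors are composites with one order less to control, so
  the induction runs over G.\<close>

lemma unif_conv_compose:
  fixes G :: "'b::euclidean_space \<Rightarrow> 'c::real_normed_vector"
  assumes "open U" and w: "\<forall>\<^sub>F i in F. smooth_on UNIV (w i)"
    and l: "l \<in> periodic_smooth" "range l \<subseteq> U"
    and "smooth_on U G" "unif_conv n w l F"
  shows "unif_conv n (\<lambda>i \<theta>. G (w i \<theta>)) (\<lambda>\<theta>. G (l \<theta>)) F"
  using assms(5,6)
proof (induction n arbitrary: G)
  case 0
  then have "uniform_limit UNIV w l F" by simp
  from uniform_limit_compose_continuous[OF this periodic_smooth_compact_range[OF l(1)] l(2) assms(1)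
      smooth_on_imp_continuous_on[OF 0(1)]]
  show ?case by simp
next
  case (Suc n)
  define G' where "G' = (\<lambda>b y. frechet_derivative G (at y) b)"
  have G': "smooth_on U (G' b)" for b
    unfolding G'_def by (rule smooth_on_frechet_derivative[OF Suc.prems(1)])
  have lim: "uniform_limit UNIV w l F" by (rule unif_conv_uniform_limit[OF Suc.prems(2)])
  obtain K where "compact K" "K \<subseteq> U" "range l \<subseteq> K" "\<forall>\<^sub>F i in F. range (w i) \<subseteq> K"
    using uniform_limit_compact_neighbourhood[OF lim periodic_smooth_compact_range[OF l(1)] l(2)
        assms(1)] .
  from this(4) have ev: "\<forall>\<^sub>F i in F. range (w i) \<subseteq> U"
    by eventually_elim (use \<open>K \<subseteq> U\<close> in blast)
  have der: "((\<lambda>\<theta>. G (h \<theta>)) has_vector_derivative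
      (\<Sum>b\<in>Basis. (vector_derivative h (at \<theta>) \<bullet> b) *\<^sub>R G' b (h \<theta>))) (at \<theta>)"
    if "smooth_on UNIV h" "range h \<subseteq> U" for h :: "real \<Rightarrow> 'b" and \<theta>
  proof -
    have G: "(G has_derivative (\<lambda>b. G' b (h \<theta>))) (at (h \<theta>))"
      unfolding G'_def by (rule smooth_on_has_derivative[OF Suc.prems(1)]) (use that in auto)
    have "((\<lambda>\<theta>. G (h \<theta>)) has_vector_derivative G' (vector_derivative h (at \<theta>)) (h \<theta>)) (at \<theta>)"
      using vector_derivative_diff_chain_within[of h _ \<theta> UNIV G "\<lambda>b. G' b (h \<theta>)",
          OF _ has_derivative_at_withinI[OF G]]
        smooth_on_has_vector_derivative[OF that(1)]
      by (simp only: o_def UNIV_I)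
    then show ?thesis
      by (subst (asm) bounded_linear_basis_expansion[OF has_derivative_bounded_linear[OF G]])
  qed
  have *: "\<forall>\<^sub>F i in F. \<forall>\<theta>. ((\<lambda>\<theta>. G (w i \<theta>)) has_vector_derivative
      (\<Sum>b\<in>Basis. (vector_derivative (w i) (at \<theta>) \<bullet> b) *\<^sub>R G' b (w i \<theta>))) (at \<theta>)"
    using ev w by eventually_elim (simp add: der)
  have **: "((\<lambda>\<theta>. G (l \<theta>)) has_vector_derivative
      (\<Sum>b\<in>Basis. (vector_derivative l (at \<theta>) \<bullet> b) *\<^sub>R G' b (l \<theta>))) (at \<theta>)" for \<theta>
    by (rule der[OF periodic_smooth_smooth[OF l(1)] l(2)])
  have inner: "bounded_bilinear (\<lambda>x (y :: 'c). (x \<bullet> b) *\<^sub>R y)" for b :: 'b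
    by (rule bounded_bilinear.comp[OF bounded_bilinear_scaleR bounded_linear_inner_left
          bounded_linear_ident])
  have smB: "smooth_on UNIV (\<lambda>\<theta>. (vector_derivative h (at \<theta>) \<bullet> b) *\<^sub>R G' b (h \<theta>))"
    if "smooth_on UNIV h" "range h \<subseteq> U" for h :: "real \<Rightarrow> 'b" and b
    by (rule smooth_on_bilinear[OF inner open_UNIV smooth_on_vector_derivative[OF open_UNIV that(1)]
          smooth_on_compose[OF open_UNIV assms(1) that(2) G' that(1)]])
  have "unif_conv n (\<lambda>i \<theta>. \<Sum>b\<in>Basis. (vector_derivative (w i) (at \<theta>) \<bullet> b) *\<^sub>R G' b (w i \<theta>))
      (\<lambda>\<theta>. \<Sum>b\<in>Basis. (vector_derivative l (at \<theta>) \<bullet> b) *\<^sub>R G' b (l \<theta>)) F"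
  proof (rule unif_conv_sum[OF finite_Basis])
    fix b :: 'b
    have "\<forall>\<^sub>F i in F. smooth_on UNIV (\<lambda>\<theta>. G' b (w i \<theta>))"
      using ev w by eventually_elim (use G' smooth_on_compose[OF open_UNIV assms(1)] in blast)
    then show "unif_conv n (\<lambda>i \<theta>. (vector_derivative (w i) (at \<theta>) \<bullet> b) *\<^sub>R G' b (w i \<theta>))
      (\<lambda>\<theta>. (vector_derivative l (at \<theta>) \<bullet> b) *\<^sub>R G' b (l \<theta>)) F"
      using Suc.prems(2) unif_conv_SucD[OF Suc.prems(2)]
      by (intro unif_conv_bilinear[OF inner] Suc.IH[OF G'] periodic_smooth_deriv l
          periodic_smooth_compose[OF assms(1) G'] eventually_smooth_vector_derivative w) simp_all
    show "\<forall>\<^sub>F i in F. smooth_on UNIV (\<lambda>\<theta>. (vector_derivative (w i) (at \<theta>) \<bullet> b) *\<^sub>R G' b (w i \<theta>))"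
      using ev w by eventually_elim (rule smB)
    show "smooth_on UNIV (\<lambda>\<theta>. (vector_derivative l (at \<theta>) \<bullet> b) *\<^sub>R G' b (l \<theta>))"
      by (rule smB[OF periodic_smooth_smooth[OF l(1)] l(2)])
  qed
  moreover have "uniform_limit UNIV (\<lambda>i \<theta>. G (w i \<theta>)) (\<lambda>\<theta>. G (l \<theta>)) F"
    by (rule uniform_limit_compose_continuous[OF lim periodic_smooth_compact_range[OF l(1)] l(2)
          assms(1) smooth_on_imp_continuous_on[OF Suc.prems(1)]])
  ultimately show ?case
    unfolding unif_conv_transform[OF * **] by blast
qed

lemma smooth_conv_compose:
  fixes G :: "'b::euclidean_space \<Rightarrow> 'c::real_normed_vector"
  assumes "open U" "smooth_on U G" "l \<in> periodic_smooth" "range l \<subseteq> U"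
    and "\<forall>\<^sub>F i in F. w i \<in> periodic_smooth" "smooth_conv w l F"
  shows "smooth_conv (\<lambda>i \<theta>. G (w i \<theta>)) (\<lambda>\<theta>. G (l \<theta>)) F"
    and "\<forall>\<^sub>F i in F. range (w i) \<subseteq> U"
    and "\<forall>\<^sub>F i in F. (\<lambda>\<theta>. G (w i \<theta>)) \<in> periodic_smooth"
proof -
  show "smooth_conv (\<lambda>i \<theta>. G (w i \<theta>)) (\<lambda>\<theta>. G (l \<theta>)) F"
    unfolding smooth_conv_def
    by (intro allI unif_conv_compose[OF assms(1) eventually_mono[OF assms(5) periodic_smooth_smooth]
          assms(3,4,2)] assms(6)[unfolded smooth_conv_def, rule_format])
  obtain K where "compact K" "K \<subseteq> U" "range l \<subseteq> K" "\<forall>\<^sub>F i in F. range (w i) \<subseteq> K"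
    using uniform_limit_compact_neighbourhood[OF smooth_conv_uniform_limit[OF assms(6)]
        periodic_smooth_compact_range[OF assms(3)] assms(4,1)] .
  from this(4) show *: "\<forall>\<^sub>F i in F. range (w i) \<subseteq> U"
    by eventually_elim (use \<open>K \<subseteq> U\<close> in blast)
  show "\<forall>\<^sub>F i in F. (\<lambda>\<theta>. G (w i \<theta>)) \<in> periodic_smooth"
    using * assms(5) by eventually_elim (rule periodic_smooth_compose[OF assms(1,2)])
qed

text \<open>The real derivative in direction v is \<open>deriv f z * v\<close>, and
  \<open>deriv f\<close> is holomorphic again, so the induction closes.\<close>

lemma higher_differentiable_on_holomorphic:
  assumes "open S" "f holomorphic_on S"
  shows "higher_differentiable_on n S f"
  using assms(2)
proof (induction n arbitrary: f)
  case 0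
  then show ?case by (simp add: holomorphic_on_imp_continuous_on)
next
  case (Suc n)
  show ?case
  proof (rule higher_differentiable_on_SucI[OF assms(1)])
    show "(f has_derivative (*) (deriv f z)) (at z)" if "z \<in> S" for z
      using holomorphic_derivI[OF Suc.prems assms(1) that] by (simp add: has_field_derivative_def)
    show "higher_differentiable_on n S (\<lambda>z. deriv f z * v)" for v
      by (intro higher_differentiable_on_linear[OF assms(1) bounded_linear_mult_left] Suc.IH
          holomorphic_deriv[OF Suc.prems assms(1)])
  qed
qed

lemma smooth_on_holomorphic: "open S \<Longrightarrow> f holomorphic_on S \<Longrightarrow> smooth_on S f"
  by (rule smooth_onI) (rule higher_differentiable_on_holomorphic)

lemma smooth_on_cis:
  assumes "open S" "smooth_on S g"
  shows "smooth_on S (\<lambda>x. cis (g x))"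
proof -
  have "smooth_on S (\<lambda>x. g x *\<^sub>R \<i>)"
    by (rule smooth_on_linear[OF bounded_linear_scaleR_left assms])
  from smooth_on_compose[OF assms(1) open_UNIV subset_UNIV
      smooth_on_holomorphic[OF open_UNIV holomorphic_on_exp] this]
  have "smooth_on S (\<lambda>x. exp (g x *\<^sub>R \<i>))" .
  then show ?thesis by (simp add: cis_conv_exp scaleR_conv_of_real mult.commute)
qed

text \<open>Sampling the punctured neighbourhoods of 0 along a sequence reduces this to termwise
  differentiation of a sequence of functions.\<close>

lemma has_vector_derivative_uniform_limit:
  fixes u :: "real \<Rightarrow> real \<Rightarrow> 'b::banach"
  assumes "\<forall>\<^sub>F s in at 0. \<forall>\<theta>. (u s has_vector_derivative u' s \<theta>) (at \<theta>)"
    and "uniform_limit UNIV u l (at 0)" "uniform_limit UNIV u' l' (at 0)"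
  shows "(l has_vector_derivative l' \<theta>) (at \<theta>)"
proof -
  obtain d where d: "d > 0" "\<And>s \<theta>. s \<noteq> 0 \<Longrightarrow> \<bar>s\<bar> < d \<Longrightarrow> (u s has_vector_derivative u' s \<theta>) (at \<theta>)"
    using assms(1) unfolding eventually_at by auto
  \<comment> \<open>With n + 2 in the denominator every term is nonzero and strictly below d, so the
    derivative exists for all n and not just for large n; n + 1 would fail at n = 0.\<close>
  define X where "X = (\<lambda>n. d / real (n + 2))"
  have X: "X n \<noteq> 0" "\<bar>X n\<bar> < d" for n using d(1) by (auto simp: X_def field_simps add_pos_nonneg)
  have "X \<longlonglongrightarrow> 0"
    unfolding X_def by (rule real_tendsto_divide_at_top[OF tendsto_const])
      (intro filterlim_compose[OF filterlim_real_sequentially] filterlim_add_const_nat_at_top)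
  then have fl: "filterlim X (at 0) sequentially" using X by (simp add: filterlim_at)
  have u: "uniform_limit UNIV (\<lambda>n. u (X n)) l sequentially"
    and u': "uniform_limit UNIV (\<lambda>n. u' (X n)) l' sequentially"
    using filterlim_compose[OF assms(2) fl] filterlim_compose[OF assms(3) fl] by simp_all
  have der: "(u (X n) has_derivative (\<lambda>h. h *\<^sub>R u' (X n) x)) (at x within UNIV)" for n x
    using d(2)[OF X] by (simp add: has_vector_derivative_def)
  have "\<forall>\<^sub>F n in sequentially. \<forall>x\<in>UNIV. \<forall>h. norm (h *\<^sub>R u' (X n) x - h *\<^sub>R l' x) \<le> e * norm h"
    if "e > 0" for e :: real
    using uniform_limitD[OF u' that]
  proof eventually_elim
    case (elim n)
    show ?case
    proof (intro ballI allI)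
      fix x and h :: real
      have "norm (h *\<^sub>R u' (X n) x - h *\<^sub>R l' x) = \<bar>h\<bar> * dist (u' (X n) x) (l' x)"
        by (simp add: dist_norm flip: scaleR_diff_right)
      also have "\<dots> \<le> \<bar>h\<bar> * e" using elim by (intro mult_left_mono) (auto simp: less_imp_le)
      finally show "norm (h *\<^sub>R u' (X n) x - h *\<^sub>R l' x) \<le> e * norm h" by (simp add: mult.commute)
    qed
  qed
  from has_derivative_sequence[OF convex_UNIV der this UNIV_I tendsto_uniform_limitI[OF u UNIV_I]]
  have "\<exists>g. \<forall>x\<in>UNIV. (\<lambda>n. u (X n) x) \<longlonglongrightarrow> g x \<and>
      (g has_derivative (\<lambda>h. h *\<^sub>R l' x)) (at x within UNIV)" .
  then obtain g where g: "\<And>x. (\<lambda>n. u (X n) x) \<longlonglongrightarrow> g x"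
    "\<And>x. (g has_vector_derivative l' x) (at x)"
    by (auto simp: has_vector_derivative_def)
  have "g = l" using LIMSEQ_unique[OF g(1) tendsto_uniform_limitI[OF u]] by auto
  then show ?thesis using g(2) by simp
qed

text \<open>Joint smoothness in the parameter and the angle turns a pointwise derivative in the
  parameter into one in the \<open>C\<^sup>\<infinity>\<close> topology.\<close>

locale joint_family =
  fixes \<delta> :: real and W :: "(real \<times> real) set"
  assumes \<delta>: "\<delta> > 0" and W_def: "W = {-\<delta><..<\<delta>} \<times> UNIV"
begin

definition joint :: "(real \<times> real \<Rightarrow> 'b::real_normed_vector) set" where
  "joint = {H. smooth_on W H \<and> (\<forall>p. H (p + (0, 2 * pi)) = H p)}"

lemma open_W: "open W"
  unfolding W_def by (intro open_Times) auto

lemma joint_frechet: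
  assumes "H \<in> joint"
  shows "(\<lambda>p. frechet_derivative H (at p) v) \<in> joint"
proof -
  have "smooth_on W H" "\<And>p. H (p + (0, 2 * pi)) = H p"
    using assms unfolding joint_def by blast+
  from smooth_on_frechet_derivative[OF this(1)] frechet_derivative_shift[of H, OF this(2)]
  show ?thesis unfolding joint_def mem_Collect_eq by metis
qed

lemma joint_theta:
  assumes "H \<in> joint" "\<bar>s\<bar> < \<delta>"
  shows "((\<lambda>\<theta>. H (s, \<theta>)) has_vector_derivative frechet_derivative H (at (s, \<theta>)) (0, 1)) (at \<theta>)"
    and "((\<lambda>\<sigma>. H (\<sigma>, \<theta>)) has_vector_derivative frechet_derivative H (at (s, \<theta>)) (1, 0)) (at s)"
    and "(\<lambda>\<theta>. H (s, \<theta>)) \<in> periodic_smooth"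
proof -
  have mem: "(s, \<theta>) \<in> W" for \<theta> using assms by (auto simp: W_def)
  have H: "(H has_derivative frechet_derivative H (at (s, \<theta>))) (at (s, \<theta>))" for \<theta>
    using smooth_on_has_derivative[of W H, OF _ mem] assms(1) by (simp add: joint_def)
  have "((\<lambda>\<theta>. (s, \<theta>)) has_vector_derivative (0, 1)) (at \<theta>)"
    by (auto intro!: derivative_eq_intros has_vector_derivative_Pair)
  then show "((\<lambda>\<theta>. H (s, \<theta>)) has_vector_derivative frechet_derivative H (at (s, \<theta>)) (0, 1)) (at \<theta>)"
    using vector_derivative_diff_chain_within[of "\<lambda>\<theta>. (s, \<theta>)" _ \<theta> UNIV H] has_derivative_at_withinI[OF H]
    by (simp add: o_def)
  have "((\<lambda>\<sigma>. (\<sigma>, \<theta>)) has_vector_derivative (1, 0)) (at s)"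
    by (auto intro!: derivative_eq_intros has_vector_derivative_Pair)
  then show "((\<lambda>\<sigma>. H (\<sigma>, \<theta>)) has_vector_derivative frechet_derivative H (at (s, \<theta>)) (1, 0)) (at s)"
    using vector_derivative_diff_chain_within[of "\<lambda>\<sigma>. (\<sigma>, \<theta>)" _ s UNIV H] has_derivative_at_withinI[OF H]
    by (simp add: o_def)
  have "smooth_on UNIV (\<lambda>\<theta>. (s, 0) + (0, \<theta>))"
    by (rule smooth_on_add[OF open_UNIV smooth_on_const[OF open_UNIV] smooth_on_linear[OF
          bounded_linear_Pair[OF bounded_linear_zero bounded_linear_ident] open_UNIV
          smooth_on_id[OF open_UNIV]]])
  then have "smooth_on UNIV (\<lambda>\<theta>. H (s, \<theta>))"
    using assms mem smooth_on_compose[OF open_UNIV open_W, of "\<lambda>\<theta>. (s, \<theta>)" H]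
    by (auto simp: joint_def simp del: split_paired_All)
  moreover have "H (s, \<theta> + 2 * pi) = H (s, \<theta>)" for \<theta>
  proof -
    have "H ((s, \<theta>) + (0, 2 * pi)) = H (s, \<theta>)" using assms(1) unfolding joint_def by blast
    then show ?thesis by simp
  qed
  ultimately show "(\<lambda>\<theta>. H (s, \<theta>)) \<in> periodic_smooth" by (simp add: periodic_smooth_def)
qed

text \<open>The mean value inequality is applied to H minus its linear part in s. The derivative of
  this difference is the increment of the s-derivative of H, which is small by uniform continuity on
  a compact rectangle; periodicity extends the bound to all angles.\<close>

lemma joint_quotient_uniform:
  assumes H: "H \<in> joint"
  shows "uniform_limit UNIV (\<lambda>s \<theta>. (H (s, \<theta>) - H (0, \<theta>)) /\<^sub>R s)
    (\<lambda>\<theta>. frechet_derivative H (at (0, \<theta>)) (1, 0)) (at 0)"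
proof (rule uniform_limitI)
  fix e :: real assume "e > 0"
  define K where "K = (\<lambda>p. frechet_derivative H (at p) (1, 0))"
  have K: "K \<in> joint" unfolding K_def by (rule joint_frechet[OF H])
  let ?R = "{-\<delta>/2..\<delta>/2} \<times> {0..2*pi}"
  have "smooth_on W K" using K by (simp add: joint_def)
  then have "continuous_on ?R K"
    by (rule continuous_on_subset[OF smooth_on_imp_continuous_on]) (use \<delta> in \<open>auto simp: W_def\<close>)
  then have "uniformly_continuous_on ?R K"
    by (intro compact_uniformly_continuous compact_Times) auto
  then obtain d where d: "d > 0"
    "\<And>x y. x \<in> ?R \<Longrightarrow> y \<in> ?R \<Longrightarrow> dist y x < d \<Longrightarrow> dist (K y) (K x) < e / 2"
    using \<open>e > 0\<close> unfolding uniformly_continuous_on_def by (metis half_gt_zero)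
  define r where "r = min d (\<delta> / 2)"
  have r: "r > 0" "r \<le> d" "r \<le> \<delta> / 2" using d \<delta> by (auto simp: r_def)
  have near: "norm (K (\<sigma>, \<theta>) - K (0, \<theta>)) \<le> e / 2" if "\<bar>\<sigma>\<bar> < r" for \<sigma> \<theta>
  proof -
    \<comment> \<open>Both values have to be moved by the same multiple of 2 pi, so the pair is
      reduced as one periodic function.\<close>
    have "(\<lambda>\<theta>. (K (\<sigma>, \<theta>), K (0, \<theta>))) (\<theta> + 2 * pi) = (\<lambda>\<theta>. (K (\<sigma>, \<theta>), K (0, \<theta>))) \<theta>" for \<theta>
      using joint_theta(3)[OF K, of \<sigma>] joint_theta(3)[OF K, of 0] that r \<delta>
      by (auto simp: periodic_smooth_def)
    from periodic_range[of "\<lambda>\<theta>. (K (\<sigma>, \<theta>), K (0, \<theta>))", OF this]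
    obtain \<phi> where \<phi>: "\<phi> \<in> {0..2*pi}" "(K (\<sigma>, \<theta>), K (0, \<theta>)) = (K (\<sigma>, \<phi>), K (0, \<phi>))" ..
    have "dist (K (\<sigma>, \<phi>)) (K (0, \<phi>)) < e / 2"
      using that r \<phi>(1) \<delta> by (intro d(2)) (auto simp: dist_Pair_Pair abs_less_iff)
    then show ?thesis using \<phi>(2) by (simp add: dist_norm)
  qed
  have "dist ((H (s, \<theta>) - H (0, \<theta>)) /\<^sub>R s) (K (0, \<theta>)) < e" if s: "s \<noteq> 0" "\<bar>s\<bar> < r" for s \<theta>
  proof -
    let ?g = "\<lambda>\<sigma>. H (\<sigma>, \<theta>) - \<sigma> *\<^sub>R K (0, \<theta>)"
    have "norm (?g s - ?g 0) \<le> e / 2 * norm (s - 0)"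
    proof (rule differentiable_bound[where S = "{-r<..<r}"])
      show "(?g has_derivative (\<lambda>h. h *\<^sub>R (K (\<sigma>, \<theta>) - K (0, \<theta>)))) (at \<sigma> within {-r<..<r})"
        if "\<sigma> \<in> {-r<..<r}" for \<sigma>
      proof -
        have "(?g has_vector_derivative K (\<sigma>, \<theta>) - 1 *\<^sub>R K (0, \<theta>)) (at \<sigma>)"
          unfolding K_def
        proof (rule has_vector_derivative_diff)
          show "((\<lambda>\<sigma>. H (\<sigma>, \<theta>)) has_vector_derivative frechet_derivative H (at (\<sigma>, \<theta>)) (1, 0)) (at \<sigma>)"
            by (rule joint_theta(2)[OF H]) (use that r \<delta> in auto)
          show "((\<lambda>\<sigma>. \<sigma> *\<^sub>R k) has_vector_derivative 1 *\<^sub>R k) (at \<sigma>)" for k :: 'a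
            by (rule bounded_linear.has_vector_derivative[OF bounded_linear_scaleR_left])
              (rule has_vector_derivative_id)
        qed
        then show ?thesis
          by (simp add: has_vector_derivative_def has_derivative_at_withinI)
      qed
      show "onorm (\<lambda>h. h *\<^sub>R (K (\<sigma>, \<theta>) - K (0, \<theta>))) \<le> e / 2" if "\<sigma> \<in> {-r<..<r}" for \<sigma>
      proof (rule onorm_le)
        fix x :: real
        have "norm (K (\<sigma>, \<theta>) - K (0, \<theta>)) * \<bar>x\<bar> \<le> e / 2 * \<bar>x\<bar>"
          using that by (intro mult_right_mono near) auto
        then show "norm (x *\<^sub>R (K (\<sigma>, \<theta>) - K (0, \<theta>))) \<le> e / 2 * norm x"
          by (simp add: mult.commute)
      qed
    qed (use s r in auto)
    then have *: "norm (H (s, \<theta>) - H (0, \<theta>) - s *\<^sub>R K (0, \<theta>)) \<le> e / 2 * \<bar>s\<bar>"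
      by (simp add: algebra_simps)
    have "(H (s, \<theta>) - H (0, \<theta>)) /\<^sub>R s - K (0, \<theta>) = (H (s, \<theta>) - H (0, \<theta>) - s *\<^sub>R K (0, \<theta>)) /\<^sub>R s"
      using s by (simp add: scaleR_diff_right)
    then have "dist ((H (s, \<theta>) - H (0, \<theta>)) /\<^sub>R s) (K (0, \<theta>)) \<le> e / 2"
      using * s by (simp add: dist_norm divide_simps mult.commute)
    then show ?thesis using \<open>e > 0\<close> by simp
  qed
  then show "\<forall>\<^sub>F s in at 0. \<forall>\<theta>\<in>UNIV. dist ((H (s, \<theta>) - H (0, \<theta>)) /\<^sub>R s)
      (frechet_derivative H (at (0, \<theta>)) (1, 0)) < e"
    using r(1) unfolding eventually_at K_def by (intro exI[of _ r]) auto
qed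

text \<open>The angular derivative of the quotient of H is the quotient of the angular derivative T,
  which is jointly smooth and periodic as well. Symmetry of the mixed second derivatives is a
  by-product: termwise differentiation shows that the limit for T is the angular derivative of the
  limit for H.\<close>

lemma joint_quotient_unif_conv:
  fixes H :: "real \<times> real \<Rightarrow> 'b::banach"
  assumes "H \<in> joint"
  shows "unif_conv n (\<lambda>s \<theta>. (H (s, \<theta>) - H (0, \<theta>)) /\<^sub>R s)
    (\<lambda>\<theta>. frechet_derivative H (at (0, \<theta>)) (1, 0)) (at 0)"
  using assms
proof (induction n arbitrary: H)
  case 0
  then show ?case by (simp add: joint_quotient_uniform)
next
  case (Suc n)
  define T where "T = (\<lambda>p. frechet_derivative H (at p) (0, 1))"
  have T: "T \<in> joint" unfolding T_def by (rule joint_frechet[OF Suc.prems])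
  have "\<forall>\<^sub>F s in at 0. \<bar>s\<bar> < \<delta>" using \<delta> unfolding eventually_at by (intro exI[of _ \<delta>]) auto
  then have *: "\<forall>\<^sub>F s in at 0. \<forall>\<theta>. ((\<lambda>\<theta>. (H (s, \<theta>) - H (0, \<theta>)) /\<^sub>R s) has_vector_derivative
      (T (s, \<theta>) - T (0, \<theta>)) /\<^sub>R s) (at \<theta>)"
  proof eventually_elim
    case (elim s)
    show ?case
      unfolding T_def
      by (intro allI bounded_linear.has_vector_derivative[OF bounded_linear_scaleR_right]
          has_vector_derivative_diff joint_theta(1)[OF Suc.prems]) (use elim \<delta> in auto)
  qed
  have "((\<lambda>\<theta>. frechet_derivative H (at (0, \<theta>)) (1, 0)) has_vector_derivative
      frechet_derivative T (at (0, \<theta>)) (1, 0)) (at \<theta>)" for \<theta>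
    by (rule has_vector_derivative_uniform_limit[OF * joint_quotient_uniform[OF Suc.prems]
          joint_quotient_uniform[OF T]])
  from unif_conv_transform[OF * this] show ?case
    using Suc.IH[OF T] joint_quotient_uniform[OF Suc.prems] by simp
qed

end

lemma joint_smooth_quotient:
  fixes a :: "real \<Rightarrow> real \<Rightarrow> 'b::banach"
  assumes \<delta>: "\<delta> > 0" and smooth: "smooth_on ({-\<delta><..<\<delta>} \<times> UNIV) (\<lambda>(s, \<theta>). a s \<theta>)"
    and per: "\<And>s \<theta>. a s (\<theta> + 2 * pi) = a s \<theta>"
    and der: "\<And>\<theta>. ((\<lambda>s. a s \<theta>) has_vector_derivative v \<theta>) (at 0)"
  shows "smooth_conv (\<lambda>s \<theta>. (a s \<theta> - a 0 \<theta>) /\<^sub>R s) v (at 0)"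
    and "v \<in> periodic_smooth" and "\<And>s. \<bar>s\<bar> < \<delta> \<Longrightarrow> a s \<in> periodic_smooth"
proof -
  interpret joint_family \<delta> "{-\<delta><..<\<delta>} \<times> UNIV" using \<delta> by unfold_locales auto
  define H where "H = (\<lambda>(s, \<theta>). a s \<theta>)"
  have H: "H \<in> joint" using smooth per by (auto simp: joint_def H_def)
  have v: "v = (\<lambda>\<theta>. frechet_derivative H (at (0, \<theta>)) (1, 0))"
    using vector_derivative_unique_at[OF der joint_theta(2)[OF H, of 0, unfolded H_def case_prod_conv]] \<delta>
    by (auto simp: H_def)
  show "smooth_conv (\<lambda>s \<theta>. (a s \<theta> - a 0 \<theta>) /\<^sub>R s) v (at 0)"
    using joint_quotient_unif_conv[OF H] by (simp add: smooth_conv_def v H_def)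
  show "v \<in> periodic_smooth"
    unfolding v using joint_theta(3)[OF joint_frechet[OF H], of 0] \<delta> by simp
  show "a s \<in> periodic_smooth" if "\<bar>s\<bar> < \<delta>" for s
    using joint_theta(3)[OF H that] by (simp add: H_def)
qed

section \<open>Matrix functions\<close>

lemma matrix_mul_bounded_bilinear:
  "bounded_bilinear ((**) :: complex^'n^'n \<Rightarrow> complex^'n^'n \<Rightarrow> complex^'n^'n)"
  unfolding bilinear_conv_bounded_bilinear[symmetric] bilinear_def
  by (auto intro!: linearI simp: vec_eq_iff
      matrix_matrix_mult_def sum_distrib_left scaleR_sum_right sum.distrib algebra_simps)

interpretation matmul:
  bounded_bilinear "(**) :: complex^'n^'n \<Rightarrow> complex^'n^'n \<Rightarrow> complex^'n^'n"
  by (rule matrix_mul_bounded_bilinear)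

lemma cscale_bounded_bilinear:
  "bounded_bilinear (cscale :: complex \<Rightarrow> complex^'n^'m \<Rightarrow> complex^'n^'m)"
  unfolding bilinear_conv_bounded_bilinear[symmetric] bilinear_def
  by (auto intro!: linearI simp: cscale_def vec_eq_iff algebra_simps)

interpretation cscale: bounded_bilinear "cscale :: complex \<Rightarrow> complex^'n^'m \<Rightarrow> complex^'n^'m"
  by (rule cscale_bounded_bilinear)

lemma cscale_mult_left: "cscale c (A :: complex^'n^'n) ** B = cscale c (A ** B)"
  by (simp add: cscale_def matrix_matrix_mult_def vec_eq_iff sum_distrib_left mult.assoc)

lemma cscale_mult_right: "(A :: complex^'n^'n) ** cscale c B = cscale c (A ** B)"
  by (simp add: cscale_def matrix_matrix_mult_def vec_eq_iff sum_distrib_left mult.left_commute)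

lemma cscale_cscale [simp]: "cscale c (cscale d A) = cscale (c * d) A"
  by (simp add: cscale_def vec_eq_iff mult.assoc)

lemma cscale_one [simp]: "cscale 1 A = A"
  by (simp add: cscale_def vec_eq_iff)

lemma cscale_of_real: "cscale (of_real r) A = r *\<^sub>R A"
  by (simp add: cscale_def vec_eq_iff complex_eq_iff)

section \<open>Entrywise smoothness and convergence of matrix functions\<close>

definition matrix_unit :: "'m \<Rightarrow> 'n \<Rightarrow> complex \<Rightarrow> complex^'n^'m" where
  "matrix_unit i k c = (\<chi> a b. if a = i \<and> b = k then c else 0)"

lemma bounded_linear_matrix_unit: "bounded_linear (matrix_unit i k :: complex \<Rightarrow> complex^'n^'m)"
  unfolding linear_conv_bounded_linear[symmetric]
  by (auto intro!: linearI simp: matrix_unit_def vec_eq_iff)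

text \<open>A matrix as a sum of linear images of its entries: entrywise statements lift to matrices
  by the rules for sums and linear maps.\<close>

lemma matrix_unit_sum: "(A :: complex^'n^'m) = (\<Sum>i\<in>UNIV. \<Sum>k\<in>UNIV. matrix_unit i k (A $ i $ k))"
proof -
  have "(\<Sum>i\<in>UNIV. \<Sum>k\<in>UNIV. matrix_unit i k (A $ i $ k) $ a $ b) = A $ a $ b" for a b
  proof -
    have "(\<Sum>k\<in>UNIV. matrix_unit i k (A $ i $ k) $ a $ b) = (if i = a then A $ a $ b else 0)" for i
      by (cases "i = a") (simp_all add: matrix_unit_def)
    then show ?thesis by simp
  qed
  then show ?thesis by (simp add: vec_eq_iff)
qed

lemma bounded_linear_entry: "bounded_linear (\<lambda>A :: complex^'n^'m. A $ i $ k)"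
  by (rule bounded_linear_compose[OF bounded_linear_vec_nth bounded_linear_vec_nth])

lemma smooth_on_matrix:
  fixes f :: "'a::real_normed_vector \<Rightarrow> complex^'n^'m"
  assumes "open S" "\<And>i k. smooth_on S (\<lambda>x. f x $ i $ k)"
  shows "smooth_on S f"
proof -
  have "smooth_on S (\<lambda>x. \<Sum>i\<in>UNIV. \<Sum>k\<in>UNIV. matrix_unit i k (f x $ i $ k))"
    by (rule smooth_on_sum[OF assms(1)], rule smooth_on_sum[OF assms(1)],
        rule smooth_on_linear[OF bounded_linear_matrix_unit assms(1,2)])
  then show ?thesis by (simp flip: matrix_unit_sum)
qed

lemma smooth_on_matrix_entry:
  fixes f :: "'a::real_normed_vector \<Rightarrow> complex^'n^'m"
  shows "open S \<Longrightarrow> smooth_on S f \<Longrightarrow> smooth_on S (\<lambda>x. f x $ i $ k)"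
  by (rule smooth_on_linear[OF bounded_linear_entry])

lemma smooth_conv_matrix:
  fixes u :: "'i \<Rightarrow> real \<Rightarrow> complex^'n^'m"
  assumes "\<And>i k. smooth_conv (\<lambda>s \<theta>. u s \<theta> $ i $ k) (\<lambda>\<theta>. l \<theta> $ i $ k) F"
    and "\<forall>\<^sub>F s in F. u s \<in> periodic_smooth" "l \<in> periodic_smooth"
  shows "smooth_conv u l F"
proof -
  have ev: "\<forall>\<^sub>F s in F. (\<lambda>\<theta>. matrix_unit i k (u s \<theta> $ i $ k)) \<in> periodic_smooth" for i :: 'm and k :: 'n
    using assms(2)
    by eventually_elim (intro periodic_smooth_linear[OF bounded_linear_matrix_unit]
        periodic_smooth_linear[OF bounded_linear_entry])
  have l: "(\<lambda>\<theta>. matrix_unit i k (l \<theta> $ i $ k)) \<in> periodic_smooth" for i :: 'm and k :: 'n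
    by (intro periodic_smooth_linear[OF bounded_linear_matrix_unit]
        periodic_smooth_linear[OF bounded_linear_entry] assms(3))
  have "smooth_conv (\<lambda>s \<theta>. matrix_unit i k (u s \<theta> $ i $ k)) (\<lambda>\<theta>. matrix_unit i k (l \<theta> $ i $ k)) F"
    for i :: 'm and k :: 'n
  proof (rule smooth_conv_linear[OF bounded_linear_matrix_unit assms(1)])
    show "\<forall>\<^sub>F s in F. (\<lambda>\<theta>. u s \<theta> $ i $ k) \<in> periodic_smooth"
      using assms(2) by eventually_elim (rule periodic_smooth_linear[OF bounded_linear_entry])
  qed (rule periodic_smooth_linear[OF bounded_linear_entry assms(3)])
  note entry = this
  have row: "smooth_conv (\<lambda>s \<theta>. \<Sum>k\<in>UNIV. matrix_unit i k (u s \<theta> $ i $ k))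
      (\<lambda>\<theta>. \<Sum>k\<in>UNIV. matrix_unit i k (l \<theta> $ i $ k)) F" for i :: 'm
    by (rule smooth_conv_sum[OF finite_class.finite_UNIV entry ev l])
  have "\<forall>\<^sub>F s in F. (\<lambda>\<theta>. \<Sum>k\<in>UNIV. matrix_unit i k (u s \<theta> $ i $ k)) \<in> periodic_smooth" for i :: 'm
    using assms(2)
    by eventually_elim (intro periodic_smooth_sum periodic_smooth_linear[OF bounded_linear_matrix_unit]
        periodic_smooth_linear[OF bounded_linear_entry])
  then have "smooth_conv (\<lambda>s \<theta>. \<Sum>i\<in>UNIV. \<Sum>k\<in>UNIV. matrix_unit i k (u s \<theta> $ i $ k))
      (\<lambda>\<theta>. \<Sum>i\<in>UNIV. \<Sum>k\<in>UNIV. matrix_unit i k (l \<theta> $ i $ k)) F"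
    by (rule smooth_conv_sum[OF finite_class.finite_UNIV row _ periodic_smooth_sum[OF l]])
  then show ?thesis by (simp flip: matrix_unit_sum)
qed

section \<open>Determinant and inverse\<close>

lemma smooth_on_prod:
  fixes f :: "'i \<Rightarrow> 'a::real_normed_vector \<Rightarrow> complex"
  assumes "open S" "finite I" "\<And>i. i \<in> I \<Longrightarrow> smooth_on S (f i)"
  shows "smooth_on S (\<lambda>x. \<Prod>i\<in>I. f i x)"
  using assms(2,3)
proof (induction I rule: finite_induct)
  case (insert i I)
  then show ?case
    using smooth_on_bilinear[OF bounded_bilinear_mult assms(1), of "f i"] by simp
qed (simp add: smooth_on_const[OF assms(1)])

lemma smooth_on_det:
  fixes f :: "'a::real_normed_vector \<Rightarrow> complex^'n^'n"
  assumes "open S" "smooth_on S f"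
  shows "smooth_on S (\<lambda>x. det (f x))"
  unfolding det_def
  by (rule smooth_on_sum[OF assms(1)], rule smooth_on_linear[OF bounded_linear_mult_right assms(1)],
      rule smooth_on_prod[OF assms(1) finite_class.finite_UNIV], rule smooth_on_matrix_entry[OF assms])

lemma open_invertible: "open {A :: complex^'n^'n. invertible A}"
proof -
  have "continuous_on UNIV (det :: complex^'n^'n \<Rightarrow> complex)"
    using smooth_on_imp_continuous_on[OF smooth_on_det[OF open_UNIV smooth_on_id[OF open_UNIV]]] .
  moreover have "{A :: complex^'n^'n. invertible A} = det -` (- {0})"
    by (auto simp: invertible_det_nz)
  ultimately show ?thesis by (metis open_vimage open_Compl closed_singleton)
qed

lemma matrix_inv_works:
  fixes A :: "complex^'n^'n"
  assumes "invertible A"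
  shows "A ** matrix_inv A = mat 1" "matrix_inv A ** A = mat 1"
  using someI_ex[OF assms[unfolded invertible_def]] unfolding matrix_inv_def by auto

lemma matrix_inv_unique:
  fixes A B :: "complex^'n^'n"
  assumes "A ** B = mat 1"
  shows "matrix_inv A = B"
proof -
  have "invertible A"
    using assms matrix_left_right_inverse unfolding invertible_def by blast
  then show ?thesis
    by (metis assms matrix_inv_works(2) matrix_mul_assoc matrix_mul_lid matrix_mul_rid)
qed

text \<open>Cramer's rule for the j-th column of the inverse. It makes each entry a quotient of two
  polynomials in the entries of A, from which smoothness of inversion follows.\<close>

lemma matrix_inv_entry:
  fixes A :: "complex^'n^'n"
  assumes "invertible A"
  shows "matrix_inv A $ k $ j =
    det (\<chi> i l. if l = k then (if i = j then 1 else 0) else A $ i $ l) / det A"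
proof -
  have "A *v (\<chi> k. matrix_inv A $ k $ j) = axis j 1"
  proof -
    have "(A ** matrix_inv A) $ i $ j = (mat 1 :: complex^'n^'n) $ i $ j" for i
      by (simp add: matrix_inv_works assms)
    then show ?thesis
      by (simp add: matrix_matrix_mult_def matrix_vector_mult_def vec_eq_iff axis_def mat_def)
  qed
  then have "(\<chi> k. matrix_inv A $ k $ j) =
      (\<chi> k. det (\<chi> i l. if l = k then axis j 1 $ i else A $ i $ l) / det A)"
    using cramer[of A "\<chi> k. matrix_inv A $ k $ j" "axis j 1"] assms by (simp add: invertible_det_nz)
  from arg_cong[OF this, of "\<lambda>v. v $ k"]
  have "matrix_inv A $ k $ j = det (\<chi> i l. if l = k then axis j 1 $ i else A $ i $ l) / det A"
    by simp
  moreover have "(\<chi> i l. if l = k then axis j 1 $ i else A $ i $ l) =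
      (\<chi> i l. if l = k then (if i = j then 1 else 0) else A $ i $ l)"
    by (simp add: vec_eq_iff axis_def)
  ultimately show ?thesis by simp
qed

lemma smooth_on_matrix_inv: "smooth_on {A :: complex^'n^'n. invertible A} matrix_inv"
proof (rule smooth_on_matrix[OF open_invertible])
  fix k j
  let ?I = "{A :: complex^'n^'n. invertible A}"
  let ?M = "\<lambda>A :: complex^'n^'n. \<chi> i l. if l = k then (if i = j then 1 else 0) else A $ i $ l"
  note id = smooth_on_id[OF open_invertible]
  have M: "smooth_on ?I ?M"
  proof (rule smooth_on_matrix[OF open_invertible])
    fix i l
    show "smooth_on ?I (\<lambda>A. ?M A $ i $ l)"
      using smooth_on_const[OF open_invertible] smooth_on_matrix_entry[OF open_invertible id]
      by (cases "l = k"; cases "i = j") simp_all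
  qed
  have sub: "det ` ?I \<subseteq> - {0}" by (auto simp: invertible_det_nz)
  have "smooth_on (- {0}) (inverse :: complex \<Rightarrow> complex)"
    by (rule smooth_on_holomorphic) (auto intro: holomorphic_intros)
  from smooth_on_compose[OF open_invertible open_Compl[OF closed_singleton] sub this
      smooth_on_det[OF open_invertible id]]
  have "smooth_on ?I (\<lambda>A. inverse (det A))" .
  from smooth_on_bilinear[OF bounded_bilinear_mult open_invertible smooth_on_det[OF open_invertible M] this]
  show "smooth_on ?I (\<lambda>A. matrix_inv A $ k $ j)"
    by (rule smooth_on_cong[OF open_invertible, rotated]) (simp add: matrix_inv_entry divide_inverse)
qed


section \<open>Loops\<close>

abbreviation (input) ang :: "(complex \<Rightarrow> 'b) \<Rightarrow> real \<Rightarrow> 'b" where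
  "ang f \<equiv> (\<lambda>\<theta>. f (cis \<theta>))"

lemma cis_in_S1 [simp]: "cis \<theta> \<in> S1"
  by simp

lemma S1_cis: "z \<in> S1 \<Longrightarrow> cis (Arg z) = z"
  by (subst cis_Arg) (auto simp: sgn_div_norm)

lemma S1_cases: assumes "z \<in> S1" obtains \<theta> where "z = cis \<theta>" "\<bar>\<theta>\<bar> \<le> pi"
  using S1_cis[OF assms] Arg_bounded[of z] by (metis abs_le_iff less_imp_le minus_le_iff)

lemma cis_periodic: "cis (\<theta> + 2 * pi) = cis \<theta>"
  by (simp add: cis.ctr complex_eq_iff)

lemma loops_iff: "f \<in> loops A \<longleftrightarrow> f \<in> extensional S1 \<and> (\<forall>\<theta>. f (cis \<theta>) \<in> A) \<and> ang f \<in> periodic_smooth"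
proof -
  have "(\<forall>\<theta>. f (cis \<theta>) \<in> A) \<longleftrightarrow> f \<in> S1 \<rightarrow> A" by (auto elim!: S1_cases)
  then show ?thesis
    unfolding loops_def periodic_smooth_def by (auto simp: PiE_def cis_periodic)
qed

lemma loops_periodic_smooth: "f \<in> loops A \<Longrightarrow> ang f \<in> periodic_smooth"
  by (simp add: loops_iff)

lemma loops_mem: "f \<in> loops A \<Longrightarrow> z \<in> S1 \<Longrightarrow> f z \<in> A"
  unfolding loops_def by auto

lemma restrict_loops_iff:
  "(\<lambda>z\<in>S1. f z) \<in> loops A \<longleftrightarrow> (\<forall>z\<in>S1. f z \<in> A) \<and> ang f \<in> periodic_smooth"
  by (auto simp: loops_iff elim!: S1_cases)

lemma loops_mono: "f \<in> loops A \<Longrightarrow> (\<And>z. z \<in> S1 \<Longrightarrow> f z \<in> B) \<Longrightarrow> f \<in> loops B"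
  by (simp add: loops_iff)

lemma loops_UNIV: "f \<in> loops A \<Longrightarrow> f \<in> loops UNIV"
  by (simp add: loops_iff)

lemma loops_eqI:
  assumes "f \<in> loops A" "g \<in> loops B" "\<And>z. z \<in> S1 \<Longrightarrow> f z = g z"
  shows "f = g"
  by (rule extensionalityI[of f S1 g]) (use assms in \<open>simp_all add: loops_iff\<close>)

lemma loops_restrict: "f \<in> loops A \<Longrightarrow> (\<lambda>z\<in>S1. f z) = f"
  by (simp add: loops_iff extensional_restrict)

lemma ang_powi_periodic_smooth: "ang (\<lambda>z. z powi j) \<in> periodic_smooth"
proof -
  have "smooth_on UNIV (\<lambda>\<theta>. cis (of_int j * \<theta>))"
    by (rule smooth_on_cis[OF open_UNIV smooth_on_linear[OF bounded_linear_mult_right open_UNIV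
          smooth_on_id[OF open_UNIV]]])
  moreover have "(\<lambda>\<theta>. cis (of_int j * \<theta>)) = ang (\<lambda>z. z powi j)" by (simp add: cis_power_int)
  ultimately show ?thesis unfolding periodic_smooth_def by (simp add: cis_periodic)
qed

lemma ang_id_periodic_smooth: "cis \<in> periodic_smooth"
  using ang_powi_periodic_smooth[of 1] by simp

text \<open>The angular derivative is a loop again. Compared with \<open>circle_deriv\<close> the
  factor 1 / (i z) is split off, so that the rules for products and velocities stay free of complex
  multipliers.\<close>

definition dtheta :: "(complex \<Rightarrow> 'b::real_normed_vector) \<Rightarrow> complex \<Rightarrow> 'b" where
  "dtheta f = (\<lambda>z\<in>S1. vector_derivative (ang f) (at (Arg z)))"

text \<open>\<open>Arg\<close> selects one of the angles that differ by multiples of 2 pi, and the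
  derivative of a periodic function does not see the choice.\<close>

lemma dtheta_cis: "dtheta f (cis \<theta>) = vector_derivative (ang f) (at \<theta>)"
proof -
  have per: "vector_derivative (ang f) (at (t + 2 * pi)) = vector_derivative (ang f) (at t)" for t
    by (rule vector_derivative_shift) (simp add: cis_periodic)
  have "vector_derivative (ang f) (at (t + 2 * pi * of_int k)) = vector_derivative (ang f) (at t)" for t k
  proof (induction k rule: int_induct[where k = 0])
    case (step1 i)
    then show ?case using per[of "t + 2 * pi * of_int i"] by (simp add: algebra_simps)
  next
    case (step2 i)
    then show ?case using per[of "t + 2 * pi * of_int (i - 1)"] by (simp add: algebra_simps)
  qed simp
  moreover have "cis (Arg (cis \<theta>)) = cis \<theta>" by (rule S1_cis) simp
  then obtain k :: int where "Arg (cis \<theta>) = \<theta> + 2 * pi * of_int k"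
    using sin_cos_eq_iff[of "Arg (cis \<theta>)" \<theta>] by (auto simp: complex_eq_iff)
  ultimately show ?thesis by (simp add: dtheta_def)
qed

lemma dtheta_loops: "f \<in> loops A \<Longrightarrow> dtheta f \<in> loops UNIV"
  by (simp add: loops_iff dtheta_cis periodic_smooth_deriv) (simp add: dtheta_def)

lemma dtheta_has_vector_derivative:
  "f \<in> loops A \<Longrightarrow> (ang f has_vector_derivative dtheta f (cis \<theta>)) (at \<theta>)"
  unfolding dtheta_cis by (intro periodic_smooth_has_vector_derivative loops_periodic_smooth)

lemma dtheta_eqI:
  "(\<And>\<theta>. (ang f has_vector_derivative f' (cis \<theta>)) (at \<theta>)) \<Longrightarrow> z \<in> S1 \<Longrightarrow> dtheta f z = f' z"
  by (metis S1_cases dtheta_cis vector_derivative_at)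

lemma circle_deriv_dtheta: "z \<in> S1 \<Longrightarrow> circle_deriv f z = cscale (1 / (\<i> * z)) (dtheta f z)"
  by (simp add: circle_deriv_def dtheta_def)


section \<open>Velocities of curves of loops\<close>

lemma smooth_conv_parameter: "smooth_conv (\<lambda>s \<theta>. s) (\<lambda>\<theta>. 0) (at (0::real))"
proof -
  have u: "uniform_limit UNIV (\<lambda>s \<theta>. s) (\<lambda>\<theta>::real. 0) (at (0::real))"
  proof (rule uniform_limitI)
    fix e :: real assume "e > 0"
    then show "\<forall>\<^sub>F s in at (0::real). \<forall>\<theta>\<in>(UNIV :: real set). dist s 0 < e"
      unfolding eventually_at by (intro exI[of _ e]) auto
  qed
  have "unif_conv n (\<lambda>s \<theta>. s) (\<lambda>\<theta>. 0) (at (0::real))" for n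
    by (cases n) (use u in \<open>simp_all add: unif_conv_const\<close>)
  then show ?thesis by (simp add: smooth_conv_def)
qed

lemma has_velocity_iff:
  "has_velocity c v \<longleftrightarrow>
     c 0 \<in> loops UNIV \<and> (\<forall>\<^sub>F s in at 0. c s \<in> loops UNIV) \<and> v \<in> loops UNIV \<and>
     smooth_conv (\<lambda>s \<theta>. (c s (cis \<theta>) - c 0 (cis \<theta>)) /\<^sub>R s) (ang v) (at 0)"
  unfolding has_velocity_def loop_tendsto_iff by simp

lemma has_velocity_quotient_periodic_smooth:
  assumes "has_velocity c v"
  shows "\<forall>\<^sub>F s in at 0. (\<lambda>\<theta>. (c s (cis \<theta>) - c 0 (cis \<theta>)) /\<^sub>R s) \<in> periodic_smooth"
  using conjunct1[OF conjunct2[OF assms[unfolded has_velocity_iff]]]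
proof eventually_elim
  case (elim s)
  have "(\<lambda>\<theta>. - c 0 (cis \<theta>)) \<in> periodic_smooth"
    by (rule periodic_smooth_linear[OF bounded_linear_minus[OF bounded_linear_ident]])
      (use assms in \<open>simp add: has_velocity_iff loops_iff\<close>)
  then have "(\<lambda>\<theta>. c s (cis \<theta>) + - c 0 (cis \<theta>)) \<in> periodic_smooth"
    by (rule periodic_smooth_add[rotated]) (use elim in \<open>simp add: loops_iff\<close>)
  then have "(\<lambda>\<theta>. c s (cis \<theta>) - c 0 (cis \<theta>)) \<in> periodic_smooth" by simp
  then show ?case by (rule periodic_smooth_linear[OF bounded_linear_scaleR_right])
qed

lemma has_velocityD:
  assumes "has_velocity c v"
  shows "c 0 \<in> loops UNIV" "v \<in> loops UNIV" "\<forall>\<^sub>F s in at 0. ang (c s) \<in> periodic_smooth"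
    and "ang (c 0) \<in> periodic_smooth" "ang v \<in> periodic_smooth"
    and "smooth_conv (\<lambda>s. ang (c s)) (ang (c 0)) (at 0)"
proof -
  show *: "c 0 \<in> loops UNIV" "v \<in> loops UNIV" "\<forall>\<^sub>F s in at 0. ang (c s) \<in> periodic_smooth"
    using assms by (auto simp: has_velocity_iff loops_iff elim: eventually_mono)
  show **: "ang (c 0) \<in> periodic_smooth" "ang v \<in> periodic_smooth"
    using * by (simp_all add: loops_iff)
  let ?q = "\<lambda>s \<theta>. (c s (cis \<theta>) - c 0 (cis \<theta>)) /\<^sub>R s"
  note q = has_velocity_quotient_periodic_smooth[OF assms]
  \<comment> \<open>For s \<noteq> 0 the loop \<open>c s\<close> equals \<open>c 0\<close> plus s
    times the quotient. As s tends to 0 uniformly, convergence of the quotients yields continuity of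
    the curve in the same topology.\<close>
  have "smooth_conv ?q (ang v) (at 0)" using assms by (simp add: has_velocity_iff)
  from smooth_conv_bilinear[OF bounded_bilinear_scaleR smooth_conv_parameter this _ q
      periodic_smooth_const **(2)]
  have 1: "smooth_conv (\<lambda>s \<theta>. s *\<^sub>R ?q s \<theta>) (\<lambda>\<theta>. 0) (at 0)"
    by (simp add: periodic_smooth_const)
  have "\<forall>\<^sub>F s in at 0. (\<lambda>\<theta>. s *\<^sub>R ?q s \<theta>) \<in> periodic_smooth"
    using q by eventually_elim (rule periodic_smooth_linear[OF bounded_linear_scaleR_right])
  from smooth_conv_add[OF smooth_conv_const 1 _ this **(1) periodic_smooth_const]
  have "smooth_conv (\<lambda>s \<theta>. c 0 (cis \<theta>) + s *\<^sub>R ?q s \<theta>) (ang (c 0)) (at 0)"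
    using **(1) by simp
  moreover have "\<forall>\<^sub>F s in at 0. (\<lambda>\<theta>. c 0 (cis \<theta>) + s *\<^sub>R ?q s \<theta>) = ang (c s)"
    by (simp add: eventually_at_filter)
  ultimately show "smooth_conv (\<lambda>s. ang (c s)) (ang (c 0)) (at 0)"
    by (rule iffD1[OF smooth_conv_cong, rotated])
qed

lemma has_velocity_pointwise:
  assumes "has_velocity c v" "z \<in> S1"
  shows "((\<lambda>s. c s z) has_vector_derivative v z) (at 0)"
proof -
  from assms(1) have "smooth_conv (\<lambda>s \<theta>. (c s (cis \<theta>) - c 0 (cis \<theta>)) /\<^sub>R s) (ang v) (at 0)"
    by (simp add: has_velocity_iff)
  from tendsto_uniform_limitI[OF smooth_conv_uniform_limit[OF this], of "Arg z"]
  have "((\<lambda>s. (c s z - c 0 z) /\<^sub>R s) \<longlongrightarrow> v z) (at 0)"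
    by (simp add: S1_cis[OF assms(2)])
  from tendsto_norm[OF tendsto_diff[OF this tendsto_const[of "v z"]]]
  have "((\<lambda>s. norm ((c s z - c 0 z) /\<^sub>R s - v z)) \<longlongrightarrow> 0) (at 0)" by simp
  moreover have "norm ((c s z - c 0 z) /\<^sub>R s - v z) = norm (c s z - c 0 z - s *\<^sub>R v z) / norm s"
    if "s \<noteq> 0" for s :: real
  proof -
    have "(c s z - c 0 z) /\<^sub>R s - v z = (c s z - c 0 z - s *\<^sub>R v z) /\<^sub>R s"
      using that by (simp add: scaleR_diff_right)
    then show ?thesis by (simp add: divide_inverse mult.commute)
  qed
  then have "\<forall>\<^sub>F s in at 0. norm ((c s z - c 0 z) /\<^sub>R s - v z) =
      norm (c s z - c 0 z - s *\<^sub>R v z) / norm s"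
    by (simp add: eventually_at_filter)
  ultimately have "((\<lambda>s. norm (c s z - c 0 z - s *\<^sub>R v z) / norm s) \<longlongrightarrow> 0) (at 0)"
    using tendsto_cong by force
  then show ?thesis
    by (simp add: has_vector_derivative_def has_derivative_at bounded_linear_scaleR_left)
qed

lemma has_velocity_unique: "has_velocity c v \<Longrightarrow> has_velocity c w \<Longrightarrow> v = w"
  by (rule loops_eqI[OF has_velocityD(2) has_velocityD(2)])
    (auto intro: vector_derivative_unique_at[OF has_velocity_pointwise has_velocity_pointwise])

lemma has_velocity_cong:
  assumes "has_velocity c v" "\<forall>\<^sub>F s in nhds 0. c s = c' s"
  shows "has_velocity c' v"
proof -
  have ev: "\<forall>\<^sub>F s in at 0. c s = c' s" and eq: "c 0 = c' 0"
    using assms(2) by (simp_all add: eventually_nhds_conv_at)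
  have "\<forall>\<^sub>F s in at 0. c' s \<in> loops UNIV"
    using ev conjunct1[OF conjunct2[OF assms(1)[unfolded has_velocity_iff]]]
    by eventually_elim simp
  moreover have "\<forall>\<^sub>F s in at 0. (\<lambda>\<theta>. (c s (cis \<theta>) - c 0 (cis \<theta>)) /\<^sub>R s) =
      (\<lambda>\<theta>. (c' s (cis \<theta>) - c' 0 (cis \<theta>)) /\<^sub>R s)"
    using ev by eventually_elim (simp add: eq)
  from smooth_conv_cong[OF this] have "smooth_conv (\<lambda>s \<theta>. (c' s (cis \<theta>) - c' 0 (cis \<theta>)) /\<^sub>R s) (ang v) (at 0)"
    using assms(1) by (simp add: has_velocity_iff)
  ultimately show ?thesis
    using assms(1) eq by (simp add: has_velocity_iff)
qed

section \<open>Rules for velocities\<close>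

lemma has_velocity_const: "f \<in> loops A \<Longrightarrow> has_velocity (\<lambda>s. f) (\<lambda>z\<in>S1. 0)"
  unfolding has_velocity_iff restrict_loops_iff
  by (simp add: loops_UNIV smooth_conv_const periodic_smooth_const)

text \<open>The difference quotient of the product splits into \<open>B\<close> of the quotient of c
  with \<open>d s\<close>, plus \<open>B\<close> of \<open>c 0\<close> with the quotient of d. The
  first term needs continuity of d at 0 with all derivatives, which having a velocity
  provides.\<close>

lemma has_velocity_bilinear:
  assumes B: "bounded_bilinear B" and c: "has_velocity c v" and d: "has_velocity d w"
  shows "has_velocity (\<lambda>s. \<lambda>z\<in>S1. B (c s z) (d s z)) (\<lambda>z\<in>S1. B (v z) (d 0 z) + B (c 0 z) (w z))"
proof -
  let ?q = "\<lambda>c s \<theta>. (c s (cis \<theta>) - c 0 (cis \<theta>)) /\<^sub>R s"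
  interpret B: bounded_bilinear B by (rule B)
  note qc = has_velocity_quotient_periodic_smooth[OF c] and qd = has_velocity_quotient_periodic_smooth[OF d]
  note psB = periodic_smooth_bilinear[OF B]
  have "smooth_conv (?q c) (ang v) (at 0)" "smooth_conv (?q d) (ang w) (at 0)"
    using c d by (simp_all add: has_velocity_iff)
  note conv = smooth_conv_bilinear[OF B this(1) has_velocityD(6)[OF d] qc has_velocityD(3)[OF d]
        has_velocityD(5)[OF c] has_velocityD(4)[OF d]]
      smooth_conv_bilinear[OF B smooth_conv_const this(2) _ qd has_velocityD(4)[OF c] has_velocityD(5)[OF d]]
  have "\<forall>\<^sub>F s in at 0. (\<lambda>\<theta>. B (?q c s \<theta>) (d s (cis \<theta>))) \<in> periodic_smooth"
    using qc has_velocityD(3)[OF d] by eventually_elim (rule psB)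
  moreover have "\<forall>\<^sub>F s in at 0. (\<lambda>\<theta>. B (c 0 (cis \<theta>)) (?q d s \<theta>)) \<in> periodic_smooth"
    using qd by eventually_elim (rule psB[OF has_velocityD(4)[OF c]])
  ultimately have "smooth_conv (\<lambda>s \<theta>. B (?q c s \<theta>) (d s (cis \<theta>)) + B (c 0 (cis \<theta>)) (?q d s \<theta>))
      (\<lambda>\<theta>. B (v (cis \<theta>)) (d 0 (cis \<theta>)) + B (c 0 (cis \<theta>)) (w (cis \<theta>))) (at 0)"
    using conv has_velocityD[OF c] has_velocityD[OF d]
    by (intro smooth_conv_add psB) simp_all
  moreover have "B (?q c s \<theta>) (d s (cis \<theta>)) + B (c 0 (cis \<theta>)) (?q d s \<theta>) =
      (B (c s (cis \<theta>)) (d s (cis \<theta>)) - B (c 0 (cis \<theta>)) (d 0 (cis \<theta>))) /\<^sub>R s" for s \<theta>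
    by (simp add: B.scaleR_left B.scaleR_right B.diff_left B.diff_right flip: scaleR_add_right)
  ultimately have "smooth_conv (\<lambda>s \<theta>. (B (c s (cis \<theta>)) (d s (cis \<theta>)) - B (c 0 (cis \<theta>)) (d 0 (cis \<theta>))) /\<^sub>R s)
      (\<lambda>\<theta>. B (v (cis \<theta>)) (d 0 (cis \<theta>)) + B (c 0 (cis \<theta>)) (w (cis \<theta>))) (at 0)" by simp
  moreover have "\<forall>\<^sub>F s in at 0. (\<lambda>\<theta>. B (c s (cis \<theta>)) (d s (cis \<theta>))) \<in> periodic_smooth"
    using has_velocityD(3)[OF c] has_velocityD(3)[OF d] by eventually_elim (rule psB)
  ultimately show ?thesis
    unfolding has_velocity_iff restrict_loops_iff
    using has_velocityD[OF c] has_velocityD[OF d]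
    by (simp add: psB periodic_smooth_add)
qed

lemma has_velocity_mult:
  assumes "has_velocity c v" "has_velocity d w"
  shows "has_velocity (\<lambda>s. loop_mult (c s) (d s)) (\<lambda>z\<in>S1. v z ** d 0 z + c 0 z ** w z)"
  unfolding loop_mult_def by (rule has_velocity_bilinear[OF matrix_mul_bounded_bilinear assms])

lemma has_velocity_linear:
  assumes T: "bounded_linear T" and c: "has_velocity c v"
  shows "has_velocity (\<lambda>s. \<lambda>z\<in>S1. T (c s z)) (\<lambda>z\<in>S1. T (v z))"
proof -
  interpret T: bounded_linear T by (rule T)
  have "smooth_conv (\<lambda>s \<theta>. T ((c s (cis \<theta>) - c 0 (cis \<theta>)) /\<^sub>R s)) (\<lambda>\<theta>. T (v (cis \<theta>))) (at 0)"
    by (rule smooth_conv_linear[OF T _ has_velocity_quotient_periodic_smooth[OF c] has_velocityD(5)[OF c]])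
      (use c in \<open>simp add: has_velocity_iff\<close>)
  moreover have "\<forall>\<^sub>F s in at 0. (\<lambda>\<theta>. T (c s (cis \<theta>))) \<in> periodic_smooth"
    using has_velocityD(3)[OF c] by eventually_elim (rule periodic_smooth_linear[OF T])
  ultimately show ?thesis
    unfolding has_velocity_iff restrict_loops_iff
    using has_velocityD[OF c] by (simp add: periodic_smooth_linear[OF T] T.scaleR T.diff)
qed

lemma has_velocity_add:
  assumes c: "has_velocity c v" and d: "has_velocity d w"
  shows "has_velocity (\<lambda>s. \<lambda>z\<in>S1. c s z + d s z) (\<lambda>z\<in>S1. v z + w z)"
proof -
  have "smooth_conv (\<lambda>s \<theta>. (c s (cis \<theta>) - c 0 (cis \<theta>)) /\<^sub>R s + (d s (cis \<theta>) - d 0 (cis \<theta>)) /\<^sub>R s)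
      (\<lambda>\<theta>. v (cis \<theta>) + w (cis \<theta>)) (at 0)"
    by (rule smooth_conv_add[OF _ _ has_velocity_quotient_periodic_smooth[OF c]
          has_velocity_quotient_periodic_smooth[OF d] has_velocityD(5)[OF c] has_velocityD(5)[OF d]])
      (use c d in \<open>simp_all add: has_velocity_iff\<close>)
  moreover have "(c s (cis \<theta>) - c 0 (cis \<theta>)) /\<^sub>R s + (d s (cis \<theta>) - d 0 (cis \<theta>)) /\<^sub>R s =
      (c s (cis \<theta>) + d s (cis \<theta>) - (c 0 (cis \<theta>) + d 0 (cis \<theta>))) /\<^sub>R s" for s \<theta>
    by (simp add: algebra_simps)
  moreover have "\<forall>\<^sub>F s in at 0. (\<lambda>\<theta>. c s (cis \<theta>) + d s (cis \<theta>)) \<in> periodic_smooth"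
    using has_velocityD(3)[OF c] has_velocityD(3)[OF d] by eventually_elim (rule periodic_smooth_add)
  ultimately show ?thesis
    unfolding has_velocity_iff restrict_loops_iff
    using has_velocityD[OF c] has_velocityD[OF d] by (simp add: periodic_smooth_add)
qed

lemma has_velocity_multiplier:
  assumes m: "ang m \<in> periodic_smooth" and c: "has_velocity c v"
  shows "has_velocity (\<lambda>s. \<lambda>z\<in>S1. cscale (m z) (c s z)) (\<lambda>z\<in>S1. cscale (m z) (v z))"
proof -
  have "smooth_conv (\<lambda>s \<theta>. cscale (m (cis \<theta>)) ((c s (cis \<theta>) - c 0 (cis \<theta>)) /\<^sub>R s))
      (\<lambda>\<theta>. cscale (m (cis \<theta>)) (v (cis \<theta>))) (at 0)"
    by (rule smooth_conv_bilinear[OF cscale_bounded_bilinear smooth_conv_const _ _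
          has_velocity_quotient_periodic_smooth[OF c] m has_velocityD(5)[OF c]])
      (use c m in \<open>simp_all add: has_velocity_iff\<close>)
  moreover have "\<forall>\<^sub>F s in at 0. (\<lambda>\<theta>. cscale (m (cis \<theta>)) (c s (cis \<theta>))) \<in> periodic_smooth"
    using has_velocityD(3)[OF c]
    by eventually_elim (rule periodic_smooth_bilinear[OF cscale_bounded_bilinear m])
  ultimately show ?thesis
    unfolding has_velocity_iff restrict_loops_iff
    using has_velocityD[OF c] periodic_smooth_bilinear[OF cscale_bounded_bilinear m has_velocityD(4)[OF c]]
      periodic_smooth_bilinear[OF cscale_bounded_bilinear m has_velocityD(5)[OF c]]
    by (simp add: cscale.scaleR_right cscale.diff_right)
qed

text \<open>The topology controls all angular derivatives, so differentiation in the angle is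
  continuous for it. It commutes with the difference quotient where \<open>c s\<close> is smooth,
  that is for small s.\<close>

lemma has_velocity_dtheta:
  assumes c: "has_velocity c v"
  shows "has_velocity (\<lambda>s. dtheta (c s)) (dtheta v)"
proof -
  let ?q = "\<lambda>s \<theta>. (c s (cis \<theta>) - c 0 (cis \<theta>)) /\<^sub>R s"
  have "smooth_conv (\<lambda>s \<theta>. vector_derivative (?q s) (at \<theta>)) (ang (dtheta v)) (at 0)"
    using c by (simp add: has_velocity_iff smooth_conv_deriv dtheta_cis)
  moreover have "\<forall>\<^sub>F s in at 0. (\<lambda>\<theta>. vector_derivative (?q s) (at \<theta>)) =
      (\<lambda>\<theta>. (dtheta (c s) (cis \<theta>) - dtheta (c 0) (cis \<theta>)) /\<^sub>R s)"
    using has_velocityD(3)[OF c]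
  proof eventually_elim
    case (elim s)
    have "(?q s has_vector_derivative (dtheta (c s) (cis \<theta>) - dtheta (c 0) (cis \<theta>)) /\<^sub>R s) (at \<theta>)" for \<theta>
      unfolding dtheta_cis
      by (intro bounded_linear.has_vector_derivative[OF bounded_linear_scaleR_right]
          has_vector_derivative_diff periodic_smooth_has_vector_derivative elim has_velocityD(4)[OF c])
    then show ?case by (intro ext vector_derivative_at)
  qed
  ultimately have "smooth_conv (\<lambda>s \<theta>. (dtheta (c s) (cis \<theta>) - dtheta (c 0) (cis \<theta>)) /\<^sub>R s)
      (ang (dtheta v)) (at 0)"
    by (rule iffD1[OF smooth_conv_cong, rotated])
  moreover have "\<forall>\<^sub>F s in at 0. c s \<in> loops UNIV" using c by (simp add: has_velocity_iff)
  then have "\<forall>\<^sub>F s in at 0. dtheta (c s) \<in> loops UNIV" by eventually_elim (rule dtheta_loops)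
  ultimately show ?thesis
    using has_velocityD[OF c] by (simp add: has_velocity_iff dtheta_loops)
qed

lemma has_velocity_reparametrize:
  assumes c: "has_velocity c v"
  shows "has_velocity (\<lambda>s. c (r * s)) (\<lambda>z\<in>S1. r *\<^sub>R v z)"
\<comment> \<open>For r = 0 the map s \<mapsto> r s does not stay in the punctured neighbourhoods of
  0, so the constant curve is treated apart.\<close>
proof (cases "r = 0")
  case True
  then show ?thesis using has_velocity_const[OF has_velocityD(1)[OF c]] by simp
next
  case False
  let ?q = "\<lambda>s \<theta>. (c s (cis \<theta>) - c 0 (cis \<theta>)) /\<^sub>R s"
  have fl: "filterlim (\<lambda>s. r * s) (at 0) (at 0)"
    using False by (auto simp: filterlim_at eventually_at_filter intro!: tendsto_eq_intros)
  have conv: "smooth_conv (\<lambda>s \<theta>. ?q (r * s) \<theta>) (ang v) (at 0)"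
    unfolding smooth_conv_iff
  proof
    fix n
    have "uniform_limit UNIV (\<lambda>s. nth_deriv n (?q s)) (nth_deriv n (ang v)) (at 0)"
      using c by (simp add: has_velocity_iff smooth_conv_iff)
    from filterlim_compose[OF this fl]
    show "uniform_limit UNIV (\<lambda>s. nth_deriv n (\<lambda>\<theta>. ?q (r * s) \<theta>)) (nth_deriv n (ang v)) (at 0)" .
  qed
  have ev: "\<forall>\<^sub>F s in at 0. (\<lambda>\<theta>. ?q (r * s) \<theta>) \<in> periodic_smooth"
    using has_velocity_quotient_periodic_smooth[OF c] fl by (rule eventually_compose_filterlim)
  have eq: "(\<lambda>s \<theta>. (c (r * s) (cis \<theta>) - c 0 (cis \<theta>)) /\<^sub>R s) = (\<lambda>s \<theta>. r *\<^sub>R ?q (r * s) \<theta>)"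
    using False by (intro ext) simp
  have "smooth_conv (\<lambda>s \<theta>. (c (r * s) (cis \<theta>) - c 0 (cis \<theta>)) /\<^sub>R s) (\<lambda>\<theta>. r *\<^sub>R v (cis \<theta>)) (at 0)"
    unfolding eq
    by (rule smooth_conv_linear[OF bounded_linear_scaleR_right conv ev has_velocityD(5)[OF c]])
  moreover have "\<forall>\<^sub>F s in at 0. c (r * s) \<in> loops UNIV"
    by (rule eventually_compose_filterlim[OF _ fl]) (use c in \<open>simp add: has_velocity_iff\<close>)
  ultimately show ?thesis
    using has_velocityD[OF c] by (simp add: has_velocity_iff restrict_loops_iff
        periodic_smooth_linear[OF bounded_linear_scaleR_right])
qed

lemma loop_inv_periodic_smooth:
  fixes f :: "complex \<Rightarrow> complex^'n^'n"
  assumes "ang f \<in> periodic_smooth" "\<And>\<theta>. invertible (f (cis \<theta>))"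
  shows "(\<lambda>\<theta>. matrix_inv (f (cis \<theta>))) \<in> periodic_smooth"
  by (rule periodic_smooth_compose[OF open_invertible smooth_on_matrix_inv assms(1)])
    (use assms(2) in auto)

text \<open>The difference of two inverses is minus the inverse of \<open>c s\<close>, times the
  difference of \<open>c s\<close> and \<open>c 0\<close>, times the inverse of \<open>c 0\<close>.
  The inverses of \<open>c s\<close> converge because inversion is smooth on the open set of
  invertible matrices.\<close>

lemma has_velocity_inv:
  assumes c: "has_velocity c v" and inv: "\<And>s z. z \<in> S1 \<Longrightarrow> invertible (c s z)"
  shows "has_velocity (\<lambda>s. loop_inv (c s))
    (\<lambda>z\<in>S1. - (matrix_inv (c 0 z) ** v z ** matrix_inv (c 0 z)))"
proof -
  let ?q = "\<lambda>s \<theta>. (c s (cis \<theta>) - c 0 (cis \<theta>)) /\<^sub>R s"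
  let ?i = "\<lambda>s \<theta>. matrix_inv (c s (cis \<theta>))"
  note comp = smooth_conv_compose[OF open_invertible smooth_on_matrix_inv has_velocityD(4)[OF c] _
      has_velocityD(3)[OF c] has_velocityD(6)[OF c]]
  note ps = periodic_smooth_bilinear[OF matrix_mul_bounded_bilinear]
  have r: "range (ang (c 0)) \<subseteq> {A. invertible A}" using inv by auto
  have i0: "?i 0 \<in> periodic_smooth"
    by (rule loop_inv_periodic_smooth[OF has_velocityD(4)[OF c]]) (simp add: inv)
  have ci: "smooth_conv ?i (?i 0) (at 0)" and ei: "\<forall>\<^sub>F s in at 0. ?i s \<in> periodic_smooth"
    using comp(1,3)[OF r] .
  have q: "smooth_conv ?q (ang v) (at 0)" using c by (simp add: has_velocity_iff)
  note eq = has_velocity_quotient_periodic_smooth[OF c]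
  have cq: "smooth_conv (\<lambda>s \<theta>. ?q s \<theta> ** ?i 0 \<theta>) (\<lambda>\<theta>. v (cis \<theta>) ** ?i 0 \<theta>) (at 0)"
    by (rule smooth_conv_bilinear[OF matrix_mul_bounded_bilinear q smooth_conv_const eq _
          has_velocityD(5)[OF c] i0]) (simp add: i0)
  have "\<forall>\<^sub>F s in at 0. (\<lambda>\<theta>. ?q s \<theta> ** ?i 0 \<theta>) \<in> periodic_smooth"
    using eq by eventually_elim (rule ps[OF _ i0])
  from smooth_conv_bilinear[OF matrix_mul_bounded_bilinear ci cq ei this i0 ps[OF has_velocityD(5)[OF c] i0]]
  have c1: "smooth_conv (\<lambda>s \<theta>. ?i s \<theta> ** (?q s \<theta> ** ?i 0 \<theta>)) (\<lambda>\<theta>. ?i 0 \<theta> ** (v (cis \<theta>) ** ?i 0 \<theta>)) (at 0)" .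
  have e1: "\<forall>\<^sub>F s in at 0. (\<lambda>\<theta>. ?i s \<theta> ** (?q s \<theta> ** ?i 0 \<theta>)) \<in> periodic_smooth"
    using ei eq by eventually_elim (intro ps i0)
  have l1: "(\<lambda>\<theta>. ?i 0 \<theta> ** (v (cis \<theta>) ** ?i 0 \<theta>)) \<in> periodic_smooth"
    by (intro ps i0 has_velocityD(5)[OF c])
  note neg = bounded_linear_minus[OF bounded_linear_ident]
  have "smooth_conv (\<lambda>s \<theta>. - (?i s \<theta> ** (?q s \<theta> ** ?i 0 \<theta>))) (\<lambda>\<theta>. - (?i 0 \<theta> ** (v (cis \<theta>) ** ?i 0 \<theta>))) (at 0)"
    by (rule smooth_conv_linear[OF neg c1 e1 l1])
  moreover have "- (?i s \<theta> ** (?q s \<theta> ** ?i 0 \<theta>)) = (?i s \<theta> - ?i 0 \<theta>) /\<^sub>R s" for s \<theta>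
  proof -
    have "?i s \<theta> ** ((c s (cis \<theta>) - c 0 (cis \<theta>)) ** ?i 0 \<theta>) =
        (?i s \<theta> ** c s (cis \<theta>)) ** ?i 0 \<theta> - ?i s \<theta> ** (c 0 (cis \<theta>) ** ?i 0 \<theta>)"
      by (simp only: matmul.diff_left matmul.diff_right matrix_mul_assoc)
    also have "\<dots> = ?i 0 \<theta> - ?i s \<theta>" by (simp add: matrix_inv_works inv)
    finally have "?i s \<theta> ** (?q s \<theta> ** ?i 0 \<theta>) = (?i 0 \<theta> - ?i s \<theta>) /\<^sub>R s"
      by (simp add: matmul.scaleR_left matmul.scaleR_right)
    then show ?thesis by (simp flip: scaleR_minus_right)
  qed
  moreover have "- (matrix_inv (c 0 z) ** v z ** matrix_inv (c 0 z)) =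
      - (matrix_inv (c 0 z) ** (v z ** matrix_inv (c 0 z)))" for z
    by (simp add: matrix_mul_assoc)
  ultimately show ?thesis
    using i0 ei periodic_smooth_linear[OF neg l1]
    by (simp add: has_velocity_iff restrict_loops_iff loop_inv_def)
qed

section \<open>Substitution into functions on the circle\<close>

text \<open>The open cone over an arc. A function g on the arc extends to it along rays as
  \<open>g (sgn w)\<close>, which turns substitution into g into composition on an open subset of
  the plane.\<close>

definition sector :: "real \<Rightarrow> complex set" where
  "sector \<epsilon> = {w. w \<noteq> 0 \<and> sgn w \<in> arc \<epsilon>}"

lemma arcI: "\<bar>t\<bar> < \<epsilon> \<Longrightarrow> cis t \<in> arc \<epsilon>"
  unfolding arc_def by blast

lemma arcE: assumes "z \<in> arc \<epsilon>" obtains t where "z = cis t" "\<bar>t\<bar> < \<epsilon>"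
  using assms unfolding arc_def by blast

lemma sectorE:
  assumes "w \<in> sector \<epsilon>" obtains t where "w \<noteq> 0" "sgn w = cis t" "\<bar>t\<bar> < \<epsilon>"
  using assms unfolding sector_def by (blast elim: arcE)

lemma arc_subset_S1: "arc \<epsilon> \<subseteq> S1"
  by (auto simp: arc_def)

text \<open>The number 4 is a convenient bound above pi. It makes the full circle an arc, so that
  loops and local homomorphisms are covered by the same lemmas.\<close>

lemma S1_eq_arc: "S1 = arc 4"
proof
  show "S1 \<subseteq> arc 4"
  proof
    fix z :: complex assume "z \<in> S1"
    then obtain \<theta> where "z = cis \<theta>" "\<bar>\<theta>\<bar> \<le> pi" by (rule S1_cases)
    then show "z \<in> arc 4" unfolding arc_def using pi_less_4 by force
  qed
qed (rule arc_subset_S1)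

lemma sgn_S1: "z \<in> S1 \<Longrightarrow> sgn z = z"
  by (simp add: sgn_div_norm)

lemma arc_subset_sector: "arc \<epsilon> \<subseteq> sector \<epsilon>"
  using arc_subset_S1[of \<epsilon>] by (auto simp: sector_def sgn_S1 subset_iff)

text \<open>\<open>t + Im (Ln (w / w0))\<close> is the branch of the argument with value t at w0.
  Dividing by w0 first keeps the cut of the logarithm away from the point of interest.\<close>

lemma sgn_eq_cis:
  assumes "w0 \<noteq> 0" "w \<noteq> 0" "sgn w0 = cis t"
  shows "sgn w = cis (t + Im (Ln (w / w0)))"
proof -
  have sgn_exp: "sgn (exp z) = cis (Im z)" for z :: complex
    by (simp add: exp_eq_polar[of z] sgn_div_norm norm_mult scaleR_conv_of_real)
  have "exp (Ln (w / w0)) = w / w0" using assms by simp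
  then have "sgn (w / w0) = cis (Im (Ln (w / w0)))" using sgn_exp[of "Ln (w / w0)"] by (simp only:)
  moreover have "w0 * (w / w0) = w" using assms by simp
  then have "sgn w = sgn w0 * sgn (w / w0)" using sgn_mult[of w0 "w / w0"] by (simp only:)
  ultimately show ?thesis by (simp only: assms(3) cis_mult)
qed

lemma Im_Ln_has_derivative:
  assumes "w0 \<noteq> 0"
  shows "((\<lambda>w. t + Im (Ln (w / w0))) has_derivative (\<lambda>v. Im (v / w0))) (at w0)"
proof -
  have "((\<lambda>w. Ln (w / w0)) has_field_derivative (1 / w0)) (at w0)"
    using assms by (auto intro!: derivative_eq_intros simp: field_simps)
  moreover have "(*) (1 / w0) = (\<lambda>v. v / w0)" by (simp add: fun_eq_iff)
  ultimately have "((\<lambda>w. Ln (w / w0)) has_derivative (\<lambda>v. v / w0)) (at w0)"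
    by (simp only: has_field_derivative_def)
  from has_derivative_add[OF has_derivative_const bounded_linear.has_derivative[OF bounded_linear_Im this]]
  show ?thesis by simp
qed

lemma compose_sgn_has_derivative:
  assumes "w0 \<noteq> 0" "sgn w0 = cis t" "(ang g has_vector_derivative g') (at t)"
  shows "((\<lambda>w. g (sgn w)) has_derivative (\<lambda>v. Im (v / w0) *\<^sub>R g')) (at w0)"
proof -
  have "(ang g has_derivative (\<lambda>h. h *\<^sub>R g')) (at (t + Im (Ln (w0 / w0))))"
    using assms(1,3) by (simp add: has_vector_derivative_def)
  from has_derivative_compose[OF Im_Ln_has_derivative[OF assms(1)] this]
  have "((\<lambda>w. g (cis (t + Im (Ln (w / w0))))) has_derivative (\<lambda>v. Im (v / w0) *\<^sub>R g')) (at w0)" .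
  then show ?thesis
    by (rule has_derivative_transform_within_open[of _ _ _ _ "- {0}"])
      (use assms(1) sgn_eq_cis[OF assms(1) _ assms(2)] in \<open>auto simp: open_Compl\<close>)
qed

lemma sector_nhd:
  assumes "w0 \<noteq> 0" "sgn w0 = cis t" "\<bar>t\<bar> < \<epsilon>"
  shows "\<forall>\<^sub>F w in nhds w0. w \<noteq> 0 \<and> \<bar>t + Im (Ln (w / w0))\<bar> < \<epsilon>"
proof -
  have lim: "((\<lambda>w. t + Im (Ln (w / w0))) \<longlongrightarrow> t + Im (Ln (w0 / w0))) (nhds w0)"
    using has_derivative_continuous[OF Im_Ln_has_derivative[OF assms(1), of t]]
      tendsto_at_iff_tendsto_nhds[of "\<lambda>w. t + Im (Ln (w / w0))" w0]
    by (simp only: isCont_def)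
  have mem: "t + Im (Ln (w0 / w0)) \<in> {-\<epsilon><..<\<epsilon>}"
    using assms(1,3) by (simp add: abs_less_iff)
  from topological_tendstoD[OF lim open_greaterThanLessThan mem]
  have "\<forall>\<^sub>F w in nhds w0. t + Im (Ln (w / w0)) \<in> {-\<epsilon><..<\<epsilon>}" .
  from eventually_conj[OF t1_space_nhds[OF assms(1)] this] show ?thesis
  proof (rule eventually_mono)
    have abs: "\<bar>x\<bar> < \<epsilon>" if "x \<in> {-\<epsilon><..<\<epsilon>}" for x :: real using that by auto
    show "w \<noteq> 0 \<and> \<bar>t + Im (Ln (w / w0))\<bar> < \<epsilon>"
      if "w \<noteq> 0 \<and> t + Im (Ln (w / w0)) \<in> {-\<epsilon><..<\<epsilon>}" for w
      by (rule conjI[OF conjunct1[OF that] abs[OF conjunct2[OF that]]])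
  qed
qed

lemma open_sector: "open (sector \<epsilon>)"
proof (subst open_subopen, rule ballI)
  fix w0 assume w0: "w0 \<in> sector \<epsilon>"
  then obtain t where t: "w0 \<noteq> 0" "sgn w0 = cis t" "\<bar>t\<bar> < \<epsilon>" by (rule sectorE)
  from sector_nhd[OF t] have "\<forall>\<^sub>F w in nhds w0. w \<in> sector \<epsilon>"
  proof eventually_elim
    case (elim w)
    then have "w \<noteq> 0" "sgn w \<in> arc \<epsilon>"
      using arcI sgn_eq_cis[OF t(1) _ t(2), of w] by simp_all
    then show ?case by (simp add: sector_def)
  qed
  then show "\<exists>T. open T \<and> w0 \<in> T \<and> T \<subseteq> sector \<epsilon>" by (auto simp: eventually_nhds subset_iff)
qed

text \<open>In polar coordinates only the angle matters: the derivative in direction v is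
  \<open>Im (v / w)\<close> times the angular derivative of g at \<open>sgn w\<close>. The first
  factor is smooth on the sector, and the second has the original shape with \<open>dtheta g\<close>
  in place of g.\<close>

lemma higher_differentiable_on_compose_sgn:
  assumes "higher_differentiable_on n {-\<epsilon><..<\<epsilon>} (ang g)"
  shows "higher_differentiable_on n (sector \<epsilon>) (\<lambda>w. g (sgn w))"
  using assms
proof (induction n arbitrary: g)
  case 0
  have "isCont (\<lambda>w. g (sgn w)) w0" if "w0 \<in> sector \<epsilon>" for w0
  proof -
    obtain t where t: "w0 \<noteq> 0" "sgn w0 = cis t" "\<bar>t\<bar> < \<epsilon>" by (rule sectorE[OF \<open>w0 \<in> sector \<epsilon>\<close>])
    have "isCont (ang g) t" using 0 t(3) by (auto simp: continuous_on_eq_continuous_at abs_less_iff)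
    then have "isCont (ang g) (t + Im (Ln (w0 / w0)))" using t(1) by simp
    from isCont_o2[OF has_derivative_continuous[OF Im_Ln_has_derivative[OF t(1), of t]] this]
    have *: "isCont (\<lambda>w. g (cis (t + Im (Ln (w / w0))))) w0" .
    have "\<forall>\<^sub>F w in nhds w0. g (sgn w) = g (cis (t + Im (Ln (w / w0))))"
      using t1_space_nhds[OF t(1)] by eventually_elim (simp add: sgn_eq_cis[OF t(1) _ t(2)])
    from isCont_cong[OF this] show ?thesis using * by simp
  qed
  then show ?case by (simp add: continuous_at_imp_continuous_on)
next
  case (Suc n)
  have der: "(ang g has_vector_derivative dtheta g (cis t)) (at t)" if "\<bar>t\<bar> < \<epsilon>" for t
  proof -
    have "ang g differentiable (at t)" using Suc.prems that by (simp add: abs_less_iff)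
    then show ?thesis unfolding dtheta_cis by (simp only: vector_derivative_works)
  qed
  have *: "((\<lambda>w. g (sgn w)) has_derivative (\<lambda>v. Im (v / w0) *\<^sub>R dtheta g (sgn w0))) (at w0)"
    if "w0 \<in> sector \<epsilon>" for w0
  proof -
    obtain t where t: "w0 \<noteq> 0" "sgn w0 = cis t" "\<bar>t\<bar> < \<epsilon>" by (rule sectorE[OF \<open>w0 \<in> sector \<epsilon>\<close>])
    show ?thesis using compose_sgn_has_derivative[OF t(1,2) der[OF t(3)]] t(2) by simp
  qed
  have "higher_differentiable_on n {-\<epsilon><..<\<epsilon>} (\<lambda>t. frechet_derivative (ang g) (at t) 1)"
    using Suc.prems by simp
  then have "higher_differentiable_on n {-\<epsilon><..<\<epsilon>} (ang (dtheta g))"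
  proof (rule higher_differentiable_on_cong[rotated 2])
    fix t assume "t \<in> {-\<epsilon><..<\<epsilon>}"
    then have "(ang g has_derivative (\<lambda>h. h *\<^sub>R dtheta g (cis t))) (at t)"
      using der[of t] by (simp add: has_vector_derivative_def abs_less_iff)
    from frechet_derivative_at[OF this, symmetric]
    show "frechet_derivative (ang g) (at t) 1 = dtheta g (cis t)" by simp
  qed simp
  note hd = Suc.IH[OF this]
  have "0 \<notin> sector \<epsilon>" by (simp add: sector_def)
  have "higher_differentiable_on n (sector \<epsilon>) (\<lambda>w. Im (v / w))" for v
    by (rule higher_differentiable_on_linear[OF open_sector bounded_linear_Im],
        rule higher_differentiable_on_holomorphic[OF open_sector])
      (use \<open>0 \<notin> sector \<epsilon>\<close> in \<open>auto intro!: holomorphic_intros\<close>)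
  from higher_differentiable_on_SucI[OF open_sector *
      higher_differentiable_on_bilinear[OF open_sector bounded_bilinear_scaleR this hd]]
  show ?case .
qed

lemma smooth_on_compose_sgn:
  "smooth_on {-\<epsilon><..<\<epsilon>} (ang g) \<Longrightarrow> smooth_on (sector \<epsilon>) (\<lambda>w. g (sgn w))"
  by (rule smooth_onI, rule higher_differentiable_on_compose_sgn, rule smooth_onD)

lemma periodic_smooth_substitute:
  assumes "smooth_on {-\<epsilon><..<\<epsilon>} (ang g)" "w \<in> periodic_smooth" "\<And>\<theta>. w \<theta> \<in> arc \<epsilon>"
  shows "(\<lambda>\<theta>. g (w \<theta>)) \<in> periodic_smooth"
proof -
  have "range w \<subseteq> sector \<epsilon>" using assms(3) arc_subset_sector by blast
  from periodic_smooth_compose[OF open_sector smooth_on_compose_sgn[OF assms(1)] assms(2) this]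
  have "(\<lambda>\<theta>. g (sgn (w \<theta>))) \<in> periodic_smooth" .
  moreover have "sgn (w \<theta>) = w \<theta>" for \<theta> using assms(3) arc_subset_S1 sgn_S1 by blast
  ultimately show ?thesis by simp
qed

lemma smooth_conv_substitute:
  assumes g: "smooth_on {-\<epsilon><..<\<epsilon>} (ang g)"
    and l: "l \<in> periodic_smooth" "\<And>\<theta>. l \<theta> \<in> arc \<epsilon>"
    and w: "\<And>i. w i \<in> periodic_smooth" "\<And>i \<theta>. w i \<theta> \<in> S1" "smooth_conv w l F"
  shows "smooth_conv (\<lambda>i \<theta>. g (w i \<theta>)) (\<lambda>\<theta>. g (l \<theta>)) F"
    and "\<forall>\<^sub>F i in F. range (w i) \<subseteq> arc \<epsilon>"
proof -
  have r: "range l \<subseteq> sector \<epsilon>" using l(2) arc_subset_sector by blast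
  note c = smooth_conv_compose[OF open_sector smooth_on_compose_sgn[OF g] l(1) r _ w(3)]
  have s: "sgn (w i \<theta>) = w i \<theta>" "sgn (l \<theta>) = l \<theta>" for i \<theta>
    using w(2) l(2) arc_subset_S1 sgn_S1 by blast+
  show "smooth_conv (\<lambda>i \<theta>. g (w i \<theta>)) (\<lambda>\<theta>. g (l \<theta>)) F"
    using c(1) w(1) by (simp add: s)
  have "\<forall>\<^sub>F i in F. range (w i) \<subseteq> sector \<epsilon>" using c(2) w(1) by simp
  then show "\<forall>\<^sub>F i in F. range (w i) \<subseteq> arc \<epsilon>"
    by eventually_elim (auto simp: sector_def s)
qed


section \<open>Complex extensions and the velocity of a flow\<close>

text \<open>The extension along rays violates the Cauchy-Riemann equations on the arc. A multiple of
  the angular derivative is added, with a factor that vanishes on the circle and whose first-order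
  behaviour there corrects the defect.\<close>

lemma complex_extension_exists:
  fixes g :: "complex \<Rightarrow> complex^'n^'n"
  assumes g: "smooth_on {-\<epsilon><..<\<epsilon>} (ang g)"
  shows "\<exists>U H. complex_extension (arc \<epsilon>) g U H"
proof -
  \<comment> \<open>This is i (1 - |w|^2) / 2. With u = v / z its derivative at z on the circle is
    -i \<open>Re u\<close>, and the extension along rays contributes \<open>Im u\<close>; the sum is
    -i u, which is complex linear in v. The derivative of the factor \<open>dtheta g (sgn w)\<close>
    drops out since \<phi> vanishes at z.\<close>
  define \<phi> :: "complex \<Rightarrow> complex" where "\<phi> = (\<lambda>w. \<i> / 2 + (- \<i> / 2) * (w * cnj w))"
  define H where "H = (\<lambda>w. g (sgn w) + cscale (\<phi> w) (dtheta g (sgn w)))"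
  have der: "(ang g has_vector_derivative dtheta g (cis t)) (at t)" if "\<bar>t\<bar> < \<epsilon>" for t
    unfolding dtheta_cis by (rule smooth_on_has_vector_derivative[OF g]) (use that in auto)
  have g': "smooth_on {-\<epsilon><..<\<epsilon>} (ang (dtheta g))"
    unfolding dtheta_cis by (rule smooth_on_vector_derivative[OF open_greaterThanLessThan g])
  have der': "(ang (dtheta g) has_vector_derivative dtheta (dtheta g) (cis t)) (at t)" if "\<bar>t\<bar> < \<epsilon>" for t
    unfolding dtheta_cis[of "dtheta g"] by (rule smooth_on_has_vector_derivative[OF g']) (use that in auto)
  have \<phi>: "smooth_on (sector \<epsilon>) \<phi>"
    unfolding \<phi>_def
    by (rule smooth_on_add[OF open_sector smooth_on_const[OF open_sector]],
        rule smooth_on_linear[OF bounded_linear_mult_right open_sector],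
        rule smooth_on_bilinear[OF bounded_bilinear_mult open_sector smooth_on_id[OF open_sector]],
        rule smooth_on_linear[OF bounded_linear_cnj open_sector smooth_on_id[OF open_sector]])
  have "smooth_on (sector \<epsilon>) H"
    unfolding H_def
    by (rule smooth_on_add[OF open_sector smooth_on_compose_sgn[OF g]
          smooth_on_bilinear[OF cscale_bounded_bilinear open_sector \<phi> smooth_on_compose_sgn[OF g']]])
  moreover have "H z = g z" if "z \<in> arc \<epsilon>" for z
  proof -
    have "z * cnj z = 1" using that by (auto simp: arc_def cis_cnj cis_mult)
    then have "\<phi> z = 0" by (simp add: \<phi>_def)
    then show ?thesis using that arc_subset_S1[of \<epsilon>] by (simp add: H_def sgn_S1 subset_iff cscale.zero_left)
  qed
  moreover have "(\<lambda>w. H w $ i $ k) field_differentiable (at z)" if "z \<in> arc \<epsilon>" for z i k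
  proof -
    obtain t where t: "z = cis t" "\<bar>t\<bar> < \<epsilon>" by (rule arcE[OF \<open>z \<in> arc \<epsilon>\<close>])
    have zc: "cnj z = inverse z" by (simp add: t(1) cis_cnj)
    have z0: "z \<noteq> 0" "sgn z = cis t" by (simp_all add: t(1))
    have p0: "\<phi> (cis t) = 0" by (simp add: \<phi>_def cis_cnj cis_mult)
    have "(\<phi> has_derivative (\<lambda>v. (- \<i> / 2) * (z * cnj v + v * cnj z))) (at z)"
      unfolding \<phi>_def by (auto intro!: derivative_eq_intros)
    from has_derivative_add[OF compose_sgn_has_derivative[OF z0 der[OF t(2)]]
        bounded_bilinear.FDERIV[OF cscale_bounded_bilinear this
          compose_sgn_has_derivative[OF z0 der'[OF t(2)]]]]
    have "(H has_derivative (\<lambda>v. Im (v / z) *\<^sub>R dtheta g z +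
        cscale ((- \<i> / 2) * (z * cnj v + v * cnj z)) (dtheta g z))) (at z)"
      unfolding H_def by (simp add: p0 cscale.zero_left t(1))
    from bounded_linear.has_derivative[OF bounded_linear_entry this, of i k]
    have "((\<lambda>w. H w $ i $ k) has_derivative (\<lambda>v. of_real (Im (v / z)) * dtheta g z $ i $ k +
        (- \<i> / 2) * (z * cnj v + v * cnj z) * dtheta g z $ i $ k)) (at z)"
      by (simp add: cscale_def scaleR_conv_of_real[symmetric])
    moreover have "of_real (Im (v / z)) * d + (- \<i> / 2) * (z * cnj v + v * cnj z) * d =
        (- \<i> / z * d) * v" for v d
    proof -
      have e: "v * cnj z = v / z" by (simp add: zc divide_inverse)
      have "z * cnj v + v * cnj z = of_real (2 * Re (v * cnj z))" by (simp add: complex_eq_iff)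
      then have re: "z * cnj v + v * cnj z = of_real (2 * Re (v / z))" by (simp only: e)
      have im: "of_real (Im u) + (- \<i> / 2) * of_real (2 * Re u) = - \<i> * u" for u
        by (simp add: complex_eq_iff)
      have "of_real (Im (v / z)) * d + (- \<i> / 2) * (z * cnj v + v * cnj z) * d =
          (of_real (Im (v / z)) + (- \<i> / 2) * of_real (2 * Re (v / z))) * d"
        by (simp only: re distrib_right)
      also have "\<dots> = - \<i> * (v / z) * d" by (simp only: im)
      finally show ?thesis by simp
    qed
    ultimately have "((\<lambda>w. H w $ i $ k) has_derivative (*) (- \<i> / z * dtheta g z $ i $ k)) (at z)"
      by (simp only:)
    then show ?thesis
      unfolding field_differentiable_def has_field_derivative_def by blast
  qed
  ultimately have "complex_extension (arc \<epsilon>) g (sector \<epsilon>) H"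
    using open_sector arc_subset_sector by (simp add: complex_extension_def)
  then show ?thesis by blast
qed

text \<open>The Cauchy-Riemann equations make the derivative complex linear, so the tangential
  direction determines it. To first order the extension is therefore independent of all
  choices.\<close>

lemma complex_extension_derivative:
  fixes h :: "complex \<Rightarrow> complex^'n^'n"
  assumes ext: "complex_extension (arc \<epsilon>) h U H" and t: "\<bar>t\<bar> < \<epsilon>"
    and h': "(ang h has_vector_derivative h') (at t)"
  shows "(H has_derivative (\<lambda>v. cscale (v / (\<i> * cis t)) h')) (at (cis t))"
proof -
  have z: "cis t \<in> arc \<epsilon>" by (rule arcI[OF t])
  obtain H' where H': "(H has_derivative H') (at (cis t))"
    using smooth_on_has_derivative[of U H] z ext by (blast dest: complex_extension_def[THEN iffD1])
  have "(cis has_vector_derivative \<i> * cis t) (at t)"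
    by (auto intro!: derivative_eq_intros simp: has_vector_derivative_def scaleR_conv_of_real)
  from vector_derivative_diff_chain_within[OF this has_derivative_at_withinI[OF H']]
  have "((\<lambda>\<theta>. H (cis \<theta>)) has_vector_derivative H' (\<i> * cis t)) (at t)" by (simp add: o_def)
  then have "(ang h has_vector_derivative H' (\<i> * cis t)) (at t)"
    by (rule has_vector_derivative_transform_within_open[of _ _ _ "{-\<epsilon><..<\<epsilon>}"])
      (use ext t in \<open>auto simp: complex_extension_def arcI abs_less_iff\<close>)
  then have h'_eq: "h' = H' (\<i> * cis t)" using h' vector_derivative_unique_at by blast
  have "H' v $ i $ k = cscale (v / (\<i> * cis t)) h' $ i $ k" for v i k
  proof -
    obtain d where "((\<lambda>w. H w $ i $ k) has_derivative (*) d) (at (cis t))"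
      using ext z unfolding complex_extension_def field_differentiable_def has_field_derivative_def
      by blast
    from has_derivative_unique[OF this bounded_linear.has_derivative[OF bounded_linear_entry H']]
    have "d * v = H' v $ i $ k" for v by (rule fun_cong)
    then have "H' v $ i $ k = d * v" "H' (\<i> * cis t) $ i $ k = d * (\<i> * cis t)" by simp_all
    then show ?thesis by (simp add: cscale_def h'_eq)
  qed
  then have "H' = (\<lambda>v. cscale (v / (\<i> * cis t)) h')" by (simp add: fun_eq_iff vec_eq_iff)
  then show ?thesis using H' by simp
qed

lemma has_vector_derivative_quadratic_bound:
  fixes h :: "real \<Rightarrow> 'a::real_normed_vector"
  assumes "\<delta> > 0" "\<And>s. \<bar>s\<bar> < \<delta> \<Longrightarrow> norm (h s - h 0 - s *\<^sub>R v) \<le> B * s\<^sup>2"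
  shows "(h has_vector_derivative v) (at 0)"
proof -
  have "((\<lambda>s. norm (h s - h 0 - s *\<^sub>R v) / norm s) \<longlongrightarrow> 0) (at 0)"
  proof (rule tendsto_0_le)
    show "((\<lambda>s. B * s) \<longlongrightarrow> 0) (at (0::real))" by (auto intro!: tendsto_eq_intros)
    have "\<forall>\<^sub>F s in at 0. \<bar>s\<bar> < \<delta>" using assms(1) unfolding eventually_at by (intro exI[of _ \<delta>]) auto
    moreover have "\<forall>\<^sub>F s in at 0. s \<noteq> (0::real)" by (simp add: eventually_at_filter)
    ultimately show "\<forall>\<^sub>F s in at 0. norm (norm (h s - h 0 - s *\<^sub>R v) / norm s) \<le> norm (B * s) * 1"
    proof eventually_elim
      case (elim s)
      have "norm (h s - h 0 - s *\<^sub>R v) \<le> B * s\<^sup>2" by (rule assms(2)[OF elim(1)])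
      also have "\<dots> \<le> \<bar>B\<bar> * s\<^sup>2" by (rule mult_right_mono) auto
      also have "\<dots> = \<bar>B * s\<bar> * \<bar>s\<bar>" by (simp add: abs_mult power2_eq_square)
      finally show ?case using elim(2) by (simp add: divide_le_eq)
    qed
  qed
  then show ?thesis
    by (simp add: has_vector_derivative_def has_derivative_at bounded_linear_scaleR_left)
qed

lemma inverse_flow_exists: "\<exists>\<delta> \<kappa>. inverse_flow j \<delta> \<kappa>"
proof -
  let ?W = "{-1<..<1::real} \<times> (UNIV :: real set)"
  \<comment> \<open>The prescribed first-order expression itself is an instance, with error bound 0
    and all parameters s of norm below 1.\<close>
  define \<kappa> where "\<kappa> = (\<lambda>s::real. \<lambda>z::complex. z - of_real s * z powi (j + 1))"
  have W: "open ?W" by (intro open_Times) auto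
  have f: "smooth_on ?W fst" "smooth_on ?W snd"
    using smooth_on_linear[OF bounded_linear_fst W smooth_on_id[OF W]]
      smooth_on_linear[OF bounded_linear_snd W smooth_on_id[OF W]] by simp_all
  have "smooth_on ?W (\<lambda>p. cis (snd p) + (- fst p) *\<^sub>R cis (of_int (j + 1) * snd p))"
    by (rule smooth_on_add[OF W smooth_on_cis[OF W f(2)] smooth_on_bilinear[OF bounded_bilinear_scaleR W
          smooth_on_linear[OF bounded_linear_minus[OF bounded_linear_ident] W f(1)]
          smooth_on_cis[OF W smooth_on_linear[OF bounded_linear_mult_right W f(2)]]]])
  moreover have "(\<lambda>p. cis (snd p) + (- fst p) *\<^sub>R cis (of_int (j + 1) * snd p)) =
      (\<lambda>(s, \<theta>). \<kappa> s (cis \<theta>))"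
    by (auto simp: \<kappa>_def fun_eq_iff cis_power_int scaleR_conv_of_real)
  ultimately have "inverse_flow j 1 \<kappa>"
    unfolding inverse_flow_def by (auto simp: \<kappa>_def intro!: exI[of _ 0])
  then show ?thesis by blast
qed

text \<open>Compactness of the circle gives one bound r on s for which \<open>\<kappa> s z\<close>
  stays in U and \<open>\<kappa> s z / z\<close> stays in V for all z. The curve is then jointly
  smooth in s and the angle, and its velocity may be computed point by point, where
  \<open>complex_extension_derivative\<close> removes the dependence on F and
  \<open>C'\<close>.\<close>

lemma diamond_flow_velocity:
  fixes f C :: "complex \<Rightarrow> complex^'n^'n"
  assumes f: "f \<in> loops UNIV" and C: "smooth_on {-\<epsilon><..<\<epsilon>} (ang C)" "\<epsilon> > 0" "C 1 = mat 1"
    and F: "complex_extension S1 f U F" and C': "complex_extension (arc \<epsilon>) C V C'"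
    and \<kappa>: "inverse_flow j \<delta> \<kappa>"
  shows "has_velocity (\<lambda>s. diamond C' (\<kappa> s) F)
      (\<lambda>z\<in>S1. - (cscale (z powi (j + 1)) (circle_deriv f z) +
         cscale (z powi j) (f z ** circle_deriv C 1)))"
    and "diamond C' (\<kappa> 0) F = f"
proof -
  obtain B where \<delta>: "\<delta> > 0" and sm: "smooth_on ({-\<delta><..<\<delta>} \<times> UNIV) (\<lambda>(s, \<theta>). \<kappa> s (cis \<theta>))"
    and B: "\<And>s z. s \<in> {-\<delta><..<\<delta>} \<Longrightarrow> z \<in> S1 \<Longrightarrow>
        norm (\<kappa> s z - (z - of_real s * z powi (j + 1))) \<le> B * s\<^sup>2"
    using \<kappa> unfolding inverse_flow_def by blast
  have U: "open U" "S1 \<subseteq> U" "smooth_on U F" "\<And>z. z \<in> S1 \<Longrightarrow> F z = f z"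
    and V: "open V" "arc \<epsilon> \<subseteq> V" "smooth_on V C'" "\<And>z. z \<in> arc \<epsilon> \<Longrightarrow> C' z = C z"
    using F C' unfolding complex_extension_def by auto
  have one: "1 \<in> arc \<epsilon>" using C(2) unfolding arc_def by (auto intro!: exI[of _ 0])
  have \<kappa>0: "\<kappa> 0 z = z" if "z \<in> S1" for z using B[of 0 z] that \<delta> by simp
  have S1_nz: "z \<noteq> 0" if "z \<in> S1" for z :: complex using that by auto
  show "diamond C' (\<kappa> 0) F = f"
    by (rule loops_eqI[OF _ f, of _ UNIV])
      (use loops_periodic_smooth[OF f] in \<open>auto simp: diamond_def restrict_loops_iff \<kappa>0 U(4) V(4) one C(3)\<close>)
  obtain e1 where e1: "e1 > 0" "(\<Union>x\<in>S1. cball x e1) \<subseteq> U"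
    using compact_subset_open_imp_cball_epsilon_subset[OF compact_sphere U(1,2)] by blast
  obtain e2 where e2: "e2 > 0" "cball 1 e2 \<subseteq> V"
    using V(1,2) one open_contains_cball by blast
  \<comment> \<open>A bound for the displacement of points of the circle: the first-order term has
    norm |s|, and the error is at most B s^2. Division by z, of norm 1, gives the same bound for the
    distance of the ratio from 1.\<close>
  have "((\<lambda>s. \<bar>s\<bar> + \<bar>B\<bar> * s\<^sup>2) \<longlongrightarrow> 0) (at (0::real))" by (auto intro!: tendsto_eq_intros)
  then have "\<forall>\<^sub>F s in at (0::real). \<bar>s\<bar> + \<bar>B\<bar> * s\<^sup>2 < min e1 e2"
    by (rule order_tendstoD) (use e1(1) e2(1) in simp)
  then obtain d where d: "d > 0" "\<And>s. s \<noteq> 0 \<Longrightarrow> \<bar>s\<bar> < d \<Longrightarrow> \<bar>s\<bar> + \<bar>B\<bar> * s\<^sup>2 < min e1 e2"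
    unfolding eventually_at by auto
  define r where "r = min d \<delta>"
  have r: "r > 0" "r \<le> d" "r \<le> \<delta>" using d(1) \<delta> by (auto simp: r_def)
  have near: "norm (\<kappa> s z - z) < min e1 e2" if "\<bar>s\<bar> < r" "z \<in> S1" for s z
  proof (cases "s = 0")
    case True
    then show ?thesis using \<kappa>0 that e1(1) e2(1) by simp
  next
    case False
    have "norm (\<kappa> s z - z) = norm (\<kappa> s z - (z - of_real s * z powi (j + 1)) - of_real s * z powi (j + 1))"
      by simp
    also have "\<dots> \<le> B * s\<^sup>2 + \<bar>s\<bar>"
      using B[of s z] that r by (intro norm_triangle_le_diff)
        (auto simp: norm_mult norm_power_int abs_less_iff)
    also have "\<dots> \<le> \<bar>s\<bar> + \<bar>B\<bar> * s\<^sup>2" using mult_right_mono[OF abs_ge_self[of B], of "s\<^sup>2"] by simp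
    also have "\<dots> < min e1 e2" using d(2)[OF False] that r by simp
    finally show ?thesis .
  qed
  let ?W = "{-r<..<r} \<times> (UNIV :: real set)"
  have W: "open ?W" by (intro open_Times) auto
  have K: "smooth_on ?W (\<lambda>p. \<kappa> (fst p) (cis (snd p)))"
    by (rule smooth_on_subset[OF sm[unfolded case_prod_unfold]]) (use r in auto)
  have KU: "(\<lambda>p. \<kappa> (fst p) (cis (snd p))) ` ?W \<subseteq> U"
  proof clarsimp
    fix s \<theta> assume "- r < s" "s < r"
    then have "\<kappa> s (cis \<theta>) \<in> cball (cis \<theta>) e1"
      using near[of s "cis \<theta>"] by (simp add: dist_norm norm_minus_commute abs_less_iff)
    then show "\<kappa> s (cis \<theta>) \<in> U" using e1(2) by (meson UN_I cis_in_S1 subsetD)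
  qed
  have sd: "smooth_on ?W (\<lambda>p. - snd p)"
    by (rule smooth_on_linear[OF bounded_linear_minus[OF bounded_linear_snd] W smooth_on_id[OF W]])
  have "smooth_on ?W (\<lambda>p. \<kappa> (fst p) (cis (snd p)) * cis (- snd p))"
    by (rule smooth_on_bilinear[OF bounded_bilinear_mult W K smooth_on_cis[OF W sd]])
  then have R: "smooth_on ?W (\<lambda>p. \<kappa> (fst p) (cis (snd p)) / cis (snd p))"
    by (simp add: divide_inverse cis_inverse)
  have RV: "(\<lambda>p. \<kappa> (fst p) (cis (snd p)) / cis (snd p)) ` ?W \<subseteq> V"
  proof clarsimp
    fix s \<theta> assume s: "- r < s" "s < r"
    have "\<kappa> s (cis \<theta>) / cis \<theta> - 1 = (\<kappa> s (cis \<theta>) - cis \<theta>) / cis \<theta>" by (simp add: diff_divide_distrib)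
    then have "norm (\<kappa> s (cis \<theta>) / cis \<theta> - 1) = norm (\<kappa> s (cis \<theta>) - cis \<theta>)"
      by (simp add: norm_divide)
    then have "\<kappa> s (cis \<theta>) / cis \<theta> \<in> cball 1 e2"
      using near[of s "cis \<theta>"] s by (simp add: dist_norm norm_minus_commute abs_less_iff)
    then show "\<kappa> s (cis \<theta>) / cis \<theta> \<in> V" using e2(2) by blast
  qed
  define a where "a = (\<lambda>s \<theta>. F (\<kappa> s (cis \<theta>)) ** C' (\<kappa> s (cis \<theta>) / cis \<theta>))"
  have "smooth_on ?W (\<lambda>p. F (\<kappa> (fst p) (cis (snd p))) ** C' (\<kappa> (fst p) (cis (snd p)) / cis (snd p)))"
    by (rule smooth_on_bilinear[OF matrix_mul_bounded_bilinear W smooth_on_compose[OF W U(1) KU U(3) K]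
          smooth_on_compose[OF W V(1) RV V(3) R]])
  then have a_smooth: "smooth_on ?W (\<lambda>(s, \<theta>). a s \<theta>)" by (simp only: a_def case_prod_unfold)
  define v where "v = (\<lambda>z\<in>S1. - (cscale (z powi (j + 1)) (circle_deriv f z) +
         cscale (z powi j) (f z ** circle_deriv C 1)))"
  have der: "((\<lambda>s. a s \<theta>) has_vector_derivative v (cis \<theta>)) (at 0)" for \<theta>
  proof -
    define z where "z = cis \<theta>"
    have z: "z \<in> S1" "z \<noteq> 0" by (simp_all add: z_def)
    have k: "((\<lambda>s. \<kappa> s z) has_vector_derivative - (z powi (j + 1))) (at 0)"
      by (rule has_vector_derivative_quadratic_bound[OF \<delta>, of _ _ B])
        (use B[of _ z] z \<kappa>0 in \<open>auto simp: algebra_simps scaleR_conv_of_real abs_less_iff\<close>)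
    from bounded_linear.has_vector_derivative[OF bounded_linear_divide k, of z]
    have k': "((\<lambda>s. \<kappa> s z / z) has_vector_derivative - (z powi j)) (at 0)"
      using z by (simp add: power_int_add)
    have "(F has_derivative (\<lambda>v. cscale (v / (\<i> * z)) (dtheta f z))) (at z)"
    proof -
      obtain t where t: "z = cis t" "\<bar>t\<bar> < 4" using z(1) unfolding S1_eq_arc arc_def by auto
      show ?thesis unfolding t(1)
        by (rule complex_extension_derivative[OF F[unfolded S1_eq_arc] t(2) dtheta_has_vector_derivative[OF f]])
    qed
    then have "(F has_derivative (\<lambda>v. cscale (v / (\<i> * z)) (dtheta f z))) (at (\<kappa> 0 z) within range (\<lambda>s. \<kappa> s z))"
      using \<kappa>0[OF z(1)] has_derivative_at_withinI by simp
    from vector_derivative_diff_chain_within[OF k this]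
    have Fd: "((\<lambda>s. F (\<kappa> s z)) has_vector_derivative
        cscale (- (z powi (j + 1)) / (\<i> * z)) (dtheta f z)) (at 0)" by (simp add: o_def)
    have "(ang C has_vector_derivative dtheta C (cis 0)) (at 0)"
      unfolding dtheta_cis by (rule smooth_on_has_vector_derivative[OF C(1)]) (use C(2) in auto)
    from complex_extension_derivative[OF C' _ this] C(2)
    have "(C' has_derivative (\<lambda>v. cscale (v / \<i>) (dtheta C 1))) (at 1)" by simp
    then have "(C' has_derivative (\<lambda>v. cscale (v / \<i>) (dtheta C 1))) (at (\<kappa> 0 z / z) within range (\<lambda>s. \<kappa> s z / z))"
      using \<kappa>0[OF z(1)] z has_derivative_at_withinI by simp
    from vector_derivative_diff_chain_within[OF k' this]
    have Cd: "((\<lambda>s. C' (\<kappa> s z / z)) has_vector_derivative cscale (- (z powi j) / \<i>) (dtheta C 1)) (at 0)"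
      by (simp add: o_def)
    from bounded_bilinear.has_vector_derivative[OF matrix_mul_bounded_bilinear Fd Cd]
    show ?thesis
      using z unfolding a_def v_def z_def[symmetric]
      by (simp add: \<kappa>0 U(4) V(4) one C(3) circle_deriv_dtheta cscale_mult_right
          cscale.minus_left[symmetric] add.commute
          mult.commute)
  qed
  have per: "a s (\<theta> + 2 * pi) = a s \<theta>" for s \<theta> by (simp add: a_def cis_periodic)
  note J = joint_smooth_quotient[of r a "\<lambda>\<theta>. v (cis \<theta>)", OF r(1) a_smooth per der]
  have dm: "diamond C' (\<kappa> s) F = (\<lambda>z\<in>S1. F (\<kappa> s z) ** C' (\<kappa> s z / z))" for s
    by (simp add: diamond_def)
  have lp: "diamond C' (\<kappa> s) F \<in> loops UNIV" if "\<bar>s\<bar> < r" for s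
    unfolding dm restrict_loops_iff using J(3)[OF that] by (simp add: a_def)
  have "\<forall>\<^sub>F s in at 0. \<bar>s\<bar> < r" using r(1) unfolding eventually_at by (intro exI[of _ r]) auto
  then have "\<forall>\<^sub>F s in at 0. diamond C' (\<kappa> s) F \<in> loops UNIV" by eventually_elim (rule lp)
  moreover have "v \<in> loops UNIV" using J(2) unfolding v_def by (simp add: restrict_loops_iff)
  moreover have "smooth_conv (\<lambda>s \<theta>. (diamond C' (\<kappa> s) F (cis \<theta>) - diamond C' (\<kappa> 0) F (cis \<theta>)) /\<^sub>R s) (ang v) (at 0)"
    using J(1) by (simp add: dm a_def)
  ultimately have "has_velocity (\<lambda>s. diamond C' (\<kappa> s) F) v"
    using lp[of 0] r(1) by (simp add: has_velocity_iff)
  then show "has_velocity (\<lambda>s. diamond C' (\<kappa> s) F)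
      (\<lambda>z\<in>S1. - (cscale (z powi (j + 1)) (circle_deriv f z) +
         cscale (z powi j) (f z ** circle_deriv C 1)))"
    by (simp only: v_def)
qed

section \<open>The Lie algebra of a matrix group\<close>

lemma has_vector_derivative_shift_zero:
  fixes \<gamma> :: "real \<Rightarrow> 'a::real_normed_vector"
  shows "(\<gamma> has_vector_derivative X) (at t) \<longleftrightarrow> ((\<lambda>s. \<gamma> (t + s)) has_vector_derivative X) (at 0)"
  by (simp add: has_vector_derivative_def has_derivative_at)

lemma has_vector_derivative_quotient:
  fixes \<gamma> :: "real \<Rightarrow> 'a::real_normed_vector"
  assumes "(\<gamma> has_vector_derivative X) (at t)"
  shows "((\<lambda>h. (\<gamma> (t + h) - \<gamma> t) /\<^sub>R h) \<longlongrightarrow> X) (at 0)"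
proof -
  have "((\<lambda>h. norm (\<gamma> (t + h) - \<gamma> t - h *\<^sub>R X) / norm h) \<longlongrightarrow> 0) (at 0)"
    using assms by (simp add: has_vector_derivative_def has_derivative_at)
  moreover have "norm (\<gamma> (t + h) - \<gamma> t - h *\<^sub>R X) / norm h = norm ((\<gamma> (t + h) - \<gamma> t) /\<^sub>R h - X)"
    if "h \<noteq> 0" for h
  proof -
    have "(\<gamma> (t + h) - \<gamma> t) /\<^sub>R h - X = (\<gamma> (t + h) - \<gamma> t - h *\<^sub>R X) /\<^sub>R h"
      using that by (simp add: scaleR_diff_right)
    then show ?thesis by (simp add: divide_inverse mult.commute)
  qed
  then have "\<forall>\<^sub>F h in at 0. norm (\<gamma> (t + h) - \<gamma> t - h *\<^sub>R X) / norm h =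
      norm ((\<gamma> (t + h) - \<gamma> t) /\<^sub>R h - X)"
    by (simp add: eventually_at_filter)
  ultimately have "((\<lambda>h. norm ((\<gamma> (t + h) - \<gamma> t) /\<^sub>R h - X)) \<longlongrightarrow> 0) (at 0)"
    using tendsto_cong by force
  then show ?thesis by (simp only: tendsto_norm_zero_iff LIM_zero_iff)
qed

lemma has_vector_derivative_mem_subspace:
  fixes \<gamma> :: "real \<Rightarrow> 'a::euclidean_space"
  assumes "subspace S" "\<And>s. \<gamma> s \<in> S" "(\<gamma> has_vector_derivative X) (at t)"
  shows "X \<in> S"
proof (rule Lim_in_closed_set[OF closed_subspace[OF assms(1)] _ _ has_vector_derivative_quotient[OF assms(3)]])
  show "\<forall>\<^sub>F h in at 0. (\<gamma> (t + h) - \<gamma> t) /\<^sub>R h \<in> S"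
    using assms(1,2) by (simp add: subspace_scale subspace_diff)
qed simp

locale matrix_lie_group =
  fixes G :: "(complex^'n^'n) set"
  assumes lie: "complex_matrix_lie_group G"
begin

abbreviation LG :: "(complex^'n^'n) set" where "LG \<equiv> matrix_lie_algebra G"

lemma G_subgroup: "subgroup G GL_group"
  using lie by (simp add: complex_matrix_lie_group_def)

lemma G_invertible: "A \<in> G \<Longrightarrow> invertible A"
  using subgroup.subset[OF G_subgroup] by (auto simp: GL_group_def)

lemma G_mult: "A \<in> G \<Longrightarrow> B \<in> G \<Longrightarrow> A ** B \<in> G"
  using subgroup.m_closed[OF G_subgroup] by (simp add: GL_group_def)

lemma G_one: "mat 1 \<in> G"
  using subgroup.one_closed[OF G_subgroup] by (simp add: GL_group_def)

lemma G_inv: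
  assumes "A \<in> G" shows "matrix_inv A \<in> G"
proof -
  note inv = matrix_inv_works[OF G_invertible[OF assms]]
  have "m_inv GL_group A = matrix_inv A"
    unfolding m_inv_def
  proof (rule the_equality)
    show "matrix_inv A \<in> carrier GL_group \<and> A \<otimes>\<^bsub>GL_group\<^esub> matrix_inv A = \<one>\<^bsub>GL_group\<^esub> \<and>
        matrix_inv A \<otimes>\<^bsub>GL_group\<^esub> A = \<one>\<^bsub>GL_group\<^esub>"
      using inv by (auto simp: GL_group_def invertible_def)
    show "B = matrix_inv A" if "B \<in> carrier GL_group \<and> A \<otimes>\<^bsub>GL_group\<^esub> B = \<one>\<^bsub>GL_group\<^esub> \<and>
        B \<otimes>\<^bsub>GL_group\<^esub> A = \<one>\<^bsub>GL_group\<^esub>" for B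
      using that matrix_inv_unique[of A B] by (simp add: GL_group_def)
  qed
  then show ?thesis using subgroup.m_inv_closed[OF G_subgroup assms] by simp
qed

text \<open>Curves in \<open>matrix_lie_algebra\<close> run in G for all times, whereas the curve s
  \<mapsto> \<open>C (cis s)\<close> is known to be in G only for small s. Replacing it by the
  identity elsewhere does not affect the derivative at 0.\<close>

lemma lie_algebra_local:
  assumes ev: "\<forall>\<^sub>F s in nhds 0. \<gamma> s \<in> G" and "\<gamma> 0 = mat 1" "(\<gamma> has_vector_derivative X) (at 0)"
  shows "X \<in> LG"
proof -
  define \<beta> where "\<beta> = (\<lambda>s. if \<gamma> s \<in> G then \<gamma> s else mat 1)"
  obtain S where S: "open S" "0 \<in> S" "\<And>s. s \<in> S \<Longrightarrow> \<gamma> s \<in> G" using ev by (auto simp: eventually_nhds)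
  have "(\<beta> has_vector_derivative X) (at 0)"
    by (rule has_vector_derivative_transform_within_open[OF assms(3) S(1,2)]) (simp add: \<beta>_def S(3))
  moreover have "\<beta> s \<in> G" for s by (simp add: \<beta>_def G_one)
  moreover have "\<beta> 0 = mat 1" by (simp add: \<beta>_def assms(2))
  ultimately show ?thesis unfolding matrix_lie_algebra_def by blast
qed

lemma lie_algebraI:
  "(\<And>s. \<gamma> s \<in> G) \<Longrightarrow> \<gamma> 0 = mat 1 \<Longrightarrow> (\<gamma> has_vector_derivative X) (at 0) \<Longrightarrow> X \<in> LG"
  unfolding matrix_lie_algebra_def by blast

lemma lie_algebra_translate:
  assumes "\<And>s. \<gamma> s \<in> G" "(\<gamma> has_vector_derivative X) (at t)"
  shows "X ** matrix_inv (\<gamma> t) \<in> LG"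
proof (rule lie_algebraI)
  show "\<gamma> (t + s) ** matrix_inv (\<gamma> t) \<in> G" for s by (intro G_mult G_inv assms(1))
  show "\<gamma> (t + 0) ** matrix_inv (\<gamma> t) = mat 1"
    using matrix_inv_works[OF G_invertible[OF assms(1)]] by simp
  show "((\<lambda>s. \<gamma> (t + s) ** matrix_inv (\<gamma> t)) has_vector_derivative X ** matrix_inv (\<gamma> t)) (at 0)"
    by (rule bounded_linear.has_vector_derivative[OF matmul.bounded_linear_left
          iffD1[OF has_vector_derivative_shift_zero assms(2)]])
qed

text \<open>Pointwise products of curves give sums, and linear reparametrization gives real
  multiples. The same device serves for subgroups of loops in \<open>LH_add\<close> and
  \<open>LH_scaleR\<close>.\<close>

lemma lie_algebra_subspace: "subspace LG"
  unfolding subspace_def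
proof (intro conjI ballI allI)
  show "0 \<in> LG" by (rule lie_algebraI[of "\<lambda>s. mat 1"]) (simp_all add: G_one)
  show "X + Y \<in> LG" if XY: "X \<in> LG" "Y \<in> LG" for X Y
  proof -
    obtain \<gamma> where \<gamma>: "\<And>s. \<gamma> s \<in> G" "\<gamma> 0 = mat 1" "(\<gamma> has_vector_derivative X) (at 0)"
      using XY(1) unfolding matrix_lie_algebra_def by blast
    obtain \<beta> where \<beta>: "\<And>s. \<beta> s \<in> G" "\<beta> 0 = mat 1" "(\<beta> has_vector_derivative Y) (at 0)"
      using XY(2) unfolding matrix_lie_algebra_def by blast
    from matmul.has_vector_derivative[OF \<gamma>(3) \<beta>(3)]
    have "((\<lambda>s. \<gamma> s ** \<beta> s) has_vector_derivative X + Y) (at 0)"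
      by (simp add: \<gamma>(2) \<beta>(2) add.commute)
    then show ?thesis by (intro lie_algebraI[of "\<lambda>s. \<gamma> s ** \<beta> s"] G_mult \<gamma> \<beta>) (simp_all add: \<gamma> \<beta>)
  qed
  show "r *\<^sub>R X \<in> LG" if "X \<in> LG" for r X
  proof -
    obtain \<gamma> where \<gamma>: "\<And>s. \<gamma> s \<in> G" "\<gamma> 0 = mat 1" "(\<gamma> has_vector_derivative X) (at 0)"
      using \<open>X \<in> LG\<close> unfolding matrix_lie_algebra_def by blast
    have "((\<lambda>s. r * s) has_vector_derivative r) (at 0)"
      by (auto intro!: derivative_eq_intros
          simp: has_real_derivative_iff_has_vector_derivative[symmetric])
    from vector_diff_chain_at[OF this] \<gamma>(3)
    have "((\<lambda>s. \<gamma> (r * s)) has_vector_derivative r *\<^sub>R X) (at 0)" by (simp add: o_def)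
    then show ?thesis by (intro lie_algebraI[of "\<lambda>s. \<gamma> (r * s)"]) (simp_all add: \<gamma>)
  qed
qed

lemma lie_algebra_cscale:
  assumes "X \<in> LG" shows "cscale c X \<in> LG"
proof -
  have "cscale \<i> X \<in> LG" using assms lie by (simp add: complex_matrix_lie_group_def)
  then have "Re c *\<^sub>R X + Im c *\<^sub>R cscale \<i> X \<in> LG"
    using assms lie_algebra_subspace by (simp add: subspace_add subspace_scale)
  moreover have "Re c *\<^sub>R X + Im c *\<^sub>R cscale \<i> X = cscale c X"
    by (simp add: cscale_def vec_eq_iff complex_eq_iff)
  ultimately show ?thesis by simp
qed

lemma lie_algebra_Ad:
  assumes "A \<in> G" "X \<in> LG"
  shows "A ** X ** matrix_inv A \<in> LG"
proof -
  obtain \<gamma> where \<gamma>: "\<And>s. \<gamma> s \<in> G" "\<gamma> 0 = mat 1" "(\<gamma> has_vector_derivative X) (at 0)"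
    using assms(2) unfolding matrix_lie_algebra_def by blast
  show ?thesis
  proof (rule lie_algebraI)
    show "A ** \<gamma> s ** matrix_inv A \<in> G" for s by (intro G_mult G_inv assms \<gamma>)
    show "A ** \<gamma> 0 ** matrix_inv A = mat 1"
      using matrix_inv_works[OF G_invertible[OF assms(1)]] by (simp add: \<gamma>(2))
    show "((\<lambda>s. A ** \<gamma> s ** matrix_inv A) has_vector_derivative A ** X ** matrix_inv A) (at 0)"
      by (intro bounded_linear.has_vector_derivative[OF matmul.bounded_linear_left]
          bounded_linear.has_vector_derivative[OF matmul.bounded_linear_right] \<gamma>(3))
  qed
qed


section \<open>Groups of loops and their Lie algebras\<close>

lemma loop_inv_loops:
  assumes "f \<in> loops G" shows "loop_inv f \<in> loops G"
  unfolding loop_inv_def restrict_loops_iff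
proof
  show "\<forall>z\<in>S1. matrix_inv (f z) \<in> G" using G_inv loops_mem[OF assms] by blast
  show "(\<lambda>\<theta>. matrix_inv (f (cis \<theta>))) \<in> periodic_smooth"
    by (rule loop_inv_periodic_smooth[OF loops_periodic_smooth[OF assms]])
      (rule G_invertible[OF loops_mem[OF assms cis_in_S1]])
qed

lemma loop_invertible: "f \<in> loops G \<Longrightarrow> z \<in> S1 \<Longrightarrow> invertible (f z)"
  using G_invertible loops_mem by blast

lemma loop_mult_loops:
  assumes "f \<in> loops G" "g \<in> loops G" shows "loop_mult f g \<in> loops G"
  unfolding loop_mult_def restrict_loops_iff
  using G_mult loops_mem[OF assms(1)] loops_mem[OF assms(2)]
    periodic_smooth_bilinear[OF matrix_mul_bounded_bilinear loops_periodic_smooth[OF assms(1)]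
      loops_periodic_smooth[OF assms(2)]] by blast

lemma loop_one_loops: "loop_one \<in> loops G"
  unfolding loop_one_def restrict_loops_iff by (simp add: G_one periodic_smooth_const)

lemma loop_mult_assoc: "loop_mult (loop_mult f g) h = loop_mult f (loop_mult g h)"
  by (auto simp: loop_mult_def matrix_mul_assoc)

lemma loop_mult_one:
  assumes "f \<in> loops A"
  shows "loop_mult f loop_one = f" "loop_mult loop_one f = f"
  using loops_restrict[OF assms] by (simp_all add: loop_mult_def loop_one_def cong: restrict_cong)

lemma loop_mult_inv:
  assumes "f \<in> loops G"
  shows "loop_mult f (loop_inv f) = loop_one" "loop_mult (loop_inv f) f = loop_one"
  using matrix_inv_works[OF loop_invertible[OF assms]]
  by (simp_all add: loop_mult_def loop_inv_def loop_one_def cong: restrict_cong)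

lemma m_inv_loop_group:
  assumes f: "f \<in> loops G" shows "m_inv (loop_group G) f = loop_inv f"
  unfolding m_inv_def
proof (rule the_equality)
  show "loop_inv f \<in> carrier (loop_group G) \<and> f \<otimes>\<^bsub>loop_group G\<^esub> loop_inv f = \<one>\<^bsub>loop_group G\<^esub> \<and>
      loop_inv f \<otimes>\<^bsub>loop_group G\<^esub> f = \<one>\<^bsub>loop_group G\<^esub>"
    using loop_inv_loops[OF f] loop_mult_inv[OF f] by (simp add: loop_group_def)
  show "g = loop_inv f" if "g \<in> carrier (loop_group G) \<and> f \<otimes>\<^bsub>loop_group G\<^esub> g = \<one>\<^bsub>loop_group G\<^esub> \<and>
      g \<otimes>\<^bsub>loop_group G\<^esub> f = \<one>\<^bsub>loop_group G\<^esub>" for g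
  proof -
    have g: "g \<in> loops G" "loop_mult f g = loop_one" using that by (simp_all add: loop_group_def)
    have "g = loop_mult (loop_mult (loop_inv f) f) g" by (simp add: loop_mult_inv[OF f] loop_mult_one[OF g(1)])
    also have "\<dots> = loop_inv f" by (simp add: loop_mult_assoc g(2) loop_mult_one[OF loop_inv_loops[OF f]])
    finally show ?thesis .
  qed
qed

end

locale loop_subgroup = matrix_lie_group G for G :: "(complex^'n^'n) set" +
  fixes H :: "(complex \<Rightarrow> complex^'n^'n) set"
  assumes subgroup_H: "subgroup H (loop_group G)"
begin

abbreviation LH :: "(complex \<Rightarrow> complex^'n^'n) set" where "LH \<equiv> subgroup_lie_algebra H"

lemma H_loops: "f \<in> H \<Longrightarrow> f \<in> loops G"
  using subgroup.subset[OF subgroup_H] by (auto simp: loop_group_def)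

lemma H_mult: "f \<in> H \<Longrightarrow> g \<in> H \<Longrightarrow> loop_mult f g \<in> H"
  using subgroup.m_closed[OF subgroup_H] by (simp add: loop_group_def)

lemma H_one: "loop_one \<in> H"
  using subgroup.one_closed[OF subgroup_H] by (simp add: loop_group_def)

lemma H_inv: "f \<in> H \<Longrightarrow> loop_inv f \<in> H"
  using subgroup.m_inv_closed[OF subgroup_H] m_inv_loop_group H_loops by metis

lemma H_invertible: "f \<in> H \<Longrightarrow> z \<in> S1 \<Longrightarrow> invertible (f z)"
  using H_loops loop_invertible by blast

lemma LH_iff: "v \<in> LH \<longleftrightarrow> (\<exists>c. (\<forall>s. c s \<in> H) \<and> c 0 = loop_one \<and> has_velocity c v)"
  by (simp add: subgroup_lie_algebra_def tangent_def curve_in_def)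

text \<open>With its converse \<open>tangent_curve\<close> this says that right translation
  identifies the tangent vectors at f with the Lie algebra; a tangent vector is handled as u f with
  u in \<open>LH\<close>.\<close>

lemma tangent_translate:
  assumes f: "f \<in> H" and c: "\<And>s. c s \<in> H" "c 0 = f" "has_velocity c v"
  shows "(\<lambda>z\<in>S1. v z ** matrix_inv (f z)) \<in> LH"
proof -
  have f': "loop_inv f \<in> H" by (rule H_inv[OF f])
  have "has_velocity (\<lambda>s. loop_mult (c s) (loop_inv f))
      (\<lambda>z\<in>S1. v z ** loop_inv f z + c 0 z ** (\<lambda>z\<in>S1. 0) z)"
    by (rule has_velocity_mult[OF c(3) has_velocity_const[OF H_loops[OF f']]])
  moreover have "(\<lambda>z\<in>S1. v z ** loop_inv f z + c 0 z ** (\<lambda>z\<in>S1. 0) z) =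
      (\<lambda>z\<in>S1. v z ** matrix_inv (f z))"
    by (auto simp: loop_inv_def matmul.zero_right)
  moreover have "loop_mult (c s) (loop_inv f) \<in> H" for s by (rule H_mult[OF c(1) f'])
  moreover have "loop_mult (c 0) (loop_inv f) = loop_one" using loop_mult_inv[OF H_loops[OF f]] c(2) by simp
  ultimately show ?thesis unfolding LH_iff by (intro exI[of _ "\<lambda>s. loop_mult (c s) (loop_inv f)"]) simp
qed

lemma tangent_curve:
  assumes f: "f \<in> H" and \<zeta>: "\<zeta> \<in> LH"
  obtains c where "\<And>s. c s \<in> H" "c 0 = f" "has_velocity c (\<lambda>z\<in>S1. \<zeta> z ** f z)"
proof -
  obtain c where c: "\<And>s. c s \<in> H" "c 0 = loop_one" "has_velocity c \<zeta>" using \<zeta> unfolding LH_iff by blast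
  have "has_velocity (\<lambda>s. loop_mult (c s) f) (\<lambda>z\<in>S1. \<zeta> z ** f z + c 0 z ** (\<lambda>z\<in>S1. 0) z)"
    by (rule has_velocity_mult[OF c(3) has_velocity_const[OF H_loops[OF f]]])
  moreover have "(\<lambda>z\<in>S1. \<zeta> z ** f z + c 0 z ** (\<lambda>z\<in>S1. 0) z) = (\<lambda>z\<in>S1. \<zeta> z ** f z)"
    by (auto simp: matmul.zero_right)
  ultimately have "has_velocity (\<lambda>s. loop_mult (c s) f) (\<lambda>z\<in>S1. \<zeta> z ** f z)" by simp
  then show ?thesis
    by (rule that[rotated 2]) (use H_mult[OF c(1) f] c(2) loop_mult_one[OF H_loops[OF f]] in simp_all)
qed

lemma LH_loops: assumes "v \<in> LH" shows "v \<in> loops LG"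
proof -
  obtain c where c: "\<And>s. c s \<in> H" "c 0 = loop_one" "has_velocity c v" using assms unfolding LH_iff by blast
  show ?thesis
  proof (rule loops_mono[OF has_velocityD(2)[OF c(3)]])
    fix z :: complex assume z: "z \<in> S1"
    show "v z \<in> LG"
      by (rule lie_algebraI[OF _ _ has_velocity_pointwise[OF c(3) z]])
        (use z c(2) loops_mem[OF H_loops[OF c(1)] z] in \<open>simp_all add: loop_one_def\<close>)
  qed
qed

lemma LH_zero: "(\<lambda>z\<in>S1. 0) \<in> LH"
  unfolding LH_iff
  by (intro exI[of _ "\<lambda>s. loop_one"]) (simp add: H_one has_velocity_const[OF loop_one_loops])

lemma LH_add:
  assumes "v \<in> LH" "w \<in> LH" shows "(\<lambda>z\<in>S1. v z + w z) \<in> LH"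
proof -
  obtain c where c: "\<And>s. c s \<in> H" "c 0 = loop_one" "has_velocity c v"
    using assms(1) unfolding LH_iff by blast
  obtain d where d: "\<And>s. d s \<in> H" "d 0 = loop_one" "has_velocity d w"
    using assms(2) unfolding LH_iff by blast
  have "(\<lambda>z\<in>S1. v z ** d 0 z + c 0 z ** w z) = (\<lambda>z\<in>S1. v z + w z)"
    by (auto simp: c(2) d(2) loop_one_def)
  with has_velocity_mult[OF c(3) d(3)]
  have "has_velocity (\<lambda>s. loop_mult (c s) (d s)) (\<lambda>z\<in>S1. v z + w z)" by simp
  then show ?thesis
    unfolding LH_iff
    by (intro exI[of _ "\<lambda>s. loop_mult (c s) (d s)"])
      (simp add: H_mult c d loop_mult_one[OF loop_one_loops])
qed

lemma LH_scaleR: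
  assumes "v \<in> LH" shows "(\<lambda>z\<in>S1. r *\<^sub>R v z) \<in> LH"
proof -
  obtain c where c: "\<And>s. c s \<in> H" "c 0 = loop_one" "has_velocity c v"
    using assms(1) unfolding LH_iff by blast
  show ?thesis
    unfolding LH_iff
    by (intro exI[of _ "\<lambda>s. c (r * s)"]) (simp add: c has_velocity_reparametrize)
qed

lemma LH_minus: "v \<in> LH \<Longrightarrow> (\<lambda>z\<in>S1. - v z) \<in> LH"
  using LH_scaleR[of v "-1"] by simp

lemma LH_quotient:
  assumes "v \<in> LH" "w \<in> LH" shows "(\<lambda>z\<in>S1. (v z - w z) /\<^sub>R r) \<in> LH"
proof -
  have "(\<lambda>z\<in>S1. inverse r *\<^sub>R (\<lambda>z\<in>S1. v z + (\<lambda>z\<in>S1. - w z) z) z) \<in> LH"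
    by (rule LH_scaleR[OF LH_add[OF assms(1) LH_minus[OF assms(2)]]])
  moreover have "(\<lambda>z\<in>S1. inverse r *\<^sub>R (\<lambda>z\<in>S1. v z + (\<lambda>z\<in>S1. - w z) z) z) = (\<lambda>z\<in>S1. (v z - w z) /\<^sub>R r)"
    by auto
  ultimately show ?thesis by simp
qed

lemma LH_Ad:
  assumes h: "h \<in> H" and v: "v \<in> LH" shows "(\<lambda>z\<in>S1. h z ** v z ** matrix_inv (h z)) \<in> LH"
proof -
  obtain c where c: "\<And>s. c s \<in> H" "c 0 = loop_one" "has_velocity c v" using v unfolding LH_iff by blast
  have h': "loop_inv h \<in> H" by (rule H_inv[OF h])
  note vel = has_velocity_mult[OF has_velocity_mult[OF has_velocity_const[OF H_loops[OF h]] c(3)]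
      has_velocity_const[OF H_loops[OF h']]]
  have "(\<lambda>z\<in>S1. (\<lambda>z\<in>S1. (\<lambda>z\<in>S1. 0) z ** c 0 z + h z ** v z) z ** loop_inv h z +
      loop_mult h (c 0) z ** (\<lambda>z\<in>S1. 0) z) = (\<lambda>z\<in>S1. h z ** v z ** matrix_inv (h z))"
    by (auto simp: loop_inv_def matmul.zero_left matmul.zero_right)
  with vel have vel: "has_velocity (\<lambda>s. loop_mult (loop_mult h (c s)) (loop_inv h))
      (\<lambda>z\<in>S1. h z ** v z ** matrix_inv (h z))" by simp
  show ?thesis
    unfolding LH_iff
    by (intro exI[of _ "\<lambda>s. loop_mult (loop_mult h (c s)) (loop_inv h)"])
      (simp add: vel H_mult h h' c(1,2) loop_mult_one[OF H_loops[OF h]] loop_mult_inv[OF H_loops[OF h]])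
qed

text \<open>Conjugating w by a curve with velocity v stays in the Lie algebra and has the bracket as
  its velocity. That the bracket itself is in the Lie algebra needs closedness, which only the
  splitting supplies.\<close>

lemma LH_bracket_velocity:
  assumes "v \<in> LH" "w \<in> LH"
  obtains x where "\<And>s. x s \<in> LH" "has_velocity x (\<lambda>z\<in>S1. v z ** w z - w z ** v z)"
proof -
  obtain c where c: "\<And>s. c s \<in> H" "c 0 = loop_one" "has_velocity c v" using assms(1) unfolding LH_iff by blast
  let ?x = "\<lambda>s. loop_mult (loop_mult (c s) w) (loop_inv (c s))"
  have w: "w \<in> loops UNIV" using LH_loops[OF assms(2)] by (rule loops_UNIV)
  have "?x s \<in> LH" for s
  proof -
    have "?x s = (\<lambda>z\<in>S1. c s z ** w z ** matrix_inv (c s z))"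
      by (auto simp: loop_mult_def loop_inv_def)
    then show ?thesis using LH_Ad[OF c(1) assms(2)] by simp
  qed
  moreover have "has_velocity (\<lambda>s. loop_inv (c s)) (\<lambda>z\<in>S1. - v z)"
  proof -
    have "(\<lambda>z\<in>S1. - (matrix_inv (c 0 z) ** v z ** matrix_inv (c 0 z))) = (\<lambda>z\<in>S1. - v z)"
      by (auto simp: c(2) loop_one_def matrix_inv_unique)
    then show ?thesis using has_velocity_inv[OF c(3) H_invertible[OF c(1)]] by simp
  qed
  from has_velocity_mult[OF has_velocity_mult[OF c(3) has_velocity_const[OF w]] this]
  have vel: "has_velocity ?x (\<lambda>z\<in>S1. (\<lambda>z\<in>S1. v z ** w z + c 0 z ** (\<lambda>z\<in>S1. 0) z) z ** loop_inv (c 0) z +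
      loop_mult (c 0) w z ** (\<lambda>z\<in>S1. - v z) z)" .
  have "(\<lambda>z\<in>S1. (\<lambda>z\<in>S1. v z ** w z + c 0 z ** (\<lambda>z\<in>S1. 0) z) z ** loop_inv (c 0) z +
      loop_mult (c 0) w z ** (\<lambda>z\<in>S1. - v z) z) = (\<lambda>z\<in>S1. v z ** w z - w z ** v z)"
    by (auto simp: c(2) loop_inv_def loop_one_def loop_mult_def matrix_inv_unique matmul.zero_right
        matmul.minus_right)
  with vel have "has_velocity ?x (\<lambda>z\<in>S1. v z ** w z - w z ** v z)" by simp
  ultimately show ?thesis by (rule that)
qed

end


section \<open>Splittings\<close>

lemma loop_tendsto_pointwise:
  assumes "loop_tendsto u l F" "z \<in> S1" shows "((\<lambda>m. u m z) \<longlongrightarrow> l z) F"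
  using tendsto_uniform_limitI[OF smooth_conv_uniform_limit[OF assms(1)[unfolded loop_tendsto_iff]], of "Arg z"]
  by (simp add: S1_cis[OF assms(2)])

lemma loop_tendsto_compose:
  assumes "loop_tendsto u l F" "filterlim X F F'" shows "loop_tendsto (\<lambda>m. u (X m)) l F'"
  using filterlim_compose[OF _ assms(2)] assms(1) unfolding loop_tendsto_def by blast

text \<open>The projection is continuous along sequences, while velocities are limits in a real
  parameter. This passes from one to the other.\<close>

lemma loop_tendsto_at_sequentially:
  fixes u :: "real \<Rightarrow> complex \<Rightarrow> 'b::real_normed_vector"
  assumes "\<And>X. (\<And>m. X m \<noteq> a) \<Longrightarrow> X \<longlonglongrightarrow> a \<Longrightarrow> loop_tendsto (\<lambda>m. u (X m)) l sequentially"
  shows "loop_tendsto u l (at a)"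
  unfolding loop_tendsto_def uniform_limit_iff
proof (intro allI impI)
  fix n and e :: real assume "e > 0"
  show "\<forall>\<^sub>F s in at a. \<forall>\<theta>\<in>UNIV. dist (nth_deriv n (\<lambda>\<theta>. u s (cis \<theta>)) \<theta>) (nth_deriv n (\<lambda>\<theta>. l (cis \<theta>)) \<theta>) < e"
  proof (rule sequentially_imp_eventually_at, intro allI impI)
    fix X :: "nat \<Rightarrow> real" assume "(\<forall>m. X m \<noteq> a) \<and> X \<longlonglongrightarrow> a"
    then have "loop_tendsto (\<lambda>m. u (X m)) l sequentially" using assms by blast
    then show "\<forall>\<^sub>F m in sequentially. \<forall>\<theta>\<in>UNIV.
        dist (nth_deriv n (\<lambda>\<theta>. u (X m) (cis \<theta>)) \<theta>) (nth_deriv n (\<lambda>\<theta>. l (cis \<theta>)) \<theta>) < e"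
      using \<open>e > 0\<close> unfolding loop_tendsto_def uniform_limit_iff by blast
  qed
qed

lemma has_velocity_sequence:
  assumes "has_velocity x v"
  shows "loop_tendsto (\<lambda>m. \<lambda>z\<in>S1. (x (inverse (real (Suc m))) z - x 0 z) /\<^sub>R inverse (real (Suc m))) v sequentially"
proof -
  have "filterlim (\<lambda>m. inverse (real (Suc m))) (at 0) sequentially"
    using LIMSEQ_inverse_real_of_nat by (simp add: filterlim_at)
  from loop_tendsto_compose[OF _ this] show ?thesis
    using assms unfolding has_velocity_def by blast
qed

locale loop_splitting = matrix_lie_group G for G :: "(complex^'n^'n) set" +
  fixes Lp Lm :: "(complex \<Rightarrow> complex^'n^'n) set"
  assumes split: "splitting G Lp Lm"
begin

sublocale plus: loop_subgroup G Lp
  by (intro loop_subgroup.intro matrix_lie_group_axioms loop_subgroup_axioms.intro)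
    (use split in \<open>simp add: splitting_def\<close>)

sublocale minus: loop_subgroup G Lm
  by (intro loop_subgroup.intro matrix_lie_group_axioms loop_subgroup_axioms.intro)
    (use split in \<open>simp add: splitting_def\<close>)

abbreviation "P \<equiv> minus_proj Lp Lm"

lemma loop_algebra_add: "\<xi> \<in> loops LG \<Longrightarrow> \<eta> \<in> loops LG \<Longrightarrow> (\<lambda>z\<in>S1. \<xi> z + \<eta> z) \<in> loops LG"
  unfolding restrict_loops_iff
  using periodic_smooth_add[OF loops_periodic_smooth loops_periodic_smooth, of \<xi> LG \<eta> LG]
    subspace_add[OF lie_algebra_subspace loops_mem loops_mem, of \<xi> _ \<eta>] by blast

lemma loop_algebra_linear:
  assumes "\<xi> \<in> loops LG" "bounded_linear T" "\<And>X. X \<in> LG \<Longrightarrow> T X \<in> LG"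
  shows "(\<lambda>z\<in>S1. T (\<xi> z)) \<in> loops LG"
  unfolding restrict_loops_iff
  using periodic_smooth_linear[OF assms(2) loops_periodic_smooth[OF assms(1)]] assms(3) loops_mem[OF assms(1)]
  by blast

lemma split_decomposition:
  "\<xi> \<in> loops LG \<Longrightarrow>
    \<exists>!(\<zeta>, \<eta>). \<zeta> \<in> plus.LH \<and> \<eta> \<in> minus.LH \<and> \<xi> = (\<lambda>z\<in>S1. \<zeta> z + \<eta> z)"
  by (rule bspec[OF conjunct1[OF conjunct2[OF conjunct2[OF conjunct2[OF split[unfolded splitting_def]]]]]])

lemma decomposition_unique:
  assumes "\<zeta> \<in> plus.LH" "\<eta> \<in> minus.LH" "\<zeta>' \<in> plus.LH" "\<eta>' \<in> minus.LH"
    and "\<And>z. z \<in> S1 \<Longrightarrow> \<zeta> z + \<eta> z = \<zeta>' z + \<eta>' z"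
  shows "\<eta> = \<eta>'"
proof -
  define \<xi> where "\<xi> = (\<lambda>z\<in>S1. \<zeta> z + \<eta> z)"
  define Q where "Q = (\<lambda>(\<zeta>, \<eta>). \<zeta> \<in> plus.LH \<and> \<eta> \<in> minus.LH \<and> \<xi> = (\<lambda>z\<in>S1. \<zeta> z + \<eta> z))"
  have "\<xi> \<in> loops LG" unfolding \<xi>_def by (rule loop_algebra_add[OF plus.LH_loops minus.LH_loops]) fact+
  from split_decomposition[OF this] have "\<exists>!p. Q p" by (simp only: Q_def)
  moreover have "Q (\<zeta>, \<eta>)" using assms(1,2) by (simp add: Q_def \<xi>_def)
  moreover have "Q (\<zeta>', \<eta>')" using assms(3,4,5) by (auto simp: Q_def \<xi>_def)
  ultimately have "(\<zeta>, \<eta>) = (\<zeta>', \<eta>')" by blast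
  then show ?thesis by simp
qed

lemma P_eqI:
  assumes "\<zeta> \<in> plus.LH" "\<eta> \<in> minus.LH" "\<xi> = (\<lambda>z\<in>S1. \<zeta> z + \<eta> z)"
  shows "P \<xi> = \<eta>"
  unfolding minus_proj_def
proof (rule the_equality)
  show "\<eta> \<in> minus.LH \<and> (\<exists>\<zeta>\<in>plus.LH. \<xi> = (\<lambda>z\<in>S1. \<zeta> z + \<eta> z))" using assms by blast
  fix \<eta>' assume "\<eta>' \<in> minus.LH \<and> (\<exists>\<zeta>\<in>plus.LH. \<xi> = (\<lambda>z\<in>S1. \<zeta> z + \<eta>' z))"
  then obtain \<zeta>' where *: "\<eta>' \<in> minus.LH" "\<zeta>' \<in> plus.LH" "\<xi> = (\<lambda>z\<in>S1. \<zeta>' z + \<eta>' z)" by blast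
  show "\<eta>' = \<eta>"
  proof (rule decomposition_unique[OF *(2,1) assms(1,2)])
    show "\<zeta>' z + \<eta>' z = \<zeta> z + \<eta> z" if "z \<in> S1" for z
      using fun_cong[OF *(3), of z] fun_cong[OF assms(3), of z] that by simp
  qed
qed

lemma decomposition:
  assumes "\<xi> \<in> loops LG"
  shows "\<exists>\<zeta>. \<zeta> \<in> plus.LH \<and> P \<xi> \<in> minus.LH \<and> (\<forall>z\<in>S1. \<xi> z = \<zeta> z + P \<xi> z)"
proof -
  obtain \<zeta> \<eta> where *: "\<zeta> \<in> plus.LH" "\<eta> \<in> minus.LH" "\<xi> = (\<lambda>z\<in>S1. \<zeta> z + \<eta> z)"
    using ex1_implies_ex[OF split_decomposition[OF assms]] by auto
  have "P \<xi> = \<eta>" by (rule P_eqI[OF *])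
  moreover have "\<forall>z\<in>S1. \<xi> z = \<zeta> z + \<eta> z" using *(3) by simp
  ultimately show ?thesis using *(1,2) by blast
qed

lemma P_minus_LH: "\<xi> \<in> loops LG \<Longrightarrow> P \<xi> \<in> minus.LH"
  using decomposition by blast

lemma P_add:
  assumes "\<xi> \<in> loops LG" "\<xi>' \<in> loops LG"
  shows "P (\<lambda>z\<in>S1. \<xi> z + \<xi>' z) = (\<lambda>z\<in>S1. P \<xi> z + P \<xi>' z)"
proof -
  obtain \<zeta> where \<zeta>: "\<zeta> \<in> plus.LH" "P \<xi> \<in> minus.LH" "\<And>z. z \<in> S1 \<Longrightarrow> \<xi> z = \<zeta> z + P \<xi> z"
    using decomposition[OF assms(1)] by blast
  obtain \<zeta>' where \<zeta>': "\<zeta>' \<in> plus.LH" "P \<xi>' \<in> minus.LH" "\<And>z. z \<in> S1 \<Longrightarrow> \<xi>' z = \<zeta>' z + P \<xi>' z"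
    using decomposition[OF assms(2)] by blast
  show ?thesis
    by (rule P_eqI[OF plus.LH_add[OF \<zeta>(1) \<zeta>'(1)] minus.LH_add[OF \<zeta>(2) \<zeta>'(2)]])
      (use \<zeta>(3) \<zeta>'(3) in \<open>auto simp: algebra_simps\<close>)
qed

lemma P_scaleR:
  assumes "\<xi> \<in> loops LG"
  shows "P (\<lambda>z\<in>S1. r *\<^sub>R \<xi> z) = (\<lambda>z\<in>S1. r *\<^sub>R P \<xi> z)"
proof -
  obtain \<zeta> where \<zeta>: "\<zeta> \<in> plus.LH" "P \<xi> \<in> minus.LH" "\<And>z. z \<in> S1 \<Longrightarrow> \<xi> z = \<zeta> z + P \<xi> z"
    using decomposition[OF assms(1)] by blast
  show ?thesis
    by (rule P_eqI[OF plus.LH_scaleR[OF \<zeta>(1)] minus.LH_scaleR[OF \<zeta>(2)]])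
      (use \<zeta>(3) in \<open>auto simp: algebra_simps\<close>)
qed

lemma loop_algebra_closed:
  assumes "\<And>m::nat. u m \<in> loops LG" "loop_tendsto u \<xi> sequentially" "\<xi> \<in> loops UNIV"
  shows "\<xi> \<in> loops LG"
proof (rule loops_mono[OF assms(3)])
  fix z :: complex assume z: "z \<in> S1"
  show "\<xi> z \<in> LG"
    by (rule Lim_in_closed_set[OF closed_subspace[OF lie_algebra_subspace] _ _
          loop_tendsto_pointwise[OF assms(2) z]])
      (use loops_mem[OF assms(1) z] in simp_all)
qed

lemma P_continuous:
  assumes "\<And>m::nat. u m \<in> loops LG" "\<xi> \<in> loops LG" "loop_tendsto u \<xi> sequentially"
  shows "loop_tendsto (\<lambda>m. P (u m)) (P \<xi>) sequentially"
  using assms conjunct2[OF conjunct2[OF conjunct2[OF conjunct2[OF split[unfolded splitting_def]]]]]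
  by blast

lemma loop_tendsto_unique:
  assumes "loop_tendsto u \<xi> sequentially" "loop_tendsto u \<eta> sequentially" "\<xi> \<in> loops A" "\<eta> \<in> loops B"
  shows "\<xi> = \<eta>"
  by (rule loops_eqI[OF assms(3,4)])
    (rule LIMSEQ_unique[OF loop_tendsto_pointwise[OF assms(1)] loop_tendsto_pointwise[OF assms(2)]])

lemma loop_tendsto_const: "loop_tendsto (\<lambda>m. u) u F"
  by (simp add: loop_tendsto_iff smooth_conv_const)

lemma P_of_minus:
  assumes "\<eta> \<in> minus.LH" shows "P \<eta> = \<eta>"
proof (rule P_eqI[OF plus.LH_zero assms])
  have "(\<lambda>z\<in>S1. (\<lambda>z\<in>S1. 0) z + \<eta> z) = (\<lambda>z\<in>S1. \<eta> z)" by auto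
  then show "\<eta> = (\<lambda>z\<in>S1. (\<lambda>z\<in>S1. 0) z + \<eta> z)" using loops_restrict[OF minus.LH_loops[OF assms]] by simp
qed

lemma P_of_plus:
  assumes "\<zeta> \<in> plus.LH" shows "P \<zeta> = (\<lambda>z\<in>S1. 0)"
proof (rule P_eqI[OF assms minus.LH_zero])
  have "(\<lambda>z\<in>S1. \<zeta> z + (\<lambda>z\<in>S1. 0) z) = (\<lambda>z\<in>S1. \<zeta> z)" by auto
  then show "\<zeta> = (\<lambda>z\<in>S1. \<zeta> z + (\<lambda>z\<in>S1. 0) z)" using loops_restrict[OF plus.LH_loops[OF assms]] by simp
qed

text \<open>The plus algebra is the kernel of the continuous projection \<open>P\<close>, hence
  sequentially closed. In the same way \<open>minus_closed\<close> rests on the minus algebra being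
  the fixed set of \<open>P\<close>.\<close>

lemma plus_closed:
  assumes "\<And>m::nat. u m \<in> plus.LH" "loop_tendsto u \<xi> sequentially" "\<xi> \<in> loops UNIV"
  shows "\<xi> \<in> plus.LH"
proof -
  note u = plus.LH_loops[OF assms(1)]
  have \<xi>: "\<xi> \<in> loops LG" by (rule loop_algebra_closed[OF u assms(2,3)])
  from P_continuous[OF u \<xi> assms(2)] have "loop_tendsto (\<lambda>m::nat. \<lambda>z\<in>S1. 0) (P \<xi>) sequentially"
    by (simp add: P_of_plus[OF assms(1)])
  then have P0: "P \<xi> = (\<lambda>z\<in>S1. 0)"
    by (rule loop_tendsto_unique[OF _ loop_tendsto_const minus.LH_loops[OF P_minus_LH[OF \<xi>]]
          minus.LH_loops[OF minus.LH_zero]])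
  obtain \<zeta> where \<zeta>: "\<zeta> \<in> plus.LH" "P \<xi> \<in> minus.LH" "\<And>z. z \<in> S1 \<Longrightarrow> \<xi> z = \<zeta> z + P \<xi> z"
    using decomposition[OF \<xi>] by blast
  have "\<xi> = \<zeta>" by (rule loops_eqI[OF assms(3) plus.LH_loops[OF \<zeta>(1)]]) (simp add: \<zeta>(3) P0)
  then show ?thesis using \<zeta>(1) by simp
qed

lemma minus_closed:
  assumes "\<And>m::nat. u m \<in> minus.LH" "loop_tendsto u \<xi> sequentially" "\<xi> \<in> loops UNIV"
  shows "\<xi> \<in> minus.LH"
proof -
  note u = minus.LH_loops[OF assms(1)]
  have \<xi>: "\<xi> \<in> loops LG" by (rule loop_algebra_closed[OF u assms(2,3)])
  from P_continuous[OF u \<xi> assms(2)] have "loop_tendsto u (P \<xi>) sequentially"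
    by (simp add: P_of_minus[OF assms(1)])
  then have "P \<xi> = \<xi>"
    by (rule loop_tendsto_unique[OF _ assms(2) minus.LH_loops[OF P_minus_LH[OF \<xi>]] \<xi>])
  then show ?thesis using P_minus_LH[OF \<xi>] by simp
qed

section \<open>Velocities and brackets inside the two subalgebras\<close>

text \<open>Difference quotients of a curve in the subalgebra stay in it, and closedness keeps their
  limit there. Applied to conjugation curves this gives the bracket, and applied to substitution
  curves the action of vector fields.\<close>

lemma plus_velocity:
  assumes "\<And>s. x s \<in> plus.LH" "has_velocity x v" shows "v \<in> plus.LH"
  by (rule plus_closed[OF plus.LH_quotient[OF assms(1,1)] has_velocity_sequence[OF assms(2)]
        has_velocityD(2)[OF assms(2)]])

lemma minus_velocity:
  assumes "\<And>s. x s \<in> minus.LH" "has_velocity x v" shows "v \<in> minus.LH"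
  by (rule minus_closed[OF minus.LH_quotient[OF assms(1,1)] has_velocity_sequence[OF assms(2)]
        has_velocityD(2)[OF assms(2)]])

lemma plus_bracket:
  assumes "v \<in> plus.LH" "w \<in> plus.LH" shows "(\<lambda>z\<in>S1. v z ** w z - w z ** v z) \<in> plus.LH"
proof (rule plus.LH_bracket_velocity[OF assms])
  fix x assume "\<And>s. x s \<in> plus.LH" "has_velocity x (\<lambda>z\<in>S1. v z ** w z - w z ** v z)"
  then show ?thesis by (rule plus_velocity)
qed

lemma minus_bracket:
  assumes "v \<in> minus.LH" "w \<in> minus.LH" shows "(\<lambda>z\<in>S1. v z ** w z - w z ** v z) \<in> minus.LH"
proof (rule minus.LH_bracket_velocity[OF assms])
  fix x assume "\<And>s. x s \<in> minus.LH" "has_velocity x (\<lambda>z\<in>S1. v z ** w z - w z ** v z)"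
  then show ?thesis by (rule minus_velocity)
qed

lemma has_velocity_loop_algebra:
  assumes "\<And>s. x s \<in> loops LG" "has_velocity x v" shows "v \<in> loops LG"
proof (rule loops_mono[OF has_velocityD(2)[OF assms(2)]])
  fix z :: complex assume z: "z \<in> S1"
  show "v z \<in> LG"
    by (rule has_vector_derivative_mem_subspace[OF lie_algebra_subspace loops_mem[OF assms(1) z]
          has_velocity_pointwise[OF assms(2) z]])
qed

lemma has_velocity_P:
  assumes x: "\<And>s. x s \<in> loops LG" and v: "has_velocity x v"
  shows "has_velocity (\<lambda>s. P (x s)) (P v)"
proof -
  have vL: "v \<in> loops LG" by (rule has_velocity_loop_algebra[OF x v])
  let ?q = "\<lambda>x s. \<lambda>z\<in>S1. (x s z - x 0 z) /\<^sub>R s"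
  have neg: "(\<lambda>z\<in>S1. (-1) *\<^sub>R x 0 z) \<in> loops LG"
    by (rule loop_algebra_linear[OF x bounded_linear_scaleR_right subspace_scale[OF lie_algebra_subspace]])
  have diff: "(\<lambda>z\<in>S1. x s z + (\<lambda>z\<in>S1. (-1) *\<^sub>R x 0 z) z) \<in> loops LG" for s
    by (rule loop_algebra_add[OF x neg])
  \<comment> \<open>The quotient is rebuilt from restricted sums and real multiples, the two
    operations through which \<open>P\<close> can be moved by \<open>P_add\<close> and
    \<open>P_scaleR\<close>.\<close>
  have q_eq: "?q x s = (\<lambda>z\<in>S1. inverse s *\<^sub>R (\<lambda>z\<in>S1. x s z + (\<lambda>z\<in>S1. (-1) *\<^sub>R x 0 z) z) z)" for s
    by auto
  have q: "?q x s \<in> loops LG" for s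
    unfolding q_eq
    by (rule loop_algebra_linear[OF diff bounded_linear_scaleR_right subspace_scale[OF lie_algebra_subspace]])
  have Pq: "P (?q x s) = ?q (\<lambda>s. P (x s)) s" for s
    unfolding q_eq P_scaleR[OF diff] P_add[OF x neg] P_scaleR[OF x] by auto
  have "loop_tendsto (\<lambda>s. ?q (\<lambda>s. P (x s)) s) (P v) (at 0)"
  proof (rule loop_tendsto_at_sequentially)
    fix X :: "nat \<Rightarrow> real" assume "\<And>m. X m \<noteq> 0" "X \<longlonglongrightarrow> 0"
    then have "filterlim X (at 0) sequentially" by (simp add: filterlim_at)
    from loop_tendsto_compose[OF _ this]
    have "loop_tendsto (\<lambda>m. ?q x (X m)) v sequentially" using v unfolding has_velocity_def by blast
    from P_continuous[OF q vL this]
    show "loop_tendsto (\<lambda>m. ?q (\<lambda>s. P (x s)) (X m)) (P v) sequentially" by (simp only: Pq)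
  qed
  moreover have "P \<xi> \<in> loops UNIV" if "\<xi> \<in> loops LG" for \<xi>
    using minus.LH_loops[OF P_minus_LH[OF that]] loops_UNIV by blast
  ultimately show ?thesis unfolding has_velocity_def using x vL by simp
qed

end

section \<open>The disc algebra\<close>

definition disc_algebra :: "(complex \<Rightarrow> complex) set" where
  "disc_algebra = {\<Phi>. continuous_on (cball 0 1) \<Phi> \<and> \<Phi> holomorphic_on ball 0 1}"

lemma disc_algebra_bound:
  assumes "\<Phi> \<in> disc_algebra" "\<And>z. z \<in> S1 \<Longrightarrow> norm (\<Phi> z) \<le> B" "z \<in> cball 0 1"
  shows "norm (\<Phi> z) \<le> B"
  by (rule maximum_modulus_frontier[of \<Phi> "cball 0 1"]) (use assms in \<open>auto simp: disc_algebra_def\<close>)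

lemma disc_algebra_diff: "\<Phi> \<in> disc_algebra \<Longrightarrow> \<Psi> \<in> disc_algebra \<Longrightarrow> (\<lambda>z. \<Phi> z - \<Psi> z) \<in> disc_algebra"
  by (auto simp: disc_algebra_def intro!: continuous_intros holomorphic_intros)

text \<open>By the maximum principle a sequence that is uniformly Cauchy on the circle is uniformly
  Cauchy on the closed disc. Its limit there is continuous, and holomorphic inside as a locally
  uniform limit.\<close>

lemma disc_algebra_limit:
  assumes Q: "\<And>m. Q m \<in> disc_algebra" and lim: "uniform_limit S1 Q g sequentially"
  obtains \<Phi> where "\<Phi> \<in> disc_algebra" "uniform_limit (cball 0 1) Q \<Phi> sequentially"
    "\<And>z. z \<in> S1 \<Longrightarrow> \<Phi> z = g z"
proof -
  have "uniformly_Cauchy_on S1 Q"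
    using lim uniformly_convergent_Cauchy unfolding uniformly_convergent_on_def by blast
  have "uniformly_Cauchy_on (cball 0 1) Q"
    unfolding uniformly_Cauchy_on_def
  proof (intro allI impI)
    fix e :: real assume "e > 0"
    then obtain M where M: "\<And>x m n. x \<in> S1 \<Longrightarrow> m \<ge> M \<Longrightarrow> n \<ge> M \<Longrightarrow> dist (Q m x) (Q n x) < e / 2"
      using \<open>uniformly_Cauchy_on S1 Q\<close> unfolding uniformly_Cauchy_on_def by (meson half_gt_zero)
    have "dist (Q m x) (Q n x) < e" if "x \<in> cball 0 1" "m \<ge> M" "n \<ge> M" for x m n
    proof -
      have "norm (Q m x - Q n x) \<le> e / 2"
        using M[OF _ that(2,3)]
        by (intro disc_algebra_bound[OF disc_algebra_diff[OF Q Q] _ that(1)])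
          (simp add: dist_norm less_imp_le)
      then show ?thesis using \<open>e > 0\<close> by (simp add: dist_norm)
    qed
    then show "\<exists>M. \<forall>x\<in>cball 0 1. \<forall>m\<ge>M. \<forall>n\<ge>M. dist (Q m x) (Q n x) < e" by blast
  qed
  then obtain \<Phi> where \<Phi>: "uniform_limit (cball 0 1) Q \<Phi> sequentially"
    using Cauchy_uniformly_convergent unfolding uniformly_convergent_on_def by blast
  have "continuous_on (cball 0 1) \<Phi>"
    by (rule uniform_limit_theorem[OF _ \<Phi>]) (use Q in \<open>simp_all add: disc_algebra_def\<close>)
  moreover have "\<Phi> holomorphic_on ball 0 1"
  proof (rule holomorphic_uniform_sequence[OF open_ball])
    show "Q n holomorphic_on ball 0 1" for n using Q by (simp add: disc_algebra_def)
    fix x :: complex assume "x \<in> ball 0 1"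
    then obtain d where "d > 0" "cball x d \<subseteq> ball 0 1" using open_contains_cball open_ball by blast
    moreover from this have "cball x d \<subseteq> cball 0 1" using ball_subset_cball by blast
    ultimately show "\<exists>d>0. cball x d \<subseteq> ball 0 1 \<and> uniform_limit (cball x d) Q \<Phi> sequentially"
      using uniform_limit_on_subset[OF \<Phi>] by blast
  qed
  ultimately have "\<Phi> \<in> disc_algebra" by (simp add: disc_algebra_def)
  moreover have "\<Phi> z = g z" if "z \<in> S1" for z
    by (rule LIMSEQ_unique[OF tendsto_uniform_limitI[OF \<Phi>] tendsto_uniform_limitI[OF lim]]) (use that in auto)
  ultimately show ?thesis using \<Phi> that by blast
qed

lemma disc_algebra_uniform_limit:
  assumes Q: "\<And>s. Q s \<in> disc_algebra" and \<Phi>: "\<Phi> \<in> disc_algebra"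
    and lim: "uniform_limit S1 Q \<Phi> F"
  shows "uniform_limit (cball 0 1) Q \<Phi> F"
proof (rule uniform_limitI)
  fix e :: real assume "e > 0"
  from uniform_limitD[OF lim half_gt_zero[OF this]]
  show "\<forall>\<^sub>F s in F. \<forall>z\<in>cball 0 1. dist (Q s z) (\<Phi> z) < e"
  proof eventually_elim
    case (elim s)
    show ?case
    proof
      fix z :: complex assume "z \<in> cball 0 1"
      from disc_algebra_bound[OF disc_algebra_diff[OF Q \<Phi>]
          less_imp_le[OF bspec[OF elim, unfolded dist_norm]] this]
      have "norm (Q s z - \<Phi> z) \<le> e / 2" .
      then show "dist (Q s z) (\<Phi> z) < e" using \<open>e > 0\<close> by (simp add: dist_norm)
    qed
  qed
qed

lemma uniform_limit_S1_iff:
  "uniform_limit S1 u l F \<longleftrightarrow> uniform_limit UNIV (\<lambda>i \<theta>. u i (cis \<theta>)) (\<lambda>\<theta>. l (cis \<theta>)) F"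
proof -
  have "(\<forall>z\<in>S1. R z) \<longleftrightarrow> (\<forall>\<theta>\<in>UNIV. R (cis \<theta>))" for R by (auto elim!: S1_cases)
  then show ?thesis by (simp add: uniform_limit_iff)
qed

lemma cis_has_vector_derivative: "(cis has_vector_derivative \<i> * cis t) (at t)"
  by (auto intro!: derivative_eq_intros simp: has_vector_derivative_def scaleR_conv_of_real)

text \<open>The angular derivative of the boundary values is the limit of the difference quotients
  under rotations, which converge on the whole disc by the maximum principle.\<close>
lemma disc_algebra_angular_derivative:
  assumes \<Phi>: "\<Phi> \<in> disc_algebra" and ps: "ang \<Phi> \<in> periodic_smooth"
  obtains \<Psi> where "\<Psi> \<in> disc_algebra" "\<And>z. z \<in> ball 0 1 \<Longrightarrow> \<Psi> z = \<i> * z * deriv \<Phi> z"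
    "\<And>\<theta>. \<Psi> (cis \<theta>) = vector_derivative (ang \<Phi>) (at \<theta>)"
proof -
  define X where "X = (\<lambda>m. inverse (real (Suc m)))"
  have X: "filterlim X (at 0) sequentially"
    using LIMSEQ_inverse_real_of_nat by (simp add: filterlim_at X_def)
  define R where "R = (\<lambda>h::real. \<lambda>z. (\<Phi> (cis h * z) - \<Phi> z) /\<^sub>R h)"
  have R: "R h \<in> disc_algebra" for h
    unfolding R_def scaleR_conv_of_real disc_algebra_def mem_Collect_eq
  proof (intro conjI)
    have cont: "continuous_on (cball 0 1) \<Phi>" and hol: "\<Phi> holomorphic_on ball 0 1"
      using \<Phi> by (auto simp: disc_algebra_def)
    show "continuous_on (cball 0 1) (\<lambda>z. of_real (inverse h) * (\<Phi> (cis h * z) - \<Phi> z))"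
      by (intro continuous_on_mult continuous_on_diff continuous_on_const cont
          continuous_on_compose2[OF cont]) (auto intro!: continuous_intros simp: norm_mult)
    have "(\<lambda>z. \<Phi> (cis h * z)) holomorphic_on ball 0 1"
      by (rule holomorphic_on_compose_gen[OF _ hol, unfolded o_def])
        (auto intro!: holomorphic_intros simp: norm_mult)
    then show "(\<lambda>z. of_real (inverse h) * (\<Phi> (cis h * z) - \<Phi> z)) holomorphic_on ball 0 1"
      by (intro holomorphic_on_mult holomorphic_on_diff holomorphic_on_const hol)
  qed
  let ?v = "\<lambda>\<theta>. vector_derivative (ang \<Phi>) (at \<theta>)"
  \<comment> \<open>On the circle a rotation is a translation of the angle, so the rotated boundary
    values depend smoothly on both variables and their quotients converge uniformly.\<close>
  have "smooth_conv (\<lambda>s \<theta>. (\<Phi> (cis (\<theta> + s)) - \<Phi> (cis (\<theta> + 0))) /\<^sub>R s) ?v (at 0)"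
  proof (rule joint_smooth_quotient(1)[of 1 "\<lambda>s \<theta>. \<Phi> (cis (\<theta> + s))"])
    let ?W = "{-1<..<1::real} \<times> (UNIV :: real set)"
    have W: "open ?W" by (intro open_Times) auto
    have "smooth_on ?W (\<lambda>p. snd p + fst p)"
      by (rule smooth_on_linear[OF bounded_linear_add[OF bounded_linear_snd bounded_linear_fst] W smooth_on_id[OF W]])
    from smooth_on_compose[OF W open_UNIV subset_UNIV periodic_smooth_smooth[OF ps] this]
    show "smooth_on ?W (\<lambda>(s, \<theta>). \<Phi> (cis (\<theta> + s)))" by (simp only: case_prod_unfold)
    show "\<Phi> (cis (\<theta> + 2 * pi + s)) = \<Phi> (cis (\<theta> + s))" for s \<theta>
      using cis_periodic[of "\<theta> + s"] by (simp add: algebra_simps)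
    show "((\<lambda>s. \<Phi> (cis (\<theta> + s))) has_vector_derivative ?v \<theta>) (at 0)" for \<theta>
      using periodic_smooth_has_vector_derivative[OF ps, of \<theta>]
      by (simp only: has_vector_derivative_shift_zero[of _ _ \<theta>])
  qed simp
  then have "uniform_limit UNIV (\<lambda>h \<theta>. R h (cis \<theta>)) ?v (at 0)"
    by (simp add: R_def cis_mult add.commute smooth_conv_uniform_limit)
  then have "uniform_limit UNIV (\<lambda>m \<theta>. R (X m) (cis \<theta>)) ?v sequentially"
    by (rule filterlim_compose[OF _ X])
  then have lim: "uniform_limit S1 (\<lambda>m. R (X m)) (dtheta \<Phi>) sequentially"
    by (simp only: uniform_limit_S1_iff dtheta_cis)
  obtain \<Psi> where \<Psi>: "\<Psi> \<in> disc_algebra" "uniform_limit (cball 0 1) (\<lambda>m. R (X m)) \<Psi> sequentially"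
    "\<And>z. z \<in> S1 \<Longrightarrow> \<Psi> z = dtheta \<Phi> z"
    using disc_algebra_limit[OF R lim] by blast
  \<comment> \<open>Inside the disc the same quotients converge pointwise to the derivative of
    \<Phi> along the rotation field i z, which identifies the limit function there.\<close>
  have "\<Psi> z = \<i> * z * deriv \<Phi> z" if z: "z \<in> ball 0 1" for z
  proof -
    have "(\<Phi> has_field_derivative deriv \<Phi> z) (at z)"
      by (rule holomorphic_derivI[OF _ open_ball z]) (use \<Phi> in \<open>simp add: disc_algebra_def\<close>)
    then have "(\<Phi> has_derivative (*) (deriv \<Phi> z)) (at (cis 0 * z) within range (\<lambda>t. cis t * z))"
      by (simp add: has_field_derivative_def has_derivative_at_withinI)
    moreover have "((\<lambda>t. cis t * z) has_vector_derivative \<i> * cis 0 * z) (at 0)"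
      by (rule bounded_linear.has_vector_derivative[OF bounded_linear_mult_left cis_has_vector_derivative])
    ultimately have "((\<lambda>t. \<Phi> (cis t * z)) has_vector_derivative deriv \<Phi> z * (\<i> * cis 0 * z)) (at 0)"
      using vector_derivative_diff_chain_within[of "\<lambda>t. cis t * z" _ 0 UNIV \<Phi>] by (simp add: o_def)
    from has_vector_derivative_quotient[OF this]
    have "((\<lambda>h. R h z) \<longlongrightarrow> deriv \<Phi> z * (\<i> * cis 0 * z)) (at 0)" by (simp add: R_def)
    from filterlim_compose[OF this X]
    have "(\<lambda>m. R (X m) z) \<longlonglongrightarrow> deriv \<Phi> z * (\<i> * cis 0 * z)" .
    moreover have "(\<lambda>m. R (X m) z) \<longlonglongrightarrow> \<Psi> z" by (rule tendsto_uniform_limitI[OF \<Psi>(2)]) (use z in auto)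
    ultimately have "\<Psi> z = deriv \<Phi> z * (\<i> * cis 0 * z)" using LIMSEQ_unique by blast
    then show ?thesis by simp
  qed
  then show ?thesis using that \<Psi>(1,3) by (simp add: dtheta_cis)
qed

lemma disc_algebra_radial_derivative:
  assumes "\<Phi> \<in> disc_algebra" "\<And>z. z \<in> ball 0 1 \<Longrightarrow> \<Psi> z = \<i> * z * deriv \<Phi> z" "0 < r" "r < 1"
  shows "((\<lambda>\<theta>. \<Phi> (of_real r * cis \<theta>)) has_vector_derivative \<Psi> (of_real r * cis \<theta>)) (at \<theta>)"
proof -
  have z: "of_real r * cis \<theta> \<in> ball 0 1" using assms(3,4) by (simp add: norm_mult)
  have "(\<Phi> has_field_derivative deriv \<Phi> (of_real r * cis \<theta>)) (at (of_real r * cis \<theta>))"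
    by (rule holomorphic_derivI[OF _ open_ball z]) (use assms(1) in \<open>simp add: disc_algebra_def\<close>)
  then have "(\<Phi> has_derivative (*) (deriv \<Phi> (of_real r * cis \<theta>)))
      (at (of_real r * cis \<theta>) within range (\<lambda>t. of_real r * cis t))"
    by (simp add: has_field_derivative_def has_derivative_at_withinI)
  moreover have "((\<lambda>t. of_real r * cis t) has_vector_derivative of_real r * (\<i> * cis \<theta>)) (at \<theta>)"
    by (rule bounded_linear.has_vector_derivative[OF bounded_linear_mult_right cis_has_vector_derivative])
  ultimately have "((\<lambda>t. \<Phi> (of_real r * cis t)) has_vector_derivative
      deriv \<Phi> (of_real r * cis \<theta>) * (of_real r * (\<i> * cis \<theta>))) (at \<theta>)"
    using vector_derivative_diff_chain_within[of "\<lambda>t. of_real r * cis t" _ \<theta> UNIV \<Phi>] by (simp add: o_def)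
  moreover have "deriv \<Phi> (of_real r * cis \<theta>) * (of_real r * (\<i> * cis \<theta>)) = \<Psi> (of_real r * cis \<theta>)"
    using assms(2)[OF z] by simp
  ultimately show ?thesis by simp
qed

text \<open>Order 0 is uniform continuity on the closed disc. The angular derivative of \<Phi> on
  the circle of radius r is the restriction of \<Psi>, which belongs to the disc algebra and has
  smooth boundary values too, so the induction over the order runs through all such
  functions.\<close>

lemma disc_algebra_radial_limit:
  assumes "\<Phi> \<in> disc_algebra" "ang \<Phi> \<in> periodic_smooth"
    and r: "\<And>m::nat. 0 < r m" "\<And>m. r m < 1" "r \<longlonglongrightarrow> 1"
  shows "smooth_conv (\<lambda>m \<theta>. \<Phi> (of_real (r m) * cis \<theta>)) (ang \<Phi>) sequentially"
proof -
  have unif: "uniform_limit UNIV (\<lambda>m \<theta>. \<Phi> (of_real (r m) * cis \<theta>)) (ang \<Phi>) sequentially"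
    if "\<Phi> \<in> disc_algebra" for \<Phi>
  proof (rule uniform_limitI)
    fix e :: real assume "e > 0"
    have "uniformly_continuous_on (cball 0 1) \<Phi>"
      using that by (intro compact_uniformly_continuous) (auto simp: disc_algebra_def)
    then obtain d where d: "d > 0"
      "\<And>x y. x \<in> cball 0 1 \<Longrightarrow> y \<in> cball 0 1 \<Longrightarrow> dist y x < d \<Longrightarrow> dist (\<Phi> y) (\<Phi> x) < e"
      using \<open>e > 0\<close> unfolding uniformly_continuous_on_def by metis
    have "\<forall>\<^sub>F m in sequentially. dist (r m) 1 < d" using r(3) d(1) by (rule tendstoD)
    then show "\<forall>\<^sub>F m in sequentially. \<forall>\<theta>\<in>UNIV. dist (\<Phi> (of_real (r m) * cis \<theta>)) (\<Phi> (cis \<theta>)) < e"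
    proof eventually_elim
      case (elim m)
      show ?case
      proof
        fix \<theta>
        have "of_real (r m) * cis \<theta> - cis \<theta> = of_real (r m - 1) * cis \<theta>" by (simp add: algebra_simps)
        then have "dist (of_real (r m) * cis \<theta>) (cis \<theta>) = dist (r m) 1"
          by (simp add: dist_norm norm_mult del: of_real_diff)
        then show "dist (\<Phi> (of_real (r m) * cis \<theta>)) (\<Phi> (cis \<theta>)) < e"
          using elim r(1,2)[of m] by (intro d(2)) (simp_all add: norm_mult less_imp_le)
      qed
    qed
  qed
  have "unif_conv n (\<lambda>m \<theta>. \<Phi> (of_real (r m) * cis \<theta>)) (ang \<Phi>) sequentially" for n
    using assms(1,2)
  proof (induction n arbitrary: \<Phi>)
    case 0
    then show ?case by (simp add: unif)
  next
    case (Suc n)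
    obtain \<Psi> where \<Psi>: "\<Psi> \<in> disc_algebra" "\<And>z. z \<in> ball 0 1 \<Longrightarrow> \<Psi> z = \<i> * z * deriv \<Phi> z"
      "\<And>\<theta>. \<Psi> (cis \<theta>) = vector_derivative (ang \<Phi>) (at \<theta>)"
      using disc_algebra_angular_derivative[OF Suc.prems] by blast
    have *: "\<forall>\<^sub>F m in sequentially. \<forall>\<theta>. ((\<lambda>\<theta>. \<Phi> (of_real (r m) * cis \<theta>)) has_vector_derivative
        \<Psi> (of_real (r m) * cis \<theta>)) (at \<theta>)"
      by (rule always_eventually)
        (intro allI disc_algebra_radial_derivative[OF Suc.prems(1) \<Psi>(2) r(1,2)])
    have **: "(ang \<Phi> has_vector_derivative \<Psi> (cis \<theta>)) (at \<theta>)" for \<theta>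
      unfolding \<Psi>(3) by (rule periodic_smooth_has_vector_derivative[OF Suc.prems(2)])
    have "ang \<Psi> \<in> periodic_smooth" using periodic_smooth_deriv[OF Suc.prems(2)] by (simp add: \<Psi>(3))
    then show ?case
      unfolding unif_conv_transform[OF * **] using Suc.IH[OF \<Psi>(1)] unif[OF Suc.prems(1)] by blast
  qed
  then show ?thesis by (simp add: smooth_conv_def)
qed

text \<open>Cauchy's inequality on discs of radius (1 - \<rho>) / 2 about points of norm at most
  \<rho>. Such discs stay within radius (1 + \<rho>) / 2, halfway between \<rho> and 1.\<close>

lemma deriv_bound_cball:
  assumes "h holomorphic_on ball 0 1" "\<rho> < 1" "z \<in> cball 0 \<rho>"
    and "\<And>w. w \<in> cball 0 ((1 + \<rho>) / 2) \<Longrightarrow> norm (h w) \<le> B"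
  shows "norm (deriv h z) \<le> B / ((1 - \<rho>) / 2)"
proof -
  let ?d = "(1 - \<rho>) / 2"
  have sub: "cball z ?d \<subseteq> cball 0 ((1 + \<rho>) / 2)"
  proof
    fix w assume "w \<in> cball z ?d"
    then have "norm w \<le> norm z + ?d" using norm_triangle_sub[of w z] by (simp add: dist_norm norm_minus_commute field_simps)
    then show "w \<in> cball 0 ((1 + \<rho>) / 2)" using assms(3) by (simp add: field_simps)
  qed
  moreover have "cball 0 ((1 + \<rho>) / 2) \<subseteq> (ball 0 1 :: complex set)" using assms(2) by auto
  ultimately have sub1: "cball z ?d \<subseteq> ball 0 1" by blast
  have "norm ((deriv ^^ 1) h z) \<le> fact 1 * B / ?d ^ 1"
  proof (rule Cauchy_inequality)
    show "h holomorphic_on ball z ?d"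
      using holomorphic_on_subset[OF assms(1)] sub1 ball_subset_cball by blast
    show "continuous_on (cball z ?d) h"
      using holomorphic_on_imp_continuous_on[OF holomorphic_on_subset[OF assms(1) sub1]] .
    show "norm (h x) \<le> B" if "norm (z - x) = ?d" for x
      using that sub by (intro assms(4)) (auto simp: dist_norm subset_iff)
  qed (use assms(2) in auto)
  then show ?thesis by simp
qed

lemma uniform_limit_deriv_compact:
  assumes hol: "\<And>s. H s holomorphic_on ball 0 1" "\<Phi> holomorphic_on ball 0 1"
    and lim: "\<And>\<rho>. \<rho> < 1 \<Longrightarrow> uniform_limit (cball 0 \<rho>) H \<Phi> F" and "\<rho> < 1"
  shows "uniform_limit (cball 0 \<rho>) (\<lambda>s. deriv (H s)) (deriv \<Phi>) F"
proof (rule uniform_limitI)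
  fix e :: real assume "e > 0"
  let ?\<rho> = "(1 + \<rho>) / 2" and ?d = "(1 - \<rho>) / 2"
  have "?\<rho> < 1" "?d > 0" using \<open>\<rho> < 1\<close> by auto
  have "\<forall>\<^sub>F s in F. \<forall>w\<in>cball 0 ?\<rho>. dist (H s w) (\<Phi> w) < e / 2 * ?d"
    by (rule uniform_limitD[OF lim[OF \<open>?\<rho> < 1\<close>]]) (use \<open>?d > 0\<close> \<open>e > 0\<close> in simp)
  then show "\<forall>\<^sub>F s in F. \<forall>z\<in>cball 0 \<rho>. dist (deriv (H s) z) (deriv \<Phi> z) < e"
  proof eventually_elim
    case (elim s)
    show ?case
    proof
      fix z :: complex assume z: "z \<in> cball 0 \<rho>"
      then have zb: "z \<in> ball 0 1" using \<open>\<rho> < 1\<close> by auto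
      have "norm (deriv (\<lambda>w. H s w - \<Phi> w) z) \<le> (e / 2 * ?d) / ?d"
        by (rule deriv_bound_cball[OF holomorphic_on_diff[OF hol] \<open>\<rho> < 1\<close> z
              less_imp_le[OF bspec[OF elim, unfolded dist_norm]]])
      moreover have "deriv (\<lambda>w. H s w - \<Phi> w) z = deriv (H s) z - deriv \<Phi> z"
        by (rule deriv_diff[OF holomorphic_on_imp_differentiable_at[OF hol(1) open_ball zb]
              holomorphic_on_imp_differentiable_at[OF hol(2) open_ball zb]])
      moreover have "e / 2 * ?d / ?d = e / 2"
        using \<open>?d > 0\<close> by (intro nonzero_mult_div_cancel_right) linarith
      ultimately have "norm (deriv (H s) z - deriv \<Phi> z) \<le> e / 2" by (simp only:)
      then show "dist (deriv (H s) z) (deriv \<Phi> z) < e" using \<open>e > 0\<close> by (simp add: dist_norm)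
    qed
  qed
qed

lemma holomorphic_compose_has_vector_derivative:
  assumes "h holomorphic_on S" "open S" "\<mu> t \<in> S" "(\<mu> has_vector_derivative d) (at t)"
  shows "((\<lambda>t. h (\<mu> t)) has_vector_derivative deriv h (\<mu> t) * d) (at t)"
proof -
  have "(h has_derivative (*) (deriv h (\<mu> t))) (at (\<mu> t) within range \<mu>)"
    using holomorphic_derivI[OF assms(1-3)] has_derivative_at_withinI unfolding has_field_derivative_def by blast
  from vector_derivative_diff_chain_within[OF assms(4) this] show ?thesis by (simp add: o_def)
qed

text \<open>By the Cauchy estimates, uniform convergence on all smaller closed discs passes to the
  complex derivatives. Along a fixed smooth curve in such a disc it therefore becomes convergence
  with all angular derivatives.\<close>

lemma holomorphic_uniform_limit_smooth:
  assumes hol: "\<And>s. H s holomorphic_on ball 0 1" "\<Phi> holomorphic_on ball 0 1"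
    and lim: "\<And>\<rho>. \<rho> < 1 \<Longrightarrow> uniform_limit (cball 0 \<rho>) H \<Phi> F"
    and \<mu>: "\<mu> \<in> periodic_smooth" "range \<mu> \<subseteq> cball 0 \<rho>" "\<rho> < 1"
  shows "smooth_conv (\<lambda>s \<theta>. H s (\<mu> \<theta>)) (\<lambda>\<theta>. \<Phi> (\<mu> \<theta>)) F"
proof -
  have sub: "range \<mu> \<subseteq> ball 0 1" using \<mu>(2,3) by auto
  have ps: "(\<lambda>\<theta>. h (\<mu> \<theta>)) \<in> periodic_smooth" if "h holomorphic_on ball 0 1" for h
    by (rule periodic_smooth_compose[OF open_ball smooth_on_holomorphic[OF open_ball that] \<mu>(1) sub])
  have mem: "\<mu> \<theta> \<in> ball 0 1" for \<theta> using sub by blast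
  let ?\<mu>' = "\<lambda>\<theta>. vector_derivative \<mu> (at \<theta>)"
  have der: "((\<lambda>\<theta>. h (\<mu> \<theta>)) has_vector_derivative deriv h (\<mu> \<theta>) * ?\<mu>' \<theta>) (at \<theta>)"
    if "h holomorphic_on ball 0 1" for h \<theta>
    by (rule holomorphic_compose_has_vector_derivative[OF that open_ball mem
          periodic_smooth_has_vector_derivative[OF \<mu>(1)]])
  have unif: "uniform_limit UNIV (\<lambda>s \<theta>. H s (\<mu> \<theta>)) (\<lambda>\<theta>. \<Phi> (\<mu> \<theta>)) F"
    if "\<And>\<rho>. \<rho> < 1 \<Longrightarrow> uniform_limit (cball 0 \<rho>) H \<Phi> F" for H \<Phi>
    unfolding uniform_limit_iff
  proof (intro allI impI)
    fix e :: real assume "e > 0"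
    from uniform_limitD[OF that[OF \<mu>(3)] this]
    show "\<forall>\<^sub>F s in F. \<forall>\<theta>\<in>UNIV. dist (H s (\<mu> \<theta>)) (\<Phi> (\<mu> \<theta>)) < e"
      by eventually_elim (use \<mu>(2) in blast)
  qed
  have "unif_conv n (\<lambda>s \<theta>. H s (\<mu> \<theta>)) (\<lambda>\<theta>. \<Phi> (\<mu> \<theta>)) F" for n
    using hol lim
  proof (induction n arbitrary: H \<Phi>)
    case 0
    from unif[OF 0(3)] show ?case by simp
  next
    case (Suc n)
    have *: "\<forall>\<^sub>F s in F. \<forall>\<theta>. ((\<lambda>\<theta>. H s (\<mu> \<theta>)) has_vector_derivative deriv (H s) (\<mu> \<theta>) * ?\<mu>' \<theta>) (at \<theta>)"
      by (rule always_eventually) (intro allI der Suc.prems(1))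
    note hol' = holomorphic_deriv[OF Suc.prems(1) open_ball] holomorphic_deriv[OF Suc.prems(2) open_ball]
    have "unif_conv n (\<lambda>s \<theta>. deriv (H s) (\<mu> \<theta>)) (\<lambda>\<theta>. deriv \<Phi> (\<mu> \<theta>)) F"
      by (rule Suc.IH[OF hol' uniform_limit_deriv_compact[OF Suc.prems]])
    then have "unif_conv n (\<lambda>s \<theta>. deriv (H s) (\<mu> \<theta>) * ?\<mu>' \<theta>) (\<lambda>\<theta>. deriv \<Phi> (\<mu> \<theta>) * ?\<mu>' \<theta>) F"
      by (rule unif_conv_bilinear[OF bounded_bilinear_mult _ unif_conv_const])
        (use ps[OF hol'(1)] ps[OF hol'(2)] periodic_smooth_deriv[OF \<mu>(1)] in
          \<open>auto intro: periodic_smooth_smooth always_eventually\<close>)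
    then show ?case
      unfolding unif_conv_transform[OF * der[OF Suc.prems(2)]] using unif[OF Suc.prems(3)] by blast
  qed
  then show ?thesis by (simp add: smooth_conv_def)
qed

section \<open>Holomorphic loops\<close>

definition disc_extension ::
    "(complex^'n^'n) set \<Rightarrow> (complex \<Rightarrow> complex^'n^'n) \<Rightarrow> (complex \<Rightarrow> complex^'n^'n) \<Rightarrow> bool" where
  "disc_extension G f F \<longleftrightarrow> continuous_on (cball 0 1) F \<and>
      (\<forall>i k. (\<lambda>z. F z $ i $ k) holomorphic_on ball 0 1) \<and>
      (\<forall>z \<in> ball 0 1. F z \<in> G) \<and> (\<forall>z\<in>S1. F z = f z)"

lemma Lplus_iff: "f \<in> Lplus G \<longleftrightarrow> f \<in> loops G \<and> (\<exists>F. disc_extension G f F)"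
  unfolding Lplus_def disc_extension_def by simp

lemma disc_extension_entry: "disc_extension G f F \<Longrightarrow> (\<lambda>z. F z $ i $ k) \<in> disc_algebra"
  using bounded_linear.continuous_on[OF bounded_linear_entry, of "cball 0 1" F i k]
  by (simp add: disc_extension_def disc_algebra_def)

text \<open>It serves two kinds of M: the extension of the inverse of a diffeomorphism in
  \<open>Dplus\<close>, and maps of the closed disc into a smaller one, which are not
  bijective.\<close>

lemma Lplus_substitute:
  assumes F: "disc_extension G f F" and M: "continuous_on (cball 0 1) M" "M holomorphic_on ball 0 1"
    and "M ` cball 0 1 \<subseteq> cball 0 1" "M ` ball 0 1 \<subseteq> ball 0 1"
    and "(\<lambda>z\<in>S1. F (M z)) \<in> loops G"
  shows "(\<lambda>z\<in>S1. F (M z)) \<in> Lplus G"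
proof -
  have "disc_extension G (\<lambda>z\<in>S1. F (M z)) (\<lambda>z. F (M z))"
    unfolding disc_extension_def
  proof (intro conjI allI)
    show "continuous_on (cball 0 1) (\<lambda>z. F (M z))"
      by (rule continuous_on_compose2[OF _ M(1) assms(4)]) (use F in \<open>simp add: disc_extension_def\<close>)
    show "(\<lambda>z. F (M z) $ i $ k) holomorphic_on ball 0 1" for i k
      using holomorphic_on_compose_gen[OF M(2) _ assms(5), of "\<lambda>z. F z $ i $ k"] F
      by (simp add: disc_extension_def o_def)
  qed (use F assms(5) in \<open>auto simp: disc_extension_def\<close>)
  then show ?thesis using assms(6) Lplus_iff by blast
qed

lemma has_vector_derivative_matrix:
  fixes f :: "real \<Rightarrow> complex^'n^'m"
  assumes "\<And>i k. ((\<lambda>s. f s $ i $ k) has_vector_derivative d $ i $ k) (at t)"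
  shows "(f has_vector_derivative d) (at t)"
proof -
  have "((\<lambda>s. \<Sum>i\<in>UNIV. \<Sum>k\<in>UNIV. matrix_unit i k (f s $ i $ k)) has_vector_derivative
      (\<Sum>i\<in>UNIV. \<Sum>k\<in>UNIV. matrix_unit i k (d $ i $ k))) (at t)"
    by (rule has_vector_derivative_sum, rule has_vector_derivative_sum,
        rule bounded_linear.has_vector_derivative[OF bounded_linear_matrix_unit assms])
  then show ?thesis by (simp flip: matrix_unit_sum)
qed

lemma periodic_smooth_matrix:
  fixes f :: "real \<Rightarrow> complex^'n^'m"
  assumes "\<And>i k. (\<lambda>\<theta>. f \<theta> $ i $ k) \<in> periodic_smooth"
  shows "f \<in> periodic_smooth"
  using assms smooth_on_matrix[OF open_UNIV, of f] by (simp add: periodic_smooth_def vec_eq_iff)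

lemma periodic_smooth_diff:
  fixes f :: "real \<Rightarrow> 'b::real_normed_vector"
  assumes "f \<in> periodic_smooth" "g \<in> periodic_smooth"
  shows "(\<lambda>\<theta>. f \<theta> - g \<theta>) \<in> periodic_smooth"
  using periodic_smooth_add[OF assms(1)
      periodic_smooth_linear[OF bounded_linear_minus[OF bounded_linear_ident] assms(2)]]
  by simp

text \<open>The multiplier \<open>m\<^sub>j\<close> with \<open>\<lambda>\<^sup>j\<^sup>+\<^sup>1 d/d\<lambda> = m\<^sub>j d/d\<theta>\<close>.\<close>
definition vir_mult :: "int \<Rightarrow> complex \<Rightarrow> complex" where
  "vir_mult j z = - \<i> * z powi j"

lemma vir_mult_periodic_smooth: "ang (vir_mult j) \<in> periodic_smooth"
  unfolding vir_mult_def
  by (rule periodic_smooth_linear[OF bounded_linear_mult_right ang_powi_periodic_smooth])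

locale holomorphic_splitting = loop_splitting G Lp Lm
  for G :: "(complex^'n^'n) set" and Lp Lm :: "(complex \<Rightarrow> complex^'n^'n) set" +
  assumes Lp_eq: "Lp = Lplus G"
begin

text \<open>The element \<zeta> is the velocity of a curve c in \<open>Lp\<close>. By the maximum
  principle the extensions of its difference quotients converge uniformly on the closed disc, to an
  extension \<Phi> of \<zeta>. After substitution of a map M into a smaller disc this becomes
  convergence with all derivatives, so that \<Phi> composed with M is the velocity of the
  substituted curve, which is again in \<open>Lp\<close>.\<close>

lemma plus_extension:
  assumes "\<zeta> \<in> plus.LH"
  obtains \<Phi> :: "complex \<Rightarrow> complex^'n^'n" where "\<And>i k. (\<lambda>z. \<Phi> z $ i $ k) \<in> disc_algebra" "\<And>z. z \<in> S1 \<Longrightarrow> \<Phi> z = \<zeta> z"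
    "\<And>M \<rho>. continuous_on (cball 0 1) M \<Longrightarrow> M holomorphic_on ball 0 1 \<Longrightarrow> ang M \<in> periodic_smooth \<Longrightarrow>
       M ` cball 0 1 \<subseteq> cball 0 \<rho> \<Longrightarrow> \<rho> < 1 \<Longrightarrow> (\<lambda>z\<in>S1. \<Phi> (M z)) \<in> plus.LH"
proof -
  obtain c where c: "\<And>s. c s \<in> Lp" "c 0 = loop_one" "has_velocity c \<zeta>"
    using assms unfolding plus.LH_iff by blast
  \<comment> \<open>The extension of \<open>c 0\<close> is chosen to be constant, so that the
    substituted curve starts at \<open>loop_one\<close> as well.\<close>
  have "\<exists>F. disc_extension G (c s) F \<and> (s = 0 \<longrightarrow> F = (\<lambda>z. mat 1))" for s
  proof (cases "s = 0")
    case True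
    have "disc_extension G (c 0) (\<lambda>z. mat 1)" by (simp add: disc_extension_def c(2) loop_one_def G_one)
    then show ?thesis using True by blast
  next
    case False
    then show ?thesis using c(1)[of s] by (simp add: Lp_eq Lplus_iff)
  qed
  then obtain F where F: "\<And>s. disc_extension G (c s) (F s)" "F 0 = (\<lambda>z. mat 1)" by metis
  define Q where "Q = (\<lambda>i k s z. (F s z $ i $ k - F 0 z $ i $ k) /\<^sub>R s)"
  have Q: "Q i k s \<in> disc_algebra" for i k s
    using disc_extension_entry[OF F(1), of s i k] disc_extension_entry[OF F(1), of 0 i k]
    unfolding Q_def scaleR_conv_of_real disc_algebra_def
    by (auto intro!: continuous_intros holomorphic_intros)
  have FS1: "F s z = c s z" if "z \<in> S1" for s z using F(1) that by (simp add: disc_extension_def)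
  have QS1: "uniform_limit S1 (Q i k) (\<lambda>z. \<zeta> z $ i $ k) (at 0)" for i k
  proof -
    have "uniform_limit UNIV (\<lambda>s \<theta>. (c s (cis \<theta>) - c 0 (cis \<theta>)) /\<^sub>R s) (ang \<zeta>) (at 0)"
      using c(3) by (simp add: has_velocity_iff smooth_conv_uniform_limit)
    from bounded_linear.uniform_limit[OF bounded_linear_entry this]
    show ?thesis unfolding uniform_limit_S1_iff by (simp add: Q_def FS1)
  qed
  have X: "filterlim (\<lambda>m. inverse (real (Suc m))) (at 0) sequentially"
    using LIMSEQ_inverse_real_of_nat by (simp add: filterlim_at)
  have ex: "\<exists>\<Phi>. \<Phi> \<in> disc_algebra \<and> (\<forall>z\<in>S1. \<Phi> z = \<zeta> z $ i $ k)" for i k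
  proof -
    have "uniform_limit S1 (\<lambda>m. Q i k (inverse (real (Suc m)))) (\<lambda>z. \<zeta> z $ i $ k) sequentially"
      by (rule filterlim_compose[OF QS1 X])
    from disc_algebra_limit[OF Q this] show ?thesis by metis
  qed
  define \<phi> where "\<phi> = (\<lambda>i k. SOME \<Phi>. \<Phi> \<in> disc_algebra \<and> (\<forall>z\<in>S1. \<Phi> z = \<zeta> z $ i $ k))"
  have "\<phi> i k \<in> disc_algebra \<and> (\<forall>z\<in>S1. \<phi> i k z = \<zeta> z $ i $ k)" for i k
    unfolding \<phi>_def by (rule someI_ex[OF ex])
  then have \<phi>: "\<And>i k. \<phi> i k \<in> disc_algebra" "\<And>i k z. z \<in> S1 \<Longrightarrow> \<phi> i k z = \<zeta> z $ i $ k"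
    by blast+
  have lim: "uniform_limit (cball 0 1) (Q i k) (\<phi> i k) (at 0)" for i k
  proof (rule disc_algebra_uniform_limit[OF Q \<phi>(1)])
    show "uniform_limit S1 (Q i k) (\<phi> i k) (at 0)"
      using QS1[of i k] by (simp add: uniform_limit_iff \<phi>(2))
  qed
  define \<Phi> where "\<Phi> = (\<lambda>z. \<chi> i k. \<phi> i k z)"
  show ?thesis
  proof (rule that[of \<Phi>])
    show "(\<lambda>z. \<Phi> z $ i $ k) \<in> disc_algebra" for i k by (simp add: \<Phi>_def \<phi>(1))
    show "\<Phi> z = \<zeta> z" if "z \<in> S1" for z using that by (simp add: \<Phi>_def \<phi>(2) vec_eq_iff)
    fix M :: "complex \<Rightarrow> complex" and \<rho>
    assume M: "continuous_on (cball 0 1) M" "M holomorphic_on ball 0 1" "ang M \<in> periodic_smooth"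
      "M ` cball 0 1 \<subseteq> cball 0 \<rho>" "\<rho> < 1"
    have Mb: "M ` cball 0 1 \<subseteq> ball 0 1" using M(4,5) by auto
    have range: "range (ang M) \<subseteq> cball 0 \<rho>" using M(4) by auto
    have ps: "(\<lambda>\<theta>. h (M (cis \<theta>))) \<in> periodic_smooth" if "h \<in> disc_algebra" for h
      by (rule periodic_smooth_compose[OF open_ball smooth_on_holomorphic[OF open_ball] M(3)])
        (use that Mb in \<open>auto simp: disc_algebra_def\<close>)
    define d where "d = (\<lambda>s. \<lambda>z\<in>S1. F s (M z))"
    have dG: "d s \<in> loops G" for s
      unfolding d_def restrict_loops_iff
    proof
      show "\<forall>z\<in>S1. F s (M z) \<in> G" 
      proof
        fix z :: complex assume "z \<in> S1"
        then have "M z \<in> ball 0 1" using Mb by (intro subsetD[OF Mb] imageI) simp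
        then show "F s (M z) \<in> G" using F(1)[of s] unfolding disc_extension_def by blast
      qed
      show "(\<lambda>\<theta>. F s (M (cis \<theta>))) \<in> periodic_smooth"
        by (rule periodic_smooth_matrix, rule ps, rule disc_extension_entry[OF F(1)])
    qed
    have "d s \<in> Lp" for s
      unfolding Lp_eq d_def
    proof (rule Lplus_substitute[OF F(1) M(1,2)])
      show "M ` cball 0 1 \<subseteq> cball 0 1" using Mb ball_subset_cball by blast
      show "M ` ball 0 1 \<subseteq> ball 0 1" using Mb ball_subset_cball by blast
      show "(\<lambda>z\<in>S1. F s (M z)) \<in> loops G" using dG[of s] by (simp add: d_def)
    qed
    moreover have "d 0 = loop_one" by (simp add: d_def F(2) loop_one_def)
    moreover have "has_velocity d (\<lambda>z\<in>S1. \<Phi> (M z))"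
      unfolding has_velocity_iff
    proof (intro conjI)
      show "d 0 \<in> loops UNIV" by (rule loops_UNIV[OF dG])
      show "\<forall>\<^sub>F s in at 0. d s \<in> loops UNIV" by (rule always_eventually) (intro allI loops_UNIV[OF dG])
      have \<Phi>ps: "(\<lambda>\<theta>. \<Phi> (M (cis \<theta>))) \<in> periodic_smooth"
        by (rule periodic_smooth_matrix) (simp add: \<Phi>_def ps \<phi>(1))
      then show "(\<lambda>z\<in>S1. \<Phi> (M z)) \<in> loops UNIV" by (simp add: restrict_loops_iff)
      have "smooth_conv (\<lambda>s \<theta>. (d s (cis \<theta>) - d 0 (cis \<theta>)) /\<^sub>R s) (\<lambda>\<theta>. \<Phi> (M (cis \<theta>))) (at 0)"
      proof (rule smooth_conv_matrix[OF _ _ \<Phi>ps])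
        fix i k
        have "smooth_conv (\<lambda>s \<theta>. Q i k s (M (cis \<theta>))) (\<lambda>\<theta>. \<phi> i k (M (cis \<theta>))) (at 0)"
        proof (rule holomorphic_uniform_limit_smooth[OF _ _ _ M(3) range M(5)])
          show "Q i k s holomorphic_on ball 0 1" for s using Q by (simp add: disc_algebra_def)
          show "\<phi> i k holomorphic_on ball 0 1" using \<phi>(1) by (simp add: disc_algebra_def)
          show "uniform_limit (cball 0 \<rho>) (Q i k) (\<phi> i k) (at 0)" if "\<rho> < 1" for \<rho>
            by (rule uniform_limit_on_subset[OF lim]) (use that in auto)
        qed
        then show "smooth_conv (\<lambda>s \<theta>. ((d s (cis \<theta>) - d 0 (cis \<theta>)) /\<^sub>R s) $ i $ k)
            (\<lambda>\<theta>. \<Phi> (M (cis \<theta>)) $ i $ k) (at 0)"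
          by (simp add: Q_def d_def \<Phi>_def)
      next
        show "\<forall>\<^sub>F s in at 0. (\<lambda>\<theta>. (d s (cis \<theta>) - d 0 (cis \<theta>)) /\<^sub>R s) \<in> periodic_smooth"
          by (rule always_eventually) (intro allI periodic_smooth_linear[OF bounded_linear_scaleR_right]
              periodic_smooth_diff loops_periodic_smooth[OF dG])
      qed
      then show "smooth_conv (\<lambda>s \<theta>. (d s (cis \<theta>) - d 0 (cis \<theta>)) /\<^sub>R s) (\<lambda>\<theta>. (\<lambda>z\<in>S1. \<Phi> (M z)) (cis \<theta>)) (at 0)"
        by simp
    qed
    ultimately show "(\<lambda>z\<in>S1. \<Phi> (M z)) \<in> plus.LH" unfolding plus.LH_iff by blast
  qed
qed

text \<open>For \<open>r < 1\<close> and small \<open>s\<close> of either sign, \<open>z \<mapsto> r (z + s z\<^sup>j\<^sup>+\<^sup>1)\<close> maps the closed disc into the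
  open disc, so that the velocity at \<open>s = 0\<close> stays in the Lie algebra.\<close>
lemma plus_radial_vector_field:
  fixes \<Phi> :: "complex \<Rightarrow> complex^'n^'n"
  assumes \<Phi>: "\<And>i k. (\<lambda>z. \<Phi> z $ i $ k) \<in> disc_algebra"
    and sub: "\<And>M \<rho>. continuous_on (cball 0 1) M \<Longrightarrow> M holomorphic_on ball 0 1 \<Longrightarrow> ang M \<in> periodic_smooth \<Longrightarrow>
       M ` cball 0 1 \<subseteq> cball 0 \<rho> \<Longrightarrow> \<rho> < 1 \<Longrightarrow> (\<lambda>z\<in>S1. \<Phi> (M z)) \<in> plus.LH"
    and r: "0 < r" "r < 1" and j: "j \<ge> -1"
  shows "(\<lambda>z\<in>S1. cscale (vir_mult j z) (dtheta (\<lambda>z\<in>S1. \<Phi> (of_real r * z)) z)) \<in> plus.LH"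
proof -
  \<comment> \<open>The place where j \<ge> -1 enters: for smaller j the power would have a pole at
    0.\<close>
  define k where "k = nat (j + 1)"
  \<comment> \<open>On the closed disc the norm of \<open>M s z\<close> is at most r (1 + |s|),
    hence at most r + |s|. For |s| < (1 - r) / 2 this is below (1 + r) / 2, the radius
    \<rho>.\<close>
  define \<delta> where "\<delta> = (1 - r) / 2"
  define \<rho> where "\<rho> = (1 + r) / 2"
  define M where "M = (\<lambda>s::real. \<lambda>z::complex. of_real r * (z + of_real s * z ^ k))"
  have \<delta>: "\<delta> > 0" "\<rho> < 1" using r by (auto simp: \<delta>_def \<rho>_def)
  have M\<rho>: "M s z \<in> cball 0 \<rho>" if "\<bar>s\<bar> < \<delta>" "z \<in> cball 0 1" for s z
  proof -
    have z: "norm z \<le> 1" using that by simp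
    have "norm (M s z) \<le> r * (norm z + \<bar>s\<bar> * norm z ^ k)"
      unfolding M_def using r norm_triangle_ineq[of z "of_real s * z ^ k"]
      by (simp add: norm_mult norm_power mult_left_mono)
    also have "\<dots> \<le> r * (1 + \<bar>s\<bar> * 1)"
      using r z by (intro mult_left_mono add_mono) (auto simp: power_le_one)
    also have "\<dots> \<le> r + \<bar>s\<bar>" using r mult_right_mono[of r 1 "\<bar>s\<bar>"] by (simp add: algebra_simps)
    also have "\<dots> \<le> \<rho>" using that by (simp add: \<rho>_def \<delta>_def field_simps)
    finally show ?thesis by simp
  qed
  let ?W = "{-\<delta><..<\<delta>} \<times> (UNIV :: real set)"
  have W: "open ?W" by (intro open_Times) auto
  have f: "smooth_on ?W fst" "smooth_on ?W snd"
    using smooth_on_linear[OF bounded_linear_fst W smooth_on_id[OF W]]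
      smooth_on_linear[OF bounded_linear_snd W smooth_on_id[OF W]] by simp_all
  have "smooth_on ?W (\<lambda>p. of_real r * (cis (snd p) + fst p *\<^sub>R cis (real k * snd p)))"
    by (rule smooth_on_linear[OF bounded_linear_mult_right W smooth_on_add[OF W smooth_on_cis[OF W f(2)]
          smooth_on_bilinear[OF bounded_bilinear_scaleR W f(1)
            smooth_on_cis[OF W smooth_on_linear[OF bounded_linear_mult_right W f(2)]]]]])
  then have Msm: "smooth_on ?W (\<lambda>p. M (fst p) (cis (snd p)))"
    by (simp add: M_def scaleR_conv_of_real Complex.DeMoivre)
  have Mball: "(\<lambda>p. M (fst p) (cis (snd p))) ` ?W \<subseteq> ball 0 1"
  proof (rule image_subsetI)
    fix p assume "p \<in> ?W"
    then have "\<bar>fst p\<bar> < \<delta>" by (auto simp: mem_Times_iff abs_less_iff)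
    then have "norm (M (fst p) (cis (snd p))) \<le> \<rho>" using M\<rho>[of "fst p" "cis (snd p)"] by simp
    then show "M (fst p) (cis (snd p)) \<in> ball 0 1" using \<delta>(2) by simp
  qed
  define a where "a = (\<lambda>s \<theta>. \<Phi> (M s (cis \<theta>)))"
  have hol: "(\<lambda>z. \<Phi> z $ i $ l) holomorphic_on ball 0 1" for i l using \<Phi> by (simp add: disc_algebra_def)
  have "smooth_on ?W (\<lambda>p. \<Phi> (M (fst p) (cis (snd p))))"
    by (rule smooth_on_matrix[OF W], rule smooth_on_compose[OF W open_ball Mball
          smooth_on_holomorphic[OF open_ball hol] Msm])
  then have a_smooth: "smooth_on ?W (\<lambda>(s, \<theta>). a s \<theta>)" by (simp only: a_def case_prod_unfold)
  have zk: "z powi j * z = z ^ k" if "z \<in> S1" for z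
  proof -
    have "z \<noteq> 0" using that by auto
    then have "z powi j * z = z powi (j + 1)" by (simp add: power_int_add)
    also have "\<dots> = z ^ k" using j by (simp add: k_def power_int_def)
    finally show ?thesis .
  qed
  define v where "v = (\<lambda>z\<in>S1. cscale (vir_mult j z) (dtheta (\<lambda>z\<in>S1. \<Phi> (of_real r * z)) z))"
  have der: "((\<lambda>s. a s \<theta>) has_vector_derivative v (cis \<theta>)) (at 0)" for \<theta>
  proof -
    define z where "z = cis \<theta>"
    define D where "D = (\<chi> i l. deriv (\<lambda>z. \<Phi> z $ i $ l) (of_real r * z))"
    have z: "z \<in> S1" by (simp add: z_def)
    have rz: "of_real r * z \<in> ball 0 1" using r z by (simp add: norm_mult)
    have "((\<lambda>\<theta>. \<Phi> (of_real r * cis \<theta>)) has_vector_derivative cscale (of_real r * (\<i> * z)) D) (at \<theta>)"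
    proof (rule has_vector_derivative_matrix)
      fix i l
      have "((\<lambda>t. of_real r * cis t) has_vector_derivative of_real r * (\<i> * z)) (at \<theta>)"
        unfolding z_def
        by (rule bounded_linear.has_vector_derivative[OF bounded_linear_mult_right cis_has_vector_derivative])
      from holomorphic_compose_has_vector_derivative[OF hol open_ball _ this] rz
      show "((\<lambda>\<theta>. \<Phi> (of_real r * cis \<theta>) $ i $ l) has_vector_derivative
          cscale (of_real r * (\<i> * z)) D $ i $ l) (at \<theta>)"
        by (simp add: D_def cscale_def z_def mult.commute)
    qed
    then have "dtheta (\<lambda>z\<in>S1. \<Phi> (of_real r * z)) z = cscale (of_real r * (\<i> * z)) D"
      unfolding z_def dtheta_cis by (simp add: vector_derivative_at)
    then have "v z = cscale (vir_mult j z * (of_real r * (\<i> * z))) D" using z by (simp add: v_def)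
    also have "vir_mult j z * (of_real r * (\<i> * z)) = of_real r * (z powi j * z)"
      by (simp add: vir_mult_def mult_ac)
    finally have vz: "v z = cscale (of_real r * z ^ k) D" by (simp only: zk[OF z])
    show ?thesis
    proof (rule has_vector_derivative_matrix)
      fix i l
      have "((\<lambda>s. s *\<^sub>R z ^ k) has_vector_derivative 1 *\<^sub>R z ^ k) (at 0)"
        by (rule bounded_linear.has_vector_derivative[OF bounded_linear_scaleR_left has_vector_derivative_id])
      from bounded_linear.has_vector_derivative[OF bounded_linear_mult_right
          has_vector_derivative_add[OF has_vector_derivative_const this]]
      have "((\<lambda>s. of_real r * (z + s *\<^sub>R z ^ k)) has_vector_derivative of_real r * (0 + 1 *\<^sub>R z ^ k)) (at 0)" .
      then have "((\<lambda>s. M s z) has_vector_derivative of_real r * z ^ k) (at 0)"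
        by (simp add: M_def scaleR_conv_of_real)
      from holomorphic_compose_has_vector_derivative[OF hol open_ball _ this] rz
      show "((\<lambda>s. a s \<theta> $ i $ l) has_vector_derivative v (cis \<theta>) $ i $ l) (at 0)"
        unfolding z_def[symmetric] vz by (simp add: a_def D_def cscale_def z_def[symmetric] M_def mult.commute)
    qed
  qed
  have per: "a s (\<theta> + 2 * pi) = a s \<theta>" for s \<theta> by (simp add: a_def cis_periodic)
  note J = joint_smooth_quotient[of \<delta> a "\<lambda>\<theta>. v (cis \<theta>)", OF \<delta>(1) a_smooth per der]
  let ?x = "\<lambda>s. \<lambda>z\<in>S1. \<Phi> (M s z)"
  have x: "?x s \<in> plus.LH" if "\<bar>s\<bar> < \<delta>" for s
  proof (rule sub[of "M s" \<rho>])
    show "M s ` cball 0 1 \<subseteq> cball 0 \<rho>" using M\<rho>[OF that] by blast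
    show "ang (M s) \<in> periodic_smooth"
    proof -
      have "smooth_on UNIV (\<lambda>\<theta>. of_real r * (cis \<theta> + s *\<^sub>R cis (real k * \<theta>)))"
        by (rule smooth_on_linear[OF bounded_linear_mult_right open_UNIV smooth_on_add[OF open_UNIV
              smooth_on_cis[OF open_UNIV smooth_on_id[OF open_UNIV]]
              smooth_on_linear[OF bounded_linear_scaleR_right open_UNIV smooth_on_cis[OF open_UNIV
              smooth_on_linear[OF bounded_linear_mult_right open_UNIV smooth_on_id[OF open_UNIV]]]]]])
      then have "smooth_on UNIV (ang (M s))" by (simp add: M_def scaleR_conv_of_real Complex.DeMoivre)
      then show ?thesis by (simp add: periodic_smooth_def cis_periodic)
    qed
  qed (use \<delta>(2) in \<open>auto simp: M_def intro!: continuous_intros holomorphic_intros\<close>)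
  have "\<forall>\<^sub>F s in at 0. \<bar>s\<bar> < \<delta>" using \<delta>(1) unfolding eventually_at by (intro exI[of _ \<delta>]) auto
  then have "\<forall>\<^sub>F s in at 0. ?x s \<in> loops UNIV"
    by eventually_elim (rule loops_UNIV[OF plus.LH_loops[OF x]])
  moreover have "v \<in> loops UNIV" using J(2) unfolding v_def by (simp add: restrict_loops_iff)
  moreover have "?x 0 \<in> loops UNIV" by (rule loops_UNIV[OF plus.LH_loops[OF x]]) (simp add: \<delta>)
  ultimately have vel: "has_velocity ?x v" using J(1) by (simp add: has_velocity_iff a_def)
  \<comment> \<open>\<open>plus_velocity\<close> asks for a curve in the algebra for all parameters.
    The value 0 for large s completes the curve without changing its velocity at 0.\<close>
  define y where "y = (\<lambda>s. if \<bar>s\<bar> < \<delta> then ?x s else (\<lambda>z\<in>S1. 0))"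
  have "\<forall>\<^sub>F s in nhds 0. s \<in> {-\<delta><..<\<delta>}" using \<delta>(1) by (intro eventually_nhds_in_open) auto
  then have "\<forall>\<^sub>F s in nhds 0. ?x s = y s" by eventually_elim (simp add: y_def abs_less_iff)
  from has_velocity_cong[OF vel this] have "has_velocity y v" .
  moreover have "y s \<in> plus.LH" for s using x plus.LH_zero by (simp add: y_def)
  ultimately show ?thesis using plus_velocity[of y v] by (simp add: v_def)
qed

text \<open>The dilates z \<mapsto> \<Phi>(r z) converge to \<zeta> with all derivatives as r
  \<rightarrow> 1, and the vector field acts continuously in this topology. The result for r < 1
  thus passes to the limit in the closed plus algebra.\<close>

lemma plus_vector_field:
  assumes \<zeta>: "\<zeta> \<in> plus.LH" and j: "j \<ge> -1"
  shows "(\<lambda>z\<in>S1. cscale (vir_mult j z) (dtheta \<zeta> z)) \<in> plus.LH"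
proof (rule plus_extension[OF \<zeta>])
  fix \<Phi> :: "complex \<Rightarrow> complex^'n^'n"
  assume \<Phi>: "\<And>i k. (\<lambda>z. \<Phi> z $ i $ k) \<in> disc_algebra" "\<And>z. z \<in> S1 \<Longrightarrow> \<Phi> z = \<zeta> z"
    and sub: "\<And>M \<rho>. continuous_on (cball 0 1) M \<Longrightarrow> M holomorphic_on ball 0 1 \<Longrightarrow>
       ang M \<in> periodic_smooth \<Longrightarrow> M ` cball 0 1 \<subseteq> cball 0 \<rho> \<Longrightarrow> \<rho> < 1 \<Longrightarrow> (\<lambda>z\<in>S1. \<Phi> (M z)) \<in> plus.LH"
  \<comment> \<open>The double successor keeps \<open>r m\<close> strictly between 0 and 1 also for
    m = 0.\<close>
  define r where "r = (\<lambda>m::nat. 1 - inverse (real (Suc (Suc m))))"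
  have r: "0 < r m" "r m < 1" for m by (auto simp: r_def field_simps)
  have "(\<lambda>m. inverse (real (Suc (Suc m)))) \<longlonglongrightarrow> 0" using LIMSEQ_Suc[OF LIMSEQ_inverse_real_of_nat] .
  from tendsto_diff[OF tendsto_const[of 1] this] have r1: "r \<longlonglongrightarrow> 1" by (simp add: r_def)
  let ?u = "\<lambda>m. \<lambda>z\<in>S1. \<Phi> (of_real (r m) * z)"
  have u: "(\<lambda>z\<in>S1. cscale (vir_mult j z) (dtheta (?u m) z)) \<in> plus.LH" for m
    by (rule plus_radial_vector_field[OF \<Phi>(1) sub r(1) r(2) j])
  have \<Phi>ps: "(\<lambda>\<theta>. \<Phi> (cis \<theta>) $ i $ k) \<in> periodic_smooth" for i k
    using periodic_smooth_linear[OF bounded_linear_entry loops_periodic_smooth[OF plus.LH_loops[OF \<zeta>]], of i k]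
    by (simp add: \<Phi>(2))
  have ups: "(\<lambda>\<theta>. \<Phi> (of_real (r m) * cis \<theta>)) \<in> periodic_smooth" for m
  proof (rule periodic_smooth_matrix)
    fix i k
    have "(\<lambda>\<theta>. of_real (r m) * cis \<theta>) \<in> periodic_smooth"
      by (rule periodic_smooth_linear[OF bounded_linear_mult_right ang_id_periodic_smooth])
    moreover have "range (\<lambda>\<theta>. of_real (r m) * cis \<theta>) \<subseteq> ball 0 1"
      using r[of m] by (auto simp: norm_mult)
    moreover have "smooth_on (ball 0 1) (\<lambda>z. \<Phi> z $ i $ k)"
      using \<Phi>(1) by (intro smooth_on_holomorphic) (auto simp: disc_algebra_def)
    ultimately show "(\<lambda>\<theta>. \<Phi> (of_real (r m) * cis \<theta>) $ i $ k) \<in> periodic_smooth"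
      using periodic_smooth_compose[OF open_ball] by blast
  qed
  have \<zeta>ps: "ang \<zeta> \<in> periodic_smooth" by (rule loops_periodic_smooth[OF plus.LH_loops[OF \<zeta>]])
  have "smooth_conv (\<lambda>m \<theta>. \<Phi> (of_real (r m) * cis \<theta>)) (ang \<zeta>) sequentially"
  proof (rule smooth_conv_matrix[OF _ _ \<zeta>ps])
    show "smooth_conv (\<lambda>m \<theta>. \<Phi> (of_real (r m) * cis \<theta>) $ i $ k) (\<lambda>\<theta>. \<zeta> (cis \<theta>) $ i $ k) sequentially" for i k
      using disc_algebra_radial_limit[OF \<Phi>(1) \<Phi>ps r r1, of i k] by (simp add: \<Phi>(2))
  qed (simp add: ups)
  from smooth_conv_deriv[OF this]
  have "smooth_conv (\<lambda>m \<theta>. dtheta (?u m) (cis \<theta>)) (ang (dtheta \<zeta>)) sequentially"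
    by (simp add: dtheta_cis)
  moreover have "ang (dtheta (?u m)) \<in> periodic_smooth" for m
    using periodic_smooth_deriv[OF ups] by (simp add: dtheta_cis)
  moreover have dps: "ang (dtheta \<zeta>) \<in> periodic_smooth"
    using periodic_smooth_deriv[OF \<zeta>ps] by (simp add: dtheta_cis)
  ultimately have "smooth_conv (\<lambda>m \<theta>. cscale (vir_mult j (cis \<theta>)) (dtheta (?u m) (cis \<theta>)))
      (\<lambda>\<theta>. cscale (vir_mult j (cis \<theta>)) (dtheta \<zeta> (cis \<theta>))) sequentially"
    using vir_mult_periodic_smooth
    by (intro smooth_conv_bilinear[OF cscale_bounded_bilinear smooth_conv_const]) simp_all
  then have "loop_tendsto (\<lambda>m. \<lambda>z\<in>S1. cscale (vir_mult j z) (dtheta (?u m) z))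
      (\<lambda>z\<in>S1. cscale (vir_mult j z) (dtheta \<zeta> z)) sequentially"
    by (simp add: loop_tendsto_iff)
  moreover have "(\<lambda>z\<in>S1. cscale (vir_mult j z) (dtheta \<zeta> z)) \<in> loops UNIV"
    using periodic_smooth_bilinear[OF cscale_bounded_bilinear vir_mult_periodic_smooth dps]
    by (simp add: restrict_loops_iff)
  ultimately show ?thesis
    using plus_closed[of "\<lambda>m. \<lambda>z\<in>S1. cscale (vir_mult j z) (dtheta (?u m) z)", OF u] by blast
qed

end

section \<open>Disc maps that are bijective on the circle\<close>

locale disc_map =
  fixes K :: "complex \<Rightarrow> complex"
  assumes cont: "continuous_on (cball 0 1) K" and hol: "K holomorphic_on ball 0 1"
    and maps: "K ` cball 0 1 \<subseteq> cball 0 1" and bij: "bij_betw K S1 S1"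
begin

lemma inj_S1: "inj_on K S1" and image_S1: "K ` S1 = S1"
  using bij by (auto simp: bij_betw_def)

lemma not_constant: "\<not> K constant_on ball 0 1"
proof
  assume "K constant_on ball 0 1"
  then obtain c where c: "\<And>z. z \<in> ball 0 1 \<Longrightarrow> K z = c" unfolding constant_on_def by blast
  have "K z = c" if "z \<in> closure (ball 0 1)" for z
    by (rule continuous_constant_on_closure[of "ball 0 1" K c]) (use cont c that in auto)
  then have "K 1 = K (- 1)" by simp
  then show False using inj_onD[OF inj_S1, of 1 "-1"] by simp
qed

text \<open>A non-constant holomorphic map is open, so the image of the open disc is an open subset
  of the closed disc and lies in its interior.\<close>

lemma maps_ball: "K ` ball 0 1 \<subseteq> ball 0 1"
proof -
  have "open (K ` ball 0 1)"
    by (rule open_mapping_thm[OF hol open_ball _ open_ball subset_refl not_constant]) simp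
  moreover have "K ` ball 0 1 \<subseteq> cball 0 1" using maps ball_subset_cball by blast
  ultimately have "K ` ball 0 1 \<subseteq> interior (cball 0 1)" by (rule interior_maximal[rotated])
  then show ?thesis by simp
qed

text \<open>The argument principle needs a contour inside the open disc, where K is holomorphic. The
  fibre over w is compact and misses the circle, which K maps to itself, so a smaller circle
  encloses the whole fibre.\<close>

lemma preimage_radius:
  assumes w: "w \<in> ball 0 1"
  obtains r where "0 < r" "r < 1" "\<And>z. z \<in> cball 0 1 \<Longrightarrow> K z = w \<Longrightarrow> norm z < r"
proof -
  let ?Z = "cball 0 1 \<inter> K -` {w}"
  have "closed ?Z" by (rule continuous_closed_preimage[OF cont]) auto
  then have Z: "compact ?Z" using compact_Int_closed[OF compact_cball, of ?Z 0 1] by (simp add: Int_absorb1 inf_commute)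
  have nb: "norm z < 1" if "z \<in> ?Z" for z
  proof (rule ccontr)
    assume "\<not> norm z < 1"
    then have "z \<in> S1" using that by simp
    then have "K z \<in> S1" using image_S1 by blast
    then show False using that w by simp
  qed
  obtain b where b: "b < 1" "\<And>z. z \<in> ?Z \<Longrightarrow> norm z \<le> b"
  proof (cases "?Z = {}")
    case True
    then show ?thesis using that[of 0] by auto
  next
    case False
    have "continuous_on ?Z norm" by (intro continuous_intros)
    from continuous_attains_sup[OF Z False this]
    obtain x where "x \<in> ?Z" "\<forall>y\<in>?Z. norm y \<le> norm x" by blast
    then show ?thesis using that[of "norm x"] nb by blast
  qed
  show ?thesis
  \<comment> \<open>The maximum with 1/2 secures a positive radius, since only b < 1 is
    recorded.\<close>
  proof (rule that[of "max (1 / 2) ((1 + b) / 2)"])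
    show "norm z < max (1 / 2) ((1 + b) / 2)" if "z \<in> cball 0 1" "K z = w" for z
    proof -
      have "norm z \<le> b" using b(2)[of z] that by simp
      then have "norm z < (1 + b) / 2" using b(1) by simp
      then show ?thesis by (rule less_le_trans[OF _ max.cobounded2])
    qed
  qed (use b(1) in auto)
qed

text \<open>The image of the unit circle is a simple closed curve, so its winding number is \<open>1\<close> or \<open>-1\<close>;
  the argument principle then leaves room for exactly one preimage.\<close>
lemma preimage_unique:
  assumes w: "w \<in> ball 0 1"
  shows "\<exists>!z. z \<in> ball 0 1 \<and> K z = w"
proof -
  obtain r where r: "0 < r" "r < 1" "\<And>z. z \<in> cball 0 1 \<Longrightarrow> K z = w \<Longrightarrow> norm z < r"
    using preimage_radius[OF w] by blast
  let ?c = "\<lambda>\<rho>. circlepath 0 \<rho> :: real \<Rightarrow> complex"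
  have cp: "?c \<rho> t = of_real \<rho> * ?c 1 t" "norm (?c 1 t) = 1" for \<rho> t
    by (simp_all add: circlepath norm_mult)
  \<comment> \<open>The radial homotopy stays in the annulus between radius r and 1, which misses
    the fibre over w. It transfers the winding number from the image of the unit circle, where
    injectivity is known, to that of the circle of radius r, where K is holomorphic.\<close>
  have "homotopic_loops (cball 0 1 - ball 0 r) (?c r) (?c 1)"
  proof (rule homotopic_loops_linear)
    fix t :: real
    show "closed_segment (?c r t) (?c 1 t) \<subseteq> cball 0 1 - ball 0 r"
    proof
      fix x assume "x \<in> closed_segment (?c r t) (?c 1 t)"
      then obtain u where u: "0 \<le> u" "u \<le> 1" "x = (1 - u) *\<^sub>R ?c r t + u *\<^sub>R ?c 1 t"
        by (auto simp: in_segment)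
      have "x = of_real ((1 - u) * r + u) * ?c 1 t"
        unfolding u(3) cp(1)[of r] by (simp add: scaleR_conv_of_real algebra_simps)
      then have "norm x = \<bar>(1 - u) * r + u\<bar>" by (simp only: norm_mult norm_of_real cp(2) mult_1_right)
      moreover have "r \<le> (1 - u) * r + u"
        using mult_left_mono[of r 1 u] u r by (simp add: algebra_simps)
      moreover have "(1 - u) * r + u \<le> 1"
        using mult_left_mono[of r 1 "1 - u"] u r by (simp add: algebra_simps)
      ultimately show "x \<in> cball 0 1 - ball 0 r" using r by simp
    qed
  qed auto
  then have "homotopic_loops (- {w}) (K \<circ> ?c r) (K \<circ> ?c 1)"
  proof (rule homotopic_loops_continuous_image)
    show "continuous_on (cball 0 1 - ball 0 r) K" by (rule continuous_on_subset[OF cont]) auto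
    show "K \<in> (cball 0 1 - ball 0 r) \<rightarrow> - {w}" using r(3) by fastforce
  qed
  then have wn: "winding_number (K \<circ> ?c r) w = winding_number (K \<circ> ?c 1) w"
    by (rule winding_number_homotopic_loops)
  have pi1: "path_image (?c 1) = S1" by (simp add: sphere_def)
  have "simple_path (K \<circ> ?c 1)"
  proof (rule simple_path_continuous_image)
    show "simple_path (?c 1)" by (simp add: simple_path_circlepath)
    show "continuous_on (path_image (?c 1)) K" unfolding pi1 by (rule continuous_on_subset[OF cont]) auto
    show "inj_on K (path_image (?c 1))" unfolding pi1 by (rule inj_S1)
  qed
  moreover have "w \<in> inside (path_image (K \<circ> ?c 1))"
  proof -
    have "path_image (K \<circ> ?c 1) = frontier (cball 0 1)"
      by (simp only: path_image_compose pi1 image_S1) simp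
    then show ?thesis using w inside_frontier_eq_interior[of "cball (0::complex) 1"] by simp
  qed
  ultimately have one: "\<bar>Re (winding_number (K \<circ> ?c 1) w)\<bar> = 1"
    by (rule simple_closed_path_abs_winding_number_inside)
  let ?f = "\<lambda>z. K z - w"
  have fh: "?f holomorphic_on ball 0 1" by (intro holomorphic_intros hol)
  have pir: "path_image (?c r) \<subseteq> ball 0 1" using r by (auto simp: sphere_def)
  have nz: "K z \<noteq> w" if "z \<in> path_image (?c r)" for z
    using r(3)[of z] r(1,2) that by (auto simp: sphere_def)
  \<comment> \<open>The zeros in the form used by the argument principle, with an empty set of
    poles.\<close>
  define pz where "pz = {z \<in> ball 0 1. K z - w = 0 \<or> z \<in> {}}"
  have pz_r: "norm z < r" if "z \<in> pz" for z using that r(3)[of z] by (auto simp: pz_def)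
  have f_nc: "\<not> ?f constant_on ball 0 1"
  proof
    assume "?f constant_on ball 0 1"
    then obtain c where "\<And>z. z \<in> ball 0 1 \<Longrightarrow> K z - w = c" unfolding constant_on_def by blast
    then have "\<And>z. z \<in> ball 0 1 \<Longrightarrow> K z = c + w" by (metis diff_add_cancel)
    then show False using not_constant unfolding constant_on_def by blast
  qed
  have fin: "finite pz"
  proof -
    have "finite {z \<in> cball 0 r. ?f z = 0}"
      by (rule holomorphic_compact_finite_zeros[OF fh open_ball _ _ _ f_nc]) (use r in auto)
    moreover have "pz \<subseteq> {z \<in> cball 0 r. ?f z = 0}" using pz_r by (auto simp: pz_def less_imp_le)
    ultimately show ?thesis by (rule finite_subset[rotated])
  qed
  have arg: "contour_integral (?c r) (\<lambda>x. deriv ?f x * 1 / ?f x) =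
      2 * pi * \<i> * (\<Sum>p\<in>pz. winding_number (?c r) p * 1 * zorder ?f p)"
    unfolding pz_def
  proof (rule argument_principle[of "ball 0 1" ?f "{}" "\<lambda>_. 1" "?c r"])
    show "path_image (?c r) \<subseteq> ball 0 1 - {z \<in> ball 0 1. K z - w = 0 \<or> z \<in> {}}"
    proof
      fix x assume x: "x \<in> path_image (?c r)"
      then have "x \<in> ball 0 1" using pir by blast
      moreover have "K x - w \<noteq> 0" using nz[OF x] by simp
      ultimately show "x \<in> ball 0 1 - {z \<in> ball 0 1. K z - w = 0 \<or> z \<in> {}}" by blast
    qed
    show "\<forall>z. z \<notin> ball 0 1 \<longrightarrow> winding_number (?c r) z = 0"
    proof (intro allI impI)
      fix z :: complex assume "z \<notin> ball 0 1"
      then show "winding_number (?c r) z = 0"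
        by (intro winding_number_zero_outside[of _ "cball 0 r"]) (use r in \<open>auto simp: sphere_def\<close>)
    qed
    show "finite {z \<in> ball 0 1. K z - w = 0 \<or> z \<in> {}}" using fin by (simp add: pz_def)
  qed (use fh in auto)
  have vp: "valid_path (K \<circ> ?c r)" by (rule valid_path_compose_holomorphic[OF _ hol open_ball pir]) simp
  have "winding_number (K \<circ> ?c r) w = 1 / (2 * pi * \<i>) * contour_integral (K \<circ> ?c r) (\<lambda>z. 1 / (z - w))"
    by (rule winding_number_valid_path[OF vp]) (unfold path_image_compose, use nz in blast)
  also have "contour_integral (K \<circ> ?c r) (\<lambda>z. 1 / (z - w)) =
      contour_integral (?c r) (\<lambda>z. deriv K z * (1 / (K z - w)))"
    by (rule contour_integral_comp_analyticW[OF _ _ pir]) (use hol in \<open>simp_all add: analytic_on_open\<close>)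
  also have "\<dots> = contour_integral (?c r) (\<lambda>x. deriv ?f x * 1 / ?f x)"
  proof (rule contour_integral_eq)
    fix x assume "x \<in> path_image (?c r)"
    then have "K field_differentiable at x"
      using holomorphic_on_imp_differentiable_at[OF hol open_ball] pir by blast
    then have "deriv ?f x = deriv K x" by simp
    then show "deriv K x * (1 / (K x - w)) = deriv ?f x * 1 / ?f x" by simp
  qed
  also note arg
  also have "1 / (2 * pi * \<i>) * (2 * pi * \<i> * (\<Sum>p\<in>pz. winding_number (?c r) p * 1 * zorder ?f p)) =
      (\<Sum>p\<in>pz. winding_number (?c r) p * 1 * zorder ?f p)" by simp
  also have "\<dots> = (\<Sum>p\<in>pz. of_int (zorder ?f p))"
    using pz_r by (intro sum.cong) (auto simp: winding_number_circlepath)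
  also have "\<dots> = of_int (\<Sum>p\<in>pz. zorder ?f p)" by simp
  finally have "winding_number (K \<circ> ?c 1) w = of_int (\<Sum>p\<in>pz. zorder ?f p)"
    unfolding wn .
  with one have "\<bar>Re (of_int (\<Sum>p\<in>pz. zorder ?f p))\<bar> = 1" by (simp only:)
  moreover have "Re (of_int n) = real_of_int n" for n by simp
  ultimately have "\<bar>real_of_int (\<Sum>p\<in>pz. zorder ?f p)\<bar> = 1" by (simp only:)
  then have sum1: "\<bar>\<Sum>p\<in>pz. zorder ?f p\<bar> = 1" by linarith
  \<comment> \<open>Orders of zeros are positive. A sum of them with absolute value 1 therefore has
    a single term, whatever the orientation of the image curve.\<close>
  have pos: "zorder ?f p \<ge> 1" if "p \<in> pz" for p
  proof -
    have "\<exists>z\<in>ball 0 1. ?f z \<noteq> 0" using f_nc unfolding constant_on_def by blast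
    from zorder_exist_zero[OF fh open_ball _ _ this, of p] that
    show ?thesis by (auto simp: pz_def)
  qed
  have "int (card pz) \<le> (\<Sum>p\<in>pz. zorder ?f p)" using sum_mono[of pz "\<lambda>_. 1" "zorder ?f"] pos by simp
  then have "card pz \<le> 1" using sum1 by linarith
  moreover have "pz \<noteq> {}" using sum1 by auto
  ultimately obtain z where "pz = {z}" using fin by (metis card_1_singletonE card_gt_0_iff le_less_Suc_eq One_nat_def Suc_leI le_antisym)
  then show ?thesis unfolding pz_def by (auto intro!: ex1I[of _ z])
qed

text \<open>K is a bijection of the closed disc: the open disc by \<open>preimage_unique\<close>,
  the circle by assumption, and the two images are disjoint. Its inverse is continuous by
  compactness and holomorphic inside because an injective holomorphic map has a holomorphic
  inverse.\<close>

lemma inverse_disc_map: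
  obtains L where "continuous_on (cball 0 1) L" "L holomorphic_on ball 0 1"
    "L ` cball 0 1 \<subseteq> cball 0 1" "L ` ball 0 1 \<subseteq> ball 0 1" "\<And>z. z \<in> S1 \<Longrightarrow> L z = inv_into S1 K z"
proof -
  have split: "cball 0 1 = ball 0 1 \<union> (S1 :: complex set)" by auto
  have injb: "inj_on K (ball 0 1)"
    using preimage_unique maps_ball by (intro inj_onI) blast
  have inj: "inj_on K (cball 0 1)"
    unfolding split
  proof (rule inj_on_Un[THEN iffD2], intro conjI injb inj_S1 ballI)
    have "K ` ball 0 1 \<inter> K ` S1 = {}" using maps_ball image_S1 by auto
    then show "K ` (ball 0 1 - S1) \<inter> K ` (S1 - ball 0 1) = {}" by blast
  qed
  have imb: "K ` ball 0 1 = ball 0 1"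
    using preimage_unique maps_ball by blast
  have im: "K ` cball 0 1 = cball 0 1" unfolding split image_Un imb image_S1 ..
  define L where "L = inv_into (cball 0 1) K"
  have LK: "L (K z) = z" if "z \<in> cball 0 1" for z unfolding L_def by (rule inv_into_f_f[OF inj that])
  have "continuous_on (K ` cball 0 1) L"
    by (rule continuous_on_inv[OF cont compact_cball]) (simp add: LK)
  then have c: "continuous_on (cball 0 1) L" by (simp only: im)
  obtain g where g: "g holomorphic_on K ` ball 0 1" "\<And>z. z \<in> ball 0 1 \<Longrightarrow> g (K z) = z"
  proof (rule holomorphic_has_inverse[OF hol open_ball injb])
    fix g assume g: "g holomorphic_on K ` ball 0 1" "\<And>z. z \<in> ball 0 1 \<Longrightarrow> g (K z) = z"
    show thesis by (rule that[OF g])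
  qed
  have h: "L holomorphic_on ball 0 1"
  proof (rule holomorphic_transform)
    show "g holomorphic_on ball 0 1" using g(1) by (simp only: imb)
    fix x :: complex assume "x \<in> ball 0 1"
    then obtain z where "z \<in> ball 0 1" "x = K z" using imb by blast
    then show "g x = L x" using g(2) LK by simp
  qed
  show ?thesis
  proof (rule that[OF c h])
    show "L ` cball 0 1 \<subseteq> cball 0 1"
    proof
      fix y assume "y \<in> L ` cball 0 1"
      then obtain x where "x \<in> cball 0 1" "y = L x" by blast
      moreover from this obtain z where "z \<in> cball 0 1" "x = K z" using im by blast
      ultimately show "y \<in> cball 0 1" by (simp only: LK)
    qed
    show "L ` ball 0 1 \<subseteq> ball 0 1"
    proof
      fix y assume "y \<in> L ` ball 0 1"
      then obtain x where "x \<in> ball 0 1" "y = L x" by blast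
      moreover from this obtain z where "z \<in> ball 0 1" "x = K z" using imb by blast
      ultimately show "y \<in> ball 0 1" using LK[of z] by simp
    qed
    show "L z = inv_into S1 K z" if "z \<in> S1" for z
    proof -
      obtain y where y: "y \<in> S1" "z = K y" using \<open>z \<in> S1\<close> image_S1 by blast
      then show ?thesis using LK[of y] inv_into_f_f[OF inj_S1 y(1)] by simp
    qed
  qed
qed

end

section \<open>Inverses and composites in \<open>Dplus\<close>\<close>

lemma DplusE:
  assumes "k \<in> Dplus"
  shows "bij_betw k S1 S1" "ang k \<in> periodic_smooth" "ang (inv_into S1 k) \<in> periodic_smooth"
    and "\<And>z. z \<in> S1 \<Longrightarrow> inv_into S1 k z \<in> S1"
proof -
  show b: "bij_betw k S1 S1" "ang k \<in> periodic_smooth" "ang (inv_into S1 k) \<in> periodic_smooth"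
    using assms by (auto simp: Dplus_def periodic_smooth_def cis_periodic)
  show "inv_into S1 k z \<in> S1" if "z \<in> S1" for z
    using bij_betwE[OF bij_betw_inv_into[OF b(1)]] that by blast
qed

lemma Dplus_inverse_extension:
  assumes "k \<in> Dplus"
  obtains L where "continuous_on (cball 0 1) L" "L holomorphic_on ball 0 1"
    "L ` cball 0 1 \<subseteq> cball 0 1" "L ` ball 0 1 \<subseteq> ball 0 1" "\<And>z. z \<in> S1 \<Longrightarrow> L z = inv_into S1 k z"
proof -
  obtain K where K: "continuous_on (cball 0 1) K" "K holomorphic_on ball 0 1"
    "K ` cball 0 1 \<subseteq> cball 0 1" "\<And>z. z \<in> S1 \<Longrightarrow> K z = k z"
    using assms unfolding Dplus_def by blast
  have bK: "bij_betw K S1 S1" using bij_betw_cong[of S1 K k S1] K(4) DplusE(1)[OF assms] by blast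
  interpret disc_map K by unfold_locales (use K bK in auto)
  have "inv_into S1 K z = inv_into S1 k z" if "z \<in> S1" for z
  proof -
    obtain y where y: "y \<in> S1" "z = K y" using \<open>z \<in> S1\<close> image_S1 by blast
    then show ?thesis
      using inv_into_f_f[OF inj_S1 y(1)] inv_into_f_f[OF bij_betw_imp_inj_on[OF DplusE(1)[OF assms]] y(1)] K(4)[OF y(1)]
      by simp
  qed
  note eq = this
  show ?thesis
  proof (rule inverse_disc_map)
    fix L assume L: "continuous_on (cball 0 1) L" "L holomorphic_on ball 0 1"
      "L ` cball 0 1 \<subseteq> cball 0 1" "L ` ball 0 1 \<subseteq> ball 0 1" "\<And>z. z \<in> S1 \<Longrightarrow> L z = inv_into S1 K z"
    show thesis by (rule that[OF L(1-4)]) (simp only: L(5) eq)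
  qed
qed

lemma Dplus_id: "id \<in> Dplus"
proof -
  have "smooth_on UNIV (\<lambda>\<theta>. inv_into S1 id (cis \<theta>))"
    using periodic_smooth_smooth[OF ang_id_periodic_smooth] by (simp add: inv_into_f_f[of id S1, simplified])
  then show ?thesis
    unfolding Dplus_def
    using periodic_smooth_smooth[OF ang_id_periodic_smooth]
    by (auto intro!: exI[of _ id] simp: bij_betw_def holomorphic_on_id)
qed

lemma periodic_smooth_substitute_loop:
  assumes g: "ang g \<in> periodic_smooth" and w: "w \<in> periodic_smooth" "\<And>\<theta>. w \<theta> \<in> S1"
  shows "(\<lambda>\<theta>. g (w \<theta>)) \<in> periodic_smooth"
  by (rule periodic_smooth_substitute[of 4, OF smooth_on_subset[OF periodic_smooth_smooth[OF g] subset_UNIV] w(1)])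
    (use w(2) S1_eq_arc in blast)

lemma Dplus_compose_inv:
  assumes "k \<in> Dplus" "l \<in> Dplus" "z \<in> S1"
  shows "inv_into S1 (k \<circ> l) z = inv_into S1 l (inv_into S1 k z)"
proof -
  note bk = DplusE(1)[OF assms(1)] and bl = DplusE(1)[OF assms(2)]
  let ?y = "inv_into S1 l (inv_into S1 k z)"
  have y: "?y \<in> S1" by (intro DplusE(4)[OF assms(2)] DplusE(4)[OF assms(1)] assms(3))
  have "(k \<circ> l) ?y = z"
    using bij_betw_inv_into_right[OF bl DplusE(4)[OF assms(1,3)]] bij_betw_inv_into_right[OF bk assms(3)]
    by simp
  then show ?thesis using inv_into_f_f[OF bij_betw_imp_inj_on[OF bij_betw_trans[OF bl bk]] y] by simp
qed

lemma Dplus_compose: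
  assumes k: "k \<in> Dplus" and l: "l \<in> Dplus" shows "k \<circ> l \<in> Dplus"
proof -
  obtain K where K: "continuous_on (cball 0 1) K" "K holomorphic_on ball 0 1"
    "K ` cball 0 1 \<subseteq> cball 0 1" "\<And>z. z \<in> S1 \<Longrightarrow> K z = k z"
    using k unfolding Dplus_def by blast
  obtain L where L: "continuous_on (cball 0 1) L" "L holomorphic_on ball 0 1"
    "L ` cball 0 1 \<subseteq> cball 0 1" "\<And>z. z \<in> S1 \<Longrightarrow> L z = l z"
    using l unfolding Dplus_def by blast
  have bL: "bij_betw L S1 S1" using bij_betw_cong[of S1 L l S1] L(4) DplusE(1)[OF l] by blast
  interpret L: disc_map L by unfold_locales (use L bL in auto)
  have "(\<lambda>\<theta>. k (l (cis \<theta>))) \<in> periodic_smooth"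
    by (rule periodic_smooth_substitute_loop[OF DplusE(2)[OF k] DplusE(2)[OF l]])
      (rule bij_betwE[OF DplusE(1)[OF l], rule_format, OF cis_in_S1])
  moreover have "(\<lambda>\<theta>. inv_into S1 l (inv_into S1 k (cis \<theta>))) \<in> periodic_smooth"
    by (rule periodic_smooth_substitute_loop[OF DplusE(3)[OF l] DplusE(3)[OF k]])
      (rule DplusE(4)[OF k cis_in_S1])
  then have "(\<lambda>\<theta>. inv_into S1 (k \<circ> l) (cis \<theta>)) \<in> periodic_smooth"
    by (simp only: Dplus_compose_inv[OF k l cis_in_S1])
  moreover have "continuous_on (cball 0 1) (K \<circ> L)"
    by (rule continuous_on_compose[OF L(1) continuous_on_subset[OF K(1) L(3)]])
  moreover have "(K \<circ> L) holomorphic_on ball 0 1"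
    by (rule holomorphic_on_compose_gen[OF L(2) K(2) L.maps_ball])
  moreover have "(K \<circ> L) ` cball 0 1 \<subseteq> cball 0 1" using K(3) L(3) by (auto simp: image_subset_iff)
  moreover have "(K \<circ> L) z = (k \<circ> l) z" if "z \<in> S1" for z
    using that L(4) K(4) bij_betwE[OF DplusE(1)[OF l]] by simp
  ultimately show ?thesis
    unfolding Dplus_def mem_Collect_eq
    using bij_betw_trans[OF DplusE(1)[OF l] DplusE(1)[OF k]]
    by (intro conjI exI[of _ "K \<circ> L"]) (auto simp: periodic_smooth_def)
qed

section \<open>The action of disc diffeomorphisms\<close>

locale sharp_setting = holomorphic_splitting G Lp Lm
  for G :: "(complex^'n^'n) set" and Lp Lm :: "(complex \<Rightarrow> complex^'n^'n) set" +
  fixes \<epsilon> :: real and C :: "complex \<Rightarrow> complex^'n^'n"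
  assumes hom: "local_hom G \<epsilon> C"
begin

lemma \<epsilon>_pos: "\<epsilon> > 0" and C_smooth: "smooth_on {-\<epsilon><..<\<epsilon>} (ang C)"
  and C_G: "x \<in> arc \<epsilon> \<Longrightarrow> C x \<in> G"
  and C_mult: "x \<in> arc \<epsilon> \<Longrightarrow> y \<in> arc \<epsilon> \<Longrightarrow> x * y \<in> arc \<epsilon> \<Longrightarrow> C (x * y) = C x ** C y"
  using hom unfolding local_hom_def by blast+

lemma one_arc: "1 \<in> arc \<epsilon>"
  using arcI[of 0 \<epsilon>] \<epsilon>_pos by simp

lemma C_one: "C 1 = mat 1"
proof -
  have "C 1 = C 1 ** C 1" using C_mult[OF one_arc one_arc] one_arc by simp
  then have "matrix_inv (C 1) ** C 1 = matrix_inv (C 1) ** C 1 ** C 1" by (simp flip: matrix_mul_assoc)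
  then show ?thesis using matrix_inv_works(2)[OF G_invertible[OF C_G[OF one_arc]]] by simp
qed

lemma ang_div_periodic_smooth:
  assumes "ang \<kappa> \<in> periodic_smooth" shows "(\<lambda>\<theta>. \<kappa> (cis \<theta>) / cis \<theta>) \<in> periodic_smooth"
  using periodic_smooth_bilinear[OF bounded_bilinear_mult assms ang_powi_periodic_smooth[of "-1"]]
  by (simp add: divide_inverse power_int_minus)

lemma diamond_loops:
  assumes f: "f \<in> loops G" and k: "k \<in> Dplus" "diamond_defined \<epsilon> k"
  shows "diamond C (inv_into S1 k) f \<in> loops G"
  unfolding diamond_def restrict_loops_iff
proof
  have "C (inv_into S1 k z / z) \<in> G" if "z \<in> S1" for z
    using k(2) that by (intro C_G) (simp add: diamond_defined_def)
  then show "\<forall>z\<in>S1. f (inv_into S1 k z) ** C (inv_into S1 k z / z) \<in> G"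
    using G_mult loops_mem[OF f DplusE(4)[OF k(1)]] by blast
  show "(\<lambda>\<theta>. f (inv_into S1 k (cis \<theta>)) ** C (inv_into S1 k (cis \<theta>) / cis \<theta>)) \<in> periodic_smooth"
  proof (rule periodic_smooth_bilinear[OF matrix_mul_bounded_bilinear])
    show "(\<lambda>\<theta>. f (inv_into S1 k (cis \<theta>))) \<in> periodic_smooth"
      by (rule periodic_smooth_substitute_loop[OF loops_periodic_smooth[OF f] DplusE(3)[OF k(1)]
            DplusE(4)[OF k(1) cis_in_S1]])
    show "(\<lambda>\<theta>. C (inv_into S1 k (cis \<theta>) / cis \<theta>)) \<in> periodic_smooth"
      by (rule periodic_smooth_substitute[OF C_smooth ang_div_periodic_smooth[OF DplusE(3)[OF k(1)]]])
        (use k(2) in \<open>simp add: diamond_defined_def\<close>)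
  qed
qed

section \<open>The big cell and its factorization\<close>

text \<open>The inverse of \<open>gp'\<close> times \<open>gp\<close> equals \<open>gm'\<close>
  times the inverse of \<open>gm\<close>. This loop lies in \<open>Lp \<inter> Lm\<close> and is
  therefore \<open>loop_one\<close>.\<close>

lemma factor_unique:
  assumes "gp \<in> Lp" "gm \<in> Lm" "gp' \<in> Lp" "gm' \<in> Lm" "loop_mult gp gm = loop_mult gp' gm'"
  shows "gp = gp'" "gm = gm'"
proof -
  note L = plus.H_loops[OF assms(1)] minus.H_loops[OF assms(2)] plus.H_loops[OF assms(3)] minus.H_loops[OF assms(4)]
  let ?q = "loop_mult (loop_inv gp') gp"
  have "loop_mult ?q gm = loop_mult (loop_inv gp') (loop_mult gp' gm')"
    by (simp add: loop_mult_assoc assms(5))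
  also have "\<dots> = gm'"
    by (simp add: loop_mult_assoc[symmetric] loop_mult_inv[OF L(3)] loop_mult_one[OF L(4)])
  finally have qgm: "loop_mult ?q gm = gm'" .
  have "?q = loop_mult (loop_mult ?q gm) (loop_inv gm)"
    by (simp add: loop_mult_assoc loop_mult_inv[OF L(2)] loop_mult_one[OF L(1)])
  also have "\<dots> = loop_mult gm' (loop_inv gm)" by (simp only: qgm)
  finally have "?q \<in> Lm" using minus.H_mult[OF assms(4) minus.H_inv[OF assms(2)]] by simp
  moreover have "?q \<in> Lp" by (rule plus.H_mult[OF plus.H_inv[OF assms(3)] assms(1)])
  moreover have "Lp \<inter> Lm = {loop_one}" using split by (simp add: splitting_def)
  ultimately have q: "?q = loop_one" by blast
  show "gm = gm'" using qgm by (simp add: q loop_mult_one[OF L(2)])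
  have "loop_mult gp' ?q = gp"
    by (simp add: loop_mult_assoc[symmetric] loop_mult_inv[OF L(3)] loop_mult_one[OF L(1)])
  then show "gp = gp'" by (simp add: q loop_mult_one[OF L(3)])
qed

lemma minus_factor_eq:
  assumes "gp \<in> Lp" "gm \<in> Lm" shows "minus_factor Lp Lm (loop_mult gp gm) = gm"
  unfolding minus_factor_def
  by (rule the_equality) (use assms factor_unique(2) in blast)+

lemma big_cellI: "gp \<in> Lp \<Longrightarrow> gm \<in> Lm \<Longrightarrow> loop_mult gp gm \<in> big_cell Lp Lm"
  unfolding big_cell_def by blast

lemma big_cell_factor:
  assumes "h \<in> big_cell Lp Lm"
  obtains gp where "gp \<in> Lp" "minus_factor Lp Lm h \<in> Lm" "h = loop_mult gp (minus_factor Lp Lm h)"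
proof -
  obtain gp gm where "gp \<in> Lp" "gm \<in> Lm" "h = loop_mult gp gm" using assms unfolding big_cell_def by blast
  then show ?thesis using minus_factor_eq that by simp
qed

text \<open>A left factor from \<open>Lp\<close> is absorbed into the plus part. The backward
  implication of the equivalence is the forward one for the inverse of p.\<close>

lemma big_cell_plus_mult:
  assumes p: "p \<in> Lp" and h: "h \<in> loops G"
  shows "loop_mult p h \<in> big_cell Lp Lm \<longleftrightarrow> h \<in> big_cell Lp Lm"
    and "h \<in> big_cell Lp Lm \<Longrightarrow> minus_factor Lp Lm (loop_mult p h) = minus_factor Lp Lm h"
proof -
  have ph: "loop_mult (loop_inv p) (loop_mult p h) = h"
    by (simp add: loop_mult_assoc[symmetric] loop_mult_inv[OF plus.H_loops[OF p]] loop_mult_one[OF h])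
  have imp: "loop_mult q g \<in> big_cell Lp Lm \<and> minus_factor Lp Lm (loop_mult q g) = minus_factor Lp Lm g"
    if "q \<in> Lp" "g \<in> big_cell Lp Lm" for q g
  proof -
    obtain gp gm where g: "gp \<in> Lp" "gm \<in> Lm" "g = loop_mult gp gm" using \<open>g \<in> _\<close> unfolding big_cell_def by blast
    have "loop_mult q g = loop_mult (loop_mult q gp) gm" by (simp add: g(3) loop_mult_assoc)
    moreover have "loop_mult q gp \<in> Lp" by (rule plus.H_mult[OF \<open>q \<in> Lp\<close> g(1)])
    ultimately show ?thesis using big_cellI g minus_factor_eq by simp
  qed
  show "loop_mult p h \<in> big_cell Lp Lm \<longleftrightarrow> h \<in> big_cell Lp Lm"
    using imp[OF p] imp[OF plus.H_inv[OF p], of "loop_mult p h"] ph by auto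
  show "minus_factor Lp Lm (loop_mult p h) = minus_factor Lp Lm h" if "h \<in> big_cell Lp Lm"
    using imp[OF p that] by blast
qed

lemma loop_one_mult: "f \<in> Lm \<Longrightarrow> loop_mult loop_one f = f"
  using loop_mult_one(2)[OF minus.H_loops] .

lemma inv_into_id: "z \<in> S1 \<Longrightarrow> inv_into S1 id z = z"
  using inv_into_f_f[of id S1 z] by simp

section \<open>The local action\<close>

lemma sharp_id:
  assumes f: "f \<in> Lm"
  shows "sharp_defined Lp Lm \<epsilon> C id f" "sharp Lp Lm C id f = f"
proof -
  have "f z ** C (z / z) = f z" if "z \<in> S1" for z
  proof -
    have "z \<noteq> 0" using that by auto
    then show ?thesis by (simp add: C_one)
  qed
  then have d: "diamond C (inv_into S1 id) f = loop_mult loop_one f"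
    using loops_restrict[OF minus.H_loops[OF f]]
    by (simp add: diamond_def inv_into_id loop_one_mult[OF f] cong: restrict_cong)
  have "diamond_defined \<epsilon> id"
    unfolding diamond_defined_def using one_arc inv_into_id
    by (metis (no_types, lifting) divide_self_if dist_0_norm mem_sphere norm_zero zero_neq_one)
  then show "sharp_defined Lp Lm \<epsilon> C id f"
    unfolding sharp_defined_def d using Dplus_id big_cellI[OF plus.H_one f] by blast
  show "sharp Lp Lm C id f = f"
    unfolding sharp_def d by (rule minus_factor_eq[OF plus.H_one f])
qed

lemma plus_compose_inverse:
  assumes g: "g \<in> Lp" and k: "k \<in> Dplus"
  shows "(\<lambda>z\<in>S1. g (inv_into S1 k z)) \<in> Lp"
proof (rule Dplus_inverse_extension[OF k])
  fix L assume L: "continuous_on (cball 0 1) L" "L holomorphic_on ball 0 1"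
    "L ` cball 0 1 \<subseteq> cball 0 1" "L ` ball 0 1 \<subseteq> ball 0 1" "\<And>z. z \<in> S1 \<Longrightarrow> L z = inv_into S1 k z"
  obtain F where F: "disc_extension G g F" using g unfolding Lp_eq Lplus_iff by blast
  have eq: "(\<lambda>z\<in>S1. F (L z)) = (\<lambda>z\<in>S1. g (inv_into S1 k z))"
    using F DplusE(4)[OF k] by (auto simp: L(5) disc_extension_def cong: restrict_cong)
  have "(\<lambda>z\<in>S1. g (inv_into S1 k z)) \<in> loops G"
    unfolding restrict_loops_iff
  proof
    show "\<forall>z\<in>S1. g (inv_into S1 k z) \<in> G" using loops_mem[OF plus.H_loops[OF g] DplusE(4)[OF k]] by blast
    show "(\<lambda>\<theta>. g (inv_into S1 k (cis \<theta>))) \<in> periodic_smooth"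
      by (rule periodic_smooth_substitute_loop[OF loops_periodic_smooth[OF plus.H_loops[OF g]]
            DplusE(3)[OF k] DplusE(4)[OF k cis_in_S1]])
  qed
  then show ?thesis using Lplus_substitute[OF F L(1-4)] unfolding eq Lp_eq by blast
qed

text \<open>A cocycle identity. With y the preimage of z under k and x that of y under l, the ratio
  x / z is the product of x / y and y / z; multiplicativity of C applies as all three ratios lie in
  the arc, which the hypotheses on l, k and their composite ensure.\<close>

lemma diamond_compose:
  assumes f: "f \<in> Lm" and k: "k \<in> Dplus" "diamond_defined \<epsilon> k" and l: "l \<in> Dplus" "diamond_defined \<epsilon> l"
    and kl: "diamond_defined \<epsilon> (k \<circ> l)" and g: "diamond C (inv_into S1 l) f = loop_mult gp gm"
  shows "diamond C (inv_into S1 (k \<circ> l)) f =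
    loop_mult (\<lambda>z\<in>S1. gp (inv_into S1 k z)) (diamond C (inv_into S1 k) gm)"
proof
  fix z
  show "diamond C (inv_into S1 (k \<circ> l)) f z =
    loop_mult (\<lambda>z\<in>S1. gp (inv_into S1 k z)) (diamond C (inv_into S1 k) gm) z"
  proof (cases "z \<in> S1")
    case True
    define y where "y = inv_into S1 k z"
    define x where "x = inv_into S1 l y"
    have y: "y \<in> S1" unfolding y_def by (rule DplusE(4)[OF k(1) True])
    have nz: "y \<noteq> 0" "z \<noteq> 0" using y True by auto
    have x_eq: "inv_into S1 (k \<circ> l) z = x" unfolding x_def y_def by (rule Dplus_compose_inv[OF k(1) l(1) True])
    have "x / y \<in> arc \<epsilon>" using l(2) y by (simp add: diamond_defined_def x_def)
    moreover have "y / z \<in> arc \<epsilon>" using k(2) True by (simp add: diamond_defined_def y_def)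
    moreover have "x / y * (y / z) = x / z" using nz by simp
    moreover have "x / z \<in> arc \<epsilon>" 
      using bspec[OF kl[unfolded diamond_defined_def] True] by (simp only: x_eq)
    ultimately have C: "C (x / z) = C (x / y) ** C (y / z)" using C_mult[of "x / y" "y / z"] by (simp only:)
    have "f x ** C (x / y) = gp y ** gm y"
      using fun_cong[OF g, of y] y by (simp add: diamond_def loop_mult_def x_def)
    then have "f x ** C (x / z) = gp y ** (gm y ** C (y / z))" by (simp add: C matrix_mul_assoc)
    then show ?thesis using True by (simp add: diamond_def loop_mult_def x_eq y_def[symmetric])
  qed (simp add: diamond_def loop_mult_def)
qed

lemma sharp_compose:
  assumes f: "f \<in> Lm" and k: "k \<in> Dplus" "diamond_defined \<epsilon> k" and l: "l \<in> Dplus"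
    and kl: "diamond_defined \<epsilon> (k \<circ> l)" and def_l: "sharp_defined Lp Lm \<epsilon> C l f"
  shows "sharp_defined Lp Lm \<epsilon> C (k \<circ> l) f \<longleftrightarrow> sharp_defined Lp Lm \<epsilon> C k (sharp Lp Lm C l f)"
    and "sharp_defined Lp Lm \<epsilon> C (k \<circ> l) f \<Longrightarrow>
      sharp Lp Lm C (k \<circ> l) f = sharp Lp Lm C k (sharp Lp Lm C l f)"
proof -
  have dl: "diamond_defined \<epsilon> l" "diamond C (inv_into S1 l) f \<in> big_cell Lp Lm"
    using def_l by (auto simp: sharp_defined_def)
  define gm where "gm = sharp Lp Lm C l f"
  obtain gp where g: "gp \<in> Lp" "gm \<in> Lm" "diamond C (inv_into S1 l) f = loop_mult gp gm"
    using big_cell_factor[OF dl(2)] unfolding gm_def sharp_def by blast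
  let ?p = "\<lambda>z\<in>S1. gp (inv_into S1 k z)" and ?h = "diamond C (inv_into S1 k) gm"
  have eq: "diamond C (inv_into S1 (k \<circ> l)) f = loop_mult ?p ?h"
    by (rule diamond_compose[OF f k l dl(1) kl g(3)])
  have p: "?p \<in> Lp" by (rule plus_compose_inverse[OF g(1) k(1)])
  have h: "?h \<in> loops G" by (rule diamond_loops[OF minus.H_loops[OF g(2)] k])
  show iff: "sharp_defined Lp Lm \<epsilon> C (k \<circ> l) f \<longleftrightarrow> sharp_defined Lp Lm \<epsilon> C k (sharp Lp Lm C l f)"
    unfolding sharp_defined_def gm_def[symmetric] eq big_cell_plus_mult(1)[OF p h]
    using Dplus_compose[OF k(1) l] k kl by blast
  show "sharp Lp Lm C (k \<circ> l) f = sharp Lp Lm C k (sharp Lp Lm C l f)"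
    if "sharp_defined Lp Lm \<epsilon> C (k \<circ> l) f"
  proof -
    have "?h \<in> big_cell Lp Lm" using that unfolding iff by (simp add: sharp_defined_def gm_def)
    from big_cell_plus_mult(2)[OF p h this]
    show ?thesis unfolding sharp_def[of _ _ _ "k \<circ> l"] sharp_def[of _ _ _ k] eq gm_def[symmetric] .
  qed
qed

text \<open>The hypothesis on the big cell concerns loops near \<open>loop_one\<close>, while the
  diamond of f under \<open>k m\<close> is near f. Multiplying on the right by the inverse of f
  moves it near \<open>loop_one\<close>, and multiplying back keeps it in the big cell because f is
  in \<open>Lm\<close>.\<close>

lemma sharp_defined_near_identity:
  assumes near: "big_cell_near_one G Lp Lm" and f: "f \<in> Lm" and k: "\<And>m::nat. k m \<in> Dplus"
    and lim: "loop_tendsto (\<lambda>m. inv_into S1 (k m)) id sequentially"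
  shows "\<forall>\<^sub>F m in sequentially. sharp_defined Lp Lm \<epsilon> C (k m) f"
proof -
  let ?\<kappa> = "\<lambda>m. inv_into S1 (k m)"
  note fps = loops_periodic_smooth[OF minus.H_loops[OF f]]
  note \<kappa> = DplusE(3)[OF k] DplusE(4)[OF k]
  have conv: "smooth_conv (\<lambda>m. ang (?\<kappa> m)) cis sequentially" using lim by (simp add: loop_tendsto_iff)
  have 1: "smooth_conv (\<lambda>m \<theta>. f (?\<kappa> m (cis \<theta>))) (ang f) sequentially"
    by (rule smooth_conv_substitute(1)[of 4, OF smooth_on_subset[OF periodic_smooth_smooth[OF fps] subset_UNIV]
          ang_id_periodic_smooth _ \<kappa>(1) \<kappa>(2)[OF cis_in_S1] conv])
      (simp only: S1_eq_arc[symmetric] cis_in_S1)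
  have "(\<lambda>\<theta>. inverse (cis \<theta>)) = ang (\<lambda>z. z powi (-1))" by (simp add: power_int_minus)
  then have inv_ps: "(\<lambda>\<theta>. inverse (cis \<theta>)) \<in> periodic_smooth"
    using ang_powi_periodic_smooth[of "-1"] by (simp only:)
  have "smooth_conv (\<lambda>m \<theta>. ?\<kappa> m (cis \<theta>) * inverse (cis \<theta>)) (\<lambda>\<theta>. cis \<theta> * inverse (cis \<theta>)) sequentially"
    by (rule smooth_conv_bilinear[OF bounded_bilinear_mult conv smooth_conv_const
          always_eventually[OF allI[OF \<kappa>(1)]] always_eventually[OF allI[OF inv_ps]]
          ang_id_periodic_smooth inv_ps])
  moreover have "cis \<theta> * inverse (cis \<theta>) = 1" for \<theta> by (rule right_inverse) simp
  ultimately have wconv: "smooth_conv (\<lambda>m \<theta>. ?\<kappa> m (cis \<theta>) / cis \<theta>) (\<lambda>\<theta>. 1) sequentially"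
    by (simp only: divide_inverse)
  have wS1: "?\<kappa> m (cis \<theta>) / cis \<theta> \<in> S1" for m \<theta> using \<kappa>(2)[OF cis_in_S1, of m \<theta>] by (simp add: norm_divide)
  note sub = smooth_conv_substitute[OF C_smooth periodic_smooth_const one_arc
      ang_div_periodic_smooth[OF \<kappa>(1)] wS1 wconv]
  have ev: "\<forall>\<^sub>F m in sequentially. diamond_defined \<epsilon> (k m)"
    using sub(2)
  proof eventually_elim
    case (elim m)
    then show ?case unfolding diamond_defined_def by (auto elim!: S1_cases)
  qed
  have Cps: "\<forall>\<^sub>F m in sequentially. (\<lambda>\<theta>. C (?\<kappa> m (cis \<theta>) / cis \<theta>)) \<in> periodic_smooth"
    using sub(2)
    by eventually_elim
      (rule periodic_smooth_substitute[OF C_smooth ang_div_periodic_smooth[OF \<kappa>(1)]], blast)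
  have f\<kappa>ps: "(\<lambda>\<theta>. f (?\<kappa> m (cis \<theta>))) \<in> periodic_smooth" for m
    by (rule periodic_smooth_substitute_loop[OF fps \<kappa>(1) \<kappa>(2)[OF cis_in_S1]])
  have dconv: "smooth_conv (\<lambda>m \<theta>. f (?\<kappa> m (cis \<theta>)) ** C (?\<kappa> m (cis \<theta>) / cis \<theta>)) (\<lambda>\<theta>. f (cis \<theta>) ** C 1) sequentially"
    by (rule smooth_conv_bilinear[OF matrix_mul_bounded_bilinear 1 sub(1) _ Cps fps periodic_smooth_const])
      (simp add: f\<kappa>ps)
  have dps: "\<forall>\<^sub>F m in sequentially. (\<lambda>\<theta>. f (?\<kappa> m (cis \<theta>)) ** C (?\<kappa> m (cis \<theta>) / cis \<theta>)) \<in> periodic_smooth"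
    using Cps by eventually_elim (rule periodic_smooth_bilinear[OF matrix_mul_bounded_bilinear f\<kappa>ps])
  have ips: "(\<lambda>\<theta>. loop_inv f (cis \<theta>)) \<in> periodic_smooth"
    by (rule loops_periodic_smooth[OF minus.H_loops[OF minus.H_inv[OF f]]])
  have "smooth_conv (\<lambda>m \<theta>. f (?\<kappa> m (cis \<theta>)) ** C (?\<kappa> m (cis \<theta>) / cis \<theta>) ** loop_inv f (cis \<theta>))
      (\<lambda>\<theta>. f (cis \<theta>) ** C 1 ** loop_inv f (cis \<theta>)) sequentially"
    by (rule smooth_conv_bilinear[OF matrix_mul_bounded_bilinear dconv smooth_conv_const dps _ _ ips])
      (simp_all add: ips C_one fps)
  moreover have "f (cis \<theta>) ** C 1 ** loop_inv f (cis \<theta>) = mat 1" for \<theta>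
    by (simp add: C_one loop_inv_def matrix_inv_works minus.H_invertible[OF f])
  ultimately have uconv: "smooth_conv (\<lambda>m \<theta>. f (?\<kappa> m (cis \<theta>)) ** C (?\<kappa> m (cis \<theta>) / cis \<theta>) ** loop_inv f (cis \<theta>))
      (\<lambda>\<theta>. mat 1) sequentially" by simp
  \<comment> \<open>The hypothesis on the big cell needs a sequence all of whose terms are loops in
    G. The first terms, where the diamond may be undefined, are set to
    \<open>loop_one\<close>.\<close>
  define u where "u = (\<lambda>m. if diamond_defined \<epsilon> (k m)
      then loop_mult (diamond C (?\<kappa> m) f) (loop_inv f) else loop_one)"
  have "u m \<in> loops G" for m
    unfolding u_def
    using loop_mult_loops[OF diamond_loops[OF minus.H_loops[OF f] k] loop_inv_loops[OF minus.H_loops[OF f]]]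
      loop_one_loops by simp
  moreover have "loop_tendsto u loop_one sequentially"
  proof -
    have "\<forall>\<^sub>F m in sequentially. (\<lambda>\<theta>. f (?\<kappa> m (cis \<theta>)) ** C (?\<kappa> m (cis \<theta>) / cis \<theta>) ** loop_inv f (cis \<theta>)) = ang (u m)"
      using ev by eventually_elim (simp add: u_def loop_mult_def diamond_def)
    from iffD1[OF smooth_conv_cong[OF this] uconv] show ?thesis by (simp add: loop_tendsto_iff loop_one_def)
  qed
  ultimately have "\<forall>\<^sub>F m in sequentially. u m \<in> big_cell Lp Lm"
    using near unfolding big_cell_near_one_def by blast
  with ev show ?thesis
  proof eventually_elim
    case (elim m)
    let ?d = "diamond C (?\<kappa> m) f"
    have d: "?d \<in> loops G" by (rule diamond_loops[OF minus.H_loops[OF f] k elim(1)])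
    obtain gp gm where g: "gp \<in> Lp" "gm \<in> Lm" "loop_mult ?d (loop_inv f) = loop_mult gp gm"
      using elim by (auto simp: u_def big_cell_def)
    have "?d = loop_mult (loop_mult ?d (loop_inv f)) f"
      by (simp add: loop_mult_assoc loop_mult_inv[OF minus.H_loops[OF f]] loop_mult_one[OF d])
    also have "\<dots> = loop_mult gp (loop_mult gm f)" by (simp only: g(3) loop_mult_assoc)
    finally have "?d \<in> big_cell Lp Lm" using big_cellI[OF g(1) minus.H_mult[OF g(2) f]] by simp
    then show ?case using k elim(1) by (simp add: sharp_defined_def)
  qed
qed

end

section \<open>The infinitesimal vector fields\<close>

lemma dtheta_diff:
  assumes f: "f \<in> loops A" and g: "g \<in> loops B" and "z \<in> S1"
    and h: "\<And>z. z \<in> S1 \<Longrightarrow> h z = f z - g z"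
  shows "dtheta h z = dtheta f z - dtheta g z"
proof (rule dtheta_eqI[OF _ \<open>z \<in> S1\<close>, of h "\<lambda>z. dtheta f z - dtheta g z"])
  fix \<theta>
  have "ang h = (\<lambda>\<theta>. f (cis \<theta>) - g (cis \<theta>))" using h by simp
  then show "(ang h has_vector_derivative dtheta f (cis \<theta>) - dtheta g (cis \<theta>)) (at \<theta>)"
    using has_vector_derivative_diff[OF dtheta_has_vector_derivative[OF f] dtheta_has_vector_derivative[OF g]]
    by simp
qed

lemma dtheta_bilinear:
  assumes B: "bounded_bilinear B" and f: "ang f \<in> periodic_smooth" and g: "ang g \<in> periodic_smooth"
    and z: "z \<in> S1" and h: "\<And>z. z \<in> S1 \<Longrightarrow> h z = B (f z) (g z)"
  shows "dtheta h z = B (dtheta f z) (g z) + B (f z) (dtheta g z)"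
proof (rule dtheta_eqI[OF _ z, of h "\<lambda>z. B (dtheta f z) (g z) + B (f z) (dtheta g z)"])
  fix \<theta>
  have "ang h = (\<lambda>\<theta>. B (f (cis \<theta>)) (g (cis \<theta>)))" using h by simp
  then show "(ang h has_vector_derivative B (dtheta f (cis \<theta>)) (g (cis \<theta>)) + B (f (cis \<theta>)) (dtheta g (cis \<theta>))) (at \<theta>)"
    using bounded_bilinear.has_vector_derivative[OF B periodic_smooth_has_vector_derivative[OF f]
        periodic_smooth_has_vector_derivative[OF g], of \<theta>]
    by (simp add: dtheta_cis add.commute)
qed

lemma dtheta_vir_mult:
  assumes "z \<in> S1" shows "dtheta (vir_mult j) z = \<i> * of_int j * vir_mult j z"
proof (rule dtheta_eqI[OF _ assms, of "vir_mult j" "\<lambda>z. \<i> * of_int j * vir_mult j z"])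
  fix \<theta>
  have "((\<lambda>\<theta>. of_int j * \<theta>) has_vector_derivative of_int j) (at \<theta>)"
    by (auto intro!: derivative_eq_intros simp: has_real_derivative_iff_has_vector_derivative[symmetric])
  from vector_diff_chain_at[OF this cis_has_vector_derivative]
  have "((\<lambda>\<theta>. cis (of_int j * \<theta>)) has_vector_derivative of_int j *\<^sub>R (\<i> * cis (of_int j * \<theta>))) (at \<theta>)"
    by (simp add: o_def)
  from bounded_linear.has_vector_derivative[OF bounded_linear_mult_right[of "- \<i>"] this]
  show "(ang (vir_mult j) has_vector_derivative \<i> * of_int j * vir_mult j (cis \<theta>)) (at \<theta>)"
    by (simp add: vir_mult_def cis_power_int scaleR_conv_of_real mult_ac)
qed

lemma vir_mult_prod: "z \<in> S1 \<Longrightarrow> \<i> * vir_mult j z * vir_mult k z = vir_mult (j + k) z"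
proof -
  assume "z \<in> S1"
  then have "z \<noteq> 0" by auto
  then show ?thesis by (simp add: vir_mult_def power_int_add mult_ac)
qed

context sharp_setting
begin

text \<open>At \<lambda> = 1 the angular derivative is i times the derivative in \<lambda>, so this
  is i C'(1).\<close>

definition A0 :: "complex^'n^'n" where "A0 = dtheta C 1"

text \<open>The gauge transform of the constant \<open>A0\<close> by f. All dependence of
  \<open>X j f\<close> on f sits here, and the index j enters only through the factor
  \<open>vir_mult j\<close>.\<close>

definition Y :: "(complex \<Rightarrow> complex^'n^'n) \<Rightarrow> complex \<Rightarrow> complex^'n^'n" where
  "Y f = (\<lambda>z\<in>S1. dtheta f z ** matrix_inv (f z) + f z ** A0 ** matrix_inv (f z))"

definition X :: "int \<Rightarrow> (complex \<Rightarrow> complex^'n^'n) \<Rightarrow> complex \<Rightarrow> complex^'n^'n" where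
  "X j f = (\<lambda>z\<in>S1. cscale (z powi (j + 1)) (circle_deriv f z ** matrix_inv (f z)) +
     cscale (z powi j) (f z ** circle_deriv C 1 ** matrix_inv (f z)))"

definition Z :: "int \<Rightarrow> (complex \<Rightarrow> complex^'n^'n) \<Rightarrow> complex \<Rightarrow> complex^'n^'n" where
  "Z j f = (\<lambda>z\<in>S1. - (P (X j f) z ** f z))"

lemma X_eq: "X j f = (\<lambda>z\<in>S1. cscale (vir_mult j z) (Y f z))"
proof
  fix z
  show "X j f z = (\<lambda>z\<in>S1. cscale (vir_mult j z) (Y f z)) z"
  proof (cases "z \<in> S1")
    case True
    then have nz: "z \<noteq> 0" by auto
    have c: "z powi (j + 1) * (1 / (\<i> * z)) = vir_mult j z" "z powi j * (1 / (\<i> * 1)) = vir_mult j z"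
      using nz by (simp_all add: vir_mult_def power_int_add field_simps)
    have one: "(1 :: complex) \<in> S1" by simp
    show ?thesis
      using True
      by (simp only: X_def Y_def A0_def restrict_apply if_True circle_deriv_dtheta[OF True]
          circle_deriv_dtheta[OF one] cscale_mult_left cscale_mult_right cscale_cscale c cscale.add_right)
  qed (simp add: X_def)
qed

lemma A0_LG: "A0 \<in> LG"
proof (rule lie_algebra_local)
  have "\<forall>\<^sub>F s in nhds 0. s \<in> {-\<epsilon><..<\<epsilon>}" using \<epsilon>_pos by (intro eventually_nhds_in_open) auto
  then show "\<forall>\<^sub>F s in nhds 0. C (cis s) \<in> G"
    by eventually_elim (rule C_G[OF arcI], simp add: abs_less_iff)
  show "C (cis 0) = mat 1" by (simp add: C_one)
  have "(ang C has_vector_derivative dtheta C (cis 0)) (at 0)"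
    unfolding dtheta_cis by (rule smooth_on_has_vector_derivative[OF C_smooth]) (use \<epsilon>_pos in auto)
  then show "((\<lambda>s. C (cis s)) has_vector_derivative A0) (at 0)" by (simp add: A0_def)
qed

lemma Y_loops:
  assumes f: "f \<in> Lm" shows "Y f \<in> loops LG"
  unfolding Y_def restrict_loops_iff
proof
  note fG = minus.H_loops[OF f]
  note fps = loops_periodic_smooth[OF fG]
  have ips: "(\<lambda>\<theta>. matrix_inv (f (cis \<theta>))) \<in> periodic_smooth"
    by (rule loop_inv_periodic_smooth[OF fps loop_invertible[OF fG cis_in_S1]])
  note ps = periodic_smooth_bilinear[OF matrix_mul_bounded_bilinear]
  show "\<forall>z\<in>S1. dtheta f z ** matrix_inv (f z) + f z ** A0 ** matrix_inv (f z) \<in> LG"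
  proof
    fix z :: complex assume z: "z \<in> S1"
    then obtain \<theta> where \<theta>: "z = cis \<theta>" by (rule S1_cases)
    have "dtheta f (cis \<theta>) ** matrix_inv (f (cis \<theta>)) \<in> LG"
      by (rule lie_algebra_translate[OF loops_mem[OF fG cis_in_S1] dtheta_has_vector_derivative[OF fG]])
    then show "dtheta f z ** matrix_inv (f z) + f z ** A0 ** matrix_inv (f z) \<in> LG"
      unfolding \<theta> by (rule subspace_add[OF lie_algebra_subspace _ lie_algebra_Ad[OF loops_mem[OF fG cis_in_S1] A0_LG]])
  qed
  show "(\<lambda>\<theta>. dtheta f (cis \<theta>) ** matrix_inv (f (cis \<theta>)) + f (cis \<theta>) ** A0 ** matrix_inv (f (cis \<theta>))) \<in> periodic_smooth"
    by (rule periodic_smooth_add[OF ps[OF loops_periodic_smooth[OF dtheta_loops[OF fG]] ips]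
          ps[OF ps[OF fps periodic_smooth_const] ips]])
qed

lemma multiplier_loops:
  assumes "\<xi> \<in> loops LG" shows "(\<lambda>z\<in>S1. cscale (vir_mult j z) (\<xi> z)) \<in> loops LG"
  unfolding restrict_loops_iff
proof
  show "\<forall>z\<in>S1. cscale (vir_mult j z) (\<xi> z) \<in> LG" using lie_algebra_cscale loops_mem[OF assms] by blast
  show "(\<lambda>\<theta>. cscale (vir_mult j (cis \<theta>)) (\<xi> (cis \<theta>))) \<in> periodic_smooth"
    by (rule periodic_smooth_bilinear[OF cscale_bounded_bilinear vir_mult_periodic_smooth loops_periodic_smooth[OF assms]])
qed

lemma X_loops: "f \<in> Lm \<Longrightarrow> X j f \<in> loops LG"
  unfolding X_eq by (rule multiplier_loops[OF Y_loops])

lemma P_neg: "\<xi> \<in> loops LG \<Longrightarrow> P (\<lambda>z\<in>S1. - \<xi> z) = (\<lambda>z\<in>S1. - P \<xi> z)"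
  using P_scaleR[of \<xi> "-1"] by simp

text \<open>\<open>Z j f\<close> is the right translate by f of an element of the minus algebra, so
  it is realized by a curve in \<open>Lm\<close>. Its smoothness and tangency, and later the
  membership of \<open>DX\<close> in the loop algebra, are read off from such a curve.\<close>

lemma Z_velocity_curve:
  assumes f: "f \<in> Lm"
  obtains c where "\<And>s. c s \<in> Lm" "c 0 = f" "has_velocity c (Z j f)"
proof -
  have \<eta>: "(\<lambda>z\<in>S1. - P (X j f) z) \<in> minus.LH" by (rule minus.LH_minus[OF P_minus_LH[OF X_loops[OF f]]])
  have eq: "(\<lambda>z\<in>S1. (\<lambda>z\<in>S1. - P (X j f) z) z ** f z) = Z j f"
    by (auto simp: Z_def matmul.minus_left)
  show ?thesis
  proof (rule minus.tangent_curve[OF f \<eta>])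
    fix c assume c: "\<And>s. c s \<in> Lm" "c 0 = f"
      "has_velocity c (\<lambda>z\<in>S1. (\<lambda>z\<in>S1. - P (X j f) z) z ** f z)"
    show thesis by (rule that[of c]) (use c eq in simp_all)
  qed
qed

text \<open>The velocity at s = 0 of s \<mapsto> k_s \<diamondop> f, before the passage to the minus
  factor.\<close>

definition W :: "int \<Rightarrow> (complex \<Rightarrow> complex^'n^'n) \<Rightarrow> complex \<Rightarrow> complex^'n^'n" where
  "W j f = (\<lambda>z\<in>S1. - (X j f z ** f z))"

lemma diamond_flow_curve_velocity:
  assumes f: "f \<in> Lm" and a: "diamond_flow_curve \<epsilon> C j f a"
  shows "has_velocity a (W j f)" "a 0 = f"
proof -
  obtain U F V C' \<delta> \<kappa> where *: "complex_extension S1 f U F" "complex_extension (arc \<epsilon>) C V C'"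
    "inverse_flow j \<delta> \<kappa>" "a = (\<lambda>s. diamond C' (\<kappa> s) F)"
    using a unfolding diamond_flow_curve_def by blast
  note v = diamond_flow_velocity[OF loops_UNIV[OF minus.H_loops[OF f]] C_smooth \<epsilon>_pos C_one *(1,2,3)]
  show "a 0 = f" using v(2) *(4) by simp
  have "W j f = (\<lambda>z\<in>S1. - (cscale (z powi (j + 1)) (circle_deriv f z) + cscale (z powi j) (f z ** circle_deriv C 1)))"
  proof
    fix z
    show "W j f z = (\<lambda>z\<in>S1. - (cscale (z powi (j + 1)) (circle_deriv f z) + cscale (z powi j) (f z ** circle_deriv C 1))) z"
    proof (cases "z \<in> S1")
      case True
      have i: "A ** matrix_inv (f z) ** f z = A" for A
        using matrix_inv_works(2)[OF minus.H_invertible[OF f True]] by (simp flip: matrix_mul_assoc)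
      show ?thesis using True
        by (simp only: W_def X_def restrict_apply if_True matmul.add_left cscale_mult_left i)
    qed (simp add: W_def)
  qed
  then show "has_velocity a (W j f)" using v(1) *(4) by simp
qed

lemma diamond_flow_curve_exists:
  assumes f: "f \<in> Lm" shows "\<exists>a. diamond_flow_curve \<epsilon> C j f a"
proof -
  note fps = loops_periodic_smooth[OF minus.H_loops[OF f]]
  obtain U F where "complex_extension S1 f U F"
    using complex_extension_exists[OF smooth_on_subset[OF periodic_smooth_smooth[OF fps] subset_UNIV], of 4]
    unfolding S1_eq_arc by blast
  moreover obtain V C' where "complex_extension (arc \<epsilon>) C V C'"
    using complex_extension_exists[OF C_smooth] by blast
  moreover obtain \<delta> \<kappa> where "inverse_flow j \<delta> \<kappa>" using inverse_flow_exists by blast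
  ultimately show ?thesis unfolding diamond_flow_curve_def by blast
qed

text \<open>Differentiating \<open>g\<^sub>+ g\<^sub>-\<close> at \<open>s = 0\<close>, where \<open>g\<^sub>+ = e\<close> and \<open>g\<^sub>- = f\<close>, splits \<open>- X\<^sub>j\<close> into
  the velocities of \<open>g\<^sub>+\<close> and of \<open>g\<^sub>- f\<^sup>-\<^sup>1\<close>.\<close>
lemma factor_velocity:
  assumes f: "f \<in> Lm" and g: "\<And>s. gp s \<in> Lp" "\<And>s. gm s \<in> Lm" "loop_mult (gp 0) (gm 0) = f"
    and w: "has_velocity (\<lambda>s. loop_mult (gp s) (gm s)) (W j f)" and v: "has_velocity gm v"
  shows "v = Z j f"
proof -
  have "loop_mult (gp 0) (gm 0) = loop_mult loop_one f" using g(3) loop_one_mult[OF f] by simp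
  then have g0: "gp 0 = loop_one" "gm 0 = f"
    using factor_unique[OF g(1) g(2) plus.H_one f] by blast+
  have g3: "loop_mult (gp 0) f = f" using g(3) g0(2) by simp
  note inv = minus.H_invertible[OF g(2)]
  have gp_eq: "loop_mult (loop_mult (gp s) (gm s)) (loop_inv (gm s)) = gp s" for s
    by (simp add: loop_mult_assoc loop_mult_inv[OF minus.H_loops[OF g(2)]] loop_mult_one[OF plus.H_loops[OF g(1)]])
  define \<zeta> where "\<zeta> = (\<lambda>z\<in>S1. - X j f z - v z ** matrix_inv (f z))"
  define \<eta> where "\<eta> = (\<lambda>z\<in>S1. v z ** matrix_inv (f z))"
  have "has_velocity gp (\<lambda>z\<in>S1. W j f z ** loop_inv (gm 0) z +
      loop_mult (gp 0) (gm 0) z ** (\<lambda>z\<in>S1. - (matrix_inv (gm 0 z) ** v z ** matrix_inv (gm 0 z))) z)"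
    using has_velocity_mult[OF w has_velocity_inv[OF v inv]] by (simp only: gp_eq)
  moreover have "(\<lambda>z\<in>S1. W j f z ** loop_inv (gm 0) z +
      loop_mult (gp 0) (gm 0) z ** (\<lambda>z\<in>S1. - (matrix_inv (gm 0 z) ** v z ** matrix_inv (gm 0 z))) z) = \<zeta>"
  proof
    fix z
    show "(\<lambda>z\<in>S1. W j f z ** loop_inv (gm 0) z +
      loop_mult (gp 0) (gm 0) z ** (\<lambda>z\<in>S1. - (matrix_inv (gm 0 z) ** v z ** matrix_inv (gm 0 z))) z) z = \<zeta> z"
    proof (cases "z \<in> S1")
      case True
      note i = matrix_inv_works(1)[OF minus.H_invertible[OF f True]]
      have 1: "X j f z ** f z ** matrix_inv (f z) = X j f z" by (simp add: i flip: matrix_mul_assoc)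
      have 2: "f z ** (matrix_inv (f z) ** v z ** matrix_inv (f z)) = v z ** matrix_inv (f z)"
        by (simp add: matrix_mul_assoc i)
      show ?thesis
        using True
        by (simp only: restrict_apply if_True \<zeta>_def W_def loop_inv_def g3 g0(2) matmul.minus_left
            matmul.minus_right 1 2 diff_conv_add_uminus)
    qed (simp add: \<zeta>_def)
  qed
  ultimately have "has_velocity gp \<zeta>" by (simp only:)
  then have \<zeta>: "\<zeta> \<in> plus.LH" unfolding plus.LH_iff using g(1) g0(1) by blast
  have \<eta>: "\<eta> \<in> minus.LH" unfolding \<eta>_def by (rule minus.tangent_translate[OF f g(2) g0(2) v])
  have "P (\<lambda>z\<in>S1. - X j f z) = \<eta>"
    by (rule P_eqI[OF \<zeta> \<eta>]) (auto simp: \<zeta>_def \<eta>_def)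
  then have \<eta>_eq: "\<eta> = (\<lambda>z\<in>S1. - P (X j f) z)" by (simp add: P_neg[OF X_loops[OF f]])
  show ?thesis
  proof (rule Z_velocity_curve[OF f, of j], rule loops_eqI[OF has_velocityD(2)[OF v]])
    fix c assume "has_velocity c (Z j f)"
    then show "Z j f \<in> loops UNIV" by (rule has_velocityD(2))
  next
    fix z :: complex assume z: "z \<in> S1"
    have "v z = \<eta> z ** f z"
      using z matrix_inv_works(2)[OF minus.H_invertible[OF f z]] by (simp add: \<eta>_def flip: matrix_mul_assoc)
    then show "v z = Z j f z" using z by (simp add: \<eta>_eq Z_def matmul.minus_left)
  qed
qed

text \<open>Uniqueness is \<open>factor_velocity\<close>. For existence, curves in \<open>Lp\<close>
  and \<open>Lm\<close> are taken whose velocities are the ones dictated by the decomposition of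
  \<open>X j f\<close>. By the product rule they factor the diamond curve to first order, which is
  what \<open>sharp_velocity\<close> asks for.\<close>

lemma sharp_velocity_iff:
  assumes f: "f \<in> Lm" shows "sharp_velocity Lp Lm \<epsilon> C j f v \<longleftrightarrow> v = Z j f"
proof
  assume "sharp_velocity Lp Lm \<epsilon> C j f v"
  then obtain a gp gm w where *: "diamond_flow_curve \<epsilon> C j f a" "\<And>s. gp s \<in> Lp" "\<And>s. gm s \<in> Lm"
    "loop_mult (gp 0) (gm 0) = a 0" "has_velocity a w" "has_velocity (\<lambda>s. loop_mult (gp s) (gm s)) w"
    "has_velocity gm v"
    unfolding sharp_velocity_def by blast
  note a = diamond_flow_curve_velocity[OF f *(1)]
  have "w = W j f" by (rule has_velocity_unique[OF *(5) a(1)])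
  then show "v = Z j f" using factor_velocity[OF f *(2,3) _ _ *(7)] *(4,6) a(2) by simp
next
  assume v: "v = Z j f"
  obtain a where a: "diamond_flow_curve \<epsilon> C j f a" using diamond_flow_curve_exists[OF f] by blast
  note av = diamond_flow_curve_velocity[OF f a]
  have X: "X j f \<in> loops LG" by (rule X_loops[OF f])
  obtain \<zeta> where \<zeta>: "\<zeta> \<in> plus.LH" "\<And>z. z \<in> S1 \<Longrightarrow> X j f z = \<zeta> z + P (X j f) z"
    using decomposition[OF X] by blast
  obtain gp where gp: "\<And>s. gp s \<in> Lp" "gp 0 = loop_one" "has_velocity gp (\<lambda>z\<in>S1. - \<zeta> z)"
    using plus.LH_minus[OF \<zeta>(1)] unfolding plus.LH_iff by blast
  show "sharp_velocity Lp Lm \<epsilon> C j f v"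
  proof (rule Z_velocity_curve[OF f, of j])
    fix gm assume gm: "\<And>s. gm s \<in> Lm" "gm 0 = f" "has_velocity gm (Z j f)"
    have "(\<lambda>z\<in>S1. (\<lambda>z\<in>S1. - \<zeta> z) z ** gm 0 z + gp 0 z ** Z j f z) = W j f"
    proof
      fix z
      show "(\<lambda>z\<in>S1. (\<lambda>z\<in>S1. - \<zeta> z) z ** gm 0 z + gp 0 z ** Z j f z) z = W j f z"
      proof (cases "z \<in> S1")
        case True
        then show ?thesis
          using \<zeta>(2)[OF True]
          by (simp add: gm(2) gp(2) loop_one_def Z_def W_def matmul.minus_left matmul.add_left)
      qed (simp add: W_def)
    qed
    with has_velocity_mult[OF gp(3) gm(3)]
    have "has_velocity (\<lambda>s. loop_mult (gp s) (gm s)) (W j f)" by (simp only:)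
    moreover have "loop_mult (gp 0) (gm 0) = a 0" by (simp add: gp(2) gm(2) av(2) loop_one_mult[OF f])
    ultimately show ?thesis
      unfolding sharp_velocity_def v using a av(1) gp(1) gm(1,3) by blast
  qed
qed

lemma sharp_field_eq: "f \<in> Lm \<Longrightarrow> sharp_field Lp Lm \<epsilon> C j f = Z j f"
  unfolding sharp_field_def by (rule the_equality) (simp_all add: sharp_velocity_iff)

lemma minus_factor_velocity:
  assumes f: "f \<in> Lm" and a: "diamond_flow_curve \<epsilon> C j f a"
    and cell: "\<forall>\<^sub>F s in nhds 0. a s \<in> big_cell Lp Lm"
    and v: "has_velocity (\<lambda>s. minus_factor Lp Lm (a s)) v"
  shows "v = Z j f"
proof -
  note av = diamond_flow_curve_velocity[OF f a]
  \<comment> \<open>\<open>factor_velocity\<close> needs factors for all s, but only for small s is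
    \<open>a s\<close> known to be in the big cell. Outside it \<open>gp\<close> is merely some
    element of \<open>Lp\<close>, and \<open>gm\<close> below is set to f.\<close>
  have "\<exists>gp. gp \<in> Lp \<and> (a s \<in> big_cell Lp Lm \<longrightarrow> a s = loop_mult gp (minus_factor Lp Lm (a s)))" for s
    using big_cell_factor[of "a s"] plus.H_one by metis
  then obtain gp where gp: "\<And>s. gp s \<in> Lp"
    "\<And>s. a s \<in> big_cell Lp Lm \<Longrightarrow> a s = loop_mult (gp s) (minus_factor Lp Lm (a s))" by metis
  define gm where "gm = (\<lambda>s. if a s \<in> big_cell Lp Lm then minus_factor Lp Lm (a s) else f)"
  have gm: "gm s \<in> Lm" for s
    unfolding gm_def using big_cell_factor[of "a s"] f by auto
  have "\<forall>\<^sub>F s in nhds 0. minus_factor Lp Lm (a s) = gm s"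
    using cell by eventually_elim (simp add: gm_def)
  from has_velocity_cong[OF v this] have gmv: "has_velocity gm v" .
  have "\<forall>\<^sub>F s in nhds 0. a s = loop_mult (gp s) (gm s)"
    using cell by eventually_elim (simp add: gm_def gp(2)[symmetric])
  from has_velocity_cong[OF av(1) this] eventually_nhds_x_imp_x[OF this]
  show ?thesis using factor_velocity[OF f gp(1) gm _ _ gmv] av(2) by simp
qed


section \<open>The Virasoro relations\<close>

definition DX :: "int \<Rightarrow> (complex \<Rightarrow> complex^'n^'n) \<Rightarrow> (complex \<Rightarrow> complex^'n^'n) \<Rightarrow> complex \<Rightarrow> complex^'n^'n" where
  "DX j f u = (\<lambda>z\<in>S1. cscale (vir_mult j z) (dtheta u z + (u z ** Y f z - Y f z ** u z)))"

text \<open>An infinitesimal gauge transformation. With v = u f the derivative of \<open>Y\<close>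
  is the angular derivative of u plus the commutator of u with \<open>Y f\<close>; the negative half
  of the commutator comes from differentiating the inverse of f.\<close>

lemma X_velocity:
  assumes c: "\<And>s. c s \<in> Lm" "c 0 = f" "has_velocity c v"
  shows "has_velocity (\<lambda>s. X j (c s)) (DX j f (\<lambda>z\<in>S1. v z ** matrix_inv (f z)))"
proof -
  have f: "f \<in> Lm" using c(1)[of 0] c(2) by simp
  note fG = minus.H_loops[OF f]
  define u where "u = (\<lambda>z\<in>S1. v z ** matrix_inv (f z))"
  have u: "u \<in> loops LG" unfolding u_def by (rule minus.LH_loops[OF minus.tangent_translate[OF f c]])
  have A0l: "(\<lambda>z\<in>S1. A0) \<in> loops LG" by (simp add: restrict_loops_iff A0_LG periodic_smooth_const)
  note iv = has_velocity_inv[OF c(3) minus.H_invertible[OF c(1)]]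
  note V = has_velocity_add[OF has_velocity_mult[OF has_velocity_dtheta[OF c(3)] iv]
      has_velocity_mult[OF has_velocity_mult[OF c(3) has_velocity_const[OF A0l]] iv]]
  have curve: "(\<lambda>z\<in>S1. loop_mult (dtheta (c s)) (loop_inv (c s)) z +
      loop_mult (loop_mult (c s) (\<lambda>z\<in>S1. A0)) (loop_inv (c s)) z) = Y (c s)" for s
    by (auto simp: Y_def loop_mult_def loop_inv_def)
  have vel: "has_velocity (\<lambda>s. Y (c s)) (\<lambda>z\<in>S1. dtheta u z + (u z ** Y f z - Y f z ** u z))"
  proof -
    have "(\<lambda>z\<in>S1. (\<lambda>z\<in>S1. dtheta v z ** loop_inv (c 0) z + dtheta (c 0) z **
          (\<lambda>z\<in>S1. - (matrix_inv (c 0 z) ** v z ** matrix_inv (c 0 z))) z) z +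
        (\<lambda>z\<in>S1. (\<lambda>z\<in>S1. v z ** (\<lambda>z\<in>S1. A0) z + c 0 z ** (\<lambda>z\<in>S1. 0) z) z ** loop_inv (c 0) z +
          loop_mult (c 0) (\<lambda>z\<in>S1. A0) z **
          (\<lambda>z\<in>S1. - (matrix_inv (c 0 z) ** v z ** matrix_inv (c 0 z))) z) z) =
      (\<lambda>z\<in>S1. dtheta u z + (u z ** Y f z - Y f z ** u z))"
    proof (rule restrict_ext)
      fix z :: complex assume z: "z \<in> S1"
      note i = matrix_inv_works[OF minus.H_invertible[OF f z]]
      let ?i = "matrix_inv (f z)"
      have v_eq: "v z = u z ** f z" if "z \<in> S1" for z
        using that matrix_inv_works(2)[OF minus.H_invertible[OF f that]] by (simp add: u_def flip: matrix_mul_assoc)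
      have dv: "dtheta v z = dtheta u z ** f z + u z ** dtheta f z"
        by (rule dtheta_bilinear[OF matrix_mul_bounded_bilinear loops_periodic_smooth[OF u]
              loops_periodic_smooth[OF fG] z v_eq])
      have k: "A ** f z ** ?i = A" for A by (simp add: i flip: matrix_mul_assoc)
      have k': "?i ** (u z ** f z) ** ?i = ?i ** u z" by (simp add: i matrix_mul_assoc flip: matrix_mul_assoc)
      have lhs: "(dtheta u z ** f z + u z ** dtheta f z) ** ?i + dtheta f z ** - (?i ** u z) +
          (u z ** f z ** A0 ** ?i + f z ** A0 ** - (?i ** u z)) =
          dtheta u z + (u z ** Y f z - Y f z ** u z)"
        using z
        by (simp add: Y_def matmul.add_left matmul.add_right matmul.minus_right k matrix_mul_assoc)
      show "(\<lambda>z\<in>S1. dtheta v z ** loop_inv (c 0) z + dtheta (c 0) z **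
          (\<lambda>z\<in>S1. - (matrix_inv (c 0 z) ** v z ** matrix_inv (c 0 z))) z) z +
        (\<lambda>z\<in>S1. (\<lambda>z\<in>S1. v z ** (\<lambda>z\<in>S1. A0) z + c 0 z ** (\<lambda>z\<in>S1. 0) z) z ** loop_inv (c 0) z +
          loop_mult (c 0) (\<lambda>z\<in>S1. A0) z **
          (\<lambda>z\<in>S1. - (matrix_inv (c 0 z) ** v z ** matrix_inv (c 0 z))) z) z =
        dtheta u z + (u z ** Y f z - Y f z ** u z)"
        using z lhs
        by (simp only: restrict_apply if_True loop_inv_def loop_mult_def c(2) dv v_eq[OF z] k'
            matmul.zero_right add_0_right)
    qed
    then show ?thesis using V by (simp only: curve)
  qed
  show ?thesis
  proof -
    have "(\<lambda>z\<in>S1. cscale (vir_mult j z) ((\<lambda>z\<in>S1. dtheta u z + (u z ** Y f z - Y f z ** u z)) z)) = DX j f u"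
      unfolding DX_def by (rule restrict_ext) simp
    then show ?thesis
      using has_velocity_multiplier[OF vir_mult_periodic_smooth vel, of j] by (simp only: X_eq u_def)
  qed
qed

definition DZ :: "int \<Rightarrow> (complex \<Rightarrow> complex^'n^'n) \<Rightarrow> (complex \<Rightarrow> complex^'n^'n) \<Rightarrow> complex \<Rightarrow> complex^'n^'n" where
  "DZ j f v = (\<lambda>z\<in>S1. - (P (DX j f (\<lambda>z\<in>S1. v z ** matrix_inv (f z))) z ** f z + P (X j f) z ** v z))"

lemma Z_velocity:
  assumes c: "\<And>s. c s \<in> Lm" "c 0 = f" "has_velocity c v"
  shows "has_velocity (\<lambda>s. Z j (c s)) (DZ j f v)"
proof -
  have "has_velocity (\<lambda>s. P (X j (c s))) (P (DX j f (\<lambda>z\<in>S1. v z ** matrix_inv (f z))))"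
    by (rule has_velocity_P[OF X_loops[OF c(1)] X_velocity[OF c]])
  from has_velocity_linear[OF bounded_linear_minus[OF bounded_linear_ident] has_velocity_mult[OF this c(3)]]
  have "has_velocity (\<lambda>s. \<lambda>z\<in>S1. - loop_mult (P (X j (c s))) (c s) z)
      (\<lambda>z\<in>S1. - (\<lambda>z\<in>S1. P (DX j f (\<lambda>z\<in>S1. v z ** matrix_inv (f z))) z ** c 0 z + P (X j (c 0)) z ** v z) z)" .
  moreover have "(\<lambda>z\<in>S1. - loop_mult (P (X j (c s))) (c s) z) = Z j (c s)" for s
    unfolding Z_def loop_mult_def by (rule restrict_ext) simp
  moreover have "(\<lambda>z\<in>S1. - (\<lambda>z\<in>S1. P (DX j f (\<lambda>z\<in>S1. v z ** matrix_inv (f z))) z ** c 0 z + P (X j (c 0)) z ** v z) z) = DZ j f v"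
    unfolding DZ_def c(2) by (rule restrict_ext) simp
  ultimately show ?thesis by (simp only:)
qed

section \<open>Tangency and directional derivatives of the fields\<close>

lemma Z_tangent: "f \<in> Lm \<Longrightarrow> Z j f \<in> tangent Lm f"
  using Z_velocity_curve[of f j] unfolding tangent_def curve_in_def by blast

text \<open>The velocity found in \<open>Z_velocity\<close> depends on the curve only through f and
  v, so one value serves for all curves quantified over in \<open>directional_deriv\<close>.\<close>

lemma sharp_field_directional_deriv:
  assumes v: "v \<in> tangent Lm f"
  shows "directional_deriv Lm (sharp_field Lp Lm \<epsilon> C j) f v (DZ j f v)"
  unfolding directional_deriv_def
proof (intro conjI v allI impI)
  fix c assume "curve_in Lm f v c"
  then have c: "\<And>s. c s \<in> Lm" "c 0 = f" "has_velocity c v" by (auto simp: curve_in_def)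
  show "has_velocity (\<lambda>s. sharp_field Lp Lm \<epsilon> C j (c s)) (DZ j f v)"
    using Z_velocity[OF c] by (simp add: sharp_field_eq[OF c(1)])
qed

lemma vector_field_sharp_field: "vector_field_on Lm (sharp_field Lp Lm \<epsilon> C j)"
  unfolding vector_field_on_def
  using Z_tangent sharp_field_eq sharp_field_directional_deriv by metis

text \<open>The algebraic core: the argument of \<open>P\<close> is an element \<zeta> of the plus
  algebra plus the bracket of \<open>q k\<close> and \<open>q j\<close>. To see it, write p = X - q.
  The loops \<open>X j f\<close> and \<open>X k f\<close> commute, being multiples of
  \<open>Y f\<close>, and the terms with the derivative of \<open>Y f\<close> cancel since the
  product of the two multipliers is symmetric. The nested restrictions have the shape on which
  \<open>P_add\<close> and \<open>P_scaleR\<close> act in \<open>P_bracket\<close>.\<close>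

lemma P_bracket_defect:
  assumes f: "f \<in> Lm" and jk: "j \<ge> -1" "k \<ge> -1"
  defines "q \<equiv> \<lambda>i. P (X i f)"
  shows "P (\<lambda>z\<in>S1. DX k f (\<lambda>z\<in>S1. - q j z) z + (\<lambda>z\<in>S1. (\<lambda>z\<in>S1. - 1 *\<^sub>R DX j f (\<lambda>z\<in>S1. - q k z) z) z +
      (\<lambda>z\<in>S1. (- real_of_int (k - j)) *\<^sub>R X (j + k) f z) z) z) =
    (\<lambda>z\<in>S1. q k z ** q j z - q j z ** q k z)"
proof -
  have q: "q i \<in> minus.LH" for i unfolding q_def by (rule P_minus_LH[OF X_loops[OF f]])
  have "\<exists>p. p \<in> plus.LH \<and> (\<forall>z\<in>S1. X i f z = p z + q i z)" for i
    using decomposition[OF X_loops[OF f]] unfolding q_def by blast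
  then obtain p where p: "\<And>i. p i \<in> plus.LH" "\<And>i z. z \<in> S1 \<Longrightarrow> X i f z = p i z + q i z" by metis
  note ql = minus.LH_loops[OF q] and pl = plus.LH_loops[OF p(1)]
  define \<zeta> where "\<zeta> = (\<lambda>z\<in>S1. (\<lambda>z\<in>S1. (\<lambda>z\<in>S1. cscale (vir_mult k z) (dtheta (p j) z)) z +
      (\<lambda>z\<in>S1. - (\<lambda>z\<in>S1. cscale (vir_mult j z) (dtheta (p k) z)) z) z) z +
      (\<lambda>z\<in>S1. p j z ** p k z - p k z ** p j z) z)"
  have \<zeta>: "\<zeta> \<in> plus.LH"
    unfolding \<zeta>_def
    by (rule plus.LH_add[OF plus.LH_add[OF plus_vector_field[OF p(1) jk(2)]
          plus.LH_minus[OF plus_vector_field[OF p(1) jk(1)]]] plus_bracket[OF p(1) p(1)]])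
  show ?thesis
  proof (rule P_eqI[OF \<zeta> minus_bracket[OF q q]], rule restrict_ext)
    fix z :: complex assume z: "z \<in> S1"
    let ?y = "Y f z" and ?y' = "dtheta (Y f) z" and ?a = "vir_mult j z" and ?b = "vir_mult k z"
    have Xz: "X i f z = cscale (vir_mult i z) ?y" for i using z by (simp add: X_eq)
    have pz: "p i z = cscale (vir_mult i z) ?y - q i z" for i using p(2)[OF z, of i] by (simp add: Xz)
    have dX: "dtheta (X i f) z = cscale (\<i> * of_int i * vir_mult i z) ?y + cscale (vir_mult i z) ?y'" for i
      using dtheta_bilinear[OF cscale_bounded_bilinear vir_mult_periodic_smooth loops_periodic_smooth[OF Y_loops[OF f]] z, of "X i f" i]
      by (simp add: X_eq dtheta_vir_mult[OF z])
    have dp: "dtheta (p i) z = dtheta (X i f) z - dtheta (q i) z" for i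
      by (rule dtheta_diff[OF X_loops[OF f] ql z]) (simp add: p(2))
    have dq: "dtheta (\<lambda>z\<in>S1. - q i z) z = - dtheta (q i) z" for i
      using dtheta_diff[OF minus.LH_loops[OF minus.LH_zero] ql z, of "\<lambda>z\<in>S1. - q i z" i]
        dtheta_eqI[OF _ z, of "\<lambda>z\<in>S1. 0" "\<lambda>z. 0"] by simp
    \<comment> \<open>The Virasoro structure constant arises here, from the vector fields
      differentiating each other's multipliers.\<close>
    have scal: "cscale (?b * (\<i> * of_int j * ?a)) ?y - cscale (?a * (\<i> * of_int k * ?b)) ?y =
        - (real_of_int (k - j) *\<^sub>R cscale (vir_mult (j + k) z) ?y)"
    proof -
      have "cscale (?b * (\<i> * of_int j * ?a)) ?y - cscale (?a * (\<i> * of_int k * ?b)) ?y =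
          cscale (?b * (\<i> * of_int j * ?a) - ?a * (\<i> * of_int k * ?b)) ?y"
        by (simp only: cscale.diff_left)
      also have "?b * (\<i> * of_int j * ?a) - ?a * (\<i> * of_int k * ?b) =
          - (of_real (real_of_int (k - j)) * (\<i> * ?a * ?b))"
        by (simp add: algebra_simps)
      also have "cscale \<dots> ?y = - (real_of_int (k - j) *\<^sub>R cscale (vir_mult (j + k) z) ?y)"
        by (simp only: vir_mult_prod[OF z] cscale.minus_left cscale_of_real flip: cscale_cscale)
      finally show ?thesis .
    qed
    have comm: "cscale (?b * ?a) M = cscale (?a * ?b) M" for M :: "complex^'n^'n" by (simp only: mult.commute)
    have "cscale ?b (- dtheta (q j) z + (- q j z ** ?y - ?y ** - q j z)) +
        (- 1 *\<^sub>R cscale ?a (- dtheta (q k) z + (- q k z ** ?y - ?y ** - q k z)) +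
         (- real_of_int (k - j)) *\<^sub>R cscale (vir_mult (j + k) z) ?y) =
      cscale ?b (cscale (\<i> * of_int j * ?a) ?y + cscale ?a ?y' - dtheta (q j) z) +
      - cscale ?a (cscale (\<i> * of_int k * ?b) ?y + cscale ?b ?y' - dtheta (q k) z) +
      ((cscale ?a ?y - q j z) ** (cscale ?b ?y - q k z) - (cscale ?b ?y - q k z) ** (cscale ?a ?y - q j z)) +
      (q k z ** q j z - q j z ** q k z)"
      using scal
      by (simp add: cscale.add_right cscale.diff_right cscale.minus_right matmul.diff_left matmul.diff_right
          matmul.minus_left matmul.minus_right cscale_mult_left cscale_mult_right comm algebra_simps)
    then show "DX k f (\<lambda>z\<in>S1. - q j z) z + (\<lambda>z\<in>S1. (\<lambda>z\<in>S1. - 1 *\<^sub>R DX j f (\<lambda>z\<in>S1. - q k z) z) z +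
      (\<lambda>z\<in>S1. (- real_of_int (k - j)) *\<^sub>R X (j + k) f z) z) z =
      \<zeta> z + (\<lambda>z\<in>S1. q k z ** q j z - q j z ** q k z) z"
      using z by (simp only: DX_def \<zeta>_def restrict_apply if_True dq dp dX pz Xz)
  qed
qed

lemma Z_translate:
  assumes f: "f \<in> Lm"
  shows "(\<lambda>z\<in>S1. Z j f z ** matrix_inv (f z)) = (\<lambda>z\<in>S1. - P (X j f) z)"
proof (rule restrict_ext)
  fix z :: complex assume z: "z \<in> S1"
  show "Z j f z ** matrix_inv (f z) = - P (X j f) z"
    using z matrix_inv_works(1)[OF minus.H_invertible[OF f z]]
    by (simp add: Z_def matmul.minus_left flip: matrix_mul_assoc)
qed

text \<open>Obtained as the velocity of a curve of loops in the Lie algebra. A direct check of the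
  formula would require the individual terms, including a commutator, to be in
  \<open>LG\<close>.\<close>

lemma DX_loops:
  assumes f: "f \<in> Lm" shows "DX k f (\<lambda>z\<in>S1. - P (X j f) z) \<in> loops LG"
proof (rule Z_velocity_curve[OF f, of j])
  fix c assume c: "\<And>s. c s \<in> Lm" "c 0 = f" "has_velocity c (Z j f)"
  show ?thesis
    using has_velocity_loop_algebra[OF X_loops[OF c(1)] X_velocity[OF c]] by (simp only: Z_translate[OF f])
qed

lemma P_bracket:
  assumes f: "f \<in> Lm" and jk: "j \<ge> -1" "k \<ge> -1" and z: "z \<in> S1"
  shows "P (DX k f (\<lambda>z\<in>S1. - P (X j f) z)) z + (- 1 *\<^sub>R P (DX j f (\<lambda>z\<in>S1. - P (X k f) z)) z +
      (- real_of_int (k - j)) *\<^sub>R P (X (j + k) f) z) =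
    P (X k f) z ** P (X j f) z - P (X j f) z ** P (X k f) z"
proof -
  note D = DX_loops[OF f, of k j] DX_loops[OF f, of j k] and sc = subspace_scale[OF lie_algebra_subspace]
  have a: "(\<lambda>z\<in>S1. - 1 *\<^sub>R DX j f (\<lambda>z\<in>S1. - P (X k f) z) z) \<in> loops LG"
    by (rule loop_algebra_linear[OF D(2) bounded_linear_scaleR_right sc])
  have b: "(\<lambda>z\<in>S1. (- real_of_int (k - j)) *\<^sub>R X (j + k) f z) \<in> loops LG"
    by (rule loop_algebra_linear[OF X_loops[OF f] bounded_linear_scaleR_right sc])
  show ?thesis
    using fun_cong[OF P_bracket_defect[OF f jk, unfolded P_add[OF D(1) loop_algebra_add[OF a b]] P_add[OF a b]
        P_scaleR[OF D(2)] P_scaleR[OF X_loops[OF f]]], of z] z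
    by (simp only: restrict_apply if_True)
qed

text \<open>Differentiating the factor f in \<open>Z\<close> contributes the products of
  \<open>P (X k f)\<close> and \<open>P (X j f)\<close> in both orders. Their difference cancels the
  commutator left over by \<open>P_bracket\<close>, and only the multiple of
  \<open>Z (j + k) f\<close> remains.\<close>

lemma sharp_field_bracket:
  assumes f: "f \<in> Lm" and jk: "j \<ge> -1" "k \<ge> -1"
  shows "lie_bracket_at Lm (sharp_field Lp Lm \<epsilon> C j) (sharp_field Lp Lm \<epsilon> C k) f
    (\<lambda>z\<in>S1. real_of_int (k - j) *\<^sub>R sharp_field Lp Lm \<epsilon> C (j + k) f z)"
  unfolding lie_bracket_at_def sharp_field_eq[OF f]
proof (intro exI conjI)
  show "directional_deriv Lm (sharp_field Lp Lm \<epsilon> C k) f (Z j f) (DZ k f (Z j f))"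
    "directional_deriv Lm (sharp_field Lp Lm \<epsilon> C j) f (Z k f) (DZ j f (Z k f))"
    by (rule sharp_field_directional_deriv[OF Z_tangent[OF f]])+
  show "(\<lambda>z\<in>S1. real_of_int (k - j) *\<^sub>R Z (j + k) f z) = (\<lambda>z\<in>S1. DZ k f (Z j f) z - DZ j f (Z k f) z)"
  proof (rule restrict_ext)
    fix z :: complex assume z: "z \<in> S1"
    let ?q = "\<lambda>i. P (X i f) z"
    let ?D = "P (DX k f (\<lambda>z\<in>S1. - P (X j f) z)) z" and ?E = "P (DX j f (\<lambda>z\<in>S1. - P (X k f) z)) z"
    have "?D - ?E = real_of_int (k - j) *\<^sub>R ?q (j + k) + (?q k ** ?q j - ?q j ** ?q k)"
      using P_bracket[OF f jk z] by (simp add: algebra_simps)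
    then have "(?D - ?E) ** f z =
        real_of_int (k - j) *\<^sub>R (?q (j + k) ** f z) + (?q k ** ?q j ** f z - ?q j ** ?q k ** f z)"
      by (simp only: matmul.add_left matmul.diff_left matmul.scaleR_left)
    moreover have "DZ k f (Z j f) z = - (?D ** f z) + ?q k ** ?q j ** f z"
      "DZ j f (Z k f) z = - (?E ** f z) + ?q j ** ?q k ** f z"
      unfolding DZ_def Z_translate[OF f] using z by (simp_all add: Z_def matmul.minus_right matrix_mul_assoc)
    moreover have "Z (j + k) f z = - (?q (j + k) ** f z)" using z by (simp add: Z_def)
    moreover have "- (?D ** f z) + A - (- (?E ** f z) + B) = (A - B) - (?D - ?E) ** f z" for A B
      by (simp add: matmul.diff_left)
    ultimately show "real_of_int (k - j) *\<^sub>R Z (j + k) f z = DZ k f (Z j f) z - DZ j f (Z k f) z"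
      by (simp only: scaleR_minus_right) (simp add: algebra_simps)
  qed
qed

lemma virasoro_action_sharp_field: "virasoro_action Lm (sharp_field Lp Lm \<epsilon> C)"
  unfolding virasoro_action_def using vector_field_sharp_field sharp_field_bracket by blast

lemma sharp_field_translate:
  assumes f: "f \<in> Lm"
  shows "loop_mult (sharp_field Lp Lm \<epsilon> C j f) (loop_inv f) = (\<lambda>z\<in>S1. - P (X j f) z)"
  unfolding loop_mult_def sharp_field_eq[OF f]
proof (rule restrict_ext)
  fix z :: complex assume z: "z \<in> S1"
  show "Z j f z ** loop_inv f z = - P (X j f) z"
    using z matrix_inv_works(1)[OF minus.H_invertible[OF f z]]
    by (simp add: Z_def loop_inv_def matmul.minus_left flip: matrix_mul_assoc)
qed

end

theorem theorem5p2:
  fixes G :: "(complex^'n^'n) set"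
    and Lp Lm :: "(complex \<Rightarrow> complex^'n^'n) set"
    and \<epsilon> :: real
    and C :: "complex \<Rightarrow> complex^'n^'n"
  assumes "complex_matrix_lie_group G"
    and "Lp = Lplus G"
    and "splitting G Lp Lm"
    and "local_hom G \<epsilon> C"
  shows
    "\<comment> \<open>the operations are well defined\<close>
     (\<forall>f\<in>Lm. \<forall>k\<in>Dplus. diamond_defined \<epsilon> k \<longrightarrow> diamond C (inv_into S1 k) f \<in> loops G) \<and>
     (\<forall>h \<in> big_cell Lp Lm. \<exists>!(gp, gm). gp \<in> Lp \<and> gm \<in> Lm \<and> h = loop_mult gp gm) \<and>
     \<comment> \<open>local action of the diffeomorphisms\<close>
     (\<forall>f\<in>Lm. \<forall>k. sharp_defined Lp Lm \<epsilon> C k f \<longrightarrow> sharp Lp Lm C k f \<in> Lm) \<and>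
     (\<forall>f\<in>Lm. sharp_defined Lp Lm \<epsilon> C id f \<and> sharp Lp Lm C id f = f) \<and>
     (\<forall>f\<in>Lm. \<forall>k\<in>Dplus. \<forall>l\<in>Dplus. sharp_defined Lp Lm \<epsilon> C l f \<longrightarrow>
        diamond_defined \<epsilon> k \<longrightarrow> diamond_defined \<epsilon> (k \<circ> l) \<longrightarrow>
        (sharp_defined Lp Lm \<epsilon> C (k \<circ> l) f \<longleftrightarrow>
           sharp_defined Lp Lm \<epsilon> C k (sharp Lp Lm C l f)) \<and>
        (sharp_defined Lp Lm \<epsilon> C (k \<circ> l) f \<longrightarrow>
           sharp Lp Lm C (k \<circ> l) f = sharp Lp Lm C k (sharp Lp Lm C l f))) \<and>
     (big_cell_near_one G Lp Lm \<longrightarrow>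
        (\<forall>f\<in>Lm. \<forall>k. (\<forall>m::nat. k m \<in> Dplus) \<longrightarrow>
           loop_tendsto (\<lambda>m. inv_into S1 (k m)) id sequentially \<longrightarrow>
           (\<forall>\<^sub>F m in sequentially. sharp_defined Lp Lm \<epsilon> C (k m) f))) \<and>
     \<comment> \<open>the infinitesimal vector fields\<close>
     (\<forall>j\<ge>-1. \<forall>f\<in>Lm.
        (\<exists>!v. sharp_velocity Lp Lm \<epsilon> C j f v) \<and>
        (\<forall>a v. diamond_flow_curve \<epsilon> C j f a \<longrightarrow>
           (\<forall>\<^sub>F s in nhds 0. a s \<in> big_cell Lp Lm) \<longrightarrow>
           has_velocity (\<lambda>s. minus_factor Lp Lm (a s)) v \<longrightarrow>
           v = sharp_field Lp Lm \<epsilon> C j f) \<and>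
        loop_mult (sharp_field Lp Lm \<epsilon> C j f) (loop_inv f) =
          (\<lambda>z\<in>S1. - minus_proj Lp Lm
             (\<lambda>z\<in>S1. cscale (z powi (j + 1)) (circle_deriv f z ** matrix_inv (f z)) +
                     cscale (z powi j) (f z ** circle_deriv C 1 ** matrix_inv (f z))) z)) \<and>
     \<comment> \<open>the action of the positive half Virasoro algebra\<close>
     virasoro_action Lm (sharp_field Lp Lm \<epsilon> C)"
proof -
  interpret sharp_setting G Lp Lm \<epsilon> C
    by unfold_locales (fact assms)+
  have factor: "\<exists>!(gp, gm). gp \<in> Lp \<and> gm \<in> Lm \<and> h = loop_mult gp gm" if h: "h \<in> big_cell Lp Lm" for h
  proof -
    obtain gp gm where g: "gp \<in> Lp" "gm \<in> Lm" "h = loop_mult gp gm" using h unfolding big_cell_def by blast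
    show ?thesis
    proof (rule ex1I[of _ "(gp, gm)"])
      show "case (gp, gm) of (gp, gm) \<Rightarrow> gp \<in> Lp \<and> gm \<in> Lm \<and> h = loop_mult gp gm"
        unfolding prod.case using g by (intro conjI)
      fix x assume "case x of (gp, gm) \<Rightarrow> gp \<in> Lp \<and> gm \<in> Lm \<and> h = loop_mult gp gm"
      then have x: "fst x \<in> Lp" "snd x \<in> Lm" "loop_mult gp gm = loop_mult (fst x) (snd x)"
        unfolding case_prod_beta g(3) by blast+
      show "x = (gp, gm)"
        using factor_unique[OF g(1,2) x] by (simp add: prod_eq_iff)
    qed
  qed
  have sharp_mem: "sharp Lp Lm C k f \<in> Lm" if "sharp_defined Lp Lm \<epsilon> C k f" for f k
    using that big_cell_factor[of "diamond C (inv_into S1 k) f"] unfolding sharp_def sharp_defined_def by blast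
  have velocity: "\<exists>!v. sharp_velocity Lp Lm \<epsilon> C j f v" if "f \<in> Lm" for f j
    by (simp add: sharp_velocity_iff[OF that])
  have exact: "v = sharp_field Lp Lm \<epsilon> C j f"
    if "f \<in> Lm" "diamond_flow_curve \<epsilon> C j f a" "\<forall>\<^sub>F s in nhds 0. a s \<in> big_cell Lp Lm"
      "has_velocity (\<lambda>s. minus_factor Lp Lm (a s)) v" for f j a v
    using minus_factor_velocity[OF that] sharp_field_eq[OF that(1)] by simp
  show ?thesis
    apply (intro conjI ballI allI impI)
    subgoal by (rule diamond_loops[OF minus.H_loops])
    subgoal by (rule factor)
    subgoal by (rule sharp_mem)
    subgoal by (rule sharp_id)
    subgoal by (rule sharp_id)
    subgoal by (rule sharp_compose)
    subgoal by (rule sharp_compose)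
    subgoal by (rule sharp_defined_near_identity) blast+
    subgoal by (rule velocity)
    subgoal by (rule exact)
    subgoal by (rule sharp_field_translate[unfolded X_def])
    subgoal by (rule virasoro_action_sharp_field)
    done
qed

end
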